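(* Let $(\mathcal{C},\otimes)$ be an Abelian tensor category. Consider the cooperad $(\mathcal{C}^{\Delta^{\mathrm{op}}},\widetilde\otimes)^{\circ,\vee}$ (counits discarded) with its simplicial enrichment by the simplicial sets underlying $\mathrm{Aw}^*\underline{\mathrm{Hom}}^{\widetilde\otimes}$. Then for any pair of (non-counital) dg-coalgebras $X,Y$ there is a natural morphism $$\underline{\mathrm{Coh}}(X,Y)_0\to\mathrm{Hom}^{A_\infty}(X,Y)$$ from coherent transformations to morphisms of $A_\infty$-coalgebras, which restricted to $\mathrm{Hom}(X,Y)$ is the usual embedding of coalgebra morphisms into $A_\infty$-coalgebra morphisms. The functor is compatible with the composition of coherent transformations (defined in the context) on the left hand side and the composition of morphisms of $A_\infty$-coalgebras on the right.
   Context: An Abelian tensor category is an abelian category with a monoidal product $\otimes$, additive in each variable. $\mathcal{C}^{\Delta^{\mathrm{op}}}\cong\mathrm{Ch}_{\ge0}(\mathcal{C})$ by Dold–Kan; $\widetilde\otimes$ is the usual tensor product of complexes (differential $d\otimes1+(-1)^i1\otimes d$ on $A_i\otimes B_j$), also used to tensor with complexes of abelian groups. The Koszul sign rule $(f\otimes g)(x\otimes y)=(-1)^{\deg(g)\deg(x)}f(x)\otimes g(y)$ is used throughout. Non-counital dg-coalgebras are coassociative coalgebras in $(\mathrm{Ch}_{\ge0}(\mathcal{C}),\widetilde\otimes)$ without counit. Enrichment: $\underline{\mathrm{Hom}}^{\widetilde\otimes}(X,Y)_{[n]}=\mathrm{Hom}(\mathbb{Z}[\Delta_n]\mathbin{\widetilde\otimes}X,Y)$;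 as a complex, this is the Hom-complex whose degree-$n$ part consists of degree-$n$ maps $X\to Y$ (restrict to the non-degenerate $n$-simplex $\{0,\dots,n\}$). Composition of $n$-simplices, and tensor products of $n$-simplices, are formed using the Alexander–Whitney diagonal $\mathbb{Z}[\Delta_n]\to\mathbb{Z}[\Delta_n]\mathbin{\widetilde\otimes}\mathbb{Z}[\Delta_n]$. Coherent transformations. Let $\Delta^\circ_{\mathrm{act}}$ be the category with objects $[k]$, $k\ge1$, and injective endpoint-preserving maps. A coalgebra $X$ gives maps $X(\alpha):X^{\widetilde\otimes j}\to X^{\widetilde\otimes k}$ for $\alpha:[j]\to[k]$ in $\Delta^\circ_{\mathrm{act}}$ (iterated comultiplications). For $j\le k$ let $N_{j,k}$ be the nerve of the category of factorizations of maps $[j]\to[k]$ in $\Delta_{\mathrm{act}}^\circ$: its $n$-simplices are chains $[j]\to c_0\to\dots\to c_n\to[k]$. An element $\mu\in\underline{\mathrm{Coh}}(X,Y)_0$ is a family of maps of simplicial sets $\mu_k:N_{1,k}\to\underline{\mathrm{Hom}}^{\widetilde\otimes}(X,Y^{\widetilde\otimes k})$, $k\ge1$, such that (a) $\mu_{k'}(\beta c)=Y(\beta)\circ\mu_k(c)$ for $\beta:[k]\to[k']$, where $\beta c$ is $c$ with last map composed with $\beta$; (b) for $\alpha:[1]\to[j]$ and $c\in(N_{j,k})_n$, which decomposes (cutting along the $j$ elementary intervals of $[j]$) into $c^1,\dots,c^j$ with $c^i\in(N_{1,k_i})_n$ and $\sum k_i=k$, one has $\mu_k(c\alpha)=\big(\mu_{k_1}(c^1)\mathbin{\widetilde\otimes}\dots\mathbin{\widetilde\otimes}\mu_{k_j}(c^j)\big)\circ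 X(\alpha)$. (This is the set of 0-simplices of the relative coherent end $\oint\underline{\mathrm{Hom}}(X,Y)$ in the sense of Cordier–Porter over the non-counital associative cooperad.) A morphism $f:X\to Y$ of coalgebras is regarded as the coherent transformation sending every simplex of $N_{1,k}$ to the (degenerate simplex on the) map $f^{\widetilde\otimes k}\circ X([1]\to[k])$. Composition: for $f\in\underline{\mathrm{Coh}}(X,Y)_0$ and $g\in\underline{\mathrm{Coh}}(Y,Z)_0$, linearize and pass to normalized complexes; the composite sends an $n$-simplex $c=([1]\to c_0\to\dots\to c_n\to[k])$ to $\sum_{i+j=n}(-1)^{ij}g(c_i=c_i\to\dots\to c_n\to[k])\circ f([1]\to c_0\to\dots\to c_i=c_i)$, where $f(\cdot)$ is a degree-$i$ map $X\to Y^{\widetilde\otimes m}$ for $c_i=[m]$ and $g$ on chains starting at $[m]$ is the degree-$j$ map $Y^{\widetilde\otimes m}\to Z^{\widetilde\otimes k}$ obtained by the tensor product of its values on the $m$ components of the chain as in (b). $A_\infty$-coalgebras: with $(s^{-1}X)_i=X_{i+1}$, an $A_\infty$-coalgebra structure on a graded object $X$ is a degree $-1$, square-zero derivation on the pro-object tensor algebra $T^{\prod}(s^{-1}X)=\prod_{k\ge0}(s^{-1}X)^{\otimes k}$ (formal product, in $\mathrm{Pro}(\mathcal{C})$). A morphism of $A_\infty$-coalgebras $X\to Y$ is a morphism of dg-algebras $T^{\prod,+}(s^{-1}X)\to T^{\prod,+}(s^{-1}Y)$ (positive parts), determined by degree-0 components $\alpha_k:s^{-1}X\to(s^{-1}Y)^{\otimes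 k}$, $k\ge1$; composition is composition of algebra morphisms. A dg-coalgebra $X$ is an $A_\infty$-coalgebra with the derivation determined by $s^{-1}x\mapsto-s^{-1}dx+\sum(-1)^{\deg x'}s^{-1}x'\otimes s^{-1}x''$ ($\sum x'\otimes x''$ the comultiplication of $x$). The usual embedding sends a coalgebra morphism $f$ to the morphism with $\alpha_1=s^{-1}fs$ and $\alpha_k=0$ for $k\ge2$. *)

theory Defs
  imports "HOL-Algebra.FiniteProduct"
begin

section \<open>Abelian tensor categories\<close>

record ('o, 'm) tensor_category =
  Obj :: "'o set"
  Arr :: "'m set"
  Src :: "'m \<Rightarrow> 'o"
  Trg :: "'m \<Rightarrow> 'o"
  Ide :: "'o \<Rightarrow> 'm"
  Cmp :: "'m \<Rightarrow> 'm \<Rightarrow> 'm"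
  Add :: "'m \<Rightarrow> 'm \<Rightarrow> 'm"
  Nul :: "'o \<Rightarrow> 'o \<Rightarrow> 'm"
  TenO :: "'o \<Rightarrow> 'o \<Rightarrow> 'o"
  TenA :: "'m \<Rightarrow> 'm \<Rightarrow> 'm"
  Uni :: "'o"
  Asc :: "'o \<Rightarrow> 'o \<Rightarrow> 'o \<Rightarrow> 'm"
  LUni :: "'o \<Rightarrow> 'm"
  RUni :: "'o \<Rightarrow> 'm"

locale category =
  fixes C :: "('o, 'm) tensor_category"
  assumes Src_Obj: "f \<in> Arr C \<Longrightarrow> Src C f \<in> Obj C"
    and Trg_Obj: "f \<in> Arr C \<Longrightarrow> Trg C f \<in> Obj C"
    and Ide_Arr: "A \<in> Obj C \<Longrightarrow> Ide C A \<in> Arr C \<and> Src C (Ide C A) = A \<and> Trg C (Ide C A) = A"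
    and Cmp_Arr: "\<lbrakk>f \<in> Arr C; g \<in> Arr C; Trg C f = Src C g\<rbrakk> \<Longrightarrow>
      Cmp C g f \<in> Arr C \<and> Src C (Cmp C g f) = Src C f \<and> Trg C (Cmp C g f) = Trg C g"
    and Cmp_assoc: "\<lbrakk>f \<in> Arr C; g \<in> Arr C; h \<in> Arr C; Trg C f = Src C g; Trg C g = Src C h\<rbrakk> \<Longrightarrow>
      Cmp C h (Cmp C g f) = Cmp C (Cmp C h g) f"
    and Cmp_Ide: "f \<in> Arr C \<Longrightarrow> Cmp C f (Ide C (Src C f)) = f"
    and Ide_Cmp: "f \<in> Arr C \<Longrightarrow> Cmp C (Ide C (Trg C f)) f = f"
begin

definition hom :: "'o \<Rightarrow> 'o \<Rightarrow> 'm set" where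
  "hom A B = {f \<in> Arr C. Src C f = A \<and> Trg C f = B}"

abbreviation cmp :: "'m \<Rightarrow> 'm \<Rightarrow> 'm" (infixr "\<cdot>" 75) where
  "g \<cdot> f \<equiv> Cmp C g f"

definition homgrp :: "'o \<Rightarrow> 'o \<Rightarrow> 'm monoid" where
  "homgrp A B = \<lparr>carrier = hom A B, monoid.mult = Add C, one = Nul C A B\<rparr>"

definition neg :: "'m \<Rightarrow> 'm" where
  "neg f = m_inv (homgrp (Src C f) (Trg C f)) f"

definition hsgn :: "int \<Rightarrow> 'm \<Rightarrow> 'm" where
  "hsgn e f = (if even e then f else neg f)"

definition hsum :: "'o \<Rightarrow> 'o \<Rightarrow> ('i \<Rightarrow> 'm) \<Rightarrow> 'i set \<Rightarrow> 'm" where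
  "hsum A B f I = finprod (homgrp A B) f I"

definition zero_object :: "'o \<Rightarrow> bool" where
  "zero_object Z \<longleftrightarrow> Z \<in> Obj C \<and> (\<forall>A\<in>Obj C. (\<exists>!f. f \<in> hom Z A) \<and> (\<exists>!f. f \<in> hom A Z))"

definition is_biproduct ::
  "'i set \<Rightarrow> ('i \<Rightarrow> 'o) \<Rightarrow> 'o \<Rightarrow> ('i \<Rightarrow> 'm) \<Rightarrow> ('i \<Rightarrow> 'm) \<Rightarrow> bool" where
  "is_biproduct I A S inc pro \<longleftrightarrow> S \<in> Obj C \<and>
     (\<forall>i\<in>I. inc i \<in> hom (A i) S \<and> pro i \<in> hom S (A i)) \<and>
     (\<forall>i\<in>I. \<forall>j\<in>I. pro j \<cdot> inc i = (if i = j then Ide C (A i) else Nul C (A i) (A j))) \<and>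
     hsum S S (\<lambda>i. inc i \<cdot> pro i) I = Ide C S"

definition mono_arr :: "'m \<Rightarrow> bool" where
  "mono_arr f \<longleftrightarrow> f \<in> Arr C \<and> (\<forall>g\<in>Arr C. \<forall>h\<in>Arr C.
     Src C g = Src C h \<and> Trg C g = Src C f \<and> Trg C h = Src C f \<and> f \<cdot> g = f \<cdot> h \<longrightarrow> g = h)"

definition epi_arr :: "'m \<Rightarrow> bool" where
  "epi_arr f \<longleftrightarrow> f \<in> Arr C \<and> (\<forall>g\<in>Arr C. \<forall>h\<in>Arr C.
     Trg C g = Trg C h \<and> Src C g = Trg C f \<and> Src C h = Trg C f \<and> g \<cdot> f = h \<cdot> f \<longrightarrow> g = h)"

definition is_kernel :: "'m \<Rightarrow> 'm \<Rightarrow> bool" where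
  "is_kernel k f \<longleftrightarrow> k \<in> Arr C \<and> f \<in> Arr C \<and> Trg C k = Src C f \<and>
     f \<cdot> k = Nul C (Src C k) (Trg C f) \<and>
     (\<forall>h\<in>Arr C. Trg C h = Src C f \<and> f \<cdot> h = Nul C (Src C h) (Trg C f) \<longrightarrow>
        (\<exists>!u. u \<in> hom (Src C h) (Src C k) \<and> k \<cdot> u = h))"

definition is_cokernel :: "'m \<Rightarrow> 'm \<Rightarrow> bool" where
  "is_cokernel q f \<longleftrightarrow> q \<in> Arr C \<and> f \<in> Arr C \<and> Src C q = Trg C f \<and>
     q \<cdot> f = Nul C (Src C f) (Trg C q) \<and>
     (\<forall>h\<in>Arr C. Src C h = Trg C f \<and> h \<cdot> f = Nul C (Src C f) (Trg C h) \<longrightarrow>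
        (\<exists>!u. u \<in> hom (Trg C q) (Trg C h) \<and> u \<cdot> q = h))"

definition iso_arr :: "'m \<Rightarrow> bool" where
  "iso_arr f \<longleftrightarrow> f \<in> Arr C \<and>
     (\<exists>g \<in> hom (Trg C f) (Src C f). g \<cdot> f = Ide C (Src C f) \<and> f \<cdot> g = Ide C (Trg C f))"

end

locale preadditive_category = category +
  assumes comm_group_homgrp: "\<lbrakk>A \<in> Obj C; B \<in> Obj C\<rbrakk> \<Longrightarrow> comm_group (homgrp A B)"
    and Cmp_Add_left: "\<lbrakk>f \<in> hom A B; g \<in> hom B D; h \<in> hom B D\<rbrakk> \<Longrightarrow>
      Add C g h \<cdot> f = Add C (g \<cdot> f) (h \<cdot> f)"
    and Cmp_Add_right: "\<lbrakk>f \<in> hom A B; g \<in> hom A B; h \<in> hom B D\<rbrakk> \<Longrightarrow>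
      h \<cdot> Add C f g = Add C (h \<cdot> f) (h \<cdot> g)"

locale abelian_category = preadditive_category +
  assumes ex_zero: "\<exists>Z. zero_object Z"
    and ex_biproduct: "\<lbrakk>A \<in> Obj C; B \<in> Obj C\<rbrakk> \<Longrightarrow>
      \<exists>S inc pro. is_biproduct (UNIV :: bool set) (\<lambda>b. if b then A else B) S inc pro"
    and ex_kernel: "f \<in> Arr C \<Longrightarrow> \<exists>k. is_kernel k f"
    and ex_cokernel: "f \<in> Arr C \<Longrightarrow> \<exists>q. is_cokernel q f"
    and mono_kernel: "mono_arr f \<Longrightarrow> \<exists>g. is_kernel f g"
    and epi_cokernel: "epi_arr f \<Longrightarrow> \<exists>g. is_cokernel f g"

locale abelian_tensor_category = abelian_category +
  assumes TenO_Obj: "\<lbrakk>A \<in> Obj C; B \<in> Obj C\<rbrakk> \<Longrightarrow> TenO C A B \<in> Obj C"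
    and TenA_hom: "\<lbrakk>f \<in> hom A A'; g \<in> hom B B'\<rbrakk> \<Longrightarrow> TenA C f g \<in> hom (TenO C A B) (TenO C A' B')"
    and TenA_Ide: "\<lbrakk>A \<in> Obj C; B \<in> Obj C\<rbrakk> \<Longrightarrow> TenA C (Ide C A) (Ide C B) = Ide C (TenO C A B)"
    and TenA_Cmp: "\<lbrakk>f \<in> hom A A'; f' \<in> hom A' A''; g \<in> hom B B'; g' \<in> hom B' B''\<rbrakk> \<Longrightarrow>
      TenA C (f' \<cdot> f) (g' \<cdot> g) = TenA C f' g' \<cdot> TenA C f g"
    and TenA_Add_left: "\<lbrakk>f \<in> hom A A'; f' \<in> hom A A'; g \<in> hom B B'\<rbrakk> \<Longrightarrow>
      TenA C (Add C f f') g = Add C (TenA C f g) (TenA C f' g)"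
    and TenA_Add_right: "\<lbrakk>f \<in> hom A A'; g \<in> hom B B'; g' \<in> hom B B'\<rbrakk> \<Longrightarrow>
      TenA C f (Add C g g') = Add C (TenA C f g) (TenA C f g')"
    and Uni_Obj: "Uni C \<in> Obj C"
    and Asc_hom: "\<lbrakk>A \<in> Obj C; B \<in> Obj C; D \<in> Obj C\<rbrakk> \<Longrightarrow>
      Asc C A B D \<in> hom (TenO C (TenO C A B) D) (TenO C A (TenO C B D)) \<and> iso_arr (Asc C A B D)"
    and LUni_hom: "A \<in> Obj C \<Longrightarrow> LUni C A \<in> hom (TenO C (Uni C) A) A \<and> iso_arr (LUni C A)"
    and RUni_hom: "A \<in> Obj C \<Longrightarrow> RUni C A \<in> hom (TenO C A (Uni C)) A \<and> iso_arr (RUni C A)"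
    and Asc_natural: "\<lbrakk>f \<in> hom A A'; g \<in> hom B B'; h \<in> hom D D'\<rbrakk> \<Longrightarrow>
      Asc C A' B' D' \<cdot> TenA C (TenA C f g) h = TenA C f (TenA C g h) \<cdot> Asc C A B D"
    and LUni_natural: "f \<in> hom A A' \<Longrightarrow> LUni C A' \<cdot> TenA C (Ide C (Uni C)) f = f \<cdot> LUni C A"
    and RUni_natural: "f \<in> hom A A' \<Longrightarrow> RUni C A' \<cdot> TenA C f (Ide C (Uni C)) = f \<cdot> RUni C A"
    and pentagon: "\<lbrakk>A \<in> Obj C; B \<in> Obj C; D \<in> Obj C; E \<in> Obj C\<rbrakk> \<Longrightarrow>
      Asc C A B (TenO C D E) \<cdot> Asc C (TenO C A B) D E
      = TenA C (Ide C A) (Asc C B D E) \<cdot> Asc C A (TenO C B D) E \<cdot> TenA C (Asc C A B D) (Ide C E)"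
    and triangle: "\<lbrakk>A \<in> Obj C; B \<in> Obj C\<rbrakk> \<Longrightarrow>
      TenA C (Ide C A) (LUni C B) \<cdot> Asc C A (Uni C) B = TenA C (RUni C A) (Ide C B)"

section \<open>Graded objects, complexes and coalgebras\<close>

text \<open>Graded objects are indexed by the integers and come with a lower bound \<open>low\<close> below which all
  components are zero objects, so that all direct sums in the tensor product are finite.
  Objects of \<open>Ch\<^sub>\<ge>\<^sub>0\<close> have lower bound 0; the desuspension has lower bound \<open>-1\<close>.\<close>

record 'o graded =
  low :: int
  cpt :: "int \<Rightarrow> 'o"

text \<open>\<open>gfun f i\<close> is the component \<open>A\<^sub>i \<rightarrow> B\<^sub>i\<^sub>+\<^sub>n\<close> of a map \<open>f : A \<rightarrow> B\<close> of degree \<open>n\<close>.\<close>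

record ('o, 'm) gmap =
  gsrc :: "'o graded"
  gtgt :: "'o graded"
  gdeg :: int
  gfun :: "int \<Rightarrow> 'm"

record ('o, 'm) cplx =
  gr :: "'o graded"
  dif :: "('o, 'm) gmap"

record ('o, 'm) coalgebra =
  cx :: "('o, 'm) cplx"
  cmul :: "('o, 'm) gmap"

context category
begin

definition dsum :: "'i set \<Rightarrow> ('i \<Rightarrow> 'o) \<Rightarrow> 'o \<times> ('i \<Rightarrow> 'm) \<times> ('i \<Rightarrow> 'm)" where
  "dsum I A = (SOME (S, inc, pro). is_biproduct I A S inc pro)"

definition dobj :: "'i set \<Rightarrow> ('i \<Rightarrow> 'o) \<Rightarrow> 'o" where "dobj I A = fst (dsum I A)"
definition dinc :: "'i set \<Rightarrow> ('i \<Rightarrow> 'o) \<Rightarrow> 'i \<Rightarrow> 'm" where "dinc I A = fst (snd (dsum I A))"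
definition dpro :: "'i set \<Rightarrow> ('i \<Rightarrow> 'o) \<Rightarrow> 'i \<Rightarrow> 'm" where "dpro I A = snd (snd (dsum I A))"

definition graded_object :: "'o graded \<Rightarrow> bool" where
  "graded_object A \<longleftrightarrow> (\<forall>i. cpt A i \<in> Obj C) \<and> (\<forall>i<low A. zero_object (cpt A i))"

definition ghom :: "'o graded \<Rightarrow> 'o graded \<Rightarrow> int \<Rightarrow> ('o, 'm) gmap set" where
  "ghom A B n = {f. gsrc f = A \<and> gtgt f = B \<and> gdeg f = n \<and>
     (\<forall>i. gfun f i \<in> hom (cpt A i) (cpt B (i + n)))}"

definition gid :: "'o graded \<Rightarrow> ('o, 'm) gmap" where
  "gid A = \<lparr>gsrc = A, gtgt = A, gdeg = 0, gfun = (\<lambda>i. Ide C (cpt A i))\<rparr>"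

definition gcomp :: "('o, 'm) gmap \<Rightarrow> ('o, 'm) gmap \<Rightarrow> ('o, 'm) gmap" (infixr "\<star>" 70) where
  "g \<star> f = \<lparr>gsrc = gsrc f, gtgt = gtgt g, gdeg = gdeg f + gdeg g,
     gfun = (\<lambda>i. gfun g (i + gdeg f) \<cdot> gfun f i)\<rparr>"

definition gsum :: "'o graded \<Rightarrow> 'o graded \<Rightarrow> int \<Rightarrow> ('i \<Rightarrow> ('o, 'm) gmap) \<Rightarrow> 'i set \<Rightarrow> ('o, 'm) gmap" where
  "gsum A B n F I = \<lparr>gsrc = A, gtgt = B, gdeg = n,
     gfun = (\<lambda>i. hsum (cpt A i) (cpt B (i + n)) (\<lambda>x. gfun (F x) i) I)\<rparr>"

definition gzero :: "'o graded \<Rightarrow> 'o graded \<Rightarrow> int \<Rightarrow> ('o, 'm) gmap" where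
  "gzero A B n = \<lparr>gsrc = A, gtgt = B, gdeg = n, gfun = (\<lambda>i. Nul C (cpt A i) (cpt B (i + n)))\<rparr>"

definition gadd :: "('o, 'm) gmap \<Rightarrow> ('o, 'm) gmap \<Rightarrow> ('o, 'm) gmap" where
  "gadd f g = f\<lparr>gfun := (\<lambda>i. Add C (gfun f i) (gfun g i))\<rparr>"

definition gsgn :: "int \<Rightarrow> ('o, 'm) gmap \<Rightarrow> ('o, 'm) gmap" where
  "gsgn e f = f\<lparr>gfun := (\<lambda>i. hsgn e (gfun f i))\<rparr>"

definition gten :: "'o graded \<Rightarrow> 'o graded \<Rightarrow> 'o graded" (infixr "\<odot>\<^sub>o" 72) where
  "A \<odot>\<^sub>o B = \<lparr>low = low A + low B,
     cpt = (\<lambda>n. dobj {low A..n - low B} (\<lambda>i. TenO C (cpt A i) (cpt B (n - i))))\<rparr>"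

definition tinc :: "'o graded \<Rightarrow> 'o graded \<Rightarrow> int \<Rightarrow> int \<Rightarrow> 'm" where
  "tinc A B i j = dinc {low A..i + j - low B} (\<lambda>l. TenO C (cpt A l) (cpt B (i + j - l))) i"

definition tpro :: "'o graded \<Rightarrow> 'o graded \<Rightarrow> int \<Rightarrow> int \<Rightarrow> 'm" where
  "tpro A B i j = dpro {low A..i + j - low B} (\<lambda>l. TenO C (cpt A l) (cpt B (i + j - l))) i"

text \<open>Tensor product of graded maps with the Koszul sign. The index set leaves out only those
  summands whose source or target is a zero object lying below the lower bounds.\<close>

definition gtenm :: "('o, 'm) gmap \<Rightarrow> ('o, 'm) gmap \<Rightarrow> ('o, 'm) gmap" (infixr "\<odot>" 72) where
  "f \<odot> g = (let A = gsrc f; B = gsrc g; A' = gtgt f; B' = gtgt g; m = gdeg f; n = gdeg g in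
     \<lparr>gsrc = A \<odot>\<^sub>o B, gtgt = A' \<odot>\<^sub>o B', gdeg = m + n,
      gfun = (\<lambda>t. hsum (cpt (A \<odot>\<^sub>o B) t) (cpt (A' \<odot>\<^sub>o B') (t + (m + n)))
        (\<lambda>i. hsgn (n * i)
          (tinc A' B' (i + m) (t - i + n) \<cdot> TenA C (gfun f i) (gfun g (t - i)) \<cdot> tpro A B i (t - i)))
        {i. low A \<le> i \<and> low B \<le> t - i \<and> low A' \<le> i + m \<and> low B' \<le> t - i + n})\<rparr>)"

definition gasc :: "'o graded \<Rightarrow> 'o graded \<Rightarrow> 'o graded \<Rightarrow> ('o, 'm) gmap" where
  "gasc A B D = \<lparr>gsrc = (A \<odot>\<^sub>o B) \<odot>\<^sub>o D, gtgt = A \<odot>\<^sub>o (B \<odot>\<^sub>o D), gdeg = 0,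
     gfun = (\<lambda>t. hsum (cpt ((A \<odot>\<^sub>o B) \<odot>\<^sub>o D) t) (cpt (A \<odot>\<^sub>o (B \<odot>\<^sub>o D)) t)
       (\<lambda>(i, j). let l = t - i - j in
          tinc A (B \<odot>\<^sub>o D) i (j + l) \<cdot> TenA C (Ide C (cpt A i)) (tinc B D j l)
          \<cdot> Asc C (cpt A i) (cpt B j) (cpt D l)
          \<cdot> TenA C (tpro A B i j) (Ide C (cpt D l)) \<cdot> tpro (A \<odot>\<^sub>o B) D (i + j) l)
       {(i, j). low A \<le> i \<and> low B \<le> j \<and> low D \<le> t - i - j})\<rparr>"

text \<open>Tensor powers are bracketed to the right. They are only used for exponents \<open>k \<ge> 1\<close>
  (the values at 0 are irrelevant).\<close>

fun gpow :: "'o graded \<Rightarrow> nat \<Rightarrow> 'o graded" where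
  "gpow A 0 = A"
| "gpow A (Suc 0) = A"
| "gpow A (Suc (Suc k)) = A \<odot>\<^sub>o gpow A (Suc k)"

fun mpow :: "('o, 'm) gmap \<Rightarrow> nat \<Rightarrow> ('o, 'm) gmap" where
  "mpow f 0 = f"
| "mpow f (Suc 0) = f"
| "mpow f (Suc (Suc k)) = f \<odot> mpow f (Suc k)"

text \<open>The canonical isomorphism \<open>A\<^sup>a \<odot> A\<^sup>b \<rightarrow> A\<^sup>a\<^sup>+\<^sup>b\<close> for \<open>a, b \<ge> 1\<close>.\<close>

fun can :: "'o graded \<Rightarrow> nat \<Rightarrow> nat \<Rightarrow> ('o, 'm) gmap" where
  "can A 0 b = gid (A \<odot>\<^sub>o gpow A b)"
| "can A (Suc 0) b = gid (A \<odot>\<^sub>o gpow A b)"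
| "can A (Suc (Suc a)) b = (gid A \<odot> can A (Suc a) b) \<star> gasc A (gpow A (Suc a)) (gpow A b)"

text \<open>The tensor product of maps into \<open>A\<^sup>k\<^sub>1, \<dots>, A\<^sup>k\<^sub>j\<close>, as a map into \<open>A\<^sup>k\<^sub>1\<^sup>+\<^sup>\<dots>\<^sup>+\<^sup>k\<^sub>j\<close>.\<close>

fun mtens :: "'o graded \<Rightarrow> (nat \<times> ('o, 'm) gmap) list \<Rightarrow> ('o, 'm) gmap" where
  "mtens A [] = undefined"
| "mtens A [(k, f)] = f"
| "mtens A ((k, f) # r # rs) = can A k (sum_list (map fst (r # rs))) \<star> (f \<odot> mtens A (r # rs))"

definition complex :: "('o, 'm) cplx \<Rightarrow> bool" where
  "complex X \<longleftrightarrow> graded_object (gr X) \<and> dif X \<in> ghom (gr X) (gr X) (-1) \<and>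
     dif X \<star> dif X = gzero (gr X) (gr X) (-2)"

definition nonneg_complex :: "('o, 'm) cplx \<Rightarrow> bool" where
  "nonneg_complex X \<longleftrightarrow> complex X \<and> low (gr X) = 0"

definition chain_map :: "('o, 'm) cplx \<Rightarrow> ('o, 'm) cplx \<Rightarrow> ('o, 'm) gmap \<Rightarrow> bool" where
  "chain_map X Y f \<longleftrightarrow> f \<in> ghom (gr X) (gr Y) 0 \<and> f \<star> dif X = dif Y \<star> f"

definition cten :: "('o, 'm) cplx \<Rightarrow> ('o, 'm) cplx \<Rightarrow> ('o, 'm) cplx" where
  "cten X Y = \<lparr>gr = gr X \<odot>\<^sub>o gr Y, dif = gadd (dif X \<odot> gid (gr Y)) (gid (gr X) \<odot> dif Y)\<rparr>"

fun cpow :: "('o, 'm) cplx \<Rightarrow> nat \<Rightarrow> ('o, 'm) cplx" where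
  "cpow X 0 = X"
| "cpow X (Suc 0) = X"
| "cpow X (Suc (Suc k)) = cten X (cpow X (Suc k))"

definition dg_coalgebra :: "('o, 'm) coalgebra \<Rightarrow> bool" where
  "dg_coalgebra X \<longleftrightarrow> nonneg_complex (cx X) \<and> chain_map (cx X) (cten (cx X) (cx X)) (cmul X) \<and>
     (let A = gr (cx X) in
       gasc A A A \<star> (cmul X \<odot> gid A) \<star> cmul X = (gid A \<odot> cmul X) \<star> cmul X)"

definition coalgebra_hom :: "('o, 'm) coalgebra \<Rightarrow> ('o, 'm) coalgebra \<Rightarrow> ('o, 'm) gmap set" where
  "coalgebra_hom X Y = {f. chain_map (cx X) (cx Y) f \<and> (f \<odot> f) \<star> cmul X = cmul Y \<star> f}"

end

section \<open>The simplicial enrichment\<close>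

text \<open>The nondegenerate \<open>p\<close>-simplices of \<open>\<Delta>\<^sub>n\<close> are the subsets of \<open>{0..n}\<close> with \<open>p + 1\<close> elements; they
  form a basis of the normalized chains of \<open>\<int>[\<Delta>\<^sub>n]\<close>. Hence, in degree \<open>t\<close>, the tensor
  product of \<open>\<int>[\<Delta>\<^sub>n]\<close> and \<open>X\<close> is the direct sum of the \<open>X\<^bsub>t - p\<^esub>\<close> over these simplices.\<close>

definition splx :: "nat \<Rightarrow> nat set set" where
  "splx n = {\<sigma>. \<sigma> \<subseteq> {0..n} \<and> \<sigma> \<noteq> {}}"

definition sdim :: "nat set \<Rightarrow> int" where
  "sdim \<sigma> = int (card \<sigma>) - 1"

text \<open>Monotone maps \<open>[m] \<rightarrow> [n]\<close>, tabulated as lists of length \<open>m + 1\<close>.\<close>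

definition mono_maps :: "nat \<Rightarrow> nat \<Rightarrow> nat list set" where
  "mono_maps m n = {\<theta>. length \<theta> = m + 1 \<and> sorted \<theta> \<and> set \<theta> \<subseteq> {0..n}}"

context category
begin

definition sgr :: "nat \<Rightarrow> 'o graded \<Rightarrow> 'o graded" where
  "sgr n A = \<lparr>low = low A, cpt = (\<lambda>t. dobj (splx n) (\<lambda>\<sigma>. cpt A (t - sdim \<sigma>)))\<rparr>"

text \<open>\<open>sinc n A \<sigma>\<close> is \<open>x \<mapsto> \<sigma> \<otimes> x\<close>.\<close>

definition sinc :: "nat \<Rightarrow> 'o graded \<Rightarrow> nat set \<Rightarrow> ('o, 'm) gmap" where
  "sinc n A \<sigma> = \<lparr>gsrc = A, gtgt = sgr n A, gdeg = sdim \<sigma>,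
     gfun = (\<lambda>i. dinc (splx n) (\<lambda>\<tau>. cpt A (i + sdim \<sigma> - sdim \<tau>)) \<sigma>)\<rparr>"

definition spro :: "nat \<Rightarrow> 'o graded \<Rightarrow> nat set \<Rightarrow> ('o, 'm) gmap" where
  "spro n A \<sigma> = \<lparr>gsrc = sgr n A, gtgt = A, gdeg = - sdim \<sigma>,
     gfun = (\<lambda>t. dpro (splx n) (\<lambda>\<tau>. cpt A (t - sdim \<tau>)) \<sigma>)\<rparr>"

text \<open>\<open>d (\<sigma> \<otimes> x) = (\<Sum>r. (-1)\<^sup>r (d\<^sub>r \<sigma> \<otimes> x)) + (-1)\<^sup>p (\<sigma> \<otimes> d x)\<close>, where \<open>d\<^sub>r \<sigma>\<close> removes the vertex \<open>w\<close>
  with exactly \<open>r\<close> smaller vertices in \<open>\<sigma>\<close>.\<close>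

definition scx :: "nat \<Rightarrow> ('o, 'm) cplx \<Rightarrow> ('o, 'm) cplx" where
  "scx n X = (let A = gr X; S = sgr n A in \<lparr>gr = S, dif = gadd
     (gsum S S (-1) (\<lambda>(\<sigma>, w). gsgn (int (card {v \<in> \<sigma>. v < w})) (sinc n A (\<sigma> - {w}) \<star> spro n A \<sigma>))
        {(\<sigma>, w). \<sigma> \<in> splx n \<and> w \<in> \<sigma> \<and> card \<sigma> \<ge> 2})
     (gsum S S (-1) (\<lambda>\<sigma>. gsgn (sdim \<sigma>) (sinc n A \<sigma> \<star> dif X \<star> spro n A \<sigma>)) (splx n))\<rparr>)"

definition shom :: "nat \<Rightarrow> ('o, 'm) cplx \<Rightarrow> ('o, 'm) cplx \<Rightarrow> ('o, 'm) gmap set" where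
  "shom n X Y = {\<phi>. chain_map (scx n X) Y \<phi>}"

text \<open>\<open>sobj m n A \<theta>\<close> is the map induced on chains by \<open>\<theta> : [m] \<rightarrow> [n]\<close>, which kills the simplices
  that become degenerate; \<open>smap n f\<close> is the identity of the chains tensor \<open>f\<close> (\<open>f\<close> of degree 0).\<close>

definition sobj :: "nat \<Rightarrow> nat \<Rightarrow> 'o graded \<Rightarrow> nat list \<Rightarrow> ('o, 'm) gmap" where
  "sobj m n A \<theta> = gsum (sgr m A) (sgr n A) 0 (\<lambda>\<sigma>. sinc n A (nth \<theta> ` \<sigma>) \<star> spro m A \<sigma>)
     {\<sigma> \<in> splx m. inj_on (nth \<theta>) \<sigma>}"

definition smap :: "nat \<Rightarrow> ('o, 'm) gmap \<Rightarrow> ('o, 'm) gmap" where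
  "smap n f = gsum (sgr n (gsrc f)) (sgr n (gtgt f)) 0
     (\<lambda>\<sigma>. sinc n (gtgt f) \<sigma> \<star> f \<star> spro n (gsrc f) \<sigma>) (splx n)"

text \<open>The degenerate \<open>n\<close>-simplex on a map of degree 0: only vertices of \<open>\<Delta>\<^sub>n\<close> survive
  the augmentation.\<close>

definition sdegen :: "nat \<Rightarrow> ('o, 'm) gmap \<Rightarrow> ('o, 'm) gmap" where
  "sdegen n f = f \<star> gsum (sgr n (gsrc f)) (gsrc f) 0 (\<lambda>v. spro n (gsrc f) {v}) {0..n}"

text \<open>The degree-\<open>n\<close> map given by the restriction of an \<open>n\<close>-simplex to the nondegenerate
  \<open>n\<close>-simplex of \<open>\<Delta>\<^sub>n\<close>; and the map with given restrictions to all simplices \<open>\<sigma>\<close> of \<open>\<Delta>\<^sub>n\<close>.\<close>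

definition stop :: "nat \<Rightarrow> 'o graded \<Rightarrow> ('o, 'm) gmap \<Rightarrow> ('o, 'm) gmap" where
  "stop n A \<phi> = \<phi> \<star> sinc n A {0..n}"

definition sglue :: "nat \<Rightarrow> 'o graded \<Rightarrow> 'o graded \<Rightarrow> (nat set \<Rightarrow> ('o, 'm) gmap) \<Rightarrow> ('o, 'm) gmap" where
  "sglue n A B \<psi> = gsum (sgr n A) B 0 (\<lambda>\<sigma>. \<psi> \<sigma> \<star> spro n A \<sigma>) (splx n)"

text \<open>Tensor product of \<open>n\<close>-simplices via the Alexander--Whitney diagonal, which sends \<open>\<sigma>\<close> to the
  sum over \<open>v \<in> \<sigma>\<close> of \<open>{u \<in> \<sigma>. u \<le> v} \<otimes> {u \<in> \<sigma>. v \<le> u}\<close>. Moving the second factor past the first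
  argument produces precisely the Koszul sign contained in \<open>\<odot>\<close>.\<close>

definition sten ::
  "nat \<Rightarrow> 'o graded \<Rightarrow> 'o graded \<Rightarrow> ('o, 'm) gmap \<Rightarrow> ('o, 'm) gmap \<Rightarrow> ('o, 'm) gmap" where
  "sten n A B \<phi> \<psi> = sglue n (A \<odot>\<^sub>o B) (gtgt \<phi> \<odot>\<^sub>o gtgt \<psi>)
     (\<lambda>\<sigma>. gsum (A \<odot>\<^sub>o B) (gtgt \<phi> \<odot>\<^sub>o gtgt \<psi>) (sdim \<sigma>)
        (\<lambda>v. (\<phi> \<star> sinc n A {u \<in> \<sigma>. u \<le> v}) \<odot> (\<psi> \<star> sinc n B {u \<in> \<sigma>. v \<le> u})) \<sigma>)"

text \<open>Iterated: \<open>n\<close>-simplices of maps \<open>A \<rightarrow> B\<^sup>k\<^sub>i\<close>, \<open>i = 1, \<dots>, j\<close>, give an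
  \<open>n\<close>-simplex of maps from \<open>A\<^sup>j\<close> to the tensor power with exponent the sum of the \<open>k\<^sub>i\<close>.\<close>

fun stens :: "nat \<Rightarrow> 'o graded \<Rightarrow> 'o graded \<Rightarrow> (nat \<times> ('o, 'm) gmap) list \<Rightarrow> ('o, 'm) gmap" where
  "stens n A B [] = undefined"
| "stens n A B [(k, \<phi>)] = \<phi>"
| "stens n A B ((k, \<phi>) # r # rs) = can B k (sum_list (map fst (r # rs))) \<star>
     sten n A (gpow A (length (r # rs))) \<phi> (stens n A B (r # rs))"

end

section \<open>The nerves of the factorization categories\<close>

text \<open>A morphism \<open>[a] \<rightarrow> [b]\<close> of \<open>\<Delta>\<^sup>\<circ>\<^bsub>act\<^esub>\<close> is tabulated as the strictly increasing list of its
  \<open>a + 1\<close> values, the first being 0 and the last being \<open>b\<close>.\<close>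

definition act :: "nat list \<Rightarrow> bool" where
  "act \<alpha> \<longleftrightarrow> length \<alpha> \<ge> 2 \<and> hd \<alpha> = 0 \<and> sorted_wrt (<) \<alpha>"

definition asrc :: "nat list \<Rightarrow> nat" where "asrc \<alpha> = length \<alpha> - 1"
definition atrg :: "nat list \<Rightarrow> nat" where "atrg \<alpha> = last \<alpha>"
definition aid :: "nat \<Rightarrow> nat list" where "aid k = [0..<k + 1]"
definition acomp :: "nat list \<Rightarrow> nat list \<Rightarrow> nat list" where "acomp \<beta> \<alpha> = map (nth \<beta>) \<alpha>"

text \<open>An \<open>n\<close>-simplex \<open>[j] \<rightarrow> c\<^sub>0 \<rightarrow> \<dots> \<rightarrow> c\<^sub>n \<rightarrow> [k]\<close> is the list of its \<open>n + 2\<close> morphisms.\<close>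

type_synonym chain = "nat list list"

definition nerve :: "nat \<Rightarrow> nat \<Rightarrow> nat \<Rightarrow> chain set" where
  "nerve j k n = {c. length c = n + 2 \<and> (\<forall>\<alpha>\<in>set c. act \<alpha>) \<and>
     (\<forall>t\<le>n. atrg (c ! t) = asrc (c ! (t + 1))) \<and> asrc (hd c) = j \<and> atrg (last c) = k}"

definition cdim :: "chain \<Rightarrow> nat" where "cdim c = length c - 2"

text \<open>Composite of a composable list of morphisms, the first one starting at \<open>[m]\<close>.\<close>

fun path :: "nat \<Rightarrow> nat list list \<Rightarrow> nat list" where
  "path m [] = aid m"
| "path m (\<alpha> # as) = acomp (path (atrg \<alpha>) as) \<alpha>"

text \<open>The simplicial operator of \<open>\<theta> : [m] \<rightarrow> [n]\<close>, giving \<open>[j] \<rightarrow> c\<^bsub>\<theta> 0\<^esub> \<rightarrow> \<dots> \<rightarrow> c\<^bsub>\<theta> m\<^esub> \<rightarrow> [k]\<close>.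
  Note that \<open>c ! t\<close> ends in \<open>c\<^sub>t\<close>.\<close>

definition nop :: "nat list \<Rightarrow> chain \<Rightarrow> chain" where
  "nop \<theta> c =
     path (asrc (hd c)) (take (hd \<theta> + 1) c) #
     map (\<lambda>t. path (atrg (c ! (\<theta> ! t))) (take (\<theta> ! (t + 1) - \<theta> ! t) (drop (\<theta> ! t + 1) c)))
       [0..<length \<theta> - 1] @
     [path (atrg (c ! last \<theta>)) (drop (last \<theta> + 1) c)]"

definition cpost :: "nat list \<Rightarrow> chain \<Rightarrow> chain" where
  "cpost \<beta> c = butlast c @ [acomp \<beta> (last c)]"

definition cpre :: "chain \<Rightarrow> nat list \<Rightarrow> chain" where
  "cpre c \<alpha> = acomp (hd c) \<alpha> # tl c"

text \<open>\<open>cut x y c\<close> is the part of the chain \<open>c\<close> lying over the interval from \<open>x\<close> to \<open>y\<close> of its initial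
  object.\<close>

fun cut :: "nat \<Rightarrow> nat \<Rightarrow> chain \<Rightarrow> chain" where
  "cut x y [] = []"
| "cut x y (\<alpha> # c) = map (\<lambda>v. v - \<alpha> ! x) (take (y - x + 1) (drop x \<alpha>)) # cut (\<alpha> ! x) (\<alpha> ! y) c"

definition blocks :: "chain \<Rightarrow> chain list" where
  "blocks c = map (\<lambda>i. cut i (i + 1) c) [0..<asrc (hd c)]"

definition cend :: "chain \<Rightarrow> nat" where "cend c = atrg (last c)"

text \<open>The chains \<open>[j] \<rightarrow> c\<^sub>0 \<rightarrow> \<dots> \<rightarrow> c\<^sub>i = c\<^sub>i\<close> and \<open>c\<^sub>i = c\<^sub>i \<rightarrow> \<dots> \<rightarrow> c\<^sub>n \<rightarrow> [k]\<close>.\<close>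

definition cfront :: "nat \<Rightarrow> chain \<Rightarrow> chain" where
  "cfront i c = take (i + 1) c @ [aid (atrg (c ! i))]"

definition cback :: "nat \<Rightarrow> chain \<Rightarrow> chain" where
  "cback i c = aid (atrg (c ! i)) # drop (i + 1) c"

section \<open>Coherent transformations\<close>

type_synonym ('o, 'm) family = "nat \<Rightarrow> chain \<Rightarrow> ('o, 'm) gmap"

context category
begin

text \<open>The map \<open>X(\<alpha>)\<close> on tensor powers: the tensor product of iterated comultiplications.\<close>

fun icmul :: "('o, 'm) coalgebra \<Rightarrow> nat \<Rightarrow> ('o, 'm) gmap" where
  "icmul X 0 = gid (gr (cx X))"
| "icmul X (Suc 0) = gid (gr (cx X))"
| "icmul X (Suc (Suc k)) = (gid (gr (cx X)) \<odot> icmul X (Suc k)) \<star> cmul X"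

definition comap :: "('o, 'm) coalgebra \<Rightarrow> nat list \<Rightarrow> ('o, 'm) gmap" where
  "comap X \<alpha> = mtens (gr (cx X))
     (map (\<lambda>i. let k = \<alpha> ! (i + 1) - \<alpha> ! i in (k, icmul X k)) [0..<asrc \<alpha>])"

text \<open>The values of a family on chains starting at an arbitrary \<open>[j]\<close>.\<close>

definition fext ::
  "('o, 'm) coalgebra \<Rightarrow> ('o, 'm) coalgebra \<Rightarrow> ('o, 'm) family \<Rightarrow> chain \<Rightarrow> ('o, 'm) gmap" where
  "fext X Y \<mu> c = stens (cdim c) (gr (cx X)) (gr (cx Y))
     (map (\<lambda>b. (cend b, \<mu> (cend b) b)) (blocks c))"

text \<open>The family with value \<open>F k c\<close> at the simplices \<open>c\<close> of \<open>N\<^bsub>1,k\<^esub>\<close>, \<open>k \<ge> 1\<close>.\<close>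

definition mk_family :: "(nat \<Rightarrow> chain \<Rightarrow> ('o, 'm) gmap) \<Rightarrow> ('o, 'm) family" where
  "mk_family F = (\<lambda>k c. if k \<ge> 1 \<and> (\<exists>n. c \<in> nerve 1 k n) then F k c else undefined)"

definition Coh :: "('o, 'm) coalgebra \<Rightarrow> ('o, 'm) coalgebra \<Rightarrow> ('o, 'm) family set" where
  "Coh X Y = {\<mu>. \<mu> = mk_family \<mu> \<and>
     (\<forall>k\<ge>1. \<forall>n. \<forall>c\<in>nerve 1 k n. \<mu> k c \<in> shom n (cx X) (cpow (cx Y) k)) \<and>
     (\<forall>k\<ge>1. \<forall>m n. \<forall>c\<in>nerve 1 k n. \<forall>\<theta>\<in>mono_maps m n.
        \<mu> k (nop \<theta> c) = \<mu> k c \<star> sobj m n (gr (cx X)) \<theta>) \<and>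
     (\<forall>k\<ge>1. \<forall>n. \<forall>c\<in>nerve 1 k n. \<forall>\<beta>. act \<beta> \<and> asrc \<beta> = k \<longrightarrow>
        \<mu> (atrg \<beta>) (cpost \<beta> c) = comap Y \<beta> \<star> \<mu> k c) \<and>
     (\<forall>j\<ge>1. \<forall>k\<ge>1. \<forall>n. \<forall>c\<in>nerve j k n. \<forall>\<alpha>. act \<alpha> \<and> asrc \<alpha> = 1 \<and> atrg \<alpha> = j \<longrightarrow>
        \<mu> k (cpre c \<alpha>) = fext X Y \<mu> c \<star> smap n (comap X \<alpha>))}"

definition coh_of_hom ::
  "('o, 'm) coalgebra \<Rightarrow> ('o, 'm) coalgebra \<Rightarrow> ('o, 'm) gmap \<Rightarrow> ('o, 'm) family" where
  "coh_of_hom X Y f = mk_family (\<lambda>k c. sdegen (cdim c) (mpow f k \<star> comap X [0, k]))"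

text \<open>Composition. \<open>coh_comp_top\<close> is the value on the simplex \<open>c\<close> in the normalized Hom-complex. The
  corresponding simplex of the simplicial Hom restricts, at each nondegenerate simplex \<open>\<sigma>\<close> of \<open>\<Delta>\<^sub>n\<close>,
  to the value on the face of \<open>c\<close> with vertices \<open>\<sigma>\<close>. For \<open>f \<in> Coh X Y\<close> and \<open>g \<in> Coh Y Z\<close> the composite
  is simplicial and compatible with postcomposition, but since the Alexander--Whitney tensor product
  of simplices does not satisfy the interchange law strictly, the last condition in \<open>Coh\<close> may fail
  for it.\<close>

definition coh_comp_top ::
  "('o, 'm) coalgebra \<Rightarrow> ('o, 'm) coalgebra \<Rightarrow> ('o, 'm) coalgebra \<Rightarrow>
   ('o, 'm) family \<Rightarrow> ('o, 'm) family \<Rightarrow> chain \<Rightarrow> ('o, 'm) gmap" where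
  "coh_comp_top X Y Z g f c = (let n = cdim c in
     gsum (gr (cx X)) (gpow (gr (cx Z)) (cend c)) (int n)
       (\<lambda>i. let m = atrg (c ! i) in gsgn (int (i * (n - i)))
          (stop (n - i) (gpow (gr (cx Y)) m) (fext Y Z g (cback i c)) \<star>
           stop i (gr (cx X)) (f m (cfront i c)))) {0..n})"

definition coh_comp ::
  "('o, 'm) coalgebra \<Rightarrow> ('o, 'm) coalgebra \<Rightarrow> ('o, 'm) coalgebra \<Rightarrow>
   ('o, 'm) family \<Rightarrow> ('o, 'm) family \<Rightarrow> ('o, 'm) family" where
  "coh_comp X Y Z g f = mk_family (\<lambda>k c.
     sglue (cdim c) (gr (cx X)) (gpow (gr (cx Z)) k)
       (\<lambda>\<sigma>. coh_comp_top X Y Z g f (nop (sorted_list_of_set \<sigma>) c)))"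

text \<open>The action of \<open>p : X' \<rightarrow> X\<close> and \<open>q : Y \<rightarrow> Y'\<close> on coherent transformations from \<open>X\<close> to \<open>Y\<close>.\<close>

definition coh_map :: "('o, 'm) gmap \<Rightarrow> ('o, 'm) gmap \<Rightarrow> ('o, 'm) family \<Rightarrow> ('o, 'm) family" where
  "coh_map p q \<mu> = mk_family (\<lambda>k c. mpow q k \<star> \<mu> k c \<star> smap (cdim c) p)"

end

section \<open>\<open>A\<^sub>\<infinity>\<close>-coalgebras\<close>

text \<open>A map between the positive parts of pro-tensor algebras is the matrix of its components
  \<open>M j k : V\<^sup>j \<rightarrow> W\<^sup>k\<close>, \<open>j, k \<ge> 1\<close>. Being a morphism of pro-objects between the formal products means
  that for every \<open>k\<close> only finitely many \<open>M j k\<close> are nonzero.\<close>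

type_synonym ('o, 'm) matrix = "nat \<Rightarrow> nat \<Rightarrow> ('o, 'm) gmap"

context category
begin

definition mk_matrix :: "(nat \<Rightarrow> nat \<Rightarrow> ('o, 'm) gmap) \<Rightarrow> ('o, 'm) matrix" where
  "mk_matrix F = (\<lambda>j k. if j \<ge> 1 \<and> k \<ge> 1 then F j k else undefined)"

definition matrix_nonzero :: "('o, 'm) matrix \<Rightarrow> nat \<Rightarrow> nat set" where
  "matrix_nonzero M k =
     {j. j \<ge> 1 \<and> M j k \<noteq> gzero (gsrc (M j k)) (gtgt (M j k)) (gdeg (M j k))}"

definition pro_hom :: "'o graded \<Rightarrow> 'o graded \<Rightarrow> int \<Rightarrow> ('o, 'm) matrix set" where
  "pro_hom V W n = {M. M = mk_matrix M \<and>
     (\<forall>j\<ge>1. \<forall>k\<ge>1. M j k \<in> ghom (gpow V j) (gpow W k) n) \<and>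
     (\<forall>k\<ge>1. finite (matrix_nonzero M k))}"

text \<open>The composite of \<open>M \<in> pro_hom U V m\<close> and \<open>N \<in> pro_hom V W n\<close>.\<close>

definition pro_comp :: "('o, 'm) matrix \<Rightarrow> ('o, 'm) matrix \<Rightarrow> ('o, 'm) matrix" where
  "pro_comp N M = mk_matrix (\<lambda>j k.
     gsum (gsrc (M j 1)) (gtgt (N 1 k)) (gdeg (M j 1) + gdeg (N 1 k))
       (\<lambda>l. N l k \<star> M j l) (matrix_nonzero N k))"

definition algebra_hom :: "'o graded \<Rightarrow> 'o graded \<Rightarrow> ('o, 'm) matrix set" where
  "algebra_hom V W = {F \<in> pro_hom V W 0. \<forall>j\<ge>1. \<forall>j'\<ge>1. \<forall>k\<ge>1.
     F (j + j') k \<star> can V j j' =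
     gsum (gpow V j \<odot>\<^sub>o gpow V j') (gpow W k) 0
       (\<lambda>l. can W l (k - l) \<star> (F j l \<odot> F j' (k - l))) {1..<k}}"

text \<open>The derivation of degree \<open>-1\<close> with components \<open>b k : V \<rightarrow> V\<^sup>k\<close> on generators, extended to
  \<open>V\<^sup>j = V \<odot> V\<^sup>j\<^sup>-\<^sup>1\<close> by the Leibniz rule (whose sign is the Koszul sign contained in \<open>\<odot>\<close>).\<close>

fun derivation :: "'o graded \<Rightarrow> (nat \<Rightarrow> ('o, 'm) gmap) \<Rightarrow> ('o, 'm) matrix" where
  "derivation V b 0 k = undefined"
| "derivation V b (Suc 0) k = (if k \<ge> 1 then b k else undefined)"
| "derivation V b (Suc (Suc j)) k =
     (if k = 0 then undefined
      else if k < Suc (Suc j) then gzero (gpow V (Suc (Suc j))) (gpow V k) (-1)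
      else gadd (can V (k - Suc j) (Suc j) \<star> (b (k - Suc j) \<odot> gid (gpow V (Suc j))))
                (gid V \<odot> derivation V b (Suc j) (k - 1)))"

definition desusp :: "'o graded \<Rightarrow> 'o graded" where
  "desusp A = \<lparr>low = low A - 1, cpt = (\<lambda>i. cpt A (i + 1))\<rparr>"

text \<open>The identity of \<open>A\<close>, regarded as a map \<open>s\<^sup>-\<^sup>1 : A \<rightarrow> s\<^sup>-\<^sup>1A\<close> of degree \<open>-1\<close>, and its inverse.\<close>

definition sdown :: "'o graded \<Rightarrow> ('o, 'm) gmap" where
  "sdown A = \<lparr>gsrc = A, gtgt = desusp A, gdeg = -1, gfun = (\<lambda>i. Ide C (cpt A i))\<rparr>"

definition slift :: "'o graded \<Rightarrow> ('o, 'm) gmap" where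
  "slift A = \<lparr>gsrc = desusp A, gtgt = A, gdeg = 1, gfun = (\<lambda>i. Ide C (cpt A (i + 1)))\<rparr>"

text \<open>The derivation of a dg-coalgebra; the sign \<open>(-1)\<^bsup>deg x'\<^esup>\<close> of its quadratic part is the Koszul
  sign of \<open>s\<^sup>-\<^sup>1 \<odot> s\<^sup>-\<^sup>1\<close>.\<close>

definition cobar :: "('o, 'm) coalgebra \<Rightarrow> ('o, 'm) matrix" where
  "cobar X = (let A = gr (cx X); V = desusp A in derivation V (\<lambda>k.
     if k = 1 then gsgn 1 (sdown A \<star> dif (cx X) \<star> slift A)
     else if k = 2 then (sdown A \<odot> sdown A) \<star> cmul X \<star> slift A
     else gzero V (gpow V k) (-1)))"

definition Ainf_hom :: "('o, 'm) coalgebra \<Rightarrow> ('o, 'm) coalgebra \<Rightarrow> ('o, 'm) matrix set" where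
  "Ainf_hom X Y = {F \<in> algebra_hom (desusp (gr (cx X))) (desusp (gr (cx Y))).
     pro_comp F (cobar X) = pro_comp (cobar Y) F}"

text \<open>The algebra morphism with components \<open>\<alpha>\<^sub>1 = s\<^sup>-\<^sup>1fs\<close> and \<open>\<alpha>\<^sub>k = 0\<close> for \<open>k \<ge> 2\<close>.\<close>

definition Ainf_of_hom :: "('o, 'm) gmap \<Rightarrow> ('o, 'm) matrix" where
  "Ainf_of_hom f = mk_matrix (\<lambda>j k.
     if j = k then mpow (sdown (gtgt f) \<star> f \<star> slift (gsrc f)) k
     else gzero (gpow (desusp (gsrc f)) j) (gpow (desusp (gtgt f)) k) 0)"

end

end

(* The chains [m] = [m] -> [m+1] -> ... -> [m+n] = [m+n] of elementary refinements are the maximal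
   simplices of a cubical complex; for m = 1 they triangulate an n-cube. Let B m n : X^m -> Y^(m+n) be
   the degree n map obtained by evaluating a coherent transformation on their signed sum. In the
   boundary of the cube the inner faces of the simplices cancel in pairs, the faces d_0 give
   B 2 (n-1) precomposed with the comultiplication of X by condition (b), and the faces d_n give
   B 1 (n-1) followed by the cofaces of Y by condition (a). Up to desuspension this is the equation
   of an A-infinity morphism with components B 1 (k-1). Its extension to an algebra morphism has the
   components B j (k-j), because the Alexander-Whitney diagonal of a cube, decomposed into shuffles,
   leaves just one nondegenerate term for each way to refine the first block before the others.
   Compatibility with composition holds since cutting every chain at its i-th vertex is a bijection
   of the words of length n with pairs of words of lengths i and n - i. *)

theory Submission
  imports Defs
begin

text \<open>Condition (b) can fail for a composite of coherent transformations, so the construction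
  starts from less: \<open>Phi\<close> freely extends \<open>row\<close>, which evaluates only
  chains starting at [1] and is defined for every family. For typed simplicial families
  (\<open>sfam\<close>) the higher rows are computed by \<open>Phi_sdown\<close>; the chain
  condition, (a) and (b) enter when \<open>Phi\<close> is compared with the differentials. Tensor
  algebras are free, so identities are tested on generators: equalities of algebra morphisms by
  \<open>ahom_eqI\<close>, intertwining of derivations by \<open>derivation_intertwine\<close>. The
  equation of an A-infinity morphism then involves only rows 1 and 2 of \<open>Phi\<close>, because
  the cobar derivation lengthens words by at most one. All desuspension signs follow one rule: a map
  of degree n passing \<open>mpow (sdown A) j\<close>, of degree -j, costs (-1) to the power j * n.
  Direct sums are picked by choice, so identities of maps out of tensor products are checked after
  precomposition with the inclusions of summands (\<open>gten_ext\<close>,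
  \<open>sgr_ext\<close>).\<close>

lemma finprod_commute_hom:
  assumes "comm_monoid G" "comm_monoid H"
    and h: "\<And>x. x \<in> carrier G \<Longrightarrow> h x \<in> carrier H"
      "\<And>x y. x \<in> carrier G \<Longrightarrow> y \<in> carrier G \<Longrightarrow> h (x \<otimes>\<^bsub>G\<^esub> y) = h x \<otimes>\<^bsub>H\<^esub> h y"
      "h \<one>\<^bsub>G\<^esub> = \<one>\<^bsub>H\<^esub>"
    and f: "\<And>i. i \<in> I \<Longrightarrow> f i \<in> carrier G"
  shows "h (finprod G f I) = finprod H (\<lambda>i. h (f i)) I"
proof -
  interpret G: comm_monoid G by fact
  interpret H: comm_monoid H by fact
  show ?thesis
    using f
  \<comment> \<open>Over an infinite index set both products are the unit by convention, so the sum
    lemmas derived from this one carry no finiteness assumption.\<close>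
  proof (induction I rule: infinite_finite_induct)
    case (insert x F)
    have "finprod G f F \<in> carrier G"
      using insert by (intro G.finprod_closed) auto
    with insert h show ?case
      by (simp add: Pi_iff)
  qed (use h in simp_all)
qed

lemma (in comm_monoid) finprod_Sigma:
  assumes "finite I" "\<And>i. i \<in> I \<Longrightarrow> finite (J i)"
    and f: "\<And>i j. i \<in> I \<Longrightarrow> j \<in> J i \<Longrightarrow> f i j \<in> carrier G"
  shows "finprod G (\<lambda>(i, j). f i j) (Sigma I J) = finprod G (\<lambda>i. finprod G (f i) (J i)) I"
  using assms
proof (induction I rule: finite_induct)
  case (insert x F)
  have eq: "Sigma (insert x F) J = Pair x ` J x \<union> Sigma F J"
    by auto
  have "finprod G (\<lambda>(i, j). f i j) (Pair x ` J x) = finprod G (f x) (J x)"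
    by (subst finprod_reindex) (use insert in \<open>auto simp: inj_on_def\<close>)
  moreover have "finprod G (\<lambda>(i, j). f i j) (Sigma F J) = finprod G (\<lambda>i. finprod G (f i) (J i)) F"
    using insert by (intro insert.IH) auto
  ultimately show ?case
    unfolding eq
    by (subst finprod_Un_disjoint) (use insert in \<open>auto intro!: finprod_closed\<close>)
qed simp

section \<open>Abelian groups of morphisms and finite direct sums\<close>

context category
begin

lemma hom_iff: "f \<in> hom A B \<longleftrightarrow> f \<in> Arr C \<and> Src C f = A \<and> Trg C f = B"
  by (simp add: hom_def)

declare Src_Obj [simp] Trg_Obj [simp] Cmp_Ide [simp] Ide_Cmp [simp]

lemma Ide_simps [simp]:
  assumes "A \<in> Obj C"
  shows "Ide C A \<in> Arr C" "Src C (Ide C A) = A" "Trg C (Ide C A) = A"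
  using Ide_Arr[OF assms] by auto

lemma Cmp_simps [simp]:
  assumes "f \<in> Arr C" "g \<in> Arr C" "Src C g = Trg C f"
  shows "g \<cdot> f \<in> Arr C" "Src C (g \<cdot> f) = Src C f" "Trg C (g \<cdot> f) = Trg C g"
  using Cmp_Arr assms by auto

lemma cmp_assoc [simp]:
  assumes "f \<in> Arr C" "g \<in> Arr C" "h \<in> Arr C" "Src C g = Trg C f" "Src C h = Trg C g"
  shows "(h \<cdot> g) \<cdot> f = h \<cdot> g \<cdot> f"
  using Cmp_assoc assms by auto

lemma Cmp_Ide' [simp]: "f \<in> Arr C \<Longrightarrow> A = Src C f \<Longrightarrow> f \<cdot> Ide C A = f"
  and Ide_Cmp' [simp]: "f \<in> Arr C \<Longrightarrow> A = Trg C f \<Longrightarrow> Ide C A \<cdot> f = f"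
  by simp_all

end

context preadditive_category
begin

lemma homgrp_simps [simp]:
  "carrier (homgrp A B) = hom A B" "monoid.mult (homgrp A B) = Add C" "one (homgrp A B) = Nul C A B"
  by (simp_all add: homgrp_def)

lemma Nul_simps [simp]:
  assumes "A \<in> Obj C" "B \<in> Obj C"
  shows "Nul C A B \<in> Arr C" "Src C (Nul C A B) = A" "Trg C (Nul C A B) = B"
proof -
  interpret comm_group "homgrp A B" using comm_group_homgrp assms .
  show "Nul C A B \<in> Arr C" "Src C (Nul C A B) = A" "Trg C (Nul C A B) = B"
    using one_closed by (auto simp: hom_iff)
qed

lemma Add_simps [simp]:
  assumes "f \<in> Arr C" "g \<in> Arr C" "Src C g = Src C f" "Trg C g = Trg C f"
  shows "Add C f g \<in> Arr C" "Src C (Add C f g) = Src C f" "Trg C (Add C f g) = Trg C f"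
proof -
  interpret comm_group "homgrp (Src C f) (Trg C f)" using comm_group_homgrp assms by simp
  show "Add C f g \<in> Arr C" "Src C (Add C f g) = Src C f" "Trg C (Add C f g) = Trg C f"
    using m_closed[of f g] assms by (auto simp: hom_iff)
qed

lemma neg_simps [simp]:
  assumes "f \<in> Arr C"
  shows "neg f \<in> Arr C" "Src C (neg f) = Src C f" "Trg C (neg f) = Trg C f"
    "Add C f (neg f) = Nul C (Src C f) (Trg C f)" "neg (neg f) = f"
proof -
  interpret comm_group "homgrp (Src C f) (Trg C f)" using comm_group_homgrp assms by simp
  have f: "f \<in> hom (Src C f) (Trg C f)" using assms by (simp add: hom_iff)
  then show *: "neg f \<in> Arr C" "Src C (neg f) = Src C f" "Trg C (neg f) = Trg C f"
    using inv_closed[of f] by (auto simp: hom_iff neg_def)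
  show "Add C f (neg f) = Nul C (Src C f) (Trg C f)" using r_inv[of f] f by (simp add: neg_def)
  show "neg (neg f) = f" using inv_inv[of f] f * by (simp add: neg_def)
qed

lemma Add_Nul [simp]:
  assumes "f \<in> Arr C" "A = Src C f" "B = Trg C f"
  shows "Add C f (Nul C A B) = f" "Add C (Nul C A B) f = f"
proof -
  interpret comm_group "homgrp A B" using comm_group_homgrp assms by simp
  show "Add C f (Nul C A B) = f" "Add C (Nul C A B) f = f"
    using l_one[of f] r_one[of f] assms by (auto simp: hom_iff)
qed

lemma Add_commute:
  assumes "f \<in> Arr C" "g \<in> Arr C" "Src C g = Src C f" "Trg C g = Trg C f"
  shows "Add C f g = Add C g f"
proof -
  interpret comm_group "homgrp (Src C f) (Trg C f)" using comm_group_homgrp assms by simp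
  show ?thesis using m_comm[of f g] assms by (auto simp: hom_iff)
qed

lemma Add_assoc:
  assumes "f \<in> Arr C" "g \<in> Arr C" "Src C g = Src C f" "Trg C g = Trg C f"
    "h \<in> Arr C" "Src C h = Src C f" "Trg C h = Trg C f"
  shows "Add C (Add C f g) h = Add C f (Add C g h)"
proof -
  interpret comm_group "homgrp (Src C f) (Trg C f)" using comm_group_homgrp assms by simp
  show ?thesis using m_assoc[of f g h] assms by (auto simp: hom_iff)
qed

text \<open>Uniqueness of the negative in the group of morphisms. It turns the compatibility of
  composition and of the tensor product with signs into a consequence of biadditivity.\<close>

lemma Add_eq_Nul_iff:
  assumes "f \<in> Arr C" "g \<in> Arr C" "Src C g = Src C f" "Trg C g = Trg C f"
    and "Add C f g = Nul C (Src C f) (Trg C f)"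
  shows "g = neg f"
proof -
  interpret comm_group "homgrp (Src C f) (Trg C f)" using comm_group_homgrp assms by simp
  have "m_inv (homgrp (Src C f) (Trg C f)) g = f"
    by (rule inv_equality) (use assms in \<open>auto simp: hom_iff\<close>)
  then show ?thesis
    using assms inv_inv[of g] by (auto simp: neg_def hom_iff)
qed

text \<open>The only idempotent of a group is its unit. Zero morphisms are therefore preserved by
  every biadditive operation, since a zero morphism is its own double.\<close>

lemma Add_self_eq_self:
  assumes "f \<in> Arr C" "Add C f f = f"
  shows "f = Nul C (Src C f) (Trg C f)"
proof -
  interpret comm_group "homgrp (Src C f) (Trg C f)" using comm_group_homgrp assms by simp
  show ?thesis
    using r_cancel_one[of f f] assms by (auto simp: hom_iff)
qed

lemma Cmp_Add_simps [simp]: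
  assumes "f \<in> Arr C" "g \<in> Arr C" "h \<in> Arr C"
  shows "Src C g = Trg C f \<Longrightarrow> Src C h = Src C g \<Longrightarrow> Trg C h = Trg C g \<Longrightarrow>
      Add C g h \<cdot> f = Add C (g \<cdot> f) (h \<cdot> f)"
    "Src C h = Trg C f \<Longrightarrow> Src C g = Src C f \<Longrightarrow> Trg C g = Trg C f \<Longrightarrow>
      h \<cdot> Add C f g = Add C (h \<cdot> f) (h \<cdot> g)"
  using Cmp_Add_left[of f "Src C f" "Trg C f" g "Trg C g" h]
    Cmp_Add_right[of f "Src C f" "Trg C f" g h "Trg C h"] assms
  by (auto simp: hom_iff)

lemma Cmp_Nul [simp]:
  assumes "f \<in> Arr C" "D \<in> Obj C"
  shows "Trg C f = B \<Longrightarrow> Nul C B D \<cdot> f = Nul C (Src C f) D"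
    "Src C f = B \<Longrightarrow> f \<cdot> Nul C D B = Nul C D (Trg C f)"
proof -
  show "Nul C B D \<cdot> f = Nul C (Src C f) D" if "Trg C f = B"
  proof -
    have "Add C (Nul C B D \<cdot> f) (Nul C B D \<cdot> f) = Nul C B D \<cdot> f"
      using assms that by (subst Cmp_Add_simps(1)[symmetric]) auto
    then show ?thesis
      using Add_self_eq_self[of "Nul C B D \<cdot> f"] assms that by auto
  qed
  show "f \<cdot> Nul C D B = Nul C D (Trg C f)" if "Src C f = B"
  proof -
    have "Add C (f \<cdot> Nul C D B) (f \<cdot> Nul C D B) = f \<cdot> Nul C D B"
      using assms that by (subst Cmp_Add_simps(2)[symmetric]) auto
    then show ?thesis
      using Add_self_eq_self[of "f \<cdot> Nul C D B"] assms that by auto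
  qed
qed

lemma Cmp_neg [simp]:
  assumes "f \<in> Arr C" "g \<in> Arr C" "Src C g = Trg C f"
  shows "neg g \<cdot> f = neg (g \<cdot> f)" "g \<cdot> neg f = neg (g \<cdot> f)"
proof -
  show "neg g \<cdot> f = neg (g \<cdot> f)"
    by (rule Add_eq_Nul_iff) (use assms in \<open>auto simp flip: Cmp_Add_simps\<close>)
  show "g \<cdot> neg f = neg (g \<cdot> f)"
    by (rule Add_eq_Nul_iff) (use assms in \<open>auto simp flip: Cmp_Add_simps\<close>)
qed

lemma neg_Nul [simp]: "A \<in> Obj C \<Longrightarrow> B \<in> Obj C \<Longrightarrow> neg (Nul C A B) = Nul C A B"
  using Add_eq_Nul_iff[of "Nul C A B" "Nul C A B"] by simp

lemma neg_Add:
  assumes "f \<in> Arr C" "g \<in> Arr C" "Src C g = Src C f" "Trg C g = Trg C f"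
  shows "neg (Add C f g) = Add C (neg f) (neg g)"
proof -
  interpret comm_group "homgrp (Src C f) (Trg C f)" using comm_group_homgrp assms by simp
  show ?thesis using inv_mult[of f g] assms by (auto simp: hom_iff neg_def)
qed

lemma hsgn_simps [simp]:
  assumes "f \<in> Arr C"
  shows "hsgn e f \<in> Arr C" "Src C (hsgn e f) = Src C f" "Trg C (hsgn e f) = Trg C f"
    "hsgn e (hsgn e' f) = hsgn (e + e') f"
  using assms by (auto simp: hsgn_def)

lemma hsgn_Cmp [simp]:
  assumes "f \<in> Arr C" "g \<in> Arr C" "Src C g = Trg C f"
  shows "hsgn e g \<cdot> f = hsgn e (g \<cdot> f)" "g \<cdot> hsgn e f = hsgn e (g \<cdot> f)"
  using assms by (auto simp: hsgn_def)

lemma hsgn_Nul [simp]: "A \<in> Obj C \<Longrightarrow> B \<in> Obj C \<Longrightarrow> hsgn e (Nul C A B) = Nul C A B"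
  by (simp add: hsgn_def)

lemma hsgn_Add:
  assumes "f \<in> Arr C" "g \<in> Arr C" "Src C g = Src C f" "Trg C g = Trg C f"
  shows "hsgn e (Add C f g) = Add C (hsgn e f) (hsgn e g)"
  using assms by (simp add: hsgn_def neg_Add)

lemma hsgn_0 [simp]: "hsgn 0 f = f"
  by (simp add: hsgn_def)

lemma hsgn_cong: "even (e - e') \<Longrightarrow> hsgn e f = hsgn e' f"
  by (cases "even e"; cases "even e'") (auto simp: hsgn_def)

lemma hsum_in_hom:
  assumes "A \<in> Obj C" "B \<in> Obj C" "\<And>i. i \<in> I \<Longrightarrow> f i \<in> hom A B"
  shows "hsum A B f I \<in> hom A B"
proof -
  interpret comm_group "homgrp A B" using comm_group_homgrp assms by simp
  show ?thesis
    using finprod_closed[of f I] assms by (auto simp: hsum_def)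
qed

lemma hsum_simps [simp]:
  assumes "A \<in> Obj C" "B \<in> Obj C" "\<forall>i\<in>I. f i \<in> Arr C \<and> Src C (f i) = A \<and> Trg C (f i) = B"
  shows "hsum A B f I \<in> Arr C" "Src C (hsum A B f I) = A" "Trg C (hsum A B f I) = B"
  using hsum_in_hom[of A B I f] assms by (auto simp: hom_iff)

lemma hsum_cong:
  assumes "A \<in> Obj C" "B \<in> Obj C" "I = J" "\<And>i. i \<in> J \<Longrightarrow> f i = g i" "\<And>i. i \<in> J \<Longrightarrow> g i \<in> hom A B"
  shows "hsum A B f I = hsum A B g J"
proof -
  interpret comm_group "homgrp A B" using comm_group_homgrp assms by simp
  show ?thesis
    unfolding hsum_def by (rule finprod_cong') (use assms in auto)
qed

lemma hsum_hom:
  assumes "A \<in> Obj C" "B \<in> Obj C" "A' \<in> Obj C" "B' \<in> Obj C"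
    and "\<And>x. x \<in> hom A B \<Longrightarrow> h x \<in> hom A' B'"
      "\<And>x y. x \<in> hom A B \<Longrightarrow> y \<in> hom A B \<Longrightarrow> h (Add C x y) = Add C (h x) (h y)"
      "h (Nul C A B) = Nul C A' B'"
      "\<And>i. i \<in> I \<Longrightarrow> f i \<in> hom A B"
  shows "h (hsum A B f I) = hsum A' B' (\<lambda>i. h (f i)) I"
proof -
  interpret G: comm_group "homgrp A B" using comm_group_homgrp assms by simp
  interpret H: comm_group "homgrp A' B'" using comm_group_homgrp assms by simp
  show ?thesis
    unfolding hsum_def
    by (rule finprod_commute_hom) (use assms in \<open>auto intro: G.comm_monoid_axioms H.comm_monoid_axioms\<close>)
qed

lemma Cmp_hsum_left:
  assumes "\<forall>i\<in>I. f i \<in> Arr C \<and> Src C (f i) = A \<and> Trg C (f i) = B" "A \<in> Obj C" "B \<in> Obj C"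
    "g \<in> Arr C" "Src C g = B"
  shows "g \<cdot> hsum A B f I = hsum A (Trg C g) (\<lambda>i. g \<cdot> f i) I"
  by (rule hsum_hom[where h="\<lambda>x. g \<cdot> x"]) (use assms in \<open>auto simp: hom_iff\<close>)

lemma Cmp_hsum_right:
  assumes "\<forall>i\<in>I. f i \<in> Arr C \<and> Src C (f i) = A \<and> Trg C (f i) = B" "A \<in> Obj C" "B \<in> Obj C"
    "g \<in> Arr C" "Trg C g = A"
  shows "hsum A B f I \<cdot> g = hsum (Src C g) B (\<lambda>i. f i \<cdot> g) I"
  by (rule hsum_hom[where h="\<lambda>x. x \<cdot> g"]) (use assms in \<open>auto simp: hom_iff\<close>)

lemma hsum_empty [simp]: "A \<in> Obj C \<Longrightarrow> B \<in> Obj C \<Longrightarrow> hsum A B f {} = Nul C A B"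
proof -
  assume "A \<in> Obj C" "B \<in> Obj C"
  then interpret comm_group "homgrp A B" using comm_group_homgrp by simp
  show ?thesis by (simp add: hsum_def)
qed

lemma hsum_insert:
  assumes "A \<in> Obj C" "B \<in> Obj C" "finite I" "x \<notin> I" "\<forall>i\<in>insert x I. f i \<in> hom A B"
  shows "hsum A B f (insert x I) = Add C (f x) (hsum A B f I)"
proof -
  interpret comm_group "homgrp A B" using comm_group_homgrp assms by simp
  show ?thesis using assms by (simp add: hsum_def Pi_iff)
qed

lemma hsum_Nul:
  assumes "A \<in> Obj C" "B \<in> Obj C" "\<And>i. i \<in> I \<Longrightarrow> f i = Nul C A B"
  shows "hsum A B f I = Nul C A B"
proof -
  interpret comm_group "homgrp A B" using comm_group_homgrp assms by simp
  show ?thesis unfolding hsum_def using finprod_one_eqI[of I f] assms by simp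
qed

lemma hsum_delta:
  assumes "A \<in> Obj C" "B \<in> Obj C" "finite I" "\<And>i. i \<in> I \<Longrightarrow> i \<noteq> j \<Longrightarrow> f i = Nul C A B"
    "f j \<in> hom A B"
  shows "hsum A B f I = (if j \<in> I then f j else Nul C A B)"
proof -
  have *: "hsum A B f J = Nul C A B" if "j \<notin> J" "J \<subseteq> I" for J
    using that assms by (intro hsum_Nul) auto
  show ?thesis
  proof (cases "j \<in> I")
    case True
    have "f i \<in> hom A B" if "i \<in> I" for i
      using assms that by (cases "i = j") (auto simp: hom_iff)
    then have "hsum A B f (insert j (I - {j})) = Add C (f j) (hsum A B f (I - {j}))"
      using True assms by (intro hsum_insert) auto
    with True * [of "I - {j}"] assms show ?thesis
      by (auto simp: insert_absorb hom_iff)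
  qed (use * in auto)
qed

lemma hsum_mono_neutral:
  assumes "A \<in> Obj C" "B \<in> Obj C" "finite J" "I \<subseteq> J" "\<And>i. i \<in> J - I \<Longrightarrow> f i = Nul C A B"
    "\<And>i. i \<in> I \<Longrightarrow> f i \<in> hom A B"
  shows "hsum A B f I = hsum A B f J"
proof -
  interpret comm_group "homgrp A B" using comm_group_homgrp assms by simp
  show ?thesis
    unfolding hsum_def
  proof (rule finprod_mono_neutral_cong_left)
    show "f \<in> J \<rightarrow> carrier (homgrp A B)"
    proof
      show "f i \<in> carrier (homgrp A B)" if "i \<in> J" for i
        using assms that by (cases "i \<in> I") (auto simp: hom_iff)
    qed
  qed (use assms in auto)
qed

lemma hsum_reindex:
  assumes "A \<in> Obj C" "B \<in> Obj C" "inj_on h I" "\<And>i. i \<in> I \<Longrightarrow> f (h i) \<in> hom A B"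
  shows "hsum A B f (h ` I) = hsum A B (\<lambda>i. f (h i)) I"
proof -
  interpret comm_group "homgrp A B" using comm_group_homgrp assms by simp
  show ?thesis
    unfolding hsum_def by (rule finprod_reindex) (use assms in \<open>auto simp: Pi_iff\<close>)
qed

lemma zero_object_Ide:
  assumes "zero_object Z"
  shows "Ide C Z = Nul C Z Z"
  using assms unfolding zero_object_def by (metis Ide_simps Nul_simps hom_iff)

text \<open>If the identity is zero, every map into or out of the object factors through zero. In
  this equational form the property passes to tensor products and can be read off from a
  decomposition of the identity.\<close>

lemma zero_object_iff: "zero_object Z \<longleftrightarrow> Z \<in> Obj C \<and> Ide C Z = Nul C Z Z"
proof (safe)
  assume *: "Z \<in> Obj C" "Ide C Z = Nul C Z Z"
  have "f = Nul C Z A" if "f \<in> hom Z A" "A \<in> Obj C" for f A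
    using that * Cmp_Ide[of f] by (auto simp: hom_iff simp del: Cmp_Ide Cmp_Ide')
  moreover have "f = Nul C A Z" if "f \<in> hom A Z" "A \<in> Obj C" for f A
    using that * Ide_Cmp[of f] by (auto simp: hom_iff simp del: Ide_Cmp Ide_Cmp')
  moreover have "Nul C Z A \<in> hom Z A" "Nul C A Z \<in> hom A Z" if "A \<in> Obj C" for A
    using * that by (auto simp: hom_iff)
  ultimately show "zero_object Z"
    unfolding zero_object_def using * by metis
qed (auto simp: zero_object_Ide, auto simp: zero_object_def)

lemma to_zero_object: "f \<in> Arr C \<Longrightarrow> zero_object (Trg C f) \<Longrightarrow> f = Nul C (Src C f) (Trg C f)"
  and from_zero_object: "f \<in> Arr C \<Longrightarrow> zero_object (Src C f) \<Longrightarrow> f = Nul C (Src C f) (Trg C f)"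
  using Ide_Cmp[of f] Cmp_Ide[of f]
  by (auto simp: zero_object_iff simp del: Ide_Cmp Cmp_Ide Ide_Cmp' Cmp_Ide')

end

section \<open>Finite biproducts\<close>

context abelian_category
begin

text \<open>Adjoining a summand to a biproduct S means taking the binary biproduct T of the new
  object with S and composing the structure maps of S with those of S in T. The empty family yields
  a zero object, which is why tensor products of graded objects vanish below the sum of the lower
  bounds.\<close>

lemma ex_finite_biproduct:
  assumes "finite I" "\<And>i. i \<in> I \<Longrightarrow> A i \<in> Obj C"
  shows "\<exists>S inc pro. is_biproduct I A S inc pro"
  using assms
proof (induction I rule: finite_induct)
  case empty
  obtain Z where "zero_object Z" using ex_zero by blast
  then have "is_biproduct {} A Z undefined undefined"
    by (auto simp: is_biproduct_def zero_object_iff)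
  then show ?case by blast
next
  case (insert x I)
  then obtain S inc pro where S: "is_biproduct I A S inc pro" by auto
  then have SO: "S \<in> Obj C" by (simp add: is_biproduct_def)
  have AO: "A x \<in> Obj C" using insert by simp
  obtain T j q where T: "is_biproduct (UNIV :: bool set) (\<lambda>b. if b then A x else S) T j q"
    using ex_biproduct[OF AO SO] by blast
  have TO: "T \<in> Obj C" using T by (simp add: is_biproduct_def)
  have jq: "j True \<in> hom (A x) T" "q True \<in> hom T (A x)" "j False \<in> hom S T" "q False \<in> hom T S"
    "q True \<cdot> j True = Ide C (A x)" "q False \<cdot> j False = Ide C S"
    "q True \<cdot> j False = Nul C S (A x)" "q False \<cdot> j True = Nul C (A x) S"
    using T unfolding is_biproduct_def by (auto dest: spec[of _ True] spec[of _ False])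
  have jq_sum: "Add C (j True \<cdot> q True) (j False \<cdot> q False) = Ide C T"
  proof -
    have "hsum T T (\<lambda>i. j i \<cdot> q i) (insert True {False}) = Add C (j True \<cdot> q True) (hsum T T (\<lambda>i. j i \<cdot> q i) {False})"
      by (rule hsum_insert) (use jq TO in \<open>auto simp: hom_iff\<close>)
    also have "hsum T T (\<lambda>i. j i \<cdot> q i) {False} = Add C (j False \<cdot> q False) (hsum T T (\<lambda>i. j i \<cdot> q i) {})"
      by (rule hsum_insert) (use jq TO in \<open>auto simp: hom_iff\<close>)
    finally have *: "hsum T T (\<lambda>i. j i \<cdot> q i) (insert True {False})
      = Add C (j True \<cdot> q True) (Add C (j False \<cdot> q False) (hsum T T (\<lambda>i. j i \<cdot> q i) {}))" .
    have "UNIV = insert True {False}" by auto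
    with * T have "Add C (j True \<cdot> q True) (Add C (j False \<cdot> q False) (hsum T T (\<lambda>i. j i \<cdot> q i) {})) = Ide C T"
      by (simp only: is_biproduct_def)
    then show ?thesis
      using jq TO by (auto simp: hom_iff)
  qed
  have ip: "inc i \<in> hom (A i) S" "pro i \<in> hom S (A i)" "A i \<in> Obj C" if "i \<in> I" for i
    using that S insert by (auto simp: is_biproduct_def)
  have ip_delta: "pro k \<cdot> inc i = (if i = k then Ide C (A i) else Nul C (A i) (A k))" if "i \<in> I" "k \<in> I" for i k
    using that S by (auto simp: is_biproduct_def)
  have ip_sum: "hsum S S (\<lambda>i. inc i \<cdot> pro i) I = Ide C S"
    using S by (auto simp: is_biproduct_def)
  define inc' where "inc' = (\<lambda>i. if i = x then j True else j False \<cdot> inc i)"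
  define pro' where "pro' = (\<lambda>i. if i = x then q True else pro i \<cdot> q False)"
  have [simp]: "pro i \<cdot> q False \<cdot> f = (pro i \<cdot> q False) \<cdot> f" if "i \<in> I" "f \<in> Arr C" "Trg C f = T" for i f
    using that ip jq by (auto simp: hom_iff)
  have aux: "q False \<cdot> j False \<cdot> inc k = inc k" "q False \<cdot> j True = Nul C (A x) S"
    "q True \<cdot> j False \<cdot> inc k = Nul C (A k) (A x)" if "k \<in> I" for k
    using that ip jq SO TO AO cmp_assoc[of "inc k" "j False" "q False"] cmp_assoc[of "inc k" "j False" "q True"]
    by (auto simp: hom_iff simp del: cmp_assoc)
  have delta': "pro' k \<cdot> inc' i = (if i = k then Ide C (A i) else Nul C (A i) (A k))"
    if "i \<in> insert x I" "k \<in> insert x I" for i k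
    using that insert(2) ip jq SO TO AO aux[of i] aux[of k] ip_delta[of i k] unfolding inc'_def pro'_def
    by (auto simp: hom_iff simp flip: cmp_assoc) (auto simp: ip hom_iff)
  have "hsum T T (\<lambda>i. inc' i \<cdot> pro' i) (insert x I)
      = Add C (inc' x \<cdot> pro' x) (hsum T T (\<lambda>i. inc' i \<cdot> pro' i) I)"
    by (rule hsum_insert) (use insert ip jq SO TO AO in \<open>auto simp: inc'_def pro'_def hom_iff\<close>)
  also have "hsum T T (\<lambda>i. inc' i \<cdot> pro' i) I = hsum T T (\<lambda>i. j False \<cdot> (inc i \<cdot> pro i) \<cdot> q False) I"
    by (rule hsum_cong) (use insert ip jq SO TO AO in \<open>auto simp: inc'_def pro'_def hom_iff\<close>)
  also have "\<dots> = j False \<cdot> hsum S S (\<lambda>i. inc i \<cdot> pro i) I \<cdot> q False"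
    using ip jq SO TO AO by (simp add: Cmp_hsum_left Cmp_hsum_right hom_iff)
  also have "Add C (inc' x \<cdot> pro' x) \<dots> = Ide C T"
    using jq_sum jq SO by (simp add: ip_sum inc'_def pro'_def hom_iff)
  finally have "is_biproduct (insert x I) A T inc' pro'"
    unfolding is_biproduct_def using TO delta' ip jq SO AO
    by (auto simp: inc'_def pro'_def hom_iff)
  then show ?case by blast
qed

context
  fixes I A
  assumes fin: "finite I" and obj: "\<forall>i\<in>I. A i \<in> Obj C"
begin

text \<open>The only place where the choice made in \<open>dsum\<close> is opened; afterwards the
  biproduct equations are used.\<close>

lemma dsum_biproduct: "is_biproduct I A (dobj I A) (dinc I A) (dpro I A)"
proof -
  have "\<exists>t. case t of (S, inc, pro) \<Rightarrow> is_biproduct I A S inc pro"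
    using ex_finite_biproduct[OF fin, of A] obj by auto
  from someI_ex[OF this] show ?thesis
    by (auto simp: dobj_def dinc_def dpro_def dsum_def case_prod_unfold)
qed

lemma dobj_Obj [simp]: "dobj I A \<in> Obj C"
  using dsum_biproduct by (simp add: is_biproduct_def)

lemma dinc_simps [simp]:
  assumes "i \<in> I"
  shows "dinc I A i \<in> Arr C" "Src C (dinc I A i) = A i" "Trg C (dinc I A i) = dobj I A"
  using dsum_biproduct assms by (auto simp: is_biproduct_def hom_iff)

lemma dpro_simps [simp]:
  assumes "i \<in> I"
  shows "dpro I A i \<in> Arr C" "Src C (dpro I A i) = dobj I A" "Trg C (dpro I A i) = A i"
  using dsum_biproduct assms by (auto simp: is_biproduct_def hom_iff)

lemma dpro_dinc:
  assumes "i \<in> I" "j \<in> I"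
  shows "dpro I A j \<cdot> dinc I A i = (if i = j then Ide C (A i) else Nul C (A i) (A j))"
  using dsum_biproduct assms by (auto simp: is_biproduct_def)

lemma dinc_dpro_sum: "hsum (dobj I A) (dobj I A) (\<lambda>i. dinc I A i \<cdot> dpro I A i) I = Ide C (dobj I A)"
  using dsum_biproduct by (auto simp: is_biproduct_def)

end

end

section \<open>Graded maps\<close>

context preadditive_category
begin

lemma graded_objectD [simp]: "graded_object A \<Longrightarrow> cpt A i \<in> Obj C"
  "graded_object A \<Longrightarrow> i < low A \<Longrightarrow> zero_object (cpt A i)"
  by (auto simp: graded_object_def)

text \<open>Typing is read off from the fields of the record itself, so that simplification computes
  source, target and degree of composite expressions and side conditions become equations between
  them.\<close>

definition gm :: "('a, 'b) gmap \<Rightarrow> bool" where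
  "gm f \<longleftrightarrow> graded_object (gsrc f) \<and> graded_object (gtgt f) \<and> f \<in> ghom (gsrc f) (gtgt f) (gdeg f)"

abbreviation (input) gmor :: "('a, 'b) gmap \<Rightarrow> 'a graded \<Rightarrow> 'a graded \<Rightarrow> int \<Rightarrow> bool" where
  "gmor f A B n \<equiv> gm f \<and> gsrc f = A \<and> gtgt f = B \<and> gdeg f = n"

lemma gm_graded [simp]: "gm f \<Longrightarrow> graded_object (gsrc f)" "gm f \<Longrightarrow> graded_object (gtgt f)"
  by (auto simp: gm_def)

lemma gm_gfun [simp]:
  assumes "gm f"
  shows "gfun f i \<in> Arr C" "Src C (gfun f i) = cpt (gsrc f) i" "Trg C (gfun f i) = cpt (gtgt f) (i + gdeg f)"
  using assms unfolding gm_def ghom_def hom_iff by blast+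

lemma gmI:
  assumes "graded_object (gsrc f)" "graded_object (gtgt f)"
    "\<And>i. gfun f i \<in> hom (cpt (gsrc f) i) (cpt (gtgt f) (i + gdeg f))"
  shows "gm f"
  using assms unfolding gm_def ghom_def by blast

lemma ghom_iff: "gm f \<Longrightarrow> f \<in> ghom A B n \<longleftrightarrow> gsrc f = A \<and> gtgt f = B \<and> gdeg f = n"
  unfolding gm_def ghom_def by blast

lemma ghom_gm: "f \<in> ghom A B n \<Longrightarrow> graded_object A \<Longrightarrow> graded_object B \<Longrightarrow> gm f"
  unfolding gm_def ghom_def by blast

lemma ghom_simps: "f \<in> ghom A B n \<Longrightarrow> gsrc f = A" "f \<in> ghom A B n \<Longrightarrow> gtgt f = B" "f \<in> ghom A B n \<Longrightarrow> gdeg f = n"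
  by (auto simp: ghom_def)

lemma gmap_eqI:
  assumes "gsrc f = gsrc g" "gtgt f = gtgt g" "gdeg f = gdeg g" "\<And>i. gfun f i = gfun g i"
  shows "f = (g :: ('a, 'b) gmap)"
  using assms by (intro gmap.equality ext) auto

lemma gid_simps [simp]: "gsrc (gid A) = A" "gtgt (gid A) = A" "gdeg (gid A) = 0"
  "gfun (gid A) i = Ide C (cpt A i)"
  by (auto simp: gid_def)

lemma gid_gm [simp]: "graded_object A \<Longrightarrow> gm (gid A)"
  by (auto intro!: gmI simp: hom_iff)

lemma gcomp_simps [simp]: "gsrc (g \<star> f) = gsrc f" "gtgt (g \<star> f) = gtgt g" "gdeg (g \<star> f) = gdeg f + gdeg g"
  "gfun (g \<star> f) i = gfun g (i + gdeg f) \<cdot> gfun f i"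
  by (auto simp: gcomp_def)

lemma gcomp_gm [simp]: "gm f \<Longrightarrow> gm g \<Longrightarrow> gsrc g = gtgt f \<Longrightarrow> gm (g \<star> f)"
  by (rule gmI) (auto simp: hom_iff add.assoc)

lemma gcomp_assoc [simp]:
  "gm f \<Longrightarrow> gm g \<Longrightarrow> gm h \<Longrightarrow> gsrc g = gtgt f \<Longrightarrow> gsrc h = gtgt g \<Longrightarrow> (h \<star> g) \<star> f = h \<star> g \<star> f"
  by (rule gmap_eqI) (auto simp: add.assoc)

lemma gcomp_gid [simp]: "gm f \<Longrightarrow> A = gsrc f \<Longrightarrow> f \<star> gid A = f"
  by (rule gmap_eqI) auto

lemma gid_gcomp [simp]: "gm f \<Longrightarrow> A = gtgt f \<Longrightarrow> gid A \<star> f = f"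
  by (rule gmap_eqI) auto

lemma gzero_simps [simp]: "gsrc (gzero A B n) = A" "gtgt (gzero A B n) = B" "gdeg (gzero A B n) = n"
  "gfun (gzero A B n) i = Nul C (cpt A i) (cpt B (i + n))"
  by (auto simp: gzero_def)

lemma gzero_gm [simp]: "graded_object A \<Longrightarrow> graded_object B \<Longrightarrow> gm (gzero A B n)"
  by (auto intro!: gmI simp: hom_iff)

lemma gcomp_gzero [simp]:
  "gm f \<Longrightarrow> gtgt f = B \<Longrightarrow> graded_object D \<Longrightarrow> gzero B D n \<star> f = gzero (gsrc f) D (gdeg f + n)"
  "gm f \<Longrightarrow> gsrc f = B \<Longrightarrow> graded_object A \<Longrightarrow> f \<star> gzero A B n = gzero A (gtgt f) (n + gdeg f)"
  by (rule gmap_eqI; auto simp: add.assoc)+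

lemma gadd_simps [simp]: "gsrc (gadd f g) = gsrc f" "gtgt (gadd f g) = gtgt f" "gdeg (gadd f g) = gdeg f"
  "gfun (gadd f g) i = Add C (gfun f i) (gfun g i)"
  by (auto simp: gadd_def)

lemma gadd_gm [simp]:
  "gm f \<Longrightarrow> gm g \<Longrightarrow> gsrc g = gsrc f \<Longrightarrow> gtgt g = gtgt f \<Longrightarrow> gdeg g = gdeg f \<Longrightarrow> gm (gadd f g)"
  by (rule gmI) (auto simp: hom_iff)

lemma gcomp_gadd:
  assumes "gm f" "gm g" "gm h"
  shows "gsrc g = gtgt f \<Longrightarrow> gsrc h = gsrc g \<Longrightarrow> gtgt h = gtgt g \<Longrightarrow> gdeg h = gdeg g \<Longrightarrow>
      gadd g h \<star> f = gadd (g \<star> f) (h \<star> f)"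
    "gsrc h = gtgt f \<Longrightarrow> gsrc g = gsrc f \<Longrightarrow> gtgt g = gtgt f \<Longrightarrow> gdeg g = gdeg f \<Longrightarrow>
      h \<star> gadd f g = gadd (h \<star> f) (h \<star> g)"
  using assms by (auto intro!: gmap_eqI simp: add.assoc)

lemma gsgn_simps [simp]: "gsrc (gsgn e f) = gsrc f" "gtgt (gsgn e f) = gtgt f" "gdeg (gsgn e f) = gdeg f"
  "gfun (gsgn e f) i = hsgn e (gfun f i)"
  by (auto simp: gsgn_def)

lemma gsgn_gm [simp]: "gm f \<Longrightarrow> gm (gsgn e f)"
  by (rule gmI) (auto simp: hom_iff)

lemma gsgn_gsgn [simp]: "gm f \<Longrightarrow> gsgn e (gsgn e' f) = gsgn (e + e') f"
  by (rule gmap_eqI) auto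

lemma gcomp_gsgn [simp]:
  assumes "gm f" "gm g" "gsrc g = gtgt f"
  shows "gsgn e g \<star> f = gsgn e (g \<star> f)" "g \<star> gsgn e f = gsgn e (g \<star> f)"
  using assms by (auto intro!: gmap_eqI)

lemma gsgn_gzero [simp]: "graded_object A \<Longrightarrow> graded_object B \<Longrightarrow> gsgn e (gzero A B n) = gzero A B n"
  by (rule gmap_eqI) auto

lemma gsgn_0 [simp]: "gsgn 0 f = f"
  by (rule gmap_eqI) auto

lemma gsgn_cong: "even (e - e') \<Longrightarrow> gsgn e f = gsgn e' f"
  by (rule gmap_eqI) (auto intro: hsgn_cong)

lemma gsgn_even [simp]: "even e \<Longrightarrow> gsgn e f = f"
  using gsgn_cong[of e 0 f] by simp

lemma gsgn_gadd:
  "gm f \<Longrightarrow> gm g \<Longrightarrow> gsrc g = gsrc f \<Longrightarrow> gtgt g = gtgt f \<Longrightarrow> gdeg g = gdeg f \<Longrightarrow>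
    gsgn e (gadd f g) = gadd (gsgn e f) (gsgn e g)"
  by (rule gmap_eqI) (auto simp: hsgn_Add)

lemma gadd_commute:
  "gm f \<Longrightarrow> gm g \<Longrightarrow> gsrc g = gsrc f \<Longrightarrow> gtgt g = gtgt f \<Longrightarrow> gdeg g = gdeg f \<Longrightarrow> gadd f g = gadd g f"
  by (rule gmap_eqI) (auto simp: Add_commute)

lemma gadd_assoc:
  "gm f \<Longrightarrow> gm g \<Longrightarrow> gm h \<Longrightarrow> gsrc g = gsrc f \<Longrightarrow> gtgt g = gtgt f \<Longrightarrow> gdeg g = gdeg f \<Longrightarrow>
    gsrc h = gsrc f \<Longrightarrow> gtgt h = gtgt f \<Longrightarrow> gdeg h = gdeg f \<Longrightarrow> gadd (gadd f g) h = gadd f (gadd g h)"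
  by (rule gmap_eqI) (auto simp: Add_assoc)

lemma gadd_gzero [simp]:
  "gm f \<Longrightarrow> A = gsrc f \<Longrightarrow> B = gtgt f \<Longrightarrow> n = gdeg f \<Longrightarrow> gadd f (gzero A B n) = f"
  "gm f \<Longrightarrow> A = gsrc f \<Longrightarrow> B = gtgt f \<Longrightarrow> n = gdeg f \<Longrightarrow> gadd (gzero A B n) f = f"
  by (rule gmap_eqI; auto)+

lemma gadd_gsgn_cancel:
  "gm f \<Longrightarrow> odd (e - e') \<Longrightarrow> gadd (gsgn e f) (gsgn e' f) = gzero (gsrc f) (gtgt f) (gdeg f)"
proof (rule gmap_eqI, goal_cases)
  case (4 i)
  then have "Add C (neg (gfun f i)) (gfun f i) = Nul C (cpt (gsrc f) i) (cpt (gtgt f) (i + gdeg f))"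
    using Add_commute[of "neg (gfun f i)" "gfun f i"] by simp
  with 4 show ?case by (cases "even e") (auto simp: hsgn_def)
qed auto

definition ggrp :: "'a graded \<Rightarrow> 'a graded \<Rightarrow> int \<Rightarrow> ('a, 'b) gmap monoid" where
  "ggrp A B n = \<lparr>carrier = ghom A B n, monoid.mult = gadd, one = gzero A B n\<rparr>"

lemma ggrp_simps [simp]:
  "carrier (ggrp A B n) = ghom A B n" "monoid.mult (ggrp A B n) = gadd" "one (ggrp A B n) = gzero A B n"
  by (simp_all add: ggrp_def)

lemma comm_monoid_ggrp: "graded_object A \<Longrightarrow> graded_object B \<Longrightarrow> Group.comm_monoid (ggrp A B n)"
proof (rule comm_monoidI, goal_cases)
  case (1 x y)
  then have "gm x" "gm y" by (auto intro: ghom_gm)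
  with 1 show ?case by (auto simp: ghom_iff)
next
  case (2) then show ?case by (simp add: ghom_iff)
next
  case (3 x y z)
  then have "gm x" "gm y" "gm z" by (auto intro: ghom_gm)
  with 3 show ?case by (auto simp: ghom_iff intro!: gadd_assoc)
next
  case (4 x)
  then have "gm x" by (auto intro: ghom_gm)
  with 4 show ?case by (auto simp: ghom_iff)
next
  case (5 x y)
  then have "gm x" "gm y" by (auto intro: ghom_gm)
  with 5 show ?case by (auto simp: ghom_iff intro!: gadd_commute)
qed

lemma gsum_simps [simp]: "gsrc (gsum A B n F I) = A" "gtgt (gsum A B n F I) = B" "gdeg (gsum A B n F I) = n"
  "gfun (gsum A B n F I) i = hsum (cpt A i) (cpt B (i + n)) (\<lambda>x. gfun (F x) i) I"
  by (auto simp: gsum_def)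

lemma gsum_gm [simp]:
  assumes "graded_object A" "graded_object B"
    "\<forall>x\<in>I. gmor (F x) A B n"
  shows "gm (gsum A B n F I)"
  using assms by (intro gmI) (auto intro!: hsum_in_hom simp: hom_iff)

text \<open>Evaluation in one degree is a homomorphism from \<open>ggrp\<close> to the group of
  morphisms in that degree, so the componentwise sums form a product in \<open>ggrp\<close>. Double
  sums, disjoint unions and sums of sums are inherited from there.\<close>

lemma gsum_finprod:
  assumes "graded_object A" "graded_object B"
    "\<forall>x\<in>I. gmor (F x) A B n"
  shows "gsum A B n F I = finprod (ggrp A B n) F I"
proof -
  interpret G: comm_monoid "ggrp A B n" by (rule comm_monoid_ggrp) fact+
  have F: "F \<in> I \<rightarrow> ghom A B n" using assms by (auto simp: ghom_iff)
  have fp: "finprod (ggrp A B n) F I \<in> ghom A B n" using F G.finprod_closed[of F I] by simp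
  show ?thesis
  proof (rule gmap_eqI)
    fix i
    have H: "comm_group (homgrp (cpt A i) (cpt B (i + n)))"
      using assms by (intro comm_group_homgrp) auto
    have "gfun (finprod (ggrp A B n) F I) i = finprod (homgrp (cpt A i) (cpt B (i + n))) (\<lambda>x. gfun (F x) i) I"
      by (rule finprod_commute_hom)
        (use F H G.comm_monoid_axioms in \<open>auto simp: ghom_def comm_group_def Pi_iff\<close>)
    then show "gfun (gsum A B n F I) i = gfun (finprod (ggrp A B n) F I) i"
      by (simp add: hsum_def)
  qed (use fp in \<open>auto simp: ghom_def\<close>)
qed

lemma gsum_cong:
  assumes "graded_object A" "graded_object B" "I = J" "\<And>x. x \<in> J \<Longrightarrow> F x = G x"
    "\<forall>x\<in>J. gmor (G x) A B n"
  shows "gsum A B n F I = gsum A B n G J"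
  using assms by (intro gmap_eqI) (auto intro!: hsum_cong simp: hom_iff)

lemma gsum_reindex:
  assumes "graded_object A" "graded_object B" "inj_on h I"
    "\<forall>x\<in>I. gmor (F (h x)) A B n"
  shows "gsum A B n F (h ` I) = gsum A B n (\<lambda>x. F (h x)) I"
  using assms by (intro gmap_eqI) (auto intro!: hsum_reindex simp: hom_iff)

lemma gsum_bij:
  assumes "graded_object A" "graded_object B" "bij_betw h I J" "\<And>x. x \<in> I \<Longrightarrow> F x = G (h x)"
    "\<forall>x\<in>J. gmor (G x) A B n"
  shows "gsum A B n F I = gsum A B n G J"
proof -
  have J: "J = h ` I" "inj_on h I" using assms(3) by (auto simp: bij_betw_def)
  have "gsum A B n F I = gsum A B n (\<lambda>x. G (h x)) I"
    using assms J by (intro gsum_cong) auto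
  also have "\<dots> = gsum A B n G J"
    unfolding J(1) using assms J by (intro gsum_reindex[symmetric]) auto
  finally show ?thesis .
qed

lemma gsum_empty [simp]: "graded_object A \<Longrightarrow> graded_object B \<Longrightarrow> gsum A B n F {} = gzero A B n"
  by (rule gmap_eqI) auto

lemma gsum_neutral:
  assumes "graded_object A" "graded_object B" "\<And>x. x \<in> I \<Longrightarrow> F x = gzero A B n"
  shows "gsum A B n F I = gzero A B n"
  using assms by (intro gmap_eqI) (auto intro!: hsum_Nul)

lemma gsum_insert:
  assumes "graded_object A" "graded_object B" "finite I" "x \<notin> I"
    "\<forall>x\<in>insert x I. gmor (F x) A B n"
  shows "gsum A B n F (insert x I) = gadd (F x) (gsum A B n F I)"
  using assms by (intro gmap_eqI) (auto simp: hom_iff intro!: hsum_insert)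

lemma gsum_singleton [simp]:
  assumes "graded_object A" "graded_object B" "gm (F x)" "gsrc (F x) = A" "gtgt (F x) = B" "gdeg (F x) = n"
  shows "gsum A B n F {x} = F x"
  using assms by (subst gsum_insert) auto

lemma gsum_delta:
  assumes "graded_object A" "graded_object B" "finite I" "\<And>i. i \<in> I \<Longrightarrow> i \<noteq> j \<Longrightarrow> F i = gzero A B n"
    "gm (F j)" "gsrc (F j) = A" "gtgt (F j) = B" "gdeg (F j) = n"
  shows "gsum A B n F I = (if j \<in> I then F j else gzero A B n)"
  using assms by (intro gmap_eqI) (auto simp: hom_iff intro!: hsum_delta[THEN trans])

lemma gsum_mono_neutral:
  assumes "graded_object A" "graded_object B" "finite J" "I \<subseteq> J" "\<And>i. i \<in> J - I \<Longrightarrow> F i = gzero A B n"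
    "\<forall>x\<in>I. gmor (F x) A B n"
  shows "gsum A B n F I = gsum A B n F J"
  using assms by (intro gmap_eqI) (auto simp: hom_iff intro!: hsum_mono_neutral)

lemma gsum_two:
  assumes "graded_object A" "graded_object B" "gm (F i)" "gsrc (F i) = A" "gtgt (F i) = B" "gdeg (F i) = n"
    "gm (F j)" "gsrc (F j) = A" "gtgt (F j) = B" "gdeg (F j) = n" "i \<noteq> j" "i \<in> I" "j \<in> I" "finite I"
    "\<And>l. l \<in> I \<Longrightarrow> l \<noteq> i \<Longrightarrow> l \<noteq> j \<Longrightarrow> F l = gzero A B n"
  shows "gsum A B n F I = gadd (F i) (F j)"
proof -
  have "gsum A B n F I = gsum A B n F {i, j}"
    by (rule gsum_mono_neutral[symmetric]) (use assms in auto)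
  also have "\<dots> = gadd (F i) (F j)"
    using assms by (subst gsum_insert) auto
  finally show ?thesis .
qed

lemma gsum_Sigma:
  assumes "graded_object A" "graded_object B" "finite I" "\<And>i. i \<in> I \<Longrightarrow> finite (J i)"
    "\<forall>i\<in>I. \<forall>j\<in>J i. gmor (F i j) A B n"
  shows "gsum A B n (\<lambda>i. gsum A B n (F i) (J i)) I = gsum A B n (\<lambda>(i, j). F i j) (Sigma I J)"
proof -
  interpret G: comm_monoid "ggrp A B n" by (rule comm_monoid_ggrp) fact+
  have "gsum A B n (\<lambda>(i, j). F i j) (Sigma I J) = finprod (ggrp A B n) (\<lambda>(i, j). F i j) (Sigma I J)"
    using assms by (intro gsum_finprod) auto
  also have "\<dots> = finprod (ggrp A B n) (\<lambda>i. finprod (ggrp A B n) (F i) (J i)) I"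
    using assms by (intro G.finprod_Sigma) (auto simp: ghom_iff)
  also have "\<dots> = finprod (ggrp A B n) (\<lambda>i. gsum A B n (F i) (J i)) I"
    using assms by (intro G.finprod_cong') (auto simp: ghom_iff gsum_finprod[symmetric])
  also have "\<dots> = gsum A B n (\<lambda>i. gsum A B n (F i) (J i)) I"
    using assms by (intro gsum_finprod[symmetric]) auto
  finally show ?thesis by simp
qed

lemma gsum_swap:
  assumes "graded_object A" "graded_object B" "finite I" "finite J"
    "\<forall>i\<in>I. \<forall>j\<in>J. gmor (F i j) A B n"
  shows "gsum A B n (\<lambda>i. gsum A B n (F i) J) I = gsum A B n (\<lambda>j. gsum A B n (\<lambda>i. F i j) I) J"
proof -
  have "gsum A B n (\<lambda>(i, j). F i j) (prod.swap ` (J \<times> I)) = gsum A B n (\<lambda>x. (\<lambda>(i, j). F i j) (prod.swap x)) (J \<times> I)"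
    using assms by (intro gsum_reindex) auto
  then show ?thesis
    using assms by (simp add: gsum_Sigma product_swap case_prod_unfold)
qed

lemma gsum_union:
  assumes "graded_object A" "graded_object B" "finite I" "finite J" "I \<inter> J = {}"
    "\<forall>x\<in>I \<union> J. gmor (F x) A B n"
  shows "gsum A B n F (I \<union> J) = gadd (gsum A B n F I) (gsum A B n F J)"
proof -
  interpret G: comm_monoid "ggrp A B n" by (rule comm_monoid_ggrp) fact+
  show ?thesis
    using assms G.finprod_Un_disjoint[of I J F] by (simp add: gsum_finprod ghom_iff Pi_iff)
qed

lemma gsum_gadd:
  assumes "graded_object A" "graded_object B"
    "\<forall>x\<in>I. gmor (F x) A B n"
    "\<forall>x\<in>I. gmor (G x) A B n"
  shows "gsum A B n (\<lambda>x. gadd (F x) (G x)) I = gadd (gsum A B n F I) (gsum A B n G I)"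
proof -
  interpret G: comm_monoid "ggrp A B n" by (rule comm_monoid_ggrp) fact+
  show ?thesis
    using assms G.finprod_multf[of F I G] by (simp add: gsum_finprod ghom_iff Pi_iff)
qed

text \<open>The common source of distributivity: composing on either side, tensoring on either side
  and inserting a sign are all additive operations \<open>h\<close>.\<close>

lemma gsum_hom:
  assumes "graded_object A" "graded_object B" "graded_object A'" "graded_object B'"
    and "\<And>f. gm f \<Longrightarrow> gsrc f = A \<Longrightarrow> gtgt f = B \<Longrightarrow> gdeg f = n \<Longrightarrow>
       gmor (h f) A' B' n'"
    and "\<And>f g. gm f \<Longrightarrow> gsrc f = A \<Longrightarrow> gtgt f = B \<Longrightarrow> gdeg f = n \<Longrightarrow>
       gm g \<Longrightarrow> gsrc g = A \<Longrightarrow> gtgt g = B \<Longrightarrow> gdeg g = n \<Longrightarrow> h (gadd f g) = gadd (h f) (h g)"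
    and "h (gzero A B n) = gzero A' B' n'"
    and F: "\<forall>x\<in>I. gmor (F x) A B n"
  shows "h (gsum A B n F I) = gsum A' B' n' (\<lambda>x. h (F x)) I"
proof -
  have *: "gmor f A B n" if "f \<in> ghom A B n" for f
    using that assms(1,2) unfolding ghom_def gm_def by blast
  have "h (finprod (ggrp A B n) F I) = finprod (ggrp A' B' n') (\<lambda>x. h (F x)) I"
  proof (rule finprod_commute_hom)
    fix x y
    assume "x \<in> carrier (ggrp A B n)"
    then have x: "gm x" "gsrc x = A" "gtgt x = B" "gdeg x = n" using * by auto
    then show "h x \<in> carrier (ggrp A' B' n')" using assms(5)[OF x] by (simp add: ghom_iff)
    assume "y \<in> carrier (ggrp A B n)"
    then have "gm y" "gsrc y = A" "gtgt y = B" "gdeg y = n" using * by auto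
    with x show "h (x \<otimes>\<^bsub>ggrp A B n\<^esub> y) = h x \<otimes>\<^bsub>ggrp A' B' n'\<^esub> h y"
      using assms(6) by simp
  qed (use assms in \<open>auto simp: ghom_iff intro: comm_monoid_ggrp\<close>)
  then show ?thesis
    using assms by (simp add: gsum_finprod)
qed

lemma gcomp_gsum_left:
  assumes "graded_object A" "\<forall>x\<in>I. gmor (F x) A B n"
    "gm g" "gsrc g = B"
  shows "g \<star> gsum A B n F I = gsum A (gtgt g) (n + gdeg g) (\<lambda>x. g \<star> F x) I"
  by (rule gsum_hom[where h="\<lambda>x. g \<star> x"]) (use assms in \<open>auto simp: gcomp_gadd\<close>)

lemma gcomp_gsum_right:
  assumes "graded_object B" "\<forall>x\<in>I. gmor (F x) A B n"
    "gm g" "gtgt g = A"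
  shows "gsum A B n F I \<star> g = gsum (gsrc g) B (gdeg g + n) (\<lambda>x. F x \<star> g) I"
  by (rule gsum_hom[where h="\<lambda>x. x \<star> g"]) (use assms in \<open>auto simp: gcomp_gadd\<close>)

lemma gsgn_gsum:
  assumes "graded_object A" "graded_object B"
    "\<forall>x\<in>I. gmor (F x) A B n"
  shows "gsgn e (gsum A B n F I) = gsum A B n (\<lambda>x. gsgn e (F x)) I"
  by (rule gsum_hom[where h="gsgn e"]) (use assms in \<open>auto simp: gsgn_gadd\<close>)

end

section \<open>Tensor products of graded maps\<close>

context abelian_tensor_category
begin

declare TenO_Obj [simp] TenA_Ide [simp]

lemma TenA_simps [simp]:
  assumes "f \<in> Arr C" "g \<in> Arr C"
  shows "TenA C f g \<in> Arr C" "Src C (TenA C f g) = TenO C (Src C f) (Src C g)"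
    "Trg C (TenA C f g) = TenO C (Trg C f) (Trg C g)"
  using TenA_hom[of f "Src C f" "Trg C f" g "Src C g" "Trg C g"] assms by (auto simp: hom_iff)

lemma TenA_TenA [simp]:
  assumes "f \<in> Arr C" "g \<in> Arr C" "f' \<in> Arr C" "g' \<in> Arr C" "Src C f' = Trg C f" "Src C g' = Trg C g"
  shows "TenA C f' g' \<cdot> TenA C f g = TenA C (f' \<cdot> f) (g' \<cdot> g)"
  using TenA_Cmp[of f "Src C f" "Trg C f" f' "Trg C f'" g "Src C g" "Trg C g" g' "Trg C g'"] assms
  by (auto simp: hom_iff)

lemma TenA_TenA_Cmp [simp]:
  assumes "f \<in> Arr C" "g \<in> Arr C" "f' \<in> Arr C" "g' \<in> Arr C" "Src C f' = Trg C f" "Src C g' = Trg C g"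
    "h \<in> Arr C" "Trg C h = TenO C (Src C f) (Src C g)"
  shows "TenA C f' g' \<cdot> TenA C f g \<cdot> h = TenA C (f' \<cdot> f) (g' \<cdot> g) \<cdot> h"
  using assms by (subst TenA_TenA[symmetric]) (auto simp del: TenA_TenA)

lemma TenA_Add:
  assumes "f \<in> Arr C" "g \<in> Arr C" "h \<in> Arr C"
  shows "Src C g = Src C f \<Longrightarrow> Trg C g = Trg C f \<Longrightarrow> TenA C (Add C f g) h = Add C (TenA C f h) (TenA C g h)"
    "Src C g = Src C f \<Longrightarrow> Trg C g = Trg C f \<Longrightarrow> TenA C h (Add C f g) = Add C (TenA C h f) (TenA C h g)"
  using TenA_Add_left[of f "Src C f" "Trg C f" g h] TenA_Add_right[of h _ _ f "Src C f" "Trg C f" g] assms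
  by (auto simp: hom_iff)

lemma TenA_Nul [simp]:
  assumes "f \<in> Arr C" "A \<in> Obj C" "B \<in> Obj C"
  shows "TenA C (Nul C A B) f = Nul C (TenO C A (Src C f)) (TenO C B (Trg C f))"
    "TenA C f (Nul C A B) = Nul C (TenO C (Src C f) A) (TenO C (Trg C f) B)"
proof -
  have "Add C (TenA C (Nul C A B) f) (TenA C (Nul C A B) f) = TenA C (Nul C A B) f"
    using assms by (subst TenA_Add(1)[symmetric]) auto
  then show "TenA C (Nul C A B) f = Nul C (TenO C A (Src C f)) (TenO C B (Trg C f))"
    using Add_self_eq_self[of "TenA C (Nul C A B) f"] assms by auto
  have "Add C (TenA C f (Nul C A B)) (TenA C f (Nul C A B)) = TenA C f (Nul C A B)"
    using assms by (subst TenA_Add(2)[symmetric]) auto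
  then show "TenA C f (Nul C A B) = Nul C (TenO C (Src C f) A) (TenO C (Trg C f) B)"
    using Add_self_eq_self[of "TenA C f (Nul C A B)"] assms by auto
qed

lemma TenA_neg:
  assumes "f \<in> Arr C" "g \<in> Arr C"
  shows "TenA C (neg f) g = neg (TenA C f g)" "TenA C f (neg g) = neg (TenA C f g)"
proof -
  show "TenA C (neg f) g = neg (TenA C f g)"
    by (rule Add_eq_Nul_iff) (use assms in \<open>auto simp flip: TenA_Add\<close>)
  show "TenA C f (neg g) = neg (TenA C f g)"
    by (rule Add_eq_Nul_iff) (use assms in \<open>auto simp flip: TenA_Add\<close>)
qed

lemma TenA_hsgn [simp]:
  assumes "f \<in> Arr C" "g \<in> Arr C"
  shows "TenA C (hsgn e f) g = hsgn e (TenA C f g)" "TenA C f (hsgn e g) = hsgn e (TenA C f g)"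
  using assms by (auto simp: hsgn_def TenA_neg)

lemma TenA_hsum:
  assumes "A \<in> Obj C" "B \<in> Obj C" "\<forall>i\<in>I. f i \<in> Arr C \<and> Src C (f i) = A \<and> Trg C (f i) = B" "g \<in> Arr C"
  shows "TenA C (hsum A B f I) g = hsum (TenO C A (Src C g)) (TenO C B (Trg C g)) (\<lambda>i. TenA C (f i) g) I"
  by (rule hsum_hom[where h="\<lambda>x. TenA C x g"]) (use assms in \<open>auto simp: hom_iff TenA_Add\<close>)

lemma zero_object_TenO [simp]:
  "zero_object A \<Longrightarrow> B \<in> Obj C \<Longrightarrow> zero_object (TenO C A B)"
  "zero_object B \<Longrightarrow> A \<in> Obj C \<Longrightarrow> zero_object (TenO C A B)"
  by (simp_all add: zero_object_iff flip: TenA_Ide)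

lemma Asc_simps [simp]:
  assumes "A \<in> Obj C" "B \<in> Obj C" "D \<in> Obj C"
  shows "Asc C A B D \<in> Arr C" "Src C (Asc C A B D) = TenO C (TenO C A B) D"
    "Trg C (Asc C A B D) = TenO C A (TenO C B D)"
  using Asc_hom[OF assms] by (auto simp: hom_iff)

lemma Asc_TenA:
  assumes "f \<in> Arr C" "g \<in> Arr C" "h \<in> Arr C"
    "A = Trg C f" "B = Trg C g" "D = Trg C h"
  shows "Asc C A B D \<cdot> TenA C (TenA C f g) h = TenA C f (TenA C g h) \<cdot> Asc C (Src C f) (Src C g) (Src C h)"
  using Asc_natural[of f "Src C f" "Trg C f" g "Src C g" "Trg C g" h "Src C h" "Trg C h"] assms
  by (auto simp: hom_iff)

text \<open>A resolution of the identity makes the maps \<open>e i\<close> jointly epic. It is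
  stated for a bare resolution so that it also applies to the tensored families of
  \<open>TenA_resolution\<close>.\<close>

lemma eq_of_resolution:
  assumes "hsum T T (\<lambda>i. e i \<cdot> p i) I = Ide C T" "T \<in> Obj C"
    and "\<forall>i\<in>I. e i \<in> Arr C \<and> Trg C (e i) = T \<and> p i \<in> Arr C \<and> Src C (p i) = T \<and> Trg C (p i) = Src C (e i)"
    and "u \<in> Arr C" "v \<in> Arr C" "Src C u = T" "Src C v = T" "Trg C v = Trg C u"
    and "\<forall>i\<in>I. u \<cdot> e i = v \<cdot> e i"
  shows "u = v"
proof -
  have "u = u \<cdot> hsum T T (\<lambda>i. e i \<cdot> p i) I" using assms by simp
  also have "\<dots> = hsum T (Trg C u) (\<lambda>i. u \<cdot> e i \<cdot> p i) I"
    using assms by (subst Cmp_hsum_left) auto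
  also have "\<dots> = hsum T (Trg C u) (\<lambda>i. v \<cdot> e i \<cdot> p i) I"
  proof (rule hsum_cong)
    fix i assume i: "i \<in> I"
    then have "(u \<cdot> e i) \<cdot> p i = (v \<cdot> e i) \<cdot> p i" using assms by auto
    then show "u \<cdot> e i \<cdot> p i = v \<cdot> e i \<cdot> p i"
      using assms(2-8) i cmp_assoc[of "p i" "e i" u] cmp_assoc[of "p i" "e i" v] by simp
  qed (use assms in \<open>auto simp: hom_iff\<close>)
  also have "\<dots> = v \<cdot> hsum T T (\<lambda>i. e i \<cdot> p i) I"
    using assms by (subst Cmp_hsum_left) auto
  also have "\<dots> = v" using assms by simp
  finally show ?thesis .
qed

text \<open>Additivity of the tensor product in its first variable carries the resolution over.
  Iterated, it allows maps out of left-bracketed products such as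
  \<open>(A \<odot>\<^sub>o B) \<odot>\<^sub>o D\<close> to be compared on threefold and fourfold
  summands.\<close>

lemma TenA_resolution:
  assumes "hsum T T (\<lambda>i. e i \<cdot> p i) I = Ide C T" "T \<in> Obj C" "Z \<in> Obj C"
    and "\<forall>i\<in>I. e i \<in> Arr C \<and> Trg C (e i) = T \<and> p i \<in> Arr C \<and> Src C (p i) = T \<and> Trg C (p i) = Src C (e i)"
  shows "hsum (TenO C T Z) (TenO C T Z) (\<lambda>i. TenA C (e i) (Ide C Z) \<cdot> TenA C (p i) (Ide C Z)) I
    = Ide C (TenO C T Z)"
proof -
  have "TenA C (hsum T T (\<lambda>i. e i \<cdot> p i) I) (Ide C Z) = Ide C (TenO C T Z)"
    using assms by simp
  also have "TenA C (hsum T T (\<lambda>i. e i \<cdot> p i) I) (Ide C Z)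
      = hsum (TenO C T Z) (TenO C T Z) (\<lambda>i. TenA C (e i \<cdot> p i) (Ide C Z)) I"
    using assms by (subst TenA_hsum) auto
  also have "\<dots> = hsum (TenO C T Z) (TenO C T Z) (\<lambda>i. TenA C (e i) (Ide C Z) \<cdot> TenA C (p i) (Ide C Z)) I"
    using assms by (intro hsum_cong) (auto simp: hom_iff)
  finally show ?thesis .
qed

lemma gten_cpt: "cpt (A \<odot>\<^sub>o B) n = dobj {low A..n - low B} (\<lambda>i. TenO C (cpt A i) (cpt B (n - i)))"
  and gten_low [simp]: "low (A \<odot>\<^sub>o B) = low A + low B"
  by (simp_all add: gten_def)

lemma gten_graded [simp]:
  assumes "graded_object A" "graded_object B"
  shows "graded_object (A \<odot>\<^sub>o B)"
  unfolding graded_object_def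
proof (intro conjI allI impI)
  show *: "cpt (A \<odot>\<^sub>o B) i \<in> Obj C" for i
    unfolding gten_cpt using assms by (intro dobj_Obj) auto
  fix i assume i: "i < low (A \<odot>\<^sub>o B)"
  then have "{low A..i - low B} = {}" by auto
  then have "Ide C (cpt (A \<odot>\<^sub>o B) i) = Nul C (cpt (A \<odot>\<^sub>o B) i) (cpt (A \<odot>\<^sub>o B) i)"
    using dinc_dpro_sum[of "{low A..i - low B}" "\<lambda>l. TenO C (cpt A l) (cpt B (i - l))"] * [of i] by (simp add: gten_cpt)
  with * show "zero_object (cpt (A \<odot>\<^sub>o B) i)" by (simp add: zero_object_iff)
qed

text \<open>The inclusion \<open>tinc\<close>, extended by 0 to the degrees missing from the index set. There the summand
  is a zero object, so that naturality holds without a case distinction.\<close>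

definition iota :: "'a graded \<Rightarrow> 'a graded \<Rightarrow> int \<Rightarrow> int \<Rightarrow> 'b" where
  "iota A B i j = (if low A \<le> i \<and> low B \<le> j then tinc A B i j
     else Nul C (TenO C (cpt A i) (cpt B j)) (cpt (A \<odot>\<^sub>o B) (i + j)))"

context
  fixes A B
  assumes AB: "graded_object A" "graded_object B"
begin

lemma tinc_simps [simp]:
  assumes "low A \<le> i" "low B \<le> j"
  shows "tinc A B i j \<in> Arr C" "Src C (tinc A B i j) = TenO C (cpt A i) (cpt B j)"
    "Trg C (tinc A B i j) = cpt (A \<odot>\<^sub>o B) (i + j)"
  using assms AB by (simp_all add: tinc_def gten_cpt)

lemma tpro_simps [simp]:
  assumes "low A \<le> i" "low B \<le> j"
  shows "tpro A B i j \<in> Arr C" "Trg C (tpro A B i j) = TenO C (cpt A i) (cpt B j)"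
    "Src C (tpro A B i j) = cpt (A \<odot>\<^sub>o B) (i + j)"
  using assms AB by (simp_all add: tpro_def gten_cpt)

lemma tpro_tinc:
  assumes "low A \<le> i" "low B \<le> j" "low A \<le> i'" "low B \<le> j'" "i' + j' = i + j"
  shows "tpro A B i' j' \<cdot> tinc A B i j = (if i = i' then Ide C (TenO C (cpt A i) (cpt B j))
    else Nul C (TenO C (cpt A i) (cpt B j)) (TenO C (cpt A i') (cpt B j')))"
proof -
  have "i' \<le> i + j - low B" using assms by linarith
  moreover have j': "j' = i + j - i'" using assms by linarith
  ultimately show ?thesis
    using assms(1-4) AB unfolding j' by (cases "i = i'") (auto simp: tinc_def tpro_def dpro_dinc)
qed

lemma iota_simps [simp]:
  shows "iota A B i j \<in> Arr C" "Src C (iota A B i j) = TenO C (cpt A i) (cpt B j)"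
    "Trg C (iota A B i j) = cpt (A \<odot>\<^sub>o B) (i + j)"
  using AB by (auto simp: iota_def)

lemma gten_resolution:
  "hsum (cpt (A \<odot>\<^sub>o B) t) (cpt (A \<odot>\<^sub>o B) t) (\<lambda>i. iota A B i (t - i) \<cdot> tpro A B i (t - i)) {low A..t - low B}
    = Ide C (cpt (A \<odot>\<^sub>o B) t)"
proof -
  let ?I = "{low A..t - low B}" and ?T = "\<lambda>l. TenO C (cpt A l) (cpt B (t - l))"
  have "Ide C (cpt (A \<odot>\<^sub>o B) t) = hsum (cpt (A \<odot>\<^sub>o B) t) (cpt (A \<odot>\<^sub>o B) t) (\<lambda>i. dinc ?I ?T i \<cdot> dpro ?I ?T i) ?I"
    using dinc_dpro_sum[of ?I ?T] AB by (simp add: gten_cpt)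
  also have "\<dots> = hsum (cpt (A \<odot>\<^sub>o B) t) (cpt (A \<odot>\<^sub>o B) t) (\<lambda>i. iota A B i (t - i) \<cdot> tpro A B i (t - i)) ?I"
    using AB by (intro hsum_cong) (auto simp: hom_iff iota_def tinc_def tpro_def gten_cpt)
  finally show ?thesis by simp
qed

text \<open>The extension principle for maps out of a graded tensor product. Together with
  \<open>gtenm_iota\<close> and \<open>gasc_iota\<close> it replaces computations with the chosen
  direct sums by computations on single summands.\<close>

lemma gten_ext:
  assumes "u \<in> Arr C" "v \<in> Arr C" "Src C u = cpt (A \<odot>\<^sub>o B) t" "Src C v = cpt (A \<odot>\<^sub>o B) t" "Trg C v = Trg C u"
    and "\<And>i j. i + j = t \<Longrightarrow> u \<cdot> iota A B i j = v \<cdot> iota A B i j"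
  shows "u = v"
  using AB assms by (intro eq_of_resolution[OF gten_resolution[of t]]) auto

lemma gten_ext_TenA:
  assumes "u \<in> Arr C" "v \<in> Arr C" "Z \<in> Obj C" "Src C u = TenO C (cpt (A \<odot>\<^sub>o B) t) Z" "Src C v = TenO C (cpt (A \<odot>\<^sub>o B) t) Z"
    "Trg C v = Trg C u"
    and "\<And>i j. i + j = t \<Longrightarrow> u \<cdot> TenA C (iota A B i j) (Ide C Z) = v \<cdot> TenA C (iota A B i j) (Ide C Z)"
  shows "u = v"
  using AB assms by (intro eq_of_resolution[OF TenA_resolution[OF gten_resolution[of t], of Z]]) auto

lemma gten_ext_TenA_TenA:
  assumes "u \<in> Arr C" "v \<in> Arr C" "Z \<in> Obj C" "Z' \<in> Obj C" "Src C u = TenO C (TenO C (cpt (A \<odot>\<^sub>o B) t) Z) Z'"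
    "Src C v = TenO C (TenO C (cpt (A \<odot>\<^sub>o B) t) Z) Z'" "Trg C v = Trg C u"
    and "\<And>i j. i + j = t \<Longrightarrow> u \<cdot> TenA C (TenA C (iota A B i j) (Ide C Z)) (Ide C Z')
      = v \<cdot> TenA C (TenA C (iota A B i j) (Ide C Z)) (Ide C Z')"
  shows "u = v"
  using AB assms
  by (intro eq_of_resolution[OF TenA_resolution[OF TenA_resolution[OF gten_resolution[of t], of Z], of Z']]) auto

end

lemma gtenm_simps [simp]:
  "gsrc (f \<odot> g) = gsrc f \<odot>\<^sub>o gsrc g" "gtgt (f \<odot> g) = gtgt f \<odot>\<^sub>o gtgt g" "gdeg (f \<odot> g) = gdeg f + gdeg g"
  by (simp_all add: gtenm_def Let_def)

lemma gtenm_gfun: "gfun (f \<odot> g) t = hsum (cpt (gsrc f \<odot>\<^sub>o gsrc g) t) (cpt (gtgt f \<odot>\<^sub>o gtgt g) (t + (gdeg f + gdeg g)))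
    (\<lambda>i. hsgn (gdeg g * i) (tinc (gtgt f) (gtgt g) (i + gdeg f) (t - i + gdeg g) \<cdot>
       TenA C (gfun f i) (gfun g (t - i)) \<cdot> tpro (gsrc f) (gsrc g) i (t - i)))
    {i. low (gsrc f) \<le> i \<and> low (gsrc g) \<le> t - i \<and> low (gtgt f) \<le> i + gdeg f \<and> low (gtgt g) \<le> t - i + gdeg g}"
  by (simp add: gtenm_def Let_def)

lemma gtenm_gm [simp]:
  assumes "gm f" "gm g"
  shows "gm (f \<odot> g)"
proof (rule gmI)
  fix t
  have [simp]: "gdeg f + (t + gdeg g) = t + (gdeg f + gdeg g)" by simp
  show "gfun (f \<odot> g) t \<in> hom (cpt (gsrc (f \<odot> g)) t) (cpt (gtgt (f \<odot> g)) (t + gdeg (f \<odot> g)))"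
    unfolding gtenm_gfun gtenm_simps
    using assms by (intro hsum_in_hom) (auto simp: hom_iff)
qed (use assms in auto)

text \<open>Of the sum defining \<open>f \<odot> g\<close> only the index i survives, by
  orthogonality of \<open>tpro\<close> and \<open>tinc\<close>. An index left out because the target
  lies below its lower bounds is matched by \<open>iota\<close> being zero there, and for (i, j)
  below the source bounds both sides start at a zero object.\<close>

lemma gtenm_iota:
  assumes f: "gm f" and g: "gm g" and t: "t = i + j" and [simp]: "A = gsrc f" "B = gsrc g"
  shows "gfun (f \<odot> g) t \<cdot> iota A B i j
    = hsgn (gdeg g * i) (iota (gtgt f) (gtgt g) (i + gdeg f) (j + gdeg g) \<cdot> TenA C (gfun f i) (gfun g j))"
proof (cases "low A \<le> i \<and> low B \<le> j")
  case True
  let ?T = "cpt (gtgt f \<odot>\<^sub>o gtgt g) (t + (gdeg f + gdeg g))"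
  let ?F = "\<lambda>i'. hsgn (gdeg g * i') (tinc (gtgt f) (gtgt g) (i' + gdeg f) (t - i' + gdeg g) \<cdot>
       TenA C (gfun f i') (gfun g (t - i')) \<cdot> tpro (gsrc f) (gsrc g) i' (t - i'))"
  let ?I = "{i. low (gsrc f) \<le> i \<and> low (gsrc g) \<le> t - i \<and> low (gtgt f) \<le> i + gdeg f \<and> low (gtgt g) \<le> t - i + gdeg g}"
  have [simp]: "gdeg f + (t + gdeg g) = t + (gdeg f + gdeg g)" by simp
  have fin: "finite ?I" by (rule finite_subset[of _ "{low (gsrc f)..t - low (gsrc g)}"]) auto
  have F: "?F i' \<in> Arr C \<and> Src C (?F i') = cpt (gsrc f \<odot>\<^sub>o gsrc g) t \<and> Trg C (?F i') = ?T" if "i' \<in> ?I" for i'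
    using that f g by auto
  have "gfun (f \<odot> g) t \<cdot> iota A B i j = hsum (Src C (iota A B i j)) ?T (\<lambda>i'. ?F i' \<cdot> iota A B i j) ?I"
    unfolding gtenm_gfun by (rule Cmp_hsum_right) (use F f g t in auto)
  also have "\<dots> = (if i \<in> ?I then ?F i \<cdot> iota A B i j else Nul C (Src C (iota A B i j)) ?T)"
  proof -
    have Nul: "?F i' \<cdot> iota A B i j = Nul C (Src C (iota A B i j)) ?T" if "i' \<in> ?I" "i' \<noteq> i" for i'
      using that f g True t by (simp add: iota_def tpro_tinc) (simp add: ac_simps)
    show ?thesis
    proof (cases "i \<in> ?I")
      case True
      show ?thesis
        by (rule hsum_delta) (use True f g fin Nul t in \<open>auto simp: hom_iff ac_simps\<close>)
    next
      case False
      show ?thesis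
        using False by (simp only: if_False, intro hsum_Nul) (use f g Nul in auto)
    qed
  qed
  also have "\<dots> = hsgn (gdeg g * i) (iota (gtgt f) (gtgt g) (i + gdeg f) (j + gdeg g) \<cdot> TenA C (gfun f i) (gfun g j))"
    using True f g t by (auto simp: iota_def tpro_tinc add.commute add.left_commute)
  finally show ?thesis .
next
  case False
  then have z: "zero_object (TenO C (cpt (gsrc f) i) (cpt (gsrc g) j))"
    using f g by auto
  show ?thesis
    using f g t z from_zero_object[of "gfun (f \<odot> g) t \<cdot> iota A B i j"]
      from_zero_object[of "iota (gtgt f) (gtgt g) (i + gdeg f) (j + gdeg g) \<cdot> TenA C (gfun f i) (gfun g j)"]
    by (simp add: ac_simps)
qed

lemma gtenm_iota_Cmp:
  assumes "gm f" "gm g" "t = i + j" "A = gsrc f" "B = gsrc g" "h \<in> Arr C" "Trg C h = TenO C (cpt A i) (cpt B j)"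
  shows "gfun (f \<odot> g) t \<cdot> iota A B i j \<cdot> h
    = hsgn (gdeg g * i) (iota (gtgt f) (gtgt g) (i + gdeg f) (j + gdeg g) \<cdot> TenA C (gfun f i) (gfun g j) \<cdot> h)"
proof -
  have "t + (gdeg f + gdeg g) = (i + gdeg f) + (j + gdeg g)" using assms by simp
  then show ?thesis
    using assms gtenm_iota[of f g t i j A B] by (simp flip: cmp_assoc)
qed

text \<open>On the summand (i, j) the left side has the sign exponent deg g * i + deg g' * (i + deg
  f), the tensor product on the right only (deg g + deg g') * i.\<close>

lemma gtenm_gcomp:
  assumes "gm f" "gm g" "gm f'" "gm g'" "gsrc f' = gtgt f" "gsrc g' = gtgt g"
  shows "(f' \<odot> g') \<star> (f \<odot> g) = gsgn (gdeg g' * gdeg f) ((f' \<star> f) \<odot> (g' \<star> g))"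
proof (rule gmap_eqI)
  fix t
  show "gfun ((f' \<odot> g') \<star> (f \<odot> g)) t = gfun (gsgn (gdeg g' * gdeg f) ((f' \<star> f) \<odot> (g' \<star> g))) t"
  proof (rule gten_ext[of "gsrc f" "gsrc g" _ _ t])
    fix i j assume "i + j = t"
    then have t: "t = i + j" by simp
    have e: "i + j + (gdeg f + gdeg g) = (i + gdeg f) + (j + gdeg g)" by simp
    show "gfun ((f' \<odot> g') \<star> (f \<odot> g)) t \<cdot> iota (gsrc f) (gsrc g) i j
        = gfun (gsgn (gdeg g' * gdeg f) ((f' \<star> f) \<odot> (g' \<star> g))) t \<cdot> iota (gsrc f) (gsrc g) i j"
      using assms unfolding t by (simp add: gtenm_iota gtenm_iota_Cmp e) (simp add: algebra_simps)
  qed (use assms in \<open>auto simp: ac_simps\<close>)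
qed (use assms in auto)

lemma gid_gtenm_gid [simp]:
  assumes "graded_object A" "graded_object B"
  shows "gid A \<odot> gid B = gid (A \<odot>\<^sub>o B)"
proof (rule gmap_eqI)
  fix t
  show "gfun (gid A \<odot> gid B) t = gfun (gid (A \<odot>\<^sub>o B)) t"
    by (rule gten_ext[of A B _ _ t]) (use assms in \<open>auto simp: gtenm_iota\<close>)
qed auto

lemma gtenm_gadd:
  assumes "gm f" "gm g" "gm h" "gsrc g = gsrc f" "gtgt g = gtgt f" "gdeg g = gdeg f"
  shows "gadd f g \<odot> h = gadd (f \<odot> h) (g \<odot> h)" "h \<odot> gadd f g = gadd (h \<odot> f) (h \<odot> g)"
proof -
  show "gadd f g \<odot> h = gadd (f \<odot> h) (g \<odot> h)"
  proof (rule gmap_eqI)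
    fix t
    show "gfun (gadd f g \<odot> h) t = gfun (gadd (f \<odot> h) (g \<odot> h)) t"
      by (rule gten_ext[of "gsrc f" "gsrc h" _ _ t]) (use assms in \<open>auto simp: gtenm_iota TenA_Add hsgn_Add\<close>)
  qed (use assms in auto)
  show "h \<odot> gadd f g = gadd (h \<odot> f) (h \<odot> g)"
  proof (rule gmap_eqI)
    fix t
    show "gfun (h \<odot> gadd f g) t = gfun (gadd (h \<odot> f) (h \<odot> g)) t"
      by (rule gten_ext[of "gsrc h" "gsrc f" _ _ t]) (use assms in \<open>auto simp: gtenm_iota TenA_Add hsgn_Add\<close>)
  qed (use assms in auto)
qed

lemma gtenm_gsgn [simp]:
  assumes "gm f" "gm g"
  shows "gsgn e f \<odot> g = gsgn e (f \<odot> g)" "f \<odot> gsgn e g = gsgn e (f \<odot> g)"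
proof -
  show "gsgn e f \<odot> g = gsgn e (f \<odot> g)"
  proof (rule gmap_eqI)
    fix t
    show "gfun (gsgn e f \<odot> g) t = gfun (gsgn e (f \<odot> g)) t"
      by (rule gten_ext[of "gsrc f" "gsrc g" _ _ t]) (use assms in \<open>auto simp: gtenm_iota ac_simps\<close>)
  qed (use assms in auto)
  show "f \<odot> gsgn e g = gsgn e (f \<odot> g)"
  proof (rule gmap_eqI)
    fix t
    show "gfun (f \<odot> gsgn e g) t = gfun (gsgn e (f \<odot> g)) t"
      by (rule gten_ext[of "gsrc f" "gsrc g" _ _ t]) (use assms in \<open>auto simp: gtenm_iota ac_simps\<close>)
  qed (use assms in auto)
qed

lemma gtenm_gzero [simp]:
  assumes "gm f" "graded_object A" "graded_object B"
  shows "gzero A B n \<odot> f = gzero (A \<odot>\<^sub>o gsrc f) (B \<odot>\<^sub>o gtgt f) (n + gdeg f)"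
    "f \<odot> gzero A B n = gzero (gsrc f \<odot>\<^sub>o A) (gtgt f \<odot>\<^sub>o B) (gdeg f + n)"
proof -
  show "gzero A B n \<odot> f = gzero (A \<odot>\<^sub>o gsrc f) (B \<odot>\<^sub>o gtgt f) (n + gdeg f)"
  proof (rule gmap_eqI)
    fix t
    show "gfun (gzero A B n \<odot> f) t = gfun (gzero (A \<odot>\<^sub>o gsrc f) (B \<odot>\<^sub>o gtgt f) (n + gdeg f)) t"
      by (rule gten_ext[of A "gsrc f" _ _ t]) (use assms in \<open>auto simp: gtenm_iota ac_simps\<close>)
  qed (use assms in auto)
  show "f \<odot> gzero A B n = gzero (gsrc f \<odot>\<^sub>o A) (gtgt f \<odot>\<^sub>o B) (gdeg f + n)"
  proof (rule gmap_eqI)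
    fix t
    show "gfun (f \<odot> gzero A B n) t = gfun (gzero (gsrc f \<odot>\<^sub>o A) (gtgt f \<odot>\<^sub>o B) (gdeg f + n)) t"
      by (rule gten_ext[of "gsrc f" A _ _ t]) (use assms in \<open>auto simp: gtenm_iota ac_simps\<close>)
  qed (use assms in auto)
qed

lemma gtenm_gsum_left:
  assumes "graded_object A" "graded_object B" "\<forall>x\<in>I. gmor (F x) A B n" "gm g"
  shows "gsum A B n F I \<odot> g = gsum (A \<odot>\<^sub>o gsrc g) (B \<odot>\<^sub>o gtgt g) (n + gdeg g) (\<lambda>x. F x \<odot> g) I"
  by (rule gsum_hom[where h="\<lambda>x. x \<odot> g"]) (use assms in \<open>auto simp: gtenm_gadd\<close>)

lemma gtenm_gsum_right:
  assumes "graded_object A" "graded_object B" "\<forall>x\<in>I. gmor (F x) A B n" "gm g"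
  shows "g \<odot> gsum A B n F I = gsum (gsrc g \<odot>\<^sub>o A) (gtgt g \<odot>\<^sub>o B) (gdeg g + n) (\<lambda>x. g \<odot> F x) I"
  by (rule gsum_hom[where h="\<lambda>x. g \<odot> x"]) (use assms in \<open>auto simp: gtenm_gadd\<close>)

section \<open>The associator of graded objects\<close>

lemma gasc_simps [simp]:
  "gsrc (gasc A B D) = (A \<odot>\<^sub>o B) \<odot>\<^sub>o D" "gtgt (gasc A B D) = A \<odot>\<^sub>o B \<odot>\<^sub>o D" "gdeg (gasc A B D) = 0"
  by (simp_all add: gasc_def)

lemma finite_gasc_index:
  "finite {(i, j). a \<le> i \<and> b \<le> j \<and> d \<le> t - i - (j :: int)}"
  by (rule finite_subset[of _ "{a..t - b - d} \<times> {b..t - a - d}"]) auto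

lemma gasc_gm [simp]:
  assumes "graded_object A" "graded_object B" "graded_object D"
  shows "gm (gasc A B D)"
proof (rule gmI)
  fix t
  show "gfun (gasc A B D) t \<in> hom (cpt (gsrc (gasc A B D)) t) (cpt (gtgt (gasc A B D)) (t + gdeg (gasc A B D)))"
    unfolding gasc_simps
    using assms by (auto simp: gasc_def hom_iff Let_def intro!: hsum_in_hom)
qed (use assms in auto)

lemma tpro_iota_Cmp:
  assumes "graded_object A" "graded_object B" "low A \<le> i" "low B \<le> j" "low A \<le> i'" "low B \<le> j'" "i' + j' = i + j"
    "h \<in> Arr C" "Trg C h = TenO C (cpt A i) (cpt B j)"
  shows "tpro A B i' j' \<cdot> iota A B i j \<cdot> h = (if i = i' then h else Nul C (Src C h) (TenO C (cpt A i') (cpt B j')))"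
proof -
  have "tpro A B i' j' \<cdot> iota A B i j \<cdot> h = (tpro A B i' j' \<cdot> tinc A B i j) \<cdot> h"
    using assms by (simp add: iota_def)
  then show ?thesis
    using assms tpro_tinc[of A B i j i' j'] by (simp split: if_splits)
qed

text \<open>The projection \<open>tpro (A \<odot>\<^sub>o B) D\<close> singles out the total degree
  i + j of the first two factors, then \<open>tpro A B\<close> singles out i; all other summands of
  \<open>gasc\<close> vanish.\<close>

lemma gasc_iota:
  assumes "graded_object A" "graded_object B" "graded_object D" and t: "t = i + j + l"
    "s = i + j" "A' = A \<odot>\<^sub>o B" "D' = cpt D l"
  shows "gfun (gasc A B D) t \<cdot> iota A' D s l \<cdot> TenA C (iota A B i j) (Ide C D')
    = iota A (B \<odot>\<^sub>o D) i (j + l) \<cdot> TenA C (Ide C (cpt A i)) (iota B D j l) \<cdot> Asc C (cpt A i) (cpt B j) (cpt D l)"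
proof -
  let ?e = "iota (A \<odot>\<^sub>o B) D (i + j) l \<cdot> TenA C (iota A B i j) (Ide C (cpt D l))"
  let ?S = "TenO C (TenO C (cpt A i) (cpt B j)) (cpt D l)" and ?T = "cpt (A \<odot>\<^sub>o B \<odot>\<^sub>o D) t"
  have e: "?e \<in> Arr C" "Src C ?e = ?S" "Trg C ?e = cpt ((A \<odot>\<^sub>o B) \<odot>\<^sub>o D) t"
    using assms by auto
  have "gfun (gasc A B D) t \<cdot> ?e = iota A (B \<odot>\<^sub>o D) i (j + l) \<cdot> TenA C (Ide C (cpt A i)) (iota B D j l) \<cdot> Asc C (cpt A i) (cpt B j) (cpt D l)"
  proof (cases "low A \<le> i \<and> low B \<le> j \<and> low D \<le> l")
    case True
    define F where "F = (\<lambda>(i, j). let l = t - i - j in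
          tinc A (B \<odot>\<^sub>o D) i (j + l) \<cdot> TenA C (Ide C (cpt A i)) (tinc B D j l)
          \<cdot> Asc C (cpt A i) (cpt B j) (cpt D l)
          \<cdot> TenA C (tpro A B i j) (Ide C (cpt D l)) \<cdot> tpro (A \<odot>\<^sub>o B) D (i + j) l)"
    let ?I = "{(i, j). low A \<le> i \<and> low B \<le> j \<and> low D \<le> t - i - j}"
    have F: "F x \<in> Arr C \<and> Src C (F x) = cpt ((A \<odot>\<^sub>o B) \<odot>\<^sub>o D) t \<and> Trg C (F x) = ?T" if "x \<in> ?I" for x
      using that assms(1-3) by (auto simp: F_def Let_def)
    have "gfun (gasc A B D) t \<cdot> ?e = hsum (Src C ?e) ?T (\<lambda>x. F x \<cdot> ?e) ?I"
      unfolding gasc_def graded.simps gmap.simps F_def[symmetric]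
      by (rule Cmp_hsum_right) (use F assms e in auto)
    also have "\<dots> = F (i, j) \<cdot> ?e"
    proof -
      have "F x \<cdot> ?e = Nul C (Src C ?e) ?T" if "x \<in> ?I" "x \<noteq> (i, j)" for x
      proof -
        obtain i' j' where x: "x = (i', j')" by force
        with that have ij: "low A \<le> i'" "low B \<le> j'" "low D \<le> t - i' - j'" "i' = i \<longrightarrow> j' \<noteq> j" by auto
        let ?l = "t - i' - j'"
        have tt: "tpro (A \<odot>\<^sub>o B) D (i' + j') ?l \<cdot> ?e = (if i + j = i' + j' then TenA C (iota A B i j) (Ide C (cpt D l))
           else Nul C ?S (TenO C (cpt (A \<odot>\<^sub>o B) (i' + j')) (cpt D ?l)))"
          using True ij assms by (subst tpro_iota_Cmp) auto
        have Fx: "F x \<cdot> ?e = (tinc A (B \<odot>\<^sub>o D) i' (j' + ?l) \<cdot> TenA C (Ide C (cpt A i')) (tinc B D j' ?l)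
            \<cdot> Asc C (cpt A i') (cpt B j') (cpt D ?l)
            \<cdot> TenA C (tpro A B i' j') (Ide C (cpt D ?l))) \<cdot> tpro (A \<odot>\<^sub>o B) D (i' + j') ?l \<cdot> ?e"
          using assms(1-3) True ij by (simp add: F_def Let_def x flip: t(1))
        show ?thesis
        proof (cases "i + j = i' + j'")
          case eq: True
          then have l: "?l = l" using t by simp
          have t': "t = i' + (j' + l)" using t eq by simp
          have "i \<noteq> i'" using eq ij by auto
          then have "tpro A B i' j' \<cdot> iota A B i j = Nul C (TenO C (cpt A i) (cpt B j)) (TenO C (cpt A i') (cpt B j'))"
            using True ij assms eq by (simp add: iota_def tpro_tinc)
          then show ?thesis
            using assms(1-3) True ij eq unfolding Fx tt unfolding l by (simp add: t')
        next
          case False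
          then show ?thesis
            using assms(1-3) True ij unfolding Fx tt by (simp flip: t(1))
        qed
      qed
      then show ?thesis
        using True t assms e F[of "(i, j)"]
        by (subst hsum_delta[where j="(i, j)"]) (auto simp: hom_iff finite_gasc_index)
    qed
    also have "\<dots> = iota A (B \<odot>\<^sub>o D) i (j + l) \<cdot> TenA C (Ide C (cpt A i)) (iota B D j l) \<cdot> Asc C (cpt A i) (cpt B j) (cpt D l)"
    proof -
      have l: "t - i - j = l" using t by simp
      have tt: "tpro (A \<odot>\<^sub>o B) D (i + j) l \<cdot> ?e = TenA C (iota A B i j) (Ide C (cpt D l))"
        using True assms by (subst tpro_iota_Cmp) auto
      have "F (i, j) \<cdot> ?e = (tinc A (B \<odot>\<^sub>o D) i (j + l) \<cdot> TenA C (Ide C (cpt A i)) (tinc B D j l)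
            \<cdot> Asc C (cpt A i) (cpt B j) (cpt D l)
            \<cdot> TenA C (tpro A B i j) (Ide C (cpt D l))) \<cdot> tpro (A \<odot>\<^sub>o B) D (i + j) l \<cdot> ?e"
        using assms True by (simp add: F_def l)
      also have "\<dots> = iota A (B \<odot>\<^sub>o D) i (j + l) \<cdot> TenA C (Ide C (cpt A i)) (iota B D j l) \<cdot> Asc C (cpt A i) (cpt B j) (cpt D l)"
        using True assms tt by (simp add: iota_def tpro_tinc)
      finally show ?thesis .
    qed
    finally show ?thesis .
  next
    case False
    then have z: "zero_object ?S" using assms by auto
    have [simp]: "i + (j + l) = i + j + l" by simp
    show ?thesis
      using z assms from_zero_object[of "gfun (gasc A B D) t \<cdot> ?e"]
        from_zero_object[of "iota A (B \<odot>\<^sub>o D) i (j + l) \<cdot> TenA C (Ide C (cpt A i)) (iota B D j l) \<cdot> Asc C (cpt A i) (cpt B j) (cpt D l)"]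
      by simp
  qed
  then show ?thesis using assms by simp
qed

lemma Asc_TenA_Cmp:
  assumes "f \<in> Arr C" "g \<in> Arr C" "h \<in> Arr C" "x \<in> Arr C" "Trg C x = TenO C (TenO C (Src C f) (Src C g)) (Src C h)"
    "A = Trg C f" "B = Trg C g" "D = Trg C h"
  shows "Asc C A B D \<cdot> TenA C (TenA C f g) h \<cdot> x = TenA C f (TenA C g h) \<cdot> Asc C (Src C f) (Src C g) (Src C h) \<cdot> x"
proof -
  have "Asc C A B D \<cdot> TenA C (TenA C f g) h \<cdot> x = (Asc C A B D \<cdot> TenA C (TenA C f g) h) \<cdot> x"
    using assms by simp
  also have "\<dots> = (TenA C f (TenA C g h) \<cdot> Asc C (Src C f) (Src C g) (Src C h)) \<cdot> x"
    using assms by (simp only: Asc_TenA)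
  finally show ?thesis
    using assms by simp
qed

lemma Asc_TenA_Ide:
  assumes "h \<in> Arr C" "A \<in> Obj C" "B \<in> Obj C" "D = Trg C h"
  shows "Asc C A B D \<cdot> TenA C (Ide C (TenO C A B)) h = TenA C (Ide C A) (TenA C (Ide C B) h) \<cdot> Asc C A B (Src C h)"
  using Asc_TenA[of "Ide C A" "Ide C B" h] assms by simp

text \<open>The same evaluation with further maps u and v in front, the shape left behind by
  simplification when a preceding map has already merged with the inclusion.\<close>

lemma gasc_iota_TenA:
  assumes "graded_object A" "graded_object B" "graded_object D" "t = s + l"
    "s = i + j" "A' = A \<odot>\<^sub>o B"
    and u: "u \<in> Arr C" "Trg C u = TenO C (cpt A i) (cpt B j)" and v: "v \<in> Arr C" "Trg C v = cpt D l"
  shows "gfun (gasc A B D) t \<cdot> iota A' D s l \<cdot> TenA C (iota A B i j \<cdot> u) v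
    = iota A (B \<odot>\<^sub>o D) i (j + l) \<cdot> TenA C (Ide C (cpt A i)) (iota B D j l) \<cdot> Asc C (cpt A i) (cpt B j) (cpt D l) \<cdot> TenA C u v"
proof -
  have e: "i + j + l = i + (j + l)" by simp
  have "gfun (gasc A B D) t \<cdot> iota A' D s l \<cdot> TenA C (iota A B i j \<cdot> u) v
      = (gfun (gasc A B D) t \<cdot> iota A' D s l \<cdot> TenA C (iota A B i j) (Ide C (cpt D l))) \<cdot> TenA C u v"
    using assms by simp
  also have "\<dots> = (iota A (B \<odot>\<^sub>o D) i (j + l) \<cdot> TenA C (Ide C (cpt A i)) (iota B D j l) \<cdot> Asc C (cpt A i) (cpt B j) (cpt D l)) \<cdot> TenA C u v"
    using assms by (subst gasc_iota) auto
  finally show ?thesis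
    using assms by simp
qed

text \<open>Both sides reduce to naturality of \<open>Asc\<close> on a threefold summand. The Koszul
  exponents agree: deg h * (i + j) + deg g * i on the left, (deg g + deg h) * i + deg h * j on the
  right.\<close>

lemma gtenm_gasc:
  assumes "gm f" "gm g" "gm h" "A = gtgt f" "B = gtgt g" "D = gtgt h"
  shows "gasc A B D \<star> ((f \<odot> g) \<odot> h) = (f \<odot> (g \<odot> h)) \<star> gasc (gsrc f) (gsrc g) (gsrc h)"
proof (rule gmap_eqI)
  fix t
  let ?u = "gfun (gasc A B D \<star> ((f \<odot> g) \<odot> h)) t" and ?v = "gfun ((f \<odot> (g \<odot> h)) \<star> gasc (gsrc f) (gsrc g) (gsrc h)) t"
  show "?u = ?v"
  proof (rule gten_ext[of "gsrc f \<odot>\<^sub>o gsrc g" "gsrc h" _ _ t])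
    fix s l assume "s + l = t"
    then have t: "t = s + l" by simp
    show "?u \<cdot> iota (gsrc f \<odot>\<^sub>o gsrc g) (gsrc h) s l = ?v \<cdot> iota (gsrc f \<odot>\<^sub>o gsrc g) (gsrc h) s l"
    proof (rule gten_ext_TenA[of "gsrc f" "gsrc g" _ _ "cpt (gsrc h) l" s])
      fix i j assume "i + j = s"
      then have s: "s = i + j" by simp
      let ?e = "TenA C (iota (gsrc f) (gsrc g) i j) (Ide C (cpt (gsrc h) l))"
      have e: "i + j + (gdeg f + gdeg g) = (i + gdeg f) + (j + gdeg g)"
        "j + l + (gdeg g + gdeg h) = (j + gdeg g) + (l + gdeg h)"
        "i + j + l + (gdeg f + gdeg g + gdeg h) = (i + gdeg f) + (j + gdeg g) + (l + gdeg h)"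
        "i + j + l + (gdeg f + (gdeg g + gdeg h)) = (i + gdeg f) + (j + gdeg g) + (l + gdeg h)"
        "i + gdeg f + ((j + gdeg g) + (l + gdeg h)) = (i + gdeg f) + (j + gdeg g) + (l + gdeg h)"
        "i + (j + l) = i + j + l"
        by simp_all
      have "?u \<cdot> iota (gsrc f \<odot>\<^sub>o gsrc g) (gsrc h) s l \<cdot> ?e = hsgn (gdeg h * s + gdeg g * i)
        (iota A (B \<odot>\<^sub>o D) (i + gdeg f) (j + gdeg g + (l + gdeg h)) \<cdot>
          TenA C (gfun f i) (iota B D (j + gdeg g) (l + gdeg h) \<cdot> TenA C (gfun g j) (gfun h l)) \<cdot>
          Asc C (cpt (gsrc f) i) (cpt (gsrc g) j) (cpt (gsrc h) l))"
        using assms by (simp add: t s gtenm_iota gtenm_iota_Cmp gasc_iota_TenA Asc_TenA e)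
      moreover have "?v \<cdot> iota (gsrc f \<odot>\<^sub>o gsrc g) (gsrc h) s l \<cdot> ?e = hsgn ((gdeg g + gdeg h) * i + gdeg h * j)
        (iota A (B \<odot>\<^sub>o D) (i + gdeg f) (j + gdeg g + (l + gdeg h)) \<cdot>
          TenA C (gfun f i) (iota B D (j + gdeg g) (l + gdeg h) \<cdot> TenA C (gfun g j) (gfun h l)) \<cdot>
          Asc C (cpt (gsrc f) i) (cpt (gsrc g) j) (cpt (gsrc h) l))"
        using assms by (simp add: t s gtenm_iota gtenm_iota_Cmp gasc_iota e)
      ultimately show "(?u \<cdot> iota (gsrc f \<odot>\<^sub>o gsrc g) (gsrc h) s l) \<cdot> ?e = (?v \<cdot> iota (gsrc f \<odot>\<^sub>o gsrc g) (gsrc h) s l) \<cdot> ?e"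
        using assms by (simp add: s t e) (simp add: algebra_simps)
    qed (use assms t in \<open>auto simp: ac_simps\<close>)
  qed (use assms in \<open>auto simp: ac_simps\<close>)
qed (use assms in auto)

text \<open>Associators have degree 0, so no signs occur, and three nested extension principles
  reduce the claim to the pentagon of the underlying category on fourfold summands.\<close>

lemma graded_pentagon:
  assumes "graded_object A" "graded_object B" "graded_object D" "graded_object E"
  shows "gasc A B (D \<odot>\<^sub>o E) \<star> gasc (A \<odot>\<^sub>o B) D E
    = (gid A \<odot> gasc B D E) \<star> gasc A (B \<odot>\<^sub>o D) E \<star> (gasc A B D \<odot> gid E)"
proof (rule gmap_eqI)
  fix t
  let ?u = "gfun (gasc A B (D \<odot>\<^sub>o E) \<star> gasc (A \<odot>\<^sub>o B) D E) t"
  let ?v = "gfun ((gid A \<odot> gasc B D E) \<star> gasc A (B \<odot>\<^sub>o D) E \<star> (gasc A B D \<odot> gid E)) t"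
  show "?u = ?v"
  proof (rule gten_ext[of "(A \<odot>\<^sub>o B) \<odot>\<^sub>o D" E _ _ t])
    fix r m assume "r + m = t"
    then have t: "t = r + m" by simp
    let ?e1 = "iota ((A \<odot>\<^sub>o B) \<odot>\<^sub>o D) E r m"
    show "?u \<cdot> ?e1 = ?v \<cdot> ?e1"
    proof (rule gten_ext_TenA[of "A \<odot>\<^sub>o B" D _ _ "cpt E m" r])
      fix s l assume "s + l = r"
      then have r: "r = s + l" by simp
      let ?e2 = "TenA C (iota (A \<odot>\<^sub>o B) D s l) (Ide C (cpt E m))"
      show "(?u \<cdot> ?e1) \<cdot> ?e2 = (?v \<cdot> ?e1) \<cdot> ?e2"
      proof (rule gten_ext_TenA_TenA[of A B _ _ "cpt D l" "cpt E m" s])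
        fix i j assume "i + j = s"
        then have s: "s = i + j" by simp
        let ?e3 = "TenA C (TenA C (iota A B i j) (Ide C (cpt D l))) (Ide C (cpt E m))"
        have e: "i + (j + l) = i + j + l" "i + (j + l + m) = i + j + l + m" "j + (l + m) = j + l + m" "i + j + (l + m) = i + j + l + m"
          by simp_all
        have g: "gfun (gasc A B (D \<odot>\<^sub>o E)) (i + j + l + m) \<cdot> iota (A \<odot>\<^sub>o B) (D \<odot>\<^sub>o E) (i + j) (l + m) \<cdot> TenA C (iota A B i j) (iota D E l m)
          = iota A (B \<odot>\<^sub>o D \<odot>\<^sub>o E) i (j + l + m) \<cdot> TenA C (Ide C (cpt A i)) (iota B (D \<odot>\<^sub>o E) j (l + m) \<cdot> TenA C (Ide C (cpt B j)) (iota D E l m))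
            \<cdot> Asc C (cpt A i) (cpt B j) (TenO C (cpt D l) (cpt E m))"
          using assms gasc_iota_TenA[of A B "D \<odot>\<^sub>o E" "i + j + l + m" "i + j" "l + m" i j "A \<odot>\<^sub>o B" "Ide C (TenO C (cpt A i) (cpt B j))" "iota D E l m"]
          by (simp add: Asc_TenA_Ide e del: TenA_Ide)
        have "?u \<cdot> ?e1 \<cdot> ?e2 \<cdot> ?e3 = (gfun (gasc A B (D \<odot>\<^sub>o E)) (i + j + l + m) \<cdot> iota (A \<odot>\<^sub>o B) (D \<odot>\<^sub>o E) (i + j) (l + m) \<cdot> TenA C (iota A B i j) (iota D E l m))
            \<cdot> Asc C (TenO C (cpt A i) (cpt B j)) (cpt D l) (cpt E m)"
          using assms by (simp add: t r s gasc_iota_TenA Asc_TenA e)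
        also have "\<dots> = iota A (B \<odot>\<^sub>o D \<odot>\<^sub>o E) i (j + l + m) \<cdot> TenA C (Ide C (cpt A i)) (iota B (D \<odot>\<^sub>o E) j (l + m) \<cdot> TenA C (Ide C (cpt B j)) (iota D E l m))
            \<cdot> Asc C (cpt A i) (cpt B j) (TenO C (cpt D l) (cpt E m)) \<cdot> Asc C (TenO C (cpt A i) (cpt B j)) (cpt D l) (cpt E m)"
          using assms unfolding g by (simp add: e)
        also have "\<dots> = ?v \<cdot> ?e1 \<cdot> ?e2 \<cdot> ?e3"
        proof -
          let ?w = "TenA C (Ide C (cpt A i)) (gfun (gasc B D E) (j + l + m) \<cdot> iota (B \<odot>\<^sub>o D) E (j + l) m)"
          have "?v \<cdot> ?e1 \<cdot> ?e2 \<cdot> ?e3 = iota A (B \<odot>\<^sub>o D \<odot>\<^sub>o E) i (j + l + m) \<cdot> ?w \<cdot> Asc C (cpt A i) (cpt (B \<odot>\<^sub>o D) (j + l)) (cpt E m)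
              \<cdot> TenA C (TenA C (Ide C (cpt A i)) (iota B D j l) \<cdot> Asc C (cpt A i) (cpt B j) (cpt D l)) (Ide C (cpt E m))"
            using assms by (simp add: t r s gtenm_iota gtenm_iota_Cmp gasc_iota gasc_iota_TenA e)
          also have "TenA C (TenA C (Ide C (cpt A i)) (iota B D j l) \<cdot> Asc C (cpt A i) (cpt B j) (cpt D l)) (Ide C (cpt E m))
            = TenA C (TenA C (Ide C (cpt A i)) (iota B D j l)) (Ide C (cpt E m)) \<cdot> TenA C (Asc C (cpt A i) (cpt B j) (cpt D l)) (Ide C (cpt E m))"
            using assms by simp
          also have "Asc C (cpt A i) (cpt (B \<odot>\<^sub>o D) (j + l)) (cpt E m) \<cdot> \<dots>
            = TenA C (Ide C (cpt A i)) (TenA C (iota B D j l) (Ide C (cpt E m))) \<cdot> Asc C (cpt A i) (TenO C (cpt B j) (cpt D l)) (cpt E m)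
              \<cdot> TenA C (Asc C (cpt A i) (cpt B j) (cpt D l)) (Ide C (cpt E m))"
            using assms by (subst Asc_TenA_Cmp) auto
          also have "?w \<cdot> \<dots> = TenA C (Ide C (cpt A i)) (iota B (D \<odot>\<^sub>o E) j (l + m) \<cdot> TenA C (Ide C (cpt B j)) (iota D E l m))
            \<cdot> Asc C (cpt A i) (cpt B j) (TenO C (cpt D l) (cpt E m)) \<cdot> Asc C (TenO C (cpt A i) (cpt B j)) (cpt D l) (cpt E m)"
            using assms by (simp add: gasc_iota e pentagon)
          finally show ?thesis by simp
        qed
        finally show "((?u \<cdot> ?e1) \<cdot> ?e2) \<cdot> ?e3 = ((?v \<cdot> ?e1) \<cdot> ?e2) \<cdot> ?e3"
          using assms by (simp add: t r s e)
      qed (use assms t r in \<open>auto simp: ac_simps\<close>)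
    qed (use assms t in \<open>auto simp: ac_simps\<close>)
  qed (use assms in \<open>auto simp: ac_simps\<close>)
qed (use assms in auto)

section \<open>Tensor powers and iterated comultiplications\<close>

lemma gpow_Suc [simp]: "k > 0 \<Longrightarrow> gpow A (Suc k) = A \<odot>\<^sub>o gpow A k"
  by (cases k) auto

lemma gpow_graded [simp]: "graded_object A \<Longrightarrow> graded_object (gpow A k)"
proof (induction k)
  case (Suc k)
  then show ?case by (cases "k = 0") auto
qed simp

lemma mpow_Suc: "k > 0 \<Longrightarrow> mpow f (Suc k) = f \<odot> mpow f k"
  by (cases k) auto

lemma mpow_typing [simp]:
  "gsrc (mpow f k) = gpow (gsrc f) k" "gtgt (mpow f k) = gpow (gtgt f) k"
  "k > 0 \<Longrightarrow> gdeg (mpow f k) = int k * gdeg f" "gm f \<Longrightarrow> gm (mpow f k)"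
  by (induction f k rule: mpow.induct) (auto simp: algebra_simps)

text \<open>One of the two maps has degree 0, so the interchange with the remaining factors costs no
  sign. Both variants occur when a strict morphism is moved past powers of
  \<open>sdown\<close>.\<close>

lemma mpow_gcomp:
  assumes "gm f" "gm g" "gsrc g = gtgt f" "gdeg f = 0"
  shows "mpow g k \<star> mpow f k = mpow (g \<star> f) k"
proof (induction k)
  case (Suc k)
  then show ?case using assms by (cases "k = 0") (auto simp: mpow_Suc gtenm_gcomp)
qed simp

lemma mpow_gcomp_left:
  assumes "gm f" "gm g" "gsrc g = gtgt f" "gdeg g = 0"
  shows "mpow g k \<star> mpow f k = mpow (g \<star> f) k"
proof (induction k)
  case (Suc k)
  then show ?case using assms by (cases "k = 0") (auto simp: mpow_Suc gtenm_gcomp)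
qed simp

lemma can_Suc: "a > 0 \<Longrightarrow> can A (Suc a) b = (gid A \<odot> can A a b) \<star> gasc A (gpow A a) (gpow A b)"
  by (cases a) auto

lemma can_typing [simp]:
  assumes "a > 0" "b > 0"
  shows "gsrc (can A a b) = gpow A a \<odot>\<^sub>o gpow A b" "gtgt (can A a b) = gpow A (a + b)" "gdeg (can A a b) = 0"
    "graded_object A \<Longrightarrow> gm (can A a b)"
  using assms by (induction a rule: nat_induct_non_zero) (auto simp: can_Suc)

text \<open>Coherence of the rebracketing maps, by induction on the first exponent: naturality moves
  \<open>can A b c\<close> past one associator, and the pentagon rewrites the two remaining ones so
  that the induction hypothesis applies inside a tensor product with \<open>gid A\<close>.\<close>

lemma can_assoc:
  assumes A: "graded_object A" and "a > 0" "b > 0" "c > 0"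
  shows "can A a (b + c) \<star> (gid (gpow A a) \<odot> can A b c) \<star> gasc (gpow A a) (gpow A b) (gpow A c)
    = can A (a + b) c \<star> (can A a b \<odot> gid (gpow A c))"
  using assms(2)
proof (induction a rule: nat_induct_non_zero)
  case 1
  then show ?case using assms by (simp add: can_Suc)
next
  case (Suc a)
  let ?A = "gpow A a" and ?B = "gpow A b" and ?D = "gpow A c"
  have "can A (Suc a) (b + c) \<star> (gid (gpow A (Suc a)) \<odot> can A b c) \<star> gasc (gpow A (Suc a)) ?B ?D
    = (gid A \<odot> can A a (b + c)) \<star> (gasc A ?A (gpow A (b + c)) \<star> ((gid A \<odot> gid ?A) \<odot> can A b c)) \<star> gasc (A \<odot>\<^sub>o ?A) ?B ?D"
    using Suc assms by (simp add: can_Suc)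
  also have "gasc A ?A (gpow A (b + c)) \<star> ((gid A \<odot> gid ?A) \<odot> can A b c)
      = (gid A \<odot> (gid ?A \<odot> can A b c)) \<star> gasc A ?A (?B \<odot>\<^sub>o ?D)"
    using Suc assms by (subst gtenm_gasc) auto
  also have "(gid A \<odot> can A a (b + c)) \<star> ((gid A \<odot> (gid ?A \<odot> can A b c)) \<star> gasc A ?A (?B \<odot>\<^sub>o ?D)) \<star> gasc (A \<odot>\<^sub>o ?A) ?B ?D
    = (gid A \<odot> can A a (b + c)) \<star> (gid A \<odot> (gid ?A \<odot> can A b c)) \<star> (gasc A ?A (?B \<odot>\<^sub>o ?D) \<star> gasc (A \<odot>\<^sub>o ?A) ?B ?D)"
    using Suc assms by simp
  also have "gasc A ?A (?B \<odot>\<^sub>o ?D) \<star> gasc (A \<odot>\<^sub>o ?A) ?B ?D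
    = (gid A \<odot> gasc ?A ?B ?D) \<star> gasc A (?A \<odot>\<^sub>o ?B) ?D \<star> (gasc A ?A ?B \<odot> gid ?D)"
    using A by (intro graded_pentagon) auto
  also have "(gid A \<odot> can A a (b + c)) \<star> (gid A \<odot> (gid ?A \<odot> can A b c)) \<star> \<dots>
      = ((gid A \<odot> can A a (b + c)) \<star> (gid A \<odot> (gid ?A \<odot> can A b c)) \<star> (gid A \<odot> gasc ?A ?B ?D)) \<star> gasc A (?A \<odot>\<^sub>o ?B) ?D \<star> (gasc A ?A ?B \<odot> gid ?D)"
    using Suc assms by simp
  also have "(gid A \<odot> can A a (b + c)) \<star> (gid A \<odot> (gid ?A \<odot> can A b c)) \<star> (gid A \<odot> gasc ?A ?B ?D)
      = gid A \<odot> (can A (a + b) c \<star> (can A a b \<odot> gid ?D))"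
    using Suc assms by (simp add: gtenm_gcomp flip: Suc.IH)
  also have "\<dots> = (gid A \<odot> can A (a + b) c) \<star> (gid A \<odot> (can A a b \<odot> gid ?D))"
    using Suc assms by (simp add: gtenm_gcomp)
  also have "\<dots> \<star> gasc A (?A \<odot>\<^sub>o ?B) ?D \<star> (gasc A ?A ?B \<odot> gid ?D)
      = (gid A \<odot> can A (a + b) c) \<star> ((gid A \<odot> (can A a b \<odot> gid ?D)) \<star> gasc A (?A \<odot>\<^sub>o ?B) ?D) \<star> (gasc A ?A ?B \<odot> gid ?D)"
    using Suc assms by simp
  also have "(gid A \<odot> (can A a b \<odot> gid ?D)) \<star> gasc A (?A \<odot>\<^sub>o ?B) ?D = gasc A (gpow A (a + b)) ?D \<star> ((gid A \<odot> can A a b) \<odot> gid ?D)"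
    using Suc assms by (subst gtenm_gasc) auto
  also have "(gid A \<odot> can A (a + b) c) \<star> \<dots> \<star> (gasc A ?A ?B \<odot> gid ?D) = can A (Suc a + b) c \<star> (can A (Suc a) b \<odot> gid (gpow A c))"
    using Suc assms by (simp add: gtenm_gcomp can_Suc)
  finally show ?case .
qed

text \<open>Rebracketing keeps the order of the factors, so there is no sign even for f of odd
  degree. It is applied to \<open>sdown\<close>, of degree -1.\<close>

lemma can_mpow:
  assumes "gm f" "a > 0" "b > 0" "A = gsrc f" "B = gtgt f"
  shows "mpow f (a + b) \<star> can A a b = can B a b \<star> (mpow f a \<odot> mpow f b)"
  using assms(2)
proof (induction a rule: nat_induct_non_zero)
  case 1
  then show ?case using assms by (simp add: mpow_Suc)
next
  case (Suc a)
  have "mpow f (Suc a + b) \<star> can A (Suc a) b = (f \<odot> (mpow f (a + b) \<star> can A a b)) \<star> gasc A (gpow A a) (gpow A b)"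
    using Suc assms by (simp add: mpow_Suc can_Suc gtenm_gcomp flip: gcomp_assoc)
  also have "f \<odot> (mpow f (a + b) \<star> can A a b) = (gid B \<odot> can B a b) \<star> (f \<odot> (mpow f a \<odot> mpow f b))"
    using Suc assms by (simp add: gtenm_gcomp)
  also have "\<dots> \<star> gasc A (gpow A a) (gpow A b) = (gid B \<odot> can B a b) \<star> ((f \<odot> (mpow f a \<odot> mpow f b)) \<star> gasc A (gpow A a) (gpow A b))"
    using Suc assms by simp
  also have "(f \<odot> (mpow f a \<odot> mpow f b)) \<star> gasc A (gpow A a) (gpow A b) = gasc B (gpow B a) (gpow B b) \<star> ((f \<odot> mpow f a) \<odot> mpow f b)"
    using Suc assms by (subst gtenm_gasc) auto
  finally show ?case
    using Suc assms by (simp add: mpow_Suc can_Suc)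
qed

lemma mtens_Cons:
  "rs \<noteq> [] \<Longrightarrow> mtens A ((k, f) # rs) = can A k (sum_list (map fst rs)) \<star> (f \<odot> mtens A rs)"
  by (cases rs) auto

text \<open>Well-typed input for \<open>mtens\<close> and \<open>stens\<close>. The common source B
  is a separate parameter: it is an ordinary graded object for lists of maps and
  \<open>sgr n A\<close> for lists of n-simplices.\<close>

definition factors :: "'a graded \<Rightarrow> 'a graded \<Rightarrow> (nat \<times> ('a, 'b) gmap) list \<Rightarrow> bool" where
  "factors B A rs \<longleftrightarrow> rs \<noteq> [] \<and> (\<forall>(k, f)\<in>set rs. k > 0 \<and> gmor f B (gpow A k) 0)"

lemma factors_single [simp]:
  "factors B A [(k, f)] \<longleftrightarrow> k > 0 \<and> gmor f B (gpow A k) 0"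
  by (auto simp: factors_def)

lemma factors_Cons [simp]: "rs \<noteq> [] \<Longrightarrow>
  factors B A ((k, f) # rs) \<longleftrightarrow> k > 0 \<and> gmor f B (gpow A k) 0 \<and> factors B A rs"
  by (auto simp: factors_def)

lemma factors_nonempty: "factors B A rs \<Longrightarrow> rs \<noteq> []" and factors_sum_pos: "factors B A rs \<Longrightarrow> sum_list (map fst rs) > 0"
  by (auto simp: factors_def neq_Nil_conv)

lemma mtens_typing:
  assumes "factors B A rs" "graded_object A"
  shows "gsrc (mtens A rs) = gpow B (length rs) \<and> gtgt (mtens A rs) = gpow A (sum_list (map fst rs)) \<and>
    gdeg (mtens A rs) = 0 \<and> gm (mtens A rs)"
proof -
  have "rs \<noteq> []" using assms by (auto simp: factors_def)
  then show ?thesis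
    using assms
  proof (induction rs rule: list_nonempty_induct)
    case (single x)
    then show ?case by (cases x) auto
  next
    case (cons x xs)
    obtain k f where x: "x = (k, f)" by force
    have "sum_list (map fst xs) > 0" "k > 0"
      using cons x by (auto intro: factors_sum_pos)
    then show ?case using cons by (simp add: mtens_Cons x)
  qed
qed

lemma mpow_mtens:
  assumes "factors B A rs" "gm g" "gsrc g = A" "gdeg g = 0"
  shows "mpow g (sum_list (map fst rs)) \<star> mtens A rs = mtens (gtgt g) (map (\<lambda>(k, f). (k, mpow g k \<star> f)) rs)"
proof -
  have "rs \<noteq> []" using assms by (auto simp: factors_def)
  then show ?thesis
    using assms
  proof (induction rs rule: list_nonempty_induct)
    case (single x)
    then show ?case by (cases x) auto
  next
    case (cons x xs)
    obtain k f where x: "x = (k, f)" by force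
    have p: "sum_list (map fst xs) > 0" "k > 0"
      using cons x by (auto intro: factors_sum_pos)
    have A: "graded_object A" using cons by (auto dest: gm_graded)
    have "mpow g (sum_list (map fst (x # xs))) \<star> mtens A (x # xs)
      = (mpow g (k + sum_list (map fst xs)) \<star> can A k (sum_list (map fst xs))) \<star> (f \<odot> mtens A xs)"
      using cons p mtens_typing[of B A xs] A by (simp add: x mtens_Cons)
    also have "\<dots> = (can (gtgt g) k (sum_list (map fst xs)) \<star> (mpow g k \<odot> mpow g (sum_list (map fst xs)))) \<star> (f \<odot> mtens A xs)"
      using cons p by (subst can_mpow) auto
    also have "\<dots> = can (gtgt g) k (sum_list (map fst xs)) \<star> ((mpow g k \<star> f) \<odot> (mpow g (sum_list (map fst xs)) \<star> mtens A xs))"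
      using cons p mtens_typing[of B A xs] A by (simp add: x gtenm_gcomp)
    finally show ?case
      using cons p by (simp add: x mtens_Cons comp_def case_prod_unfold)
  qed
qed

text \<open>\<open>comap\<close> parametrized by block sizes rather than by the values of the
  monotone map, which is the form suited to recursion over the blocks.\<close>

definition cmuls :: "('a, 'b) coalgebra \<Rightarrow> nat list \<Rightarrow> ('a, 'b) gmap" where
  "cmuls X ks = mtens (gr (cx X)) (map (\<lambda>k. (k, icmul X k)) ks)"

definition dgc :: "('a, 'b) coalgebra \<Rightarrow> bool" where
  "dgc X \<longleftrightarrow> graded_object (gr (cx X)) \<and> cmul X \<in> ghom (gr (cx X)) (gr (cx X) \<odot>\<^sub>o gr (cx X)) 0 \<and>
     (let A = gr (cx X) in gasc A A A \<star> (cmul X \<odot> gid A) \<star> cmul X = (gid A \<odot> cmul X) \<star> cmul X)"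

lemma dg_coalgebra_dgc: "dg_coalgebra X \<Longrightarrow> dgc X"
  unfolding dg_coalgebra_def dgc_def nonneg_complex_def complex_def chain_map_def cten_def by simp

context
  fixes X assumes X: "dgc X"
begin

lemma dgc_graded [simp]: "graded_object (gr (cx X))"
  using X by (simp add: dgc_def)

lemma cmul_typing [simp]:
  "gsrc (cmul X) = gr (cx X)" "gtgt (cmul X) = gr (cx X) \<odot>\<^sub>o gr (cx X)" "gdeg (cmul X) = 0" "gm (cmul X)"
  using X ghom_gm[of "cmul X" "gr (cx X)" "gr (cx X) \<odot>\<^sub>o gr (cx X)" 0] unfolding dgc_def by (auto dest: ghom_simps)

lemma cmul_coassoc:
  "gasc (gr (cx X)) (gr (cx X)) (gr (cx X)) \<star> (cmul X \<odot> gid (gr (cx X))) \<star> cmul X = (gid (gr (cx X)) \<odot> cmul X) \<star> cmul X"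
  using X by (simp add: dgc_def Let_def)

lemma icmul_Suc: "k > 0 \<Longrightarrow> icmul X (Suc k) = (gid (gr (cx X)) \<odot> icmul X k) \<star> cmul X"
  by (cases k) auto

lemma icmul_typing [simp]:
  assumes "k > 0"
  shows "gsrc (icmul X k) = gr (cx X)" "gtgt (icmul X k) = gpow (gr (cx X)) k" "gdeg (icmul X k) = 0" "gm (icmul X k)"
  using assms by (induction k rule: nat_induct_non_zero) (auto simp: icmul_Suc)

text \<open>Generalized coassociativity. Since \<open>icmul\<close> keeps splitting the rightmost
  factor, the induction on a has to convert \<open>cmul X \<odot> gid\<close> into
  \<open>gid \<odot> cmul X\<close>; naturality of the associator isolates the one instance of
  coassociativity that does this.\<close>

lemma icmul_add:
  assumes "a > 0" "b > 0"
  shows "can (gr (cx X)) a b \<star> (icmul X a \<odot> icmul X b) \<star> cmul X = icmul X (a + b)"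
  using assms(1)
proof (induction a rule: nat_induct_non_zero)
  case 1
  then show ?case using assms by (simp add: icmul_Suc)
next
  case (Suc a)
  let ?A = "gr (cx X)"
  have "can ?A (Suc a) b \<star> (icmul X (Suc a) \<odot> icmul X b) \<star> cmul X
    = (gid ?A \<odot> can ?A a b) \<star> (gasc ?A (gpow ?A a) (gpow ?A b) \<star> ((gid ?A \<odot> icmul X a) \<odot> icmul X b)) \<star> (cmul X \<odot> gid ?A) \<star> cmul X"
  proof -
    have "((gid ?A \<odot> icmul X a) \<star> cmul X) \<odot> icmul X b = ((gid ?A \<odot> icmul X a) \<odot> icmul X b) \<star> (cmul X \<odot> gid ?A)"
      using Suc assms by (simp add: gtenm_gcomp)
    then show ?thesis using Suc assms by (simp add: can_Suc icmul_Suc)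
  qed
  also have "gasc ?A (gpow ?A a) (gpow ?A b) \<star> ((gid ?A \<odot> icmul X a) \<odot> icmul X b)
    = (gid ?A \<odot> (icmul X a \<odot> icmul X b)) \<star> gasc ?A ?A ?A"
    using Suc assms by (subst gtenm_gasc) auto
  also have "(gid ?A \<odot> can ?A a b) \<star> \<dots> \<star> (cmul X \<odot> gid ?A) \<star> cmul X
    = (gid ?A \<odot> can ?A a b) \<star> (gid ?A \<odot> (icmul X a \<odot> icmul X b)) \<star> (gasc ?A ?A ?A \<star> (cmul X \<odot> gid ?A) \<star> cmul X)"
    using Suc assms by simp
  also have "gasc ?A ?A ?A \<star> (cmul X \<odot> gid ?A) \<star> cmul X = (gid ?A \<odot> cmul X) \<star> cmul X"
    by (rule cmul_coassoc)
  also have "(gid ?A \<odot> can ?A a b) \<star> (gid ?A \<odot> (icmul X a \<odot> icmul X b)) \<star> (gid ?A \<odot> cmul X) \<star> cmul X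
    = (gid ?A \<odot> (can ?A a b \<star> (icmul X a \<odot> icmul X b) \<star> cmul X)) \<star> cmul X"
    using Suc assms by (simp add: gtenm_gcomp flip: gcomp_assoc)
  finally show ?case using Suc assms by (simp add: icmul_Suc)
qed

lemma cmuls_factors:
  "ks \<noteq> [] \<Longrightarrow> \<forall>k\<in>set ks. k > 0 \<Longrightarrow> factors (gr (cx X)) (gr (cx X)) (map (\<lambda>k. (k, icmul X k)) ks)"
  by (auto simp: factors_def)

lemma cmuls_typing [simp]:
  assumes "ks \<noteq> []" "\<forall>k\<in>set ks. k > 0"
  shows "gsrc (cmuls X ks) = gpow (gr (cx X)) (length ks)" "gtgt (cmuls X ks) = gpow (gr (cx X)) (sum_list ks)"
    "gdeg (cmuls X ks) = 0" "gm (cmuls X ks)"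
  using mtens_typing[OF cmuls_factors[OF assms]] by (auto simp: cmuls_def comp_def)

lemma cmuls_single [simp]: "cmuls X [k] = icmul X k"
  by (simp add: cmuls_def)

lemma cmuls_Cons:
  "ks \<noteq> [] \<Longrightarrow> cmuls X (k # ks) = can (gr (cx X)) k (sum_list ks) \<star> (icmul X k \<odot> cmuls X ks)"
  by (simp add: cmuls_def mtens_Cons comp_def)

text \<open>Functoriality of the tensor powers of X along [1] -> [j] -> [k]. The induction
  hypothesis collects all blocks but the first, and \<open>icmul_add\<close> joins the two
  halves.\<close>

lemma cmuls_icmul:
  assumes "ks \<noteq> []" "\<forall>k\<in>set ks. k > 0"
  shows "cmuls X ks \<star> icmul X (length ks) = icmul X (sum_list ks)"
  using assms
proof (induction ks rule: list_nonempty_induct)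
  case (single k)
  then show ?case by simp
next
  case (cons k ks)
  let ?A = "gr (cx X)"
  have pos: "sum_list ks > 0" using cons by (cases ks) auto
  have "cmuls X (k # ks) \<star> icmul X (length (k # ks))
      = can ?A k (sum_list ks) \<star> ((icmul X k \<odot> cmuls X ks) \<star> (gid ?A \<odot> icmul X (length ks))) \<star> cmul X"
    using cons pos by (simp add: cmuls_Cons icmul_Suc)
  also have "(icmul X k \<odot> cmuls X ks) \<star> (gid ?A \<odot> icmul X (length ks)) = icmul X k \<odot> icmul X (sum_list ks)"
    using cons pos by (simp add: gtenm_gcomp)
  finally show ?case
    using cons pos icmul_add[of k "sum_list ks"] by simp
qed

lemma cmuls_ones: "k > 0 \<Longrightarrow> cmuls X (replicate k 1) = gid (gpow (gr (cx X)) k)"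
proof (induction k rule: nat_induct_non_zero)
  case (Suc k)
  then show ?case by (simp add: cmuls_Cons sum_list_replicate)
qed (simp add: cmuls_def)

end

lemma icmul_nat:
  assumes "dgc X" "dgc Y" "gm f" "gsrc f = gr (cx X)" "gtgt f = gr (cx Y)" "gdeg f = 0"
    and "(f \<odot> f) \<star> cmul X = cmul Y \<star> f" "k > 0"
  shows "mpow f k \<star> icmul X k = icmul Y k \<star> f"
  using assms(8)
proof (induction k rule: nat_induct_non_zero)
  case 1
  then show ?case using assms by simp
next
  case (Suc k)
  have "mpow f (Suc k) \<star> icmul X (Suc k) = ((f \<odot> mpow f k) \<star> (gid (gr (cx X)) \<odot> icmul X k)) \<star> cmul X"
    using Suc assms by (simp add: mpow_Suc icmul_Suc)
  also have "(f \<odot> mpow f k) \<star> (gid (gr (cx X)) \<odot> icmul X k) = (gid (gr (cx Y)) \<odot> icmul Y k) \<star> (f \<odot> f)"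
    using Suc assms by (simp add: gtenm_gcomp)
  also have "\<dots> \<star> cmul X = (gid (gr (cx Y)) \<odot> icmul Y k) \<star> (f \<odot> f) \<star> cmul X"
    using Suc assms by simp
  also have "(f \<odot> f) \<star> cmul X = cmul Y \<star> f" by fact
  finally show ?case
    using Suc assms by (simp add: icmul_Suc)
qed

lemma cmuls_nat:
  assumes "dgc X" "dgc Y" "gm f" "gsrc f = gr (cx X)" "gtgt f = gr (cx Y)" "gdeg f = 0"
    and "(f \<odot> f) \<star> cmul X = cmul Y \<star> f" "ks \<noteq> []" "\<forall>k\<in>set ks. k > 0"
  shows "mpow f (sum_list ks) \<star> cmuls X ks = cmuls Y ks \<star> mpow f (length ks)"
  using assms(8,9)
proof (induction ks rule: list_nonempty_induct)
  case (single k)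
  then show ?case using assms icmul_nat[of X Y f k] by simp
next
  case (cons k ks)
  have pos: "sum_list ks > 0" using cons by (cases ks) auto
  have "mpow f (sum_list (k # ks)) \<star> cmuls X (k # ks)
    = (mpow f (k + sum_list ks) \<star> can (gr (cx X)) k (sum_list ks)) \<star> (icmul X k \<odot> cmuls X ks)"
    using cons pos assms by (simp add: cmuls_Cons)
  also have "\<dots> = can (gr (cx Y)) k (sum_list ks) \<star> (mpow f k \<odot> mpow f (sum_list ks)) \<star> (icmul X k \<odot> cmuls X ks)"
    using cons pos assms by (simp add: can_mpow)
  also have "(mpow f k \<odot> mpow f (sum_list ks)) \<star> (icmul X k \<odot> cmuls X ks) = (icmul Y k \<odot> cmuls Y ks) \<star> (f \<odot> mpow f (length ks))"
    using cons pos assms icmul_nat[of X Y f k] by (simp add: gtenm_gcomp)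
  finally show ?case
    using cons pos assms by (simp add: cmuls_Cons mpow_Suc)
qed

end

section \<open>Simplices of graded maps\<close>

lemma splx_finite [simp]: "\<sigma> \<in> splx n \<Longrightarrow> finite \<sigma>" "finite (splx n)"
  by (auto simp: splx_def intro: finite_subset)

lemma splx_singleton [simp]: "{v} \<in> splx n \<longleftrightarrow> v \<le> n"
  and splx_top [simp]: "{0..n} \<in> splx n"
  by (auto simp: splx_def)

lemma splx_nonempty: "\<sigma> \<in> splx n \<Longrightarrow> \<sigma> \<noteq> {}"
  by (auto simp: splx_def)

lemma sdim_nonneg: "\<sigma> \<in> splx n \<Longrightarrow> sdim \<sigma> \<ge> 0"
  using card_gt_0_iff[of \<sigma>] by (auto simp: sdim_def dest: splx_nonempty)

lemma sdim_top [simp]: "sdim {0..n} = int n" and sdim_singleton [simp]: "sdim {v} = 0"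
  by (simp_all add: sdim_def)

lemma splx_front_back [simp]:
  assumes "\<sigma> \<in> splx n" "v \<in> \<sigma>"
  shows "{u \<in> \<sigma>. u \<le> v} \<in> splx n" "{u \<in> \<sigma>. v \<le> u} \<in> splx n"
  using assms by (auto simp: splx_def)

lemma sdim_front_back:
  assumes "finite \<sigma>" "v \<in> \<sigma>"
  shows "sdim {u \<in> \<sigma>. u \<le> v} + sdim {u \<in> \<sigma>. v \<le> u} = sdim \<sigma>"
proof -
  have "card {u \<in> \<sigma>. u \<le> v} + card {u \<in> \<sigma>. v \<le> u} = card ({u \<in> \<sigma>. u \<le> v} \<union> {u \<in> \<sigma>. v \<le> u}) + card ({u \<in> \<sigma>. u \<le> v} \<inter> {u \<in> \<sigma>. v \<le> u})"
    using assms by (intro card_Un_Int) auto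
  moreover have "{u \<in> \<sigma>. u \<le> v} \<union> {u \<in> \<sigma>. v \<le> u} = \<sigma>" "{u \<in> \<sigma>. u \<le> v} \<inter> {u \<in> \<sigma>. v \<le> u} = {v}"
    using assms by auto
  ultimately show ?thesis by (simp add: sdim_def)
qed

lemma mono_maps_nth:
  assumes "\<theta> \<in> mono_maps m n"
  shows "i \<le> m \<Longrightarrow> \<theta> ! i \<le> n" "i \<le> j \<Longrightarrow> j \<le> m \<Longrightarrow> \<theta> ! i \<le> \<theta> ! j" "length \<theta> = m + 1"
  using assms by (auto simp: mono_maps_def sorted_nth_mono subset_iff)

lemma mono_maps_image [simp]:
  assumes "\<theta> \<in> mono_maps m n" "\<sigma> \<in> splx m"
  shows "nth \<theta> ` \<sigma> \<in> splx n"
  using assms mono_maps_nth(1)[OF assms(1)] by (auto simp: splx_def subset_iff)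

lemma sdim_image [simp]: "inj_on f \<sigma> \<Longrightarrow> sdim (f ` \<sigma>) = sdim \<sigma>"
  by (simp add: sdim_def card_image)

context abelian_tensor_category
begin

lemma sgr_cpt: "cpt (sgr n A) t = dobj (splx n) (\<lambda>\<sigma>. cpt A (t - sdim \<sigma>))"
  and sgr_low [simp]: "low (sgr n A) = low A"
  by (simp_all add: sgr_def)

text \<open>Simplices have nonnegative dimension, so below the lower bound of A every summand, and
  hence the identity of the direct sum, is zero.\<close>

lemma sgr_graded [simp]:
  assumes "graded_object A"
  shows "graded_object (sgr n A)"
  unfolding graded_object_def
proof (intro conjI allI impI)
  show *: "cpt (sgr n A) i \<in> Obj C" for i
    unfolding sgr_cpt using assms by (intro dobj_Obj) auto
  fix t assume t: "t < low (sgr n A)"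
  let ?A = "\<lambda>\<sigma>. cpt A (t - sdim \<sigma>)" and ?T = "cpt (sgr n A) t"
  have A: "finite (splx n)" "\<forall>\<sigma>\<in>splx n. ?A \<sigma> \<in> Obj C" using assms by auto
  have "dinc (splx n) ?A \<sigma> \<cdot> dpro (splx n) ?A \<sigma> = Nul C ?T ?T" if "\<sigma> \<in> splx n" for \<sigma>
  proof -
    have "zero_object (?A \<sigma>)" using that assms t sdim_nonneg[OF that] by simp
    then have "dpro (splx n) ?A \<sigma> = Nul C ?T (?A \<sigma>)"
      using to_zero_object[of "dpro (splx n) ?A \<sigma>"] that A by (simp add: sgr_cpt)
    then show ?thesis using that A * by (simp add: sgr_cpt)
  qed
  then have "hsum ?T ?T (\<lambda>\<sigma>. dinc (splx n) ?A \<sigma> \<cdot> dpro (splx n) ?A \<sigma>) (splx n) = Nul C ?T ?T"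
    using * by (intro hsum_Nul) auto
  then have "Ide C ?T = Nul C ?T ?T"
    using dinc_dpro_sum[OF A] by (simp add: sgr_cpt)
  with * show "zero_object ?T" by (simp add: zero_object_iff)
qed

lemma sinc_simps [simp]: "gsrc (sinc n A \<sigma>) = A" "gtgt (sinc n A \<sigma>) = sgr n A" "gdeg (sinc n A \<sigma>) = sdim \<sigma>"
  and spro_simps [simp]: "gsrc (spro n A \<sigma>) = sgr n A" "gtgt (spro n A \<sigma>) = A" "gdeg (spro n A \<sigma>) = - sdim \<sigma>"
  by (simp_all add: sinc_def spro_def)

lemma sinc_gm [simp]: "graded_object A \<Longrightarrow> \<sigma> \<in> splx n \<Longrightarrow> gm (sinc n A \<sigma>)"
  by (rule gmI) (auto simp: sinc_def sgr_cpt hom_iff)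

lemma spro_gm [simp]: "graded_object A \<Longrightarrow> \<sigma> \<in> splx n \<Longrightarrow> gm (spro n A \<sigma>)"
  by (rule gmI) (auto simp: spro_def sgr_cpt hom_iff)

lemma spro_sinc:
  assumes "graded_object A" "\<sigma> \<in> splx n" "\<tau> \<in> splx n"
  shows "spro n A \<tau> \<star> sinc n A \<sigma> = (if \<tau> = \<sigma> then gid A else gzero A A (sdim \<sigma> - sdim \<tau>))"
proof (rule gmap_eqI)
  fix i
  show "gfun (spro n A \<tau> \<star> sinc n A \<sigma>) i = gfun (if \<tau> = \<sigma> then gid A else gzero A A (sdim \<sigma> - sdim \<tau>)) i"
    using assms by (cases "\<tau> = \<sigma>") (auto simp: spro_def sinc_def dpro_dinc add_diff_eq)
qed auto

lemma sinc_spro_sum: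
  assumes "graded_object A"
  shows "gsum (sgr n A) (sgr n A) 0 (\<lambda>\<sigma>. sinc n A \<sigma> \<star> spro n A \<sigma>) (splx n) = gid (sgr n A)"
proof (rule gmap_eqI)
  fix t
  show "gfun (gsum (sgr n A) (sgr n A) 0 (\<lambda>\<sigma>. sinc n A \<sigma> \<star> spro n A \<sigma>) (splx n)) t = gfun (gid (sgr n A)) t"
    using dinc_dpro_sum[of "splx n" "\<lambda>\<sigma>. cpt A (t - sdim \<sigma>)"] assms by (simp add: sinc_def spro_def sgr_cpt)
qed auto

text \<open>The inclusions \<open>sinc\<close> are jointly epic because the composites of
  \<open>sinc\<close> and \<open>spro\<close> sum to the identity. Identities between simplices are
  thereby checked one face at a time.\<close>

lemma sgr_ext:
  assumes "gm \<phi>" "gm \<psi>" "gsrc \<phi> = sgr n A" "gsrc \<psi> = sgr n A" "gtgt \<psi> = gtgt \<phi>" "gdeg \<psi> = gdeg \<phi>" "graded_object A"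
    and "\<And>\<sigma>. \<sigma> \<in> splx n \<Longrightarrow> \<phi> \<star> sinc n A \<sigma> = \<psi> \<star> sinc n A \<sigma>"
  shows "\<phi> = \<psi>"
proof -
  have "\<phi> = \<phi> \<star> gsum (sgr n A) (sgr n A) 0 (\<lambda>\<sigma>. sinc n A \<sigma> \<star> spro n A \<sigma>) (splx n)"
    using assms by (simp add: sinc_spro_sum)
  also have "\<dots> = gsum (sgr n A) (gtgt \<phi>) (gdeg \<phi>) (\<lambda>\<sigma>. \<phi> \<star> sinc n A \<sigma> \<star> spro n A \<sigma>) (splx n)"
    using assms by (simp add: gcomp_gsum_left)
  also have "\<dots> = gsum (sgr n A) (gtgt \<phi>) (gdeg \<phi>) (\<lambda>\<sigma>. \<psi> \<star> sinc n A \<sigma> \<star> spro n A \<sigma>) (splx n)"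
  proof (rule gsum_cong)
    fix \<sigma> assume "\<sigma> \<in> splx n"
    then have "(\<phi> \<star> sinc n A \<sigma>) \<star> spro n A \<sigma> = (\<psi> \<star> sinc n A \<sigma>) \<star> spro n A \<sigma>"
      using assms(8) by simp
    then show "\<phi> \<star> sinc n A \<sigma> \<star> spro n A \<sigma> = \<psi> \<star> sinc n A \<sigma> \<star> spro n A \<sigma>"
      using assms(1-7) \<open>\<sigma> \<in> splx n\<close> by simp
  qed (use assms(1-7) in auto)
  also have "\<dots> = \<psi> \<star> gsum (sgr n A) (sgr n A) 0 (\<lambda>\<sigma>. sinc n A \<sigma> \<star> spro n A \<sigma>) (splx n)"
    using assms(1-7) by (simp add: gcomp_gsum_left)
  also have "\<dots> = \<psi>"
    using assms(1-7) by (simp add: sinc_spro_sum)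
  finally show ?thesis .
qed

text \<open>Orthogonality of \<open>spro\<close> and \<open>sinc\<close> leaves at most one term,
  the one whose simplex is \<sigma>. The constructions \<open>sobj\<close>, \<open>smap\<close>,
  \<open>sdegen\<close>, \<open>sglue\<close> and \<open>scx\<close> are all evaluated by
  it.\<close>

lemma gsum_spro_sinc:
  assumes "graded_object A" "graded_object B" "\<sigma> \<in> splx n" "finite I" "\<forall>x\<in>I. s x \<in> splx n" "inj_on s I"
    and "\<forall>x\<in>I. gmor (F x) A B (d + sdim (s x))"
  shows "gsum (sgr n A) B d (\<lambda>x. F x \<star> spro n A (s x)) I \<star> sinc n A \<sigma>
    = (if \<sigma> \<in> s ` I then F (the_inv_into I s \<sigma>) else gzero A B (d + sdim \<sigma>))"
proof -
  have "gsum (sgr n A) B d (\<lambda>x. F x \<star> spro n A (s x)) I \<star> sinc n A \<sigma>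
    = gsum A B (sdim \<sigma> + d) (\<lambda>x. (F x \<star> spro n A (s x)) \<star> sinc n A \<sigma>) I"
    using assms by (subst gcomp_gsum_right) auto
  also have "\<dots> = gsum A B (sdim \<sigma> + d) (\<lambda>x. F x \<star> (spro n A (s x) \<star> sinc n A \<sigma>)) I"
    using assms by (intro gsum_cong) auto
  also have "\<dots> = (if \<sigma> \<in> s ` I then F (the_inv_into I s \<sigma>) else gzero A B (d + sdim \<sigma>))"
  proof (cases "\<sigma> \<in> s ` I")
    case True
    then obtain x where x: "x \<in> I" "\<sigma> = s x" by auto
    then have [simp]: "the_inv_into I s (s x) = x" using assms by (simp add: the_inv_into_f_f)
    have "F y \<star> (spro n A (s y) \<star> sinc n A \<sigma>) = gzero A B (sdim \<sigma> + d)" if "y \<in> I" "y \<noteq> x" for y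
    proof -
      have "s y \<noteq> \<sigma>" using that x assms by (auto simp: inj_on_def)
      then show ?thesis using that x assms by (simp add: spro_sinc)
    qed
    then show ?thesis
      using True x assms by (subst gsum_delta[where j=x]) (auto simp: spro_sinc)
  next
    case False
    then have "F y \<star> (spro n A (s y) \<star> sinc n A \<sigma>) = gzero A B (sdim \<sigma> + d)" if "y \<in> I" for y
      using that assms False by (auto simp: spro_sinc)
    with False assms show ?thesis by (subst gsum_neutral) (auto simp: add.commute)
  qed
  finally show ?thesis .
qed

lemma sobj_simps [simp]: "gsrc (sobj m n A \<theta>) = sgr m A" "gtgt (sobj m n A \<theta>) = sgr n A" "gdeg (sobj m n A \<theta>) = 0"
  by (simp_all add: sobj_def)

lemma sobj_gm [simp]:
  assumes "graded_object A" "\<theta> \<in> mono_maps m n"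
  shows "gm (sobj m n A \<theta>)"
  unfolding sobj_def using assms by (intro gsum_gm) auto

lemma sobj_sinc:
  assumes "graded_object A" "\<theta> \<in> mono_maps m n" "\<sigma> \<in> splx m"
  shows "sobj m n A \<theta> \<star> sinc m A \<sigma>
    = (if inj_on (nth \<theta>) \<sigma> then sinc n A (nth \<theta> ` \<sigma>) else gzero A (sgr n A) (sdim \<sigma>))"
  using assms unfolding sobj_def
  by (subst gsum_spro_sinc[where s="\<lambda>\<sigma>. \<sigma>"]) (auto simp: the_inv_into_f_f[of "\<lambda>x. x", simplified])

lemma smap_simps [simp]: "gsrc (smap n f) = sgr n (gsrc f)" "gtgt (smap n f) = sgr n (gtgt f)" "gdeg (smap n f) = 0"
  by (simp_all add: smap_def)

lemma smap_gm [simp]: "gm f \<Longrightarrow> gdeg f = 0 \<Longrightarrow> gm (smap n f)"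
  unfolding smap_def by (intro gsum_gm) auto

lemma smap_sinc:
  assumes "gm f" "gdeg f = 0" "\<sigma> \<in> splx n" "A = gsrc f"
  shows "smap n f \<star> sinc n A \<sigma> = sinc n (gtgt f) \<sigma> \<star> f"
proof -
  have "smap n f = gsum (sgr n (gsrc f)) (sgr n (gtgt f)) 0
     (\<lambda>\<sigma>. (sinc n (gtgt f) \<sigma> \<star> f) \<star> spro n (gsrc f) \<sigma>) (splx n)"
    unfolding smap_def using assms by (intro gsum_cong) auto
  then show ?thesis
    using assms
    by (simp only:) (subst gsum_spro_sinc[where s="\<lambda>\<sigma>. \<sigma>"], auto simp: the_inv_into_f_f[of "\<lambda>x. x", simplified])
qed

lemma sdegen_simps [simp]: "gsrc (sdegen n f) = sgr n (gsrc f)" "gtgt (sdegen n f) = gtgt f" "gdeg (sdegen n f) = gdeg f"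
  by (simp_all add: sdegen_def)

lemma sdegen_gm [simp]: "gm f \<Longrightarrow> gm (sdegen n f)"
  unfolding sdegen_def by (intro gcomp_gm gsum_gm) auto

lemma sdegen_sinc:
  assumes "gm f" "gdeg f = 0" "\<sigma> \<in> splx n" "A = gsrc f"
  shows "sdegen n f \<star> sinc n A \<sigma> = (if card \<sigma> = 1 then f else gzero A (gtgt f) (sdim \<sigma>))"
proof -
  have "gsum (sgr n A) A 0 (\<lambda>v. spro n A {v}) {0..n}
    = gsum (sgr n A) A 0 (\<lambda>v. gid A \<star> spro n A {v}) {0..n}"
    using assms by (intro gsum_cong) auto
  then have "sdegen n f \<star> sinc n A \<sigma> = f \<star> (gsum (sgr n A) A 0 (\<lambda>v. gid A \<star> spro n A {v}) {0..n} \<star> sinc n A \<sigma>)"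
    using assms by (simp add: sdegen_def)
  also have "\<dots> = f \<star> (if \<sigma> \<in> (\<lambda>v. {v}) ` {0..n} then gid A else gzero A A (sdim \<sigma>))"
    using assms by (subst gsum_spro_sinc[where s="\<lambda>v. {v}"]) (auto simp: inj_on_def)
  also have "\<sigma> \<in> (\<lambda>v. {v}) ` {0..n} \<longleftrightarrow> card \<sigma> = 1"
    using assms(3) by (auto simp: card_1_singleton_iff)
  finally show ?thesis using assms by simp
qed

lemma sglue_simps [simp]: "gsrc (sglue n A B \<psi>) = sgr n A" "gtgt (sglue n A B \<psi>) = B" "gdeg (sglue n A B \<psi>) = 0"
  by (simp_all add: sglue_def)

context
  fixes n A B \<psi>
  assumes g: "graded_object A" "graded_object B"
    and \<psi>: "\<forall>\<sigma>\<in>splx n. gmor (\<psi> \<sigma>) A B (sdim \<sigma>)"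
begin

lemma sglue_gm: "gm (sglue n A B \<psi>)"
  unfolding sglue_def using g \<psi> by (intro gsum_gm) auto

lemma sglue_sinc: "\<sigma> \<in> splx n \<Longrightarrow> sglue n A B \<psi> \<star> sinc n A \<sigma> = \<psi> \<sigma>"
  unfolding sglue_def using g \<psi>
  by (subst gsum_spro_sinc[where s="\<lambda>\<sigma>. \<sigma>"]) (auto simp: the_inv_into_f_f[of "\<lambda>x. x", simplified])

end

section \<open>Tensor products of simplices along the Alexander-Whitney diagonal\<close>

lemma sten_simps [simp]: "gsrc (sten n A B \<phi> \<psi>) = sgr n (A \<odot>\<^sub>o B)" "gtgt (sten n A B \<phi> \<psi>) = gtgt \<phi> \<odot>\<^sub>o gtgt \<psi>"
  "gdeg (sten n A B \<phi> \<psi>) = 0"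
  by (simp_all add: sten_def)

context
  fixes n A B \<phi> \<psi>
  assumes ty: "gm \<phi>" "gm \<psi>" "gsrc \<phi> = sgr n A" "gsrc \<psi> = sgr n B" "gdeg \<phi> = 0" "gdeg \<psi> = 0"
    and g: "graded_object A" "graded_object B"
begin

lemma sten_aux: "\<forall>\<sigma>\<in>splx n. gm (gsum (A \<odot>\<^sub>o B) (gtgt \<phi> \<odot>\<^sub>o gtgt \<psi>) (sdim \<sigma>)
        (\<lambda>v. (\<phi> \<star> sinc n A {u \<in> \<sigma>. u \<le> v}) \<odot> (\<psi> \<star> sinc n B {u \<in> \<sigma>. v \<le> u})) \<sigma>)"
  using ty g by (auto simp: sdim_front_back)

lemma sten_gm [simp]: "gm (sten n A B \<phi> \<psi>)"
  unfolding sten_def by (rule sglue_gm) (use ty g sten_aux in auto)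

lemma sten_sinc:
  assumes "\<sigma> \<in> splx n" "T = A \<odot>\<^sub>o B"
  shows "sten n A B \<phi> \<psi> \<star> sinc n T \<sigma> = gsum (A \<odot>\<^sub>o B) (gtgt \<phi> \<odot>\<^sub>o gtgt \<psi>) (sdim \<sigma>)
        (\<lambda>v. (\<phi> \<star> sinc n A {u \<in> \<sigma>. u \<le> v}) \<odot> (\<psi> \<star> sinc n B {u \<in> \<sigma>. v \<le> u})) \<sigma>"
  unfolding sten_def assms(2) by (rule sglue_sinc) (use assms ty g sten_aux in auto)

text \<open>Naturality of the Alexander-Whitney diagonal in the simplex. If \<theta> is injective on
  \<sigma>, it carries front and back faces to front and back faces. Otherwise it identifies two
  neighbouring vertices of \<sigma>; wherever \<sigma> is split, both of them lie in a common part,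
  which is killed.\<close>

lemma sten_sobj:
  assumes \<theta>: "\<theta> \<in> mono_maps m n"
  shows "sten m A B (\<phi> \<star> sobj m n A \<theta>) (\<psi> \<star> sobj m n B \<theta>) = sten n A B \<phi> \<psi> \<star> sobj m n (A \<odot>\<^sub>o B) \<theta>"
proof (rule sgr_ext)
  fix \<sigma> assume \<sigma>: "\<sigma> \<in> splx m"
  let ?F = "\<lambda>v. (\<phi> \<star> (sobj m n A \<theta> \<star> sinc m A {u \<in> \<sigma>. u \<le> v})) \<odot> (\<psi> \<star> (sobj m n B \<theta> \<star> sinc m B {u \<in> \<sigma>. v \<le> u}))"
  let ?T = "gtgt \<phi> \<odot>\<^sub>o gtgt \<psi>"
  have F: "gmor (?F v) (A \<odot>\<^sub>o B) ?T (sdim \<sigma>)" if "v \<in> \<sigma>" for v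
    using that \<sigma> \<theta> ty g by (simp add: sdim_front_back)
  have "sten m A B (\<phi> \<star> sobj m n A \<theta>) (\<psi> \<star> sobj m n B \<theta>) \<star> sinc m (A \<odot>\<^sub>o B) \<sigma>
    = gsum (A \<odot>\<^sub>o B) ?T (sdim \<sigma>) (\<lambda>v. ((\<phi> \<star> sobj m n A \<theta>) \<star> sinc m A {u \<in> \<sigma>. u \<le> v}) \<odot> ((\<psi> \<star> sobj m n B \<theta>) \<star> sinc m B {u \<in> \<sigma>. v \<le> u})) \<sigma>"
    unfolding sten_def using \<sigma> \<theta> ty g
    by (subst sglue_sinc) (auto simp: sdim_front_back)
  also have "\<dots> = gsum (A \<odot>\<^sub>o B) ?T (sdim \<sigma>) ?F \<sigma>"
    by (rule gsum_cong) (use F \<sigma> \<theta> ty g in auto)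
  also have "\<dots> = sten n A B \<phi> \<psi> \<star> (sobj m n (A \<odot>\<^sub>o B) \<theta> \<star> sinc m (A \<odot>\<^sub>o B) \<sigma>)"
  proof (cases "inj_on (nth \<theta>) \<sigma>")
    case True
    let ?h = "nth \<theta>"
    have le: "?h u \<le> ?h v \<longleftrightarrow> u \<le> v" if "u \<in> \<sigma>" "v \<in> \<sigma>" for u v
    proof -
      have "u \<le> m" "v \<le> m" using that \<sigma> by (auto simp: splx_def)
      then show ?thesis
        using mono_maps_nth(2)[OF \<theta>, of u v] mono_maps_nth(2)[OF \<theta>, of v u] that True
        by (cases "u \<le> v") (auto simp: inj_on_def dest: le_antisym)
    qed
    have im: "?h ` {u \<in> \<sigma>. u \<le> v} = {u \<in> ?h ` \<sigma>. u \<le> ?h v}" "?h ` {u \<in> \<sigma>. v \<le> u} = {u \<in> ?h ` \<sigma>. ?h v \<le> u}" if "v \<in> \<sigma>" for v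
      using le that by auto
    let ?G = "\<lambda>v. (\<phi> \<star> sinc n A {u \<in> ?h ` \<sigma>. u \<le> v}) \<odot> (\<psi> \<star> sinc n B {u \<in> ?h ` \<sigma>. v \<le> u})"
    have G: "?F v = ?G (?h v)" if "v \<in> \<sigma>" for v
    proof -
      have "inj_on ?h {u \<in> \<sigma>. u \<le> v}" "inj_on ?h {u \<in> \<sigma>. v \<le> u}" using True by (auto simp: inj_on_def)
      then show ?thesis
        using that \<theta> ty g \<sigma> unfolding im[OF that, symmetric] by (simp add: sobj_sinc)
    qed
    have "gsum (A \<odot>\<^sub>o B) ?T (sdim \<sigma>) ?F \<sigma> = gsum (A \<odot>\<^sub>o B) ?T (sdim \<sigma>) (\<lambda>v. ?G (?h v)) \<sigma>"
      by (rule gsum_cong) (use F G ty g in auto)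
    also have "\<dots> = gsum (A \<odot>\<^sub>o B) ?T (sdim \<sigma>) ?G (?h ` \<sigma>)"
      by (rule gsum_reindex[symmetric]) (use F G ty g True in auto)
    also have "\<dots> = sten n A B \<phi> \<psi> \<star> sinc n (A \<odot>\<^sub>o B) (?h ` \<sigma>)"
      using \<sigma> \<theta> True by (subst sten_sinc) auto
    finally show ?thesis using \<sigma> \<theta> True g by (simp add: sobj_sinc)
  next
    case False
    have fin: "finite \<sigma>" using \<sigma> by simp
    have "\<exists>u u'. u \<in> \<sigma> \<and> u' \<in> \<sigma> \<and> u < u' \<and> \<theta> ! u = \<theta> ! u' \<and> (\<forall>v\<in>\<sigma>. v \<le> u \<or> u' \<le> v)"
    proof -
      obtain a b where ab: "a \<in> \<sigma>" "b \<in> \<sigma>" "a < b" "\<theta> ! a = \<theta> ! b"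
        using False unfolding inj_on_def by (metis linorder_neqE_nat)
      \<comment> \<open>The successor of a in \<sigma>; monotonicity of \<theta> squeezes its image
        between the equal images of a and b.\<close>
      let ?u' = "Min {v \<in> \<sigma>. a < v}"
      have S: "finite {v \<in> \<sigma>. a < v}" "{v \<in> \<sigma>. a < v} \<noteq> {}" using fin ab by auto
      then have u': "?u' \<in> \<sigma>" "a < ?u'" "?u' \<le> b" using Min_in[OF S] Min_le[of "{v \<in> \<sigma>. a < v}" b] ab by auto
      have "b \<le> m" using ab \<sigma> by (auto simp: splx_def)
      then have "\<theta> ! a \<le> \<theta> ! ?u'" "\<theta> ! ?u' \<le> \<theta> ! b"
        using mono_maps_nth(2)[OF \<theta>, of a ?u'] mono_maps_nth(2)[OF \<theta>, of ?u' b] u' by auto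
      moreover have "\<forall>v\<in>\<sigma>. v \<le> a \<or> ?u' \<le> v" using Min_le[OF S(1)] by force
      ultimately show ?thesis using ab u' by (intro exI[of _ a] exI[of _ ?u']) auto
    qed
    then obtain u u' where u: "u \<in> \<sigma>" "u' \<in> \<sigma>" "u < u'" "\<theta> ! u = \<theta> ! u'" "\<forall>v\<in>\<sigma>. v \<le> u \<or> u' \<le> v" by blast
    have "?F v = gzero (A \<odot>\<^sub>o B) ?T (sdim \<sigma>)" if "v \<in> \<sigma>" for v
    proof -
      have "\<not> inj_on (nth \<theta>) {w \<in> \<sigma>. v \<le> w} \<or> \<not> inj_on (nth \<theta>) {w \<in> \<sigma>. w \<le> v}"
      proof (cases "v \<le> u")
        case True
        then have "u \<in> {w \<in> \<sigma>. v \<le> w}" "u' \<in> {w \<in> \<sigma>. v \<le> w}" using u by auto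
        then show ?thesis using u unfolding inj_on_def by (metis less_irrefl)
      next
        case False
        then have "u \<in> {w \<in> \<sigma>. w \<le> v}" "u' \<in> {w \<in> \<sigma>. w \<le> v}" using u that by auto
        then show ?thesis using u unfolding inj_on_def by (metis less_irrefl)
      qed
      then show ?thesis using that \<theta> ty g \<sigma> by (auto simp: sobj_sinc sdim_front_back)
    qed
    then have "gsum (A \<odot>\<^sub>o B) ?T (sdim \<sigma>) ?F \<sigma> = gzero (A \<odot>\<^sub>o B) ?T (sdim \<sigma>)"
      using ty g by (intro gsum_neutral) auto
    then show ?thesis using False \<sigma> \<theta> ty g by (simp add: sobj_sinc)
  qed
  finally show "sten m A B (\<phi> \<star> sobj m n A \<theta>) (\<psi> \<star> sobj m n B \<theta>) \<star> sinc m (A \<odot>\<^sub>o B) \<sigma>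
    = (sten n A B \<phi> \<psi> \<star> sobj m n (A \<odot>\<^sub>o B) \<theta>) \<star> sinc m (A \<odot>\<^sub>o B) \<sigma>"
    using \<sigma> \<theta> ty g by simp
next
  show "gm (sten m A B (\<phi> \<star> sobj m n A \<theta>) (\<psi> \<star> sobj m n B \<theta>))"
    unfolding sten_def using \<theta> ty g by (intro sglue_gm) (auto simp: sdim_front_back)
qed (use \<theta> ty g in auto)

end

text \<open>Both parts of a split of \<sigma> have dimension 0 only if \<sigma> is a vertex.\<close>

lemma sten_sdegen:
  assumes "gm f" "gm g" "gdeg f = 0" "gdeg g = 0" "A = gsrc f" "B = gsrc g"
  shows "sten n A B (sdegen n f) (sdegen n g) = sdegen n (f \<odot> g)"
proof (rule sgr_ext)
  fix \<sigma> assume \<sigma>: "\<sigma> \<in> splx n"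
  let ?F = "\<lambda>v. (sdegen n f \<star> sinc n A {u \<in> \<sigma>. u \<le> v}) \<odot> (sdegen n g \<star> sinc n B {u \<in> \<sigma>. v \<le> u})"
  have eq: "sten n A B (sdegen n f) (sdegen n g) \<star> sinc n (A \<odot>\<^sub>o B) \<sigma>
    = gsum (A \<odot>\<^sub>o B) (gtgt f \<odot>\<^sub>o gtgt g) (sdim \<sigma>) ?F \<sigma>"
    using \<sigma> assms by (subst sten_sinc) auto
  show "sten n A B (sdegen n f) (sdegen n g) \<star> sinc n (A \<odot>\<^sub>o B) \<sigma> = sdegen n (f \<odot> g) \<star> sinc n (A \<odot>\<^sub>o B) \<sigma>"
  proof (cases "card \<sigma> = 1")
    case True
    then obtain v where v: "\<sigma> = {v}" "v \<le> n" using \<sigma> by (auto simp: card_1_singleton_iff)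
    then have "{u \<in> \<sigma>. u \<le> v} = {v}" "{u \<in> \<sigma>. v \<le> u} = {v}" by auto
    then show ?thesis
      using assms v eq by (simp add: sdegen_sinc)
  next
    case False
    have "?F v = gzero (A \<odot>\<^sub>o B) (gtgt f \<odot>\<^sub>o gtgt g) (sdim \<sigma>)" if "v \<in> \<sigma>" for v
    proof -
      have "card {u \<in> \<sigma>. u \<le> v} + card {u \<in> \<sigma>. v \<le> u} = card \<sigma> + 1"
        using sdim_front_back[of \<sigma> v] that \<sigma> by (simp add: sdim_def)
      then have "\<not> (card {u \<in> \<sigma>. u \<le> v} = 1 \<and> card {u \<in> \<sigma>. v \<le> u} = 1)"
        using False by auto
      moreover have "sdim {u \<in> \<sigma>. u \<le> v} + sdim {u \<in> \<sigma>. v \<le> u} = sdim \<sigma>"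
        using sdim_front_back[of \<sigma> v] that \<sigma> by simp
      ultimately show ?thesis
        using \<sigma> that assms by (auto simp: sdegen_sinc) (auto simp: sdim_def)
    qed
    then have "gsum (A \<odot>\<^sub>o B) (gtgt f \<odot>\<^sub>o gtgt g) (sdim \<sigma>) ?F \<sigma> = gzero (A \<odot>\<^sub>o B) (gtgt f \<odot>\<^sub>o gtgt g) (sdim \<sigma>)"
      using assms by (intro gsum_neutral) auto
    then show ?thesis
      using False \<sigma> assms eq by (simp add: sdegen_sinc)
  qed
qed (use assms in auto)

text \<open>The outer maps have degree 0 and are the same for every vertex at which \<sigma> is
  split, so they can be pulled out of the sum without signs.\<close>

lemma sten_map:
  assumes "gm \<phi>" "gm \<psi>" "gsrc \<phi> = sgr (n :: nat) (gtgt p)" "gsrc \<psi> = sgr n (gtgt p')" "gdeg \<phi> = 0" "gdeg \<psi> = 0"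
    and "gm f" "gm g" "gm p" "gm p'" "gdeg f = 0" "gdeg g = 0" "gdeg p = 0" "gdeg p' = 0"
      "gsrc f = gtgt \<phi>" "gsrc g = gtgt \<psi>" "A = gtgt p" "B = gtgt p'" "A' = gsrc p" "B' = gsrc p'"
  shows "sten n A' B' (f \<star> \<phi> \<star> smap n p) (g \<star> \<psi> \<star> smap n p') = (f \<odot> g) \<star> sten n A B \<phi> \<psi> \<star> smap n (p \<odot> p')"
proof (rule sgr_ext)
  fix \<sigma> assume \<sigma>: "\<sigma> \<in> splx n"
  let ?T = "gtgt f \<odot>\<^sub>o gtgt g"
  have g: "graded_object A" "graded_object B" "graded_object A'" "graded_object B'" using assms by auto
  let ?F = "\<lambda>v. (\<phi> \<star> sinc n A {u \<in> \<sigma>. u \<le> v}) \<odot> (\<psi> \<star> sinc n B {u \<in> \<sigma>. v \<le> u})"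
  have F: "\<forall>v\<in>\<sigma>. gmor (?F v) (A \<odot>\<^sub>o B) (gtgt \<phi> \<odot>\<^sub>o gtgt \<psi>) (sdim \<sigma>)"
    using assms \<sigma> by (auto simp: sdim_front_back)
  have "sten n A' B' (f \<star> \<phi> \<star> smap n p) (g \<star> \<psi> \<star> smap n p') \<star> sinc n (A' \<odot>\<^sub>o B') \<sigma>
    = gsum (A' \<odot>\<^sub>o B') ?T (sdim \<sigma>) (\<lambda>v. ((f \<star> \<phi> \<star> smap n p) \<star> sinc n A' {u \<in> \<sigma>. u \<le> v}) \<odot> ((g \<star> \<psi> \<star> smap n p') \<star> sinc n B' {u \<in> \<sigma>. v \<le> u})) \<sigma>"
    using \<sigma> assms by (subst sten_sinc) auto
  also have "\<dots> = gsum (A' \<odot>\<^sub>o B') ?T (sdim \<sigma>) (\<lambda>v. (f \<odot> g) \<star> ?F v \<star> (p \<odot> p')) \<sigma>"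
  proof (rule gsum_cong)
    fix v assume v: "v \<in> \<sigma>"
    then show "((f \<star> \<phi> \<star> smap n p) \<star> sinc n A' {u \<in> \<sigma>. u \<le> v}) \<odot> ((g \<star> \<psi> \<star> smap n p') \<star> sinc n B' {u \<in> \<sigma>. v \<le> u}) = (f \<odot> g) \<star> ?F v \<star> (p \<odot> p')"
      using \<sigma> assms by (simp add: smap_sinc gtenm_gcomp)
  qed (use assms \<sigma> F in auto)
  also have "\<dots> = (f \<odot> g) \<star> gsum (A \<odot>\<^sub>o B) (gtgt \<phi> \<odot>\<^sub>o gtgt \<psi>) (sdim \<sigma>) ?F \<sigma> \<star> (p \<odot> p')"
    using F assms g by (simp add: gcomp_gsum_left gcomp_gsum_right)
  also have "gsum (A \<odot>\<^sub>o B) (gtgt \<phi> \<odot>\<^sub>o gtgt \<psi>) (sdim \<sigma>) ?F \<sigma> = sten n A B \<phi> \<psi> \<star> sinc n (A \<odot>\<^sub>o B) \<sigma>"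
    using \<sigma> assms by (subst sten_sinc) auto
  finally show "sten n A' B' (f \<star> \<phi> \<star> smap n p) (g \<star> \<psi> \<star> smap n p') \<star> sinc n (A' \<odot>\<^sub>o B') \<sigma>
      = ((f \<odot> g) \<star> sten n A B \<phi> \<psi> \<star> smap n (p \<odot> p')) \<star> sinc n (A' \<odot>\<^sub>o B') \<sigma>"
    using \<sigma> assms by (simp add: smap_sinc)
qed (use assms in auto)

lemma stens_Cons:
  "rs \<noteq> [] \<Longrightarrow> stens n A B ((k, \<phi>) # rs) = can B k (sum_list (map fst rs)) \<star> sten n A (gpow A (length rs)) \<phi> (stens n A B rs)"
  by (cases rs) auto

context
  fixes n :: nat and A B
  assumes g: "graded_object A" "graded_object B"
begin

lemma stens_typing:
  assumes "factors (sgr n A) B rs"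
  shows "gsrc (stens n A B rs) = sgr n (gpow A (length rs)) \<and> gtgt (stens n A B rs) = gpow B (sum_list (map fst rs)) \<and>
    gdeg (stens n A B rs) = 0 \<and> gm (stens n A B rs)"
  using factors_nonempty[OF assms] assms
proof (induction rs rule: list_nonempty_induct)
  case (single x)
  then show ?case by (cases x) auto
next
  case (cons x xs)
  obtain k \<phi> where x: "x = (k, \<phi>)" by force
  have "sum_list (map fst xs) > 0" "k > 0"
    using cons x by (auto intro: factors_sum_pos)
  then show ?case using cons g by (simp add: stens_Cons x)
qed

lemma stens_sobj:
  assumes "factors (sgr n A) B rs" "\<theta> \<in> mono_maps m n"
  shows "stens m A B (map (\<lambda>(k, \<phi>). (k, \<phi> \<star> sobj m n A \<theta>)) rs) = stens n A B rs \<star> sobj m n (gpow A (length rs)) \<theta>"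
  using factors_nonempty[OF assms(1)] assms
proof (induction rs rule: list_nonempty_induct)
  case (single x)
  then show ?case by (cases x) auto
next
  case (cons x xs)
  obtain k \<phi> where x: "x = (k, \<phi>)" by force
  have p: "sum_list (map fst xs) > 0" "k > 0"
    using cons x by (auto intro: factors_sum_pos)
  show ?case using cons g p stens_typing[of xs]
    by (simp add: stens_Cons x comp_def case_prod_unfold sten_sobj)
qed

lemma stens_sdegen:
  assumes "factors A B rs"
  shows "stens n A B (map (\<lambda>(k, f). (k, sdegen n f)) rs) = sdegen n (mtens B rs)"
  using factors_nonempty[OF assms(1)] assms
proof (induction rs rule: list_nonempty_induct)
  case (single x)
  then show ?case by (cases x) auto
next
  case (cons x xs)
  obtain k f where x: "x = (k, f)" by force
  have p: "sum_list (map fst xs) > 0" "k > 0"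
    using cons x by (auto intro: factors_sum_pos)
  show ?case using cons g p mtens_typing[of A B xs]
    by (simp add: stens_Cons mtens_Cons x comp_def case_prod_unfold sten_sdegen) (simp add: sdegen_def)
qed

lemma stens_map:
  assumes "factors (sgr n A) B rs" "gm p" "gtgt p = A" "gdeg p = 0" "gm q" "gsrc q = B" "gdeg q = 0"
  shows "stens n (gsrc p) (gtgt q) (map (\<lambda>(k, \<phi>). (k, mpow q k \<star> \<phi> \<star> smap n p)) rs)
    = mpow q (sum_list (map fst rs)) \<star> stens n A B rs \<star> smap n (mpow p (length rs))"
  using factors_nonempty[OF assms(1)] assms
proof (induction rs rule: list_nonempty_induct)
  case (single x)
  then show ?case by (cases x) auto
next
  case (cons x xs)
  obtain k \<phi> where x: "x = (k, \<phi>)" by force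
  have pos: "sum_list (map fst xs) > 0" "k > 0"
    using cons x by (auto intro: factors_sum_pos)
  have ty: "gsrc (stens n A B xs) = sgr n (gpow A (length xs))" "gtgt (stens n A B xs) = gpow B (sum_list (map fst xs))"
    "gdeg (stens n A B xs) = 0" "gm (stens n A B xs)"
    using stens_typing[of xs] cons x by auto
  have m: "map (\<lambda>x. fst (case x of (k, \<phi>) \<Rightarrow> (k, mpow q k \<star> \<phi> \<star> smap n p))) xs = map fst xs"
    by auto
  have "stens n (gsrc p) (gtgt q) (map (\<lambda>(k, \<phi>). (k, mpow q k \<star> \<phi> \<star> smap n p)) (x # xs))
    = can (gtgt q) k (sum_list (map fst xs)) \<star> sten n (gsrc p) (gpow (gsrc p) (length xs)) (mpow q k \<star> \<phi> \<star> smap n p)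
        (mpow q (sum_list (map fst xs)) \<star> stens n A B xs \<star> smap n (mpow p (length xs)))"
    using cons x by (simp add: stens_Cons comp_def case_prod_unfold)
  also have "\<dots> = (can (gtgt q) k (sum_list (map fst xs)) \<star> (mpow q k \<odot> mpow q (sum_list (map fst xs))))
      \<star> sten n A (gpow A (length xs)) \<phi> (stens n A B xs) \<star> smap n (p \<odot> mpow p (length xs))"
    using cons x pos ty g by (subst sten_map[where A=A and B="gpow A (length xs)"]) auto
  also have "can (gtgt q) k (sum_list (map fst xs)) \<star> (mpow q k \<odot> mpow q (sum_list (map fst xs)))
      = mpow q (k + sum_list (map fst xs)) \<star> can B k (sum_list (map fst xs))"
    using cons pos by (subst can_mpow) auto
  finally show ?case
    using cons x pos ty g by (simp add: stens_Cons mpow_Suc)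
qed

end

lemma smap_sobj:
  assumes "gm f" "gdeg f = 0" "\<theta> \<in> mono_maps m n" "A = gsrc f" "B = gtgt f"
  shows "smap n f \<star> sobj m n A \<theta> = sobj m n B \<theta> \<star> smap m f"
proof (rule sgr_ext)
  fix \<sigma> assume "\<sigma> \<in> splx m"
  then have "sobj m n B \<theta> \<star> (smap m f \<star> sinc m A \<sigma>) = (sobj m n B \<theta> \<star> sinc m B \<sigma>) \<star> f"
    using assms by (simp add: smap_sinc)
  with \<open>\<sigma> \<in> splx m\<close> show "(smap n f \<star> sobj m n A \<theta>) \<star> sinc m A \<sigma> = (sobj m n B \<theta> \<star> smap m f) \<star> sinc m A \<sigma>"
    using assms by (auto simp: sobj_sinc smap_sinc)
qed (use assms in auto)

lemma smap_gcomp: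
  assumes "gm f" "gm g" "gdeg f = 0" "gdeg g = 0" "gsrc g = gtgt f"
  shows "smap n g \<star> smap n f = smap n (g \<star> f)"
proof (rule sgr_ext)
  fix \<sigma> assume s: "\<sigma> \<in> splx n"
  have "smap n g \<star> (smap n f \<star> sinc n (gsrc f) \<sigma>) = (smap n g \<star> sinc n (gtgt f) \<sigma>) \<star> f"
    using assms s by (simp add: smap_sinc[of f])
  then show "(smap n g \<star> smap n f) \<star> sinc n (gsrc f) \<sigma> = smap n (g \<star> f) \<star> sinc n (gsrc f) \<sigma>"
    using assms s by (simp add: smap_sinc)
qed (use assms in auto)

lemma sdegen_smap:
  assumes "gm f" "gm g" "gdeg f = 0" "gdeg g = 0" "gsrc g = gtgt f"
  shows "sdegen n g \<star> smap n f = sdegen n (g \<star> f)"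
proof (rule sgr_ext)
  fix \<sigma> assume s: "\<sigma> \<in> splx n"
  have "sdegen n g \<star> (smap n f \<star> sinc n (gsrc f) \<sigma>) = (sdegen n g \<star> sinc n (gtgt f) \<sigma>) \<star> f"
    using assms s by (simp add: smap_sinc)
  then show "(sdegen n g \<star> smap n f) \<star> sinc n (gsrc f) \<sigma> = sdegen n (g \<star> f) \<star> sinc n (gsrc f) \<sigma>"
    using assms s by (auto simp: sdegen_sinc)
qed (use assms in auto)

lemma gcomp_sdegen:
  assumes "gm f" "gm g" "gsrc g = gtgt f"
  shows "g \<star> sdegen n f = sdegen n (g \<star> f)"
  using assms by (simp add: sdegen_def)

lemma sdegen_sobj:
  assumes "gm f" "gdeg f = 0" "\<theta> \<in> mono_maps m n" "A = gsrc f"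
  shows "sdegen n f \<star> sobj m n A \<theta> = sdegen m f"
proof (rule sgr_ext)
  fix \<sigma> assume s: "\<sigma> \<in> splx m"
  show "(sdegen n f \<star> sobj m n A \<theta>) \<star> sinc m A \<sigma> = sdegen m f \<star> sinc m A \<sigma>"
  proof (cases "inj_on (nth \<theta>) \<sigma>")
    case True
    then show ?thesis using assms s by (simp add: sobj_sinc sdegen_sinc card_image)
  next
    case False
    then have "card \<sigma> \<noteq> 1" by (auto simp: card_1_singleton_iff)
    then show ?thesis using False assms s by (simp add: sobj_sinc sdegen_sinc)
  qed
qed (use assms in auto)

section \<open>Differentials, chain maps and the simplicial Hom\<close>

definition cplx :: "('a, 'b) cplx \<Rightarrow> bool" where
  "cplx X \<longleftrightarrow> gmor (dif X) (gr X) (gr X) (-1)"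

lemma complex_cplx: "complex X \<Longrightarrow> cplx X"
  unfolding complex_def cplx_def using ghom_gm[of "dif X" "gr X" "gr X" "-1"] by (auto dest: ghom_simps)

lemma cplxD [simp]: "cplx X \<Longrightarrow> gm (dif X)" "cplx X \<Longrightarrow> gsrc (dif X) = gr X" "cplx X \<Longrightarrow> gtgt (dif X) = gr X"
  "cplx X \<Longrightarrow> gdeg (dif X) = -1"
  by (auto simp: cplx_def)

lemma cplx_graded [simp]: "cplx X \<Longrightarrow> graded_object (gr X)"
  using gm_graded[of "dif X"] by simp

lemma cten_simps: "gr (cten X Y) = gr X \<odot>\<^sub>o gr Y" "dif (cten X Y) = gadd (dif X \<odot> gid (gr Y)) (gid (gr X) \<odot> dif Y)"
  by (simp_all add: cten_def)

lemma cten_cplx [simp]: "cplx X \<Longrightarrow> cplx Y \<Longrightarrow> cplx (cten X Y)"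
  unfolding cplx_def[of "cten X Y"] by (simp add: cten_simps)

lemma cpow_Suc: "k > 0 \<Longrightarrow> cpow X (Suc k) = cten X (cpow X k)"
  by (cases k) auto

lemma cpow_cplx [simp]: "cplx X \<Longrightarrow> cplx (cpow X k)" "gr (cpow X k) = gpow (gr X) k"
proof (induction k)
  case (Suc k)
  { case 1 then show ?case using Suc by (cases "k = 0") (auto simp: cpow_Suc) }
  { case 2 then show ?case using Suc by (cases "k = 0") (auto simp: cpow_Suc cten_simps) }
qed auto

definition cmap :: "('a, 'b) cplx \<Rightarrow> ('a, 'b) cplx \<Rightarrow> ('a, 'b) gmap \<Rightarrow> bool" where
  "cmap X Y f \<longleftrightarrow> gmor f (gr X) (gr Y) 0 \<and> f \<star> dif X = dif Y \<star> f"

lemma cmapI: "gm f \<Longrightarrow> gsrc f = gr X \<Longrightarrow> gtgt f = gr Y \<Longrightarrow> gdeg f = 0 \<Longrightarrow> f \<star> dif X = dif Y \<star> f \<Longrightarrow> cmap X Y f"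
  by (simp add: cmap_def)

lemma cmapD: "cmap X Y f \<Longrightarrow> gm f" "cmap X Y f \<Longrightarrow> gsrc f = gr X" "cmap X Y f \<Longrightarrow> gtgt f = gr Y"
  "cmap X Y f \<Longrightarrow> gdeg f = 0"
  by (auto simp: cmap_def)

lemma cmap_comm: "cmap X Y f \<Longrightarrow> f \<star> dif X = dif Y \<star> f"
  by (auto simp: cmap_def)

lemma chain_map_iff:
  assumes "graded_object (gr X)" "graded_object (gr Y)"
  shows "chain_map X Y f \<longleftrightarrow> cmap X Y f"
proof
  assume "chain_map X Y f"
  then show "cmap X Y f"
    using assms ghom_gm[of f "gr X" "gr Y" 0] ghom_simps[of f "gr X" "gr Y" 0] unfolding chain_map_def cmap_def by blast
next
  assume "cmap X Y f"
  then show "chain_map X Y f"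
    unfolding cmap_def chain_map_def by (simp add: ghom_iff)
qed

lemma cmap_gid: "cplx X \<Longrightarrow> cmap X X (gid (gr X))"
  by (rule cmapI) auto

lemma cmap_gcomp:
  assumes "cplx X" "cplx Y" "cplx Z" "cmap X Y f" "cmap Y Z g"
  shows "cmap X Z (g \<star> f)"
proof (rule cmapI)
  note [simp] = cmapD[OF assms(4)] cmapD[OF assms(5)]
  have "(g \<star> f) \<star> dif X = (g \<star> dif Y) \<star> f" using assms cmap_comm[of X Y f] by simp
  then show "(g \<star> f) \<star> dif X = dif Z \<star> (g \<star> f)"
    using assms cmap_comm[of Y Z g] by simp
qed (auto simp: cmapD[OF assms(4)] cmapD[OF assms(5)])

lemma cmap_gtenm:
  assumes "cplx X" "cplx Y" "cplx X'" "cplx Y'" "cmap X Y f" "cmap X' Y' g"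
  shows "cmap (cten X X') (cten Y Y') (f \<odot> g)"
proof (rule cmapI)
  note [simp] = cmapD[OF assms(5)] cmapD[OF assms(6)]
  have "(f \<odot> g) \<star> dif (cten X X') = gadd ((f \<star> dif X) \<odot> g) (f \<odot> (g \<star> dif X'))"
    using assms by (simp add: cten_simps gcomp_gadd gtenm_gcomp)
  also have "\<dots> = dif (cten Y Y') \<star> (f \<odot> g)"
    using assms by (simp add: cten_simps gcomp_gadd gtenm_gcomp cmap_comm[OF assms(5)] cmap_comm[OF assms(6)])
  finally show "(f \<odot> g) \<star> dif (cten X X') = dif (cten Y Y') \<star> (f \<odot> g)" .
qed (auto simp: cten_simps cmapD[OF assms(5)] cmapD[OF assms(6)])

lemma cmap_mpow:
  assumes "cplx X" "cplx Y" "cmap X Y f"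
  shows "cmap (cpow X k) (cpow Y k) (mpow f k)"
proof (induction k)
  case (Suc k)
  then show ?case using assms by (cases "k = 0") (auto simp: mpow_Suc cpow_Suc intro: cmap_gtenm)
qed (use assms in auto)

lemma cmap_icmul:
  assumes "cplx (cx X)" "cmap (cx X) (cten (cx X) (cx X)) (cmul X)" "k > 0"
  shows "cmap (cx X) (cpow (cx X) k) (icmul X k)"
  using assms(3)
proof (induction k rule: nat_induct_non_zero)
  case 1
  then show ?case using assms by (simp add: cmap_gid)
next
  case (Suc k)
  then have "icmul X (Suc k) = (gid (gr (cx X)) \<odot> icmul X k) \<star> cmul X" by (cases k) auto
  then show ?case
    using Suc assms by (auto simp: cpow_Suc intro!: cmap_gcomp[of _ "cten (cx X) (cx X)"] cmap_gtenm cmap_gid)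
qed

text \<open>The simplicial half of the boundary of \<phi> at \<sigma>. A vertex gets the empty sum,
  because removing it would leave no simplex.\<close>

definition sbd :: "nat \<Rightarrow> 'a graded \<Rightarrow> ('a, 'b) gmap \<Rightarrow> nat set \<Rightarrow> ('a, 'b) gmap" where
  "sbd n A \<phi> \<sigma> = gsum A (gtgt \<phi>) (sdim \<sigma> - 1) (\<lambda>w. gsgn (int (card {v \<in> \<sigma>. v < w})) (\<phi> \<star> sinc n A (\<sigma> - {w})))
     (if card \<sigma> \<ge> 2 then \<sigma> else {})"

lemma splx_remove:
  assumes "\<sigma> \<in> splx n" "w \<in> (if card \<sigma> \<ge> 2 then \<sigma> else {})"
  shows "\<sigma> - {w} \<in> splx n" "sdim (\<sigma> - {w}) = sdim \<sigma> - 1"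
proof -
  have "\<sigma> \<noteq> {w}" using assms by (auto split: if_splits)
  then show "\<sigma> - {w} \<in> splx n" using assms by (auto simp: splx_def split: if_splits)
  show "sdim (\<sigma> - {w}) = sdim \<sigma> - 1" using assms by (auto simp: sdim_def split: if_splits)
qed

lemma sbd_simps [simp]: "gsrc (sbd n A \<phi> \<sigma>) = A" "gtgt (sbd n A \<phi> \<sigma>) = gtgt \<phi>" "gdeg (sbd n A \<phi> \<sigma>) = sdim \<sigma> - 1"
  by (simp_all add: sbd_def)

lemma sbd_gm [simp]:
  assumes "graded_object A" "gm \<phi>" "gsrc \<phi> = sgr n A" "gdeg \<phi> = 0" "\<sigma> \<in> splx n"
  shows "gm (sbd n A \<phi> \<sigma>)"
  unfolding sbd_def using assms splx_remove[OF assms(5)] by (intro gsum_gm) auto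

lemma scx_simps [simp]: "gr (scx n X) = sgr n (gr X)"
  by (simp add: scx_def Let_def)

text \<open>Both halves of the differential are rewritten as sums of maps precomposed with
  \<open>spro\<close>, the shape required by \<open>gsum_spro_sinc\<close>; the first half is a sum
  over pairs and has to be grouped by \<sigma> beforehand.\<close>

lemma scx_dif:
  assumes "cplx X"
  shows "gm (dif (scx n X))" "gsrc (dif (scx n X)) = sgr n (gr X)" "gtgt (dif (scx n X)) = sgr n (gr X)"
    "gdeg (dif (scx n X)) = -1"
    "\<sigma> \<in> splx n \<Longrightarrow> dif (scx n X) \<star> sinc n (gr X) \<sigma> = gadd (sbd n (gr X) (gid (sgr n (gr X))) \<sigma>)
      (gsgn (sdim \<sigma>) (sinc n (gr X) \<sigma> \<star> dif X))"
proof -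
  let ?A = "gr X" let ?S = "sgr n (gr X)"
  let ?W = "\<lambda>\<sigma>. if card \<sigma> \<ge> 2 then \<sigma> else {}"
  let ?D1 = "gsum ?S ?S (-1) (\<lambda>(\<sigma>, w). gsgn (int (card {v \<in> \<sigma>. v < w})) (sinc n ?A (\<sigma> - {w}) \<star> spro n ?A \<sigma>))
        {(\<sigma>, w). \<sigma> \<in> splx n \<and> w \<in> \<sigma> \<and> card \<sigma> \<ge> 2}"
  let ?D2 = "gsum ?S ?S (-1) (\<lambda>\<sigma>. gsgn (sdim \<sigma>) (sinc n ?A \<sigma> \<star> dif X \<star> spro n ?A \<sigma>)) (splx n)"
  have D: "dif (scx n X) = gadd ?D1 ?D2" by (simp add: scx_def Let_def)
  have W: "{(\<sigma>, w). \<sigma> \<in> splx n \<and> w \<in> \<sigma> \<and> card \<sigma> \<ge> 2} = Sigma (splx n) ?W" by (auto split: if_splits)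
  have ty: "\<forall>\<sigma>\<in>splx n. \<forall>w\<in>?W \<sigma>. gm (sinc n ?A (\<sigma> - {w}) \<star> spro n ?A \<sigma>) \<and> gdeg (sinc n ?A (\<sigma> - {w}) \<star> spro n ?A \<sigma>) = -1"
    using splx_remove assms by auto
  have "?D1 = gsum ?S ?S (-1) (\<lambda>\<sigma>. gsum ?S ?S (-1) (\<lambda>w. gsgn (int (card {v \<in> \<sigma>. v < w})) (sinc n ?A (\<sigma> - {w}) \<star> spro n ?A \<sigma>)) (?W \<sigma>)) (splx n)"
    unfolding W by (rule gsum_Sigma[symmetric]) (use assms ty in \<open>auto split: if_splits\<close>)
  also have "\<dots> = gsum ?S ?S (-1) (\<lambda>\<sigma>. sbd n ?A (gid ?S) \<sigma> \<star> spro n ?A \<sigma>) (splx n)"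
  proof (rule gsum_cong)
    fix \<sigma> assume \<sigma>: "\<sigma> \<in> splx n"
    have "sbd n ?A (gid ?S) \<sigma> \<star> spro n ?A \<sigma>
      = gsum ?S ?S (-1) (\<lambda>w. gsgn (int (card {v \<in> \<sigma>. v < w})) (gid ?S \<star> sinc n ?A (\<sigma> - {w})) \<star> spro n ?A \<sigma>) (?W \<sigma>)"
      unfolding sbd_def using assms \<sigma> splx_remove[OF \<sigma>] by (subst gcomp_gsum_right) auto
    also have "\<dots> = gsum ?S ?S (-1) (\<lambda>w. gsgn (int (card {v \<in> \<sigma>. v < w})) (sinc n ?A (\<sigma> - {w}) \<star> spro n ?A \<sigma>)) (?W \<sigma>)"
      using assms \<sigma> splx_remove[OF \<sigma>] by (intro gsum_cong) auto
    finally show "gsum ?S ?S (-1) (\<lambda>w. gsgn (int (card {v \<in> \<sigma>. v < w})) (sinc n ?A (\<sigma> - {w}) \<star> spro n ?A \<sigma>)) (?W \<sigma>)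
      = sbd n ?A (gid ?S) \<sigma> \<star> spro n ?A \<sigma>" by simp
  qed (use assms in auto)
  finally have D1: "?D1 = gsum ?S ?S (-1) (\<lambda>\<sigma>. sbd n ?A (gid ?S) \<sigma> \<star> spro n ?A \<sigma>) (splx n)" .
  have D2: "?D2 = gsum ?S ?S (-1) (\<lambda>\<sigma>. gsgn (sdim \<sigma>) (sinc n ?A \<sigma> \<star> dif X) \<star> spro n ?A \<sigma>) (splx n)"
    by (rule gsum_cong) (use assms in auto)
  have gm12: "gm ?D1" "gm ?D2"
    unfolding D1 D2 using assms by auto
  then show "gm (dif (scx n X))" "gsrc (dif (scx n X)) = ?S" "gtgt (dif (scx n X)) = ?S" "gdeg (dif (scx n X)) = -1"
    unfolding D by auto
  assume \<sigma>: "\<sigma> \<in> splx n"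
  have "?D1 \<star> sinc n ?A \<sigma> = sbd n ?A (gid ?S) \<sigma>"
    unfolding D1 using assms \<sigma>
    by (subst gsum_spro_sinc[where s="\<lambda>\<sigma>. \<sigma>"]) (auto simp: the_inv_into_f_f[of "\<lambda>x. x", simplified])
  moreover have "?D2 \<star> sinc n ?A \<sigma> = gsgn (sdim \<sigma>) (sinc n ?A \<sigma> \<star> dif X)"
    unfolding D2 using assms \<sigma>
    by (subst gsum_spro_sinc[where s="\<lambda>\<sigma>. \<sigma>"]) (auto simp: the_inv_into_f_f[of "\<lambda>x. x", simplified])
  ultimately show "dif (scx n X) \<star> sinc n ?A \<sigma> = gadd (sbd n ?A (gid ?S) \<sigma>) (gsgn (sdim \<sigma>) (sinc n ?A \<sigma> \<star> dif X))"
    unfolding D using gm12 assms \<sigma> by (simp add: gcomp_gadd)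
qed

lemma scx_cplx [simp]: "cplx X \<Longrightarrow> cplx (scx n X)"
  unfolding cplx_def[of "scx n X"] by (simp add: scx_dif scx_simps)

lemma gcomp_sbd:
  assumes "graded_object A" "gm \<phi>" "gsrc \<phi> = sgr n A" "gdeg \<phi> = 0" "\<sigma> \<in> splx n" "gm \<psi>" "gsrc \<psi> = gtgt \<phi>" "gdeg \<psi> = 0"
  shows "\<psi> \<star> sbd n A \<phi> \<sigma> = sbd n A (\<psi> \<star> \<phi>) \<sigma>"
proof -
  have "\<psi> \<star> sbd n A \<phi> \<sigma> = gsum A (gtgt \<psi>) (sdim \<sigma> - 1) (\<lambda>w. \<psi> \<star> gsgn (int (card {v \<in> \<sigma>. v < w})) (\<phi> \<star> sinc n A (\<sigma> - {w})))
     (if card \<sigma> \<ge> 2 then \<sigma> else {})"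
    unfolding sbd_def using assms splx_remove[OF assms(5)] by (subst gcomp_gsum_left) auto
  also have "\<dots> = sbd n A (\<psi> \<star> \<phi>) \<sigma>"
    unfolding sbd_def gcomp_simps using assms splx_remove[OF assms(5)] by (intro gsum_cong) auto
  finally show ?thesis .
qed

lemma sbd_smap:
  assumes "gm \<phi>" "gsrc \<phi> = sgr n (gtgt p)" "gdeg \<phi> = 0" "\<sigma> \<in> splx n" "gm p" "gdeg p = 0" "A = gtgt p" "A' = gsrc p"
  shows "sbd n A' (\<phi> \<star> smap n p) \<sigma> = sbd n A \<phi> \<sigma> \<star> p"
proof -
  have "sbd n A \<phi> \<sigma> \<star> p = gsum A' (gtgt \<phi>) (sdim \<sigma> - 1) (\<lambda>w. gsgn (int (card {v \<in> \<sigma>. v < w})) (\<phi> \<star> sinc n A (\<sigma> - {w})) \<star> p)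
     (if card \<sigma> \<ge> 2 then \<sigma> else {})"
    unfolding sbd_def using assms splx_remove[OF assms(4)] by (subst gcomp_gsum_right) auto
  also have "\<dots> = sbd n A' (\<phi> \<star> smap n p) \<sigma>"
    unfolding sbd_def gcomp_simps using assms splx_remove[OF assms(4)] by (intro gsum_cong) (auto simp: smap_sinc)
  finally show ?thesis by simp
qed

text \<open>The chain map condition read off at each simplex. At the top simplex it is the boundary
  formula of the Hom complex that drives the computation on the cube.\<close>

lemma shom_iff:
  assumes "cplx X" "cplx Y"
  shows "\<phi> \<in> shom n X Y \<longleftrightarrow> gmor \<phi> (sgr n (gr X)) (gr Y) 0 \<and>
    (\<forall>\<sigma>\<in>splx n. dif Y \<star> \<phi> \<star> sinc n (gr X) \<sigma>
      = gadd (sbd n (gr X) \<phi> \<sigma>) (gsgn (sdim \<sigma>) (\<phi> \<star> sinc n (gr X) \<sigma> \<star> dif X)))" (is "_ \<longleftrightarrow> ?R")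
proof -
  let ?S = "sgr n (gr X)"
  have "\<phi> \<in> shom n X Y \<longleftrightarrow> gmor \<phi> ?S (gr Y) 0 \<and> \<phi> \<star> dif (scx n X) = dif Y \<star> \<phi>"
    using assms unfolding shom_def by (simp add: chain_map_iff scx_simps) (simp only: cmap_def scx_simps conj_assoc)
  also have "\<dots> \<longleftrightarrow> ?R"
  proof (rule conj_cong[OF refl])
    assume "gmor \<phi> ?S (gr Y) 0"
    then have \<phi>: "gm \<phi>" "gsrc \<phi> = ?S" "gtgt \<phi> = gr Y" "gdeg \<phi> = 0" by simp_all
    have D: "(\<phi> \<star> dif (scx n X)) \<star> sinc n (gr X) \<sigma> = gadd (sbd n (gr X) \<phi> \<sigma>) (gsgn (sdim \<sigma>) (\<phi> \<star> sinc n (gr X) \<sigma> \<star> dif X))"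
      if "\<sigma> \<in> splx n" for \<sigma>
    proof -
      have "(\<phi> \<star> dif (scx n X)) \<star> sinc n (gr X) \<sigma> = \<phi> \<star> gadd (sbd n (gr X) (gid ?S) \<sigma>) (gsgn (sdim \<sigma>) (sinc n (gr X) \<sigma> \<star> dif X))"
        using \<phi> assms that scx_dif(5)[OF assms(1) that] by (simp add: scx_simps)
      also have "\<dots> = gadd (\<phi> \<star> sbd n (gr X) (gid ?S) \<sigma>) (\<phi> \<star> gsgn (sdim \<sigma>) (sinc n (gr X) \<sigma> \<star> dif X))"
        using \<phi> assms that by (intro gcomp_gadd(2)) auto
      also have "\<phi> \<star> sbd n (gr X) (gid ?S) \<sigma> = sbd n (gr X) \<phi> \<sigma>"
        using \<phi> assms that by (subst gcomp_sbd) auto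
      finally show ?thesis using \<phi> assms that by simp
    qed
    show "\<phi> \<star> dif (scx n X) = dif Y \<star> \<phi> \<longleftrightarrow> (\<forall>\<sigma>\<in>splx n. dif Y \<star> \<phi> \<star> sinc n (gr X) \<sigma>
      = gadd (sbd n (gr X) \<phi> \<sigma>) (gsgn (sdim \<sigma>) (\<phi> \<star> sinc n (gr X) \<sigma> \<star> dif X)))"
    proof
      assume "\<phi> \<star> dif (scx n X) = dif Y \<star> \<phi>"
      then show "\<forall>\<sigma>\<in>splx n. dif Y \<star> \<phi> \<star> sinc n (gr X) \<sigma>
          = gadd (sbd n (gr X) \<phi> \<sigma>) (gsgn (sdim \<sigma>) (\<phi> \<star> sinc n (gr X) \<sigma> \<star> dif X))"
        using D \<phi> assms by simp
    next
      assume *: "\<forall>\<sigma>\<in>splx n. dif Y \<star> \<phi> \<star> sinc n (gr X) \<sigma>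
          = gadd (sbd n (gr X) \<phi> \<sigma>) (gsgn (sdim \<sigma>) (\<phi> \<star> sinc n (gr X) \<sigma> \<star> dif X))"
      show "\<phi> \<star> dif (scx n X) = dif Y \<star> \<phi>"
        by (rule sgr_ext[of _ _ n "gr X"]) (use * D \<phi> assms in \<open>auto simp: scx_dif(1)\<close>)
    qed
  qed
  finally show ?thesis .
qed

lemma shom_post:
  assumes "cplx X" "cplx Y" "cplx Z" "\<phi> \<in> shom n X Y" "cmap Y Z q"
  shows "q \<star> \<phi> \<in> shom n X Z"
  using assms cmap_gcomp[of "scx n X" Y Z \<phi> q] by (simp add: shom_def chain_map_iff scx_simps)

lemma shom_pre:
  assumes "cplx X'" "cplx X" "cplx Y" "\<phi> \<in> shom n X Y" "cmap X' X p"
  shows "\<phi> \<star> smap n p \<in> shom n X' Y"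
  unfolding shom_iff[OF assms(1,3)]
proof (intro conjI ballI)
  have \<phi>: "gm \<phi>" "gsrc \<phi> = sgr n (gr X)" "gtgt \<phi> = gr Y" "gdeg \<phi> = 0"
    using assms(4) unfolding shom_iff[OF assms(2,3)] by auto
  have eq: "dif Y \<star> \<phi> \<star> sinc n (gr X) \<sigma> = gadd (sbd n (gr X) \<phi> \<sigma>) (gsgn (sdim \<sigma>) (\<phi> \<star> sinc n (gr X) \<sigma> \<star> dif X))"
    if "\<sigma> \<in> splx n" for \<sigma>
    using assms(4) that unfolding shom_iff[OF assms(2,3)] by auto
  note [simp] = cmapD[OF assms(5)]
  from \<phi> show "gm (\<phi> \<star> smap n p)" "gsrc (\<phi> \<star> smap n p) = sgr n (gr X')" "gtgt (\<phi> \<star> smap n p) = gr Y" "gdeg (\<phi> \<star> smap n p) = 0"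
    using assms by auto
  fix \<sigma> assume \<sigma>: "\<sigma> \<in> splx n"
  have "dif Y \<star> (\<phi> \<star> smap n p) \<star> sinc n (gr X') \<sigma> = (dif Y \<star> \<phi> \<star> sinc n (gr X) \<sigma>) \<star> p"
    using \<sigma> \<phi> assms by (simp add: smap_sinc)
  also have "\<dots> = gadd (sbd n (gr X) \<phi> \<sigma> \<star> p) (gsgn (sdim \<sigma>) (\<phi> \<star> sinc n (gr X) \<sigma> \<star> dif X) \<star> p)"
    unfolding eq[OF \<sigma>] using \<sigma> \<phi> assms by (intro gcomp_gadd) auto
  also have "sbd n (gr X) \<phi> \<sigma> \<star> p = sbd n (gr X') (\<phi> \<star> smap n p) \<sigma>"
    using \<sigma> \<phi> assms by (subst sbd_smap[where A="gr X"]) auto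
  also have "gsgn (sdim \<sigma>) (\<phi> \<star> sinc n (gr X) \<sigma> \<star> dif X) \<star> p = gsgn (sdim \<sigma>) ((\<phi> \<star> smap n p) \<star> sinc n (gr X') \<sigma> \<star> dif X')"
  proof -
    have "(\<phi> \<star> smap n p) \<star> sinc n (gr X') \<sigma> \<star> dif X' = \<phi> \<star> (smap n p \<star> sinc n (gr X') \<sigma>) \<star> dif X'"
      using \<sigma> \<phi> assms by simp
    also have "\<dots> = \<phi> \<star> sinc n (gr X) \<sigma> \<star> (p \<star> dif X')"
      using \<sigma> \<phi> assms by (simp add: smap_sinc)
    finally show ?thesis using \<sigma> \<phi> assms cmap_comm[of X' X p] by simp
  qed
  finally show "dif Y \<star> (\<phi> \<star> smap n p) \<star> sinc n (gr X') \<sigma>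
    = gadd (sbd n (gr X') (\<phi> \<star> smap n p) \<sigma>) (gsgn (sdim \<sigma>) ((\<phi> \<star> smap n p) \<star> sinc n (gr X') \<sigma> \<star> dif X'))" .
qed

text \<open>The faces of an edge are two vertices with equal values and opposite signs; the faces of
  a simplex of dimension at least 2 have positive dimension, where \<open>sdegen\<close> vanishes.
  So the simplicial half of the boundary is zero.\<close>

lemma shom_sdegen:
  assumes "cplx X" "cplx Y" "cmap X Y f"
  shows "sdegen n f \<in> shom n X Y"
  unfolding shom_iff[OF assms(1,2)]
proof (intro conjI ballI)
  note [simp] = cmapD[OF assms(3)]
  fix \<sigma> assume \<sigma>: "\<sigma> \<in> splx n"
  let ?A = "gr X"
  let ?F = "\<lambda>w. gsgn (int (card {v \<in> \<sigma>. v < w})) (sdegen n f \<star> sinc n ?A (\<sigma> - {w}))"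
  have sb: "sbd n ?A (sdegen n f) \<sigma> = gzero ?A (gr Y) (sdim \<sigma> - 1)"
  proof (cases "card \<sigma> = 2")
    case True
    then obtain a b where ab: "\<sigma> = {a, b}" "a < b"
      by (metis card_2_iff linorder_neqE_nat insert_commute)
    then have ab': "a \<le> n" "b \<le> n" "{v \<in> \<sigma>. v < a} = {}" "{v \<in> \<sigma>. v < b} = {a}" "\<sigma> - {a} = {b}" "\<sigma> - {b} = {a}"
      using \<sigma> by (auto simp: splx_def)
    have F: "?F a = f" "?F b = gsgn 1 f"
      using ab' assms unfolding ab' by (auto simp: sdegen_sinc)
    have "sbd n ?A (sdegen n f) \<sigma> = gsum ?A (gr Y) 0 ?F {a, b}"
      using True assms by (simp add: sbd_def sdim_def ab(1))
    also have "\<dots> = gadd (?F a) (gsum ?A (gr Y) 0 ?F {b})"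
    proof (rule gsum_insert)
      show "\<forall>w\<in>insert a {b}. gmor (?F w) ?A (gr Y) 0"
        unfolding ball_simps F by simp
    qed (use ab assms in auto)
    also have "gsum ?A (gr Y) 0 ?F {b} = ?F b"
      by (rule gsum_singleton) (use assms in \<open>simp_all only: F\<close>, auto)
    also have "gadd (?F a) (?F b) = gadd f (gsgn 1 f)"
      unfolding F ..
    also have "\<dots> = gzero ?A (gr Y) (sdim \<sigma> - 1)"
      using assms gadd_gsgn_cancel[of f 0 1] True by (simp add: sdim_def)
    finally show ?thesis .
  next
    case False
    have "?F w = gzero ?A (gr Y) (sdim \<sigma> - 1)" if "w \<in> (if card \<sigma> \<ge> 2 then \<sigma> else {})" for w
    proof -
      have "card (\<sigma> - {w}) \<noteq> 1" using that False by (auto split: if_splits)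
      then show ?thesis using splx_remove[OF \<sigma> that] assms by (simp add: sdegen_sinc)
    qed
    then show ?thesis
      unfolding sbd_def using assms by (subst gsum_neutral) auto
  qed
  show "dif Y \<star> sdegen n f \<star> sinc n ?A \<sigma> = gadd (sbd n ?A (sdegen n f) \<sigma>) (gsgn (sdim \<sigma>) (sdegen n f \<star> sinc n ?A \<sigma> \<star> dif X))"
  proof (cases "card \<sigma> = 1")
    case True
    have "sdegen n f \<star> sinc n ?A \<sigma> \<star> dif X = (sdegen n f \<star> sinc n ?A \<sigma>) \<star> dif X"
      using \<sigma> assms by simp
    with True show ?thesis
      unfolding sb using \<sigma> assms cmap_comm[of X Y f] by (simp add: sdegen_sinc sdim_def)
  next
    case False
    have "sdegen n f \<star> sinc n ?A \<sigma> \<star> dif X = (sdegen n f \<star> sinc n ?A \<sigma>) \<star> dif X"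
      using \<sigma> assms by simp
    with False show ?thesis
      unfolding sb using \<sigma> assms by (simp add: sdegen_sinc)
  qed
qed (use assms cmapD[OF assms(3)] in auto)

end

section \<open>Combinatorics of the factorization nerves\<close>

lemma act_nth:
  assumes "act \<alpha>"
  shows "asrc \<alpha> > 0" "length \<alpha> = asrc \<alpha> + 1" "\<alpha> ! 0 = 0" "atrg \<alpha> = \<alpha> ! asrc \<alpha>"
    "i < j \<Longrightarrow> j \<le> asrc \<alpha> \<Longrightarrow> \<alpha> ! i < \<alpha> ! j"
proof -
  have a: "length \<alpha> \<ge> 2" "hd \<alpha> = 0" "sorted_wrt (<) \<alpha>" using assms by (auto simp: act_def)
  then have "\<alpha> \<noteq> []" by auto
  then show "asrc \<alpha> > 0" "length \<alpha> = asrc \<alpha> + 1" "\<alpha> ! 0 = 0" "atrg \<alpha> = \<alpha> ! asrc \<alpha>"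
    using a by (auto simp: asrc_def atrg_def hd_conv_nth last_conv_nth)
  show "i < j \<Longrightarrow> j \<le> asrc \<alpha> \<Longrightarrow> \<alpha> ! i < \<alpha> ! j"
    using a sorted_wrt_nth_less[OF a(3)] by (auto simp: asrc_def)
qed

lemma act_mono: "act \<alpha> \<Longrightarrow> i \<le> j \<Longrightarrow> j \<le> asrc \<alpha> \<Longrightarrow> \<alpha> ! i \<le> \<alpha> ! j"
  using act_nth(5)[of \<alpha> i j] by (cases "i = j") auto

lemma act_le_atrg: "act \<alpha> \<Longrightarrow> i \<le> asrc \<alpha> \<Longrightarrow> \<alpha> ! i \<le> atrg \<alpha>"
  using act_mono[of \<alpha> i "asrc \<alpha>"] act_nth(4)[of \<alpha>] by simp

lemma act_atrg_pos: "act \<alpha> \<Longrightarrow> atrg \<alpha> > 0"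
  using act_nth(5)[of \<alpha> 0 "asrc \<alpha>"] act_nth(1,4)[of \<alpha>] by simp

lemma actI:
  assumes "length \<alpha> = a + 1" "a > 0" "\<alpha> ! 0 = 0" "\<And>i. i < a \<Longrightarrow> \<alpha> ! i < \<alpha> ! (i + 1)"
  shows "act \<alpha>" "asrc \<alpha> = a" "atrg \<alpha> = \<alpha> ! a"
proof -
  have "\<alpha> \<noteq> []" using assms by auto
  then show "act \<alpha>" "asrc \<alpha> = a" "atrg \<alpha> = \<alpha> ! a"
    using assms by (auto simp: act_def asrc_def atrg_def hd_conv_nth last_conv_nth
        sorted_wrt_iff_nth_Suc_transp transp_on_less)
qed

lemma aid_act [simp]: "k > 0 \<Longrightarrow> act (aid k)" "asrc (aid k) = k" "atrg (aid k) = k" "length (aid k) = k + 1"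
  by (auto simp: act_def aid_def asrc_def atrg_def simp del: upt_Suc)

lemma aid_nth [simp]: "i \<le> k \<Longrightarrow> aid k ! i = i"
  by (simp add: aid_def del: upt_Suc)

lemma acomp_nth: "i < length \<alpha> \<Longrightarrow> acomp \<beta> \<alpha> ! i = \<beta> ! (\<alpha> ! i)" and acomp_length [simp]: "length (acomp \<beta> \<alpha>) = length \<alpha>"
  by (auto simp: acomp_def)

lemma acomp_act:
  assumes "act \<alpha>" "act \<beta>" "atrg \<alpha> = asrc \<beta>"
  shows "act (acomp \<beta> \<alpha>)" "asrc (acomp \<beta> \<alpha>) = asrc \<alpha>" "atrg (acomp \<beta> \<alpha>) = atrg \<beta>"
proof -
  have *: "length (acomp \<beta> \<alpha>) = asrc \<alpha> + 1" "acomp \<beta> \<alpha> ! 0 = 0"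
    "\<And>i. i < asrc \<alpha> \<Longrightarrow> acomp \<beta> \<alpha> ! i < acomp \<beta> \<alpha> ! (i + 1)" "acomp \<beta> \<alpha> ! asrc \<alpha> = atrg \<beta>"
    using assms act_nth[OF assms(1)] act_nth[OF assms(2)] act_le_atrg[OF assms(1)] by (auto simp: acomp_nth)
  from actI[OF *(1) act_nth(1)[OF assms(1)] *(2,3)] *(4)
  show "act (acomp \<beta> \<alpha>)" "asrc (acomp \<beta> \<alpha>) = asrc \<alpha>" "atrg (acomp \<beta> \<alpha>) = atrg \<beta>" by auto
qed

lemma acomp_assoc:
  assumes "act \<alpha>" "atrg \<alpha> = asrc \<beta>" "act \<beta>"
  shows "acomp \<gamma> (acomp \<beta> \<alpha>) = acomp (acomp \<gamma> \<beta>) \<alpha>"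
proof (rule nth_equalityI)
  fix i assume "i < length (acomp \<gamma> (acomp \<beta> \<alpha>))"
  moreover from this have "\<alpha> ! i \<le> atrg \<alpha>" using act_le_atrg[of \<alpha> i] act_nth(2)[of \<alpha>] assms by simp
  ultimately show "acomp \<gamma> (acomp \<beta> \<alpha>) ! i = acomp (acomp \<gamma> \<beta>) \<alpha> ! i"
    using assms act_nth(2)[OF assms(3)] by (simp add: acomp_nth)
qed simp

lemma acomp_aid:
  assumes "act \<alpha>"
  shows "acomp (aid (atrg \<alpha>)) \<alpha> = \<alpha>" "acomp \<alpha> (aid (asrc \<alpha>)) = \<alpha>"
proof -
  have "\<alpha> ! i \<le> atrg \<alpha>" if "i < length \<alpha>" for i using that act_le_atrg[OF assms, of i] act_nth(2)[OF assms] by simp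
  then show "acomp (aid (atrg \<alpha>)) \<alpha> = \<alpha>" by (intro nth_equalityI) (auto simp: acomp_nth)
  show "acomp \<alpha> (aid (asrc \<alpha>)) = \<alpha>"
    using act_nth(2)[OF assms] by (intro nth_equalityI) (auto simp: acomp_nth)
qed

section \<open>Restriction to intervals, paths and cuts of chains\<close>

definition restr :: "nat list \<Rightarrow> nat \<Rightarrow> nat \<Rightarrow> nat list" where
  "restr \<alpha> x y = map (\<lambda>v. v - \<alpha> ! x) (take (y - x + 1) (drop x \<alpha>))"

lemma restr_nth:
  assumes "act \<alpha>" "x \<le> y" "y \<le> asrc \<alpha>" "i \<le> y - x"
  shows "restr \<alpha> x y ! i = \<alpha> ! (x + i) - \<alpha> ! x"
  using assms act_nth(2)[OF assms(1)] by (simp add: restr_def)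

lemma restr_act:
  assumes "act \<alpha>" "x < y" "y \<le> asrc \<alpha>"
  shows "act (restr \<alpha> x y)" "asrc (restr \<alpha> x y) = y - x" "atrg (restr \<alpha> x y) = \<alpha> ! y - \<alpha> ! x"
proof -
  have "length (restr \<alpha> x y) = (y - x) + 1" using assms act_nth(2)[OF assms(1)] by (simp add: restr_def)
  moreover have "restr \<alpha> x y ! i < restr \<alpha> x y ! (i + 1)" if "i < y - x" for i
    using that assms restr_nth[OF assms(1), of x y i] restr_nth[OF assms(1), of x y "i + 1"]
      act_nth(5)[OF assms(1), of "x + i" "x + (i + 1)"] act_mono[OF assms(1), of x "x + i"]
    by (auto intro: diff_less_mono)
  moreover have "restr \<alpha> x y ! 0 = 0" "restr \<alpha> x y ! (y - x) = \<alpha> ! y - \<alpha> ! x"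
    using assms restr_nth[of \<alpha> x y] by auto
  ultimately show "act (restr \<alpha> x y)" "asrc (restr \<alpha> x y) = y - x" "atrg (restr \<alpha> x y) = \<alpha> ! y - \<alpha> ! x"
    using actI[of "restr \<alpha> x y" "y - x"] assms by auto
qed

lemma restr_acomp:
  assumes "act \<alpha>" "act \<beta>" "atrg \<alpha> = asrc \<beta>" "x < y" "y \<le> asrc \<alpha>"
  shows "restr (acomp \<beta> \<alpha>) x y = acomp (restr \<beta> (\<alpha> ! x) (\<alpha> ! y)) (restr \<alpha> x y)"
proof (rule nth_equalityI)
  have a: "act (acomp \<beta> \<alpha>)" "asrc (acomp \<beta> \<alpha>) = asrc \<alpha>" using acomp_act[OF assms(1-3)] by auto
  have l: "length (restr (acomp \<beta> \<alpha>) x y) = y - x + 1" "length (restr \<alpha> x y) = y - x + 1"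
    using restr_act[of "acomp \<beta> \<alpha>" x y] restr_act[of \<alpha> x y] a assms act_nth(2) by fastforce+
  then show "length (restr (acomp \<beta> \<alpha>) x y) = length (acomp (restr \<beta> (\<alpha> ! x) (\<alpha> ! y)) (restr \<alpha> x y))" by simp
  fix i assume "i < length (restr (acomp \<beta> \<alpha>) x y)"
  then have i: "i \<le> y - x" using l by simp
  have m: "\<alpha> ! x \<le> \<alpha> ! (x + i)" "\<alpha> ! (x + i) \<le> \<alpha> ! y" "\<alpha> ! y \<le> asrc \<beta>"
    using i assms act_mono[OF assms(1)] act_le_atrg[OF assms(1)] by (auto simp flip: assms(3))
  have len: "length \<alpha> = asrc \<alpha> + 1" using act_nth(2) assms by auto
  show "restr (acomp \<beta> \<alpha>) x y ! i = acomp (restr \<beta> (\<alpha> ! x) (\<alpha> ! y)) (restr \<alpha> x y) ! i"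
    using i l m assms a len restr_nth[of "acomp \<beta> \<alpha>" x y i] restr_nth[of \<alpha> x y i]
      restr_nth[of \<beta> "\<alpha> ! x" "\<alpha> ! y" "\<alpha> ! (x + i) - \<alpha> ! x"]
    by (simp add: acomp_nth)
qed

lemma restr_restr:
  assumes "act \<alpha>" "a \<le> b" "b \<le> asrc \<alpha>" "x \<le> y" "a + y \<le> b"
  shows "restr (restr \<alpha> a b) x y = restr \<alpha> (a + x) (a + y)"
proof (rule nth_equalityI)
  have len: "length \<alpha> = asrc \<alpha> + 1" using act_nth(2) assms by auto
  then show "length (restr (restr \<alpha> a b) x y) = length (restr \<alpha> (a + x) (a + y))"
    using assms by (simp add: restr_def)
  fix i assume "i < length (restr (restr \<alpha> a b) x y)"
  then have i: "i \<le> y - x" by (simp add: restr_def)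
  have m: "\<alpha> ! a \<le> \<alpha> ! (a + x)" "\<alpha> ! (a + x) \<le> \<alpha> ! (a + x + i)"
    using i assms act_mono[OF assms(1)] by auto
  have "restr (restr \<alpha> a b) x y ! i = restr \<alpha> a b ! (x + i) - restr \<alpha> a b ! x"
    using i assms len by (simp add: restr_def)
  then show "restr (restr \<alpha> a b) x y ! i = restr \<alpha> (a + x) (a + y) ! i"
    using i assms m restr_nth[of \<alpha> a b "x + i"] restr_nth[of \<alpha> a b x] restr_nth[of \<alpha> "a + x" "a + y" i]
    by (simp add: add.assoc)
qed

text \<open>Recursive form of the composability conditions in \<open>nerve\<close>, made for
  induction on the list. The empty path demands m > 0 so that every object on a path is
  positive.\<close>

fun cpath :: "nat \<Rightarrow> chain \<Rightarrow> bool" where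
  "cpath m [] \<longleftrightarrow> m > 0"
| "cpath m (\<alpha> # as) \<longleftrightarrow> act \<alpha> \<and> asrc \<alpha> = m \<and> cpath (atrg \<alpha>) as"

fun pend :: "nat \<Rightarrow> chain \<Rightarrow> nat" where
  "pend m [] = m"
| "pend m (\<alpha> # as) = pend (atrg \<alpha>) as"

lemma cpath_pos: "cpath m as \<Longrightarrow> m > 0"
  using act_nth(1) by (cases as) auto

lemma cpath_append [simp]: "cpath m (as @ bs) \<longleftrightarrow> cpath m as \<and> cpath (pend m as) bs"
  by (induction m as rule: cpath.induct) (auto dest: cpath_pos)

lemma pend_append [simp]: "pend m (as @ bs) = pend (pend m as) bs"
  by (induction m as rule: pend.induct) auto

lemma pend_last: "as \<noteq> [] \<Longrightarrow> pend m as = atrg (last as)"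
  by (induction m as rule: pend.induct) auto

lemma cpath_pend_pos: "cpath m as \<Longrightarrow> pend m as > 0"
  by (induction m as rule: cpath.induct) auto

lemma nerve_iff: "c \<in> nerve j k n \<longleftrightarrow> length c = n + 2 \<and> cpath j c \<and> pend j c = k"
proof -
  \<comment> \<open>Stated for length n + 1 rather than n + 2, so that the induction on the list can
    start from a single morphism.\<close>
  have "(\<forall>\<alpha>\<in>set c. act \<alpha>) \<and> (\<forall>t<n. atrg (c ! t) = asrc (c ! (t + 1))) \<and> asrc (hd c) = j \<longleftrightarrow> cpath j c"
    if "length c = n + 1" for n
    using that
  proof (induction c arbitrary: j n)
    case (Cons \<alpha> c)
    show ?case
    proof (cases n)
      case 0
      then show ?thesis using Cons act_atrg_pos by auto
    next
      case (Suc n')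
      then have "c \<noteq> []" "length c = n' + 1" using Cons by auto
      then show ?thesis
        using Suc Cons.IH[of n' "atrg \<alpha>"] by (auto simp: All_less_Suc2 hd_conv_nth)
    qed
  qed simp
  from this[of "n + 1"] show ?thesis
    using pend_last[of c j] by (cases "c = []") (auto simp: nerve_def less_Suc_eq_le)
qed

lemma path_act:
  assumes "cpath m as"
  shows "act (path m as)" "asrc (path m as) = m" "atrg (path m as) = pend m as"
  using assms by (induction m as rule: cpath.induct) (auto simp: acomp_act)

lemma path_append:
  "cpath m as \<Longrightarrow> cpath (pend m as) bs \<Longrightarrow> path m (as @ bs) = acomp (path (pend m as) bs) (path m as)"
proof (induction m as rule: cpath.induct)
  case (1 m)
  then show ?case using acomp_aid(2)[of "path m bs"] path_act[of m bs] by simp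
next
  case (2 m \<alpha> as)
  then show ?case using acomp_assoc[of \<alpha> "path (atrg \<alpha>) as"] path_act[of "atrg \<alpha>" as] by auto
qed

lemma cut_Cons: "cut x y (\<alpha> # c) = restr \<alpha> x y # cut (\<alpha> ! x) (\<alpha> ! y) c"
  by (simp add: restr_def)

lemma cut_length [simp]: "length (cut x y c) = length c"
  by (induction x y c rule: cut.induct) auto

text \<open>Cutting commutes with composition by \<open>restr_acomp\<close>: the recursion of
  \<open>cut\<close> passes on the image of the interval, which is where the next map has to be
  restricted.\<close>

lemma cut_cpath:
  assumes "cpath m c" "x < y" "y \<le> m"
  shows "cpath (y - x) (cut x y c)" "path (y - x) (cut x y c) = restr (path m c) x y"
    "pend (y - x) (cut x y c) = path m c ! y - path m c ! x"
proof -
  have "cpath (y - x) (cut x y c) \<and> path (y - x) (cut x y c) = restr (path m c) x y"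
    using assms
  proof (induction x y c arbitrary: m rule: cut.induct)
    case (1 x y)
    have "aid (y - x) = restr (aid m) x y"
      using 1 restr_act[of "aid m" x y] act_nth(2)[of "restr (aid m) x y"]
      by (intro nth_equalityI) (auto simp: restr_nth)
    then show ?case using 1 by simp
  next
    case (2 x y \<alpha> c)
    have xy: "\<alpha> ! x < \<alpha> ! y" "\<alpha> ! y \<le> atrg \<alpha>"
      using 2 act_nth(5)[of \<alpha> x y] act_le_atrg[of \<alpha> y] by auto
    then have IH: "cpath (\<alpha> ! y - \<alpha> ! x) (cut (\<alpha> ! x) (\<alpha> ! y) c)"
      "path (\<alpha> ! y - \<alpha> ! x) (cut (\<alpha> ! x) (\<alpha> ! y) c) = restr (path (atrg \<alpha>) c) (\<alpha> ! x) (\<alpha> ! y)"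
      using 2 by auto
    show ?case
      using 2 IH restr_act[of \<alpha> x y] xy path_act[of "atrg \<alpha>" c]
        restr_acomp[of \<alpha> "path (atrg \<alpha>) c" x y]
      by (auto simp: cut_Cons simp del: cut.simps)
  qed
  then show "cpath (y - x) (cut x y c)" "path (y - x) (cut x y c) = restr (path m c) x y" by auto
  then show "pend (y - x) (cut x y c) = path m c ! y - path m c ! x"
    using path_act(3)[of "y - x" "cut x y c"] restr_act[of "path m c" x y] path_act[OF assms(1)] assms by auto
qed

lemma cut_append:
  assumes "cpath m as" "y \<le> m" "x \<le> y"
  shows "cut x y (as @ bs) = cut x y as @ cut (path m as ! x) (path m as ! y) bs"
  using assms
proof (induction x y as arbitrary: m rule: cut.induct)
  case (2 x y \<alpha> c)
  then have "\<alpha> ! x \<le> \<alpha> ! y" "\<alpha> ! y \<le> atrg \<alpha>"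
    using act_mono[of \<alpha> x y] act_le_atrg[of \<alpha> y] by auto
  moreover have "path m (\<alpha> # c) ! x = path (atrg \<alpha>) c ! (\<alpha> ! x)" "path m (\<alpha> # c) ! y = path (atrg \<alpha>) c ! (\<alpha> ! y)"
    using 2 act_nth(2)[of \<alpha>] by (auto simp: acomp_nth)
  ultimately show ?case using 2 by simp
qed simp

lemma cut_cut:
  assumes "cpath m c" "a < b" "b \<le> m" "x < y" "a + y \<le> b"
  shows "cut x y (cut a b c) = cut (a + x) (a + y) c"
  using assms
proof (induction a b c arbitrary: m x y rule: cut.induct)
  case (2 a b \<alpha> c)
  let ?x = "restr \<alpha> a b ! x" and ?y = "restr \<alpha> a b ! y"
  have e: "?x = \<alpha> ! (a + x) - \<alpha> ! a" "?y = \<alpha> ! (a + y) - \<alpha> ! a"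
    using 2 restr_nth[of \<alpha> a b x] restr_nth[of \<alpha> a b y] by auto
  have m: "\<alpha> ! a \<le> \<alpha> ! (a + x)" "\<alpha> ! (a + x) < \<alpha> ! (a + y)" "\<alpha> ! (a + y) \<le> \<alpha> ! b" "\<alpha> ! b \<le> atrg \<alpha>" "\<alpha> ! a < \<alpha> ! b"
    using 2 act_mono[of \<alpha> a "a + x"] act_mono[of \<alpha> "a + y" b] act_nth(5)[of \<alpha> "a + x" "a + y"] act_nth(5)[of \<alpha> a b] act_le_atrg[of \<alpha> b] by auto
  have "cut ?x ?y (cut (\<alpha> ! a) (\<alpha> ! b) c) = cut (\<alpha> ! a + ?x) (\<alpha> ! a + ?y) c"
    using 2 m e by (intro "2.IH"[of "atrg \<alpha>"]) auto
  then show ?case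
    using 2 m e restr_restr[of \<alpha> a b x y] unfolding cut_Cons by simp
qed simp

lemma cut_full:
  assumes "cpath m c"
  shows "cut 0 m c = c"
  using assms
proof (induction c arbitrary: m)
  case (Cons \<alpha> c)
  have "restr \<alpha> 0 m = \<alpha>"
    using Cons act_nth(2)[of \<alpha>] act_nth(3)[of \<alpha>] by (simp add: restr_def)
  then show ?case using Cons act_nth(3,4)[of \<alpha>] by (auto simp: cut_Cons simp del: cut.simps)
qed simp

text \<open>The simplicial operator \<open>nop \<theta>\<close> cuts a chain into a first segment of length \<open>hd \<theta> + 1\<close>, segments
  of lengths \<open>lens \<theta>\<close> and a last segment, and composes each of them.\<close>

fun pseg :: "nat \<Rightarrow> chain list \<Rightarrow> chain" where
  "pseg m [] = []"
| "pseg m (s # ss) = path m s # pseg (pend m s) ss"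

fun splt :: "nat list \<Rightarrow> chain \<Rightarrow> chain list" where
  "splt [] c = [c]"
| "splt (l # ls) c = take l c # splt ls (drop l c)"

fun lens :: "nat list \<Rightarrow> nat list" where
  "lens [] = []"
| "lens [t] = []"
| "lens (t # t' # ts) = (t' - t) # lens (t' # ts)"

lemma splt_concat [simp]: "concat (splt ls c) = c"
  by (induction ls c rule: splt.induct) auto

lemma splt_length [simp]: "length (splt ls c) = length ls + 1"
  by (induction ls c rule: splt.induct) auto

lemma lens_length [simp]: "length (lens \<theta>) = length \<theta> - 1"
  by (induction \<theta> rule: lens.induct) auto

lemma pseg_length [simp]: "length (pseg m ss) = length ss"
  by (induction m ss rule: pseg.induct) auto

lemma pseg_cpath:
  "cpath m (concat ss) \<Longrightarrow> cpath m (pseg m ss) \<and> pend m (pseg m ss) = pend m (concat ss) \<and> path m (pseg m ss) = path m (concat ss)"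
proof (induction m ss rule: pseg.induct)
  case (2 m s ss)
  then show ?case using path_act[of m s] path_append[of m s "concat ss"] by auto
qed auto

text \<open>\<open>nop\<close> is written with absolute positions. The segment form involves only
  the gaps of \<theta> and is stable under dropping an initial segment, which makes inductions
  possible.\<close>

lemma nop_pseg:
  assumes "cpath j c" "\<theta> \<in> mono_maps m n" "length c = n + 2"
  shows "nop \<theta> c = pseg j (splt ((hd \<theta> + 1) # lens \<theta>) c)"
proof -
  have pend: "pend j (take (t + 1) c) = atrg (c ! t)" if "t < length c" for t
    using that pend_last[of "take (t + 1) c" j] by (simp add: take_Suc_conv_app_nth)
  \<comment> \<open>Proved for an arbitrary \<theta>, so that the induction may pass to its
    suffixes.\<close>
  have tl: "map (\<lambda>t. path (atrg (c ! (\<theta> ! t))) (take (\<theta> ! (t + 1) - \<theta> ! t) (drop (\<theta> ! t + 1) c))) [0..<length \<theta> - 1]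
      @ [path (atrg (c ! last \<theta>)) (drop (last \<theta> + 1) c)] = pseg (atrg (c ! hd \<theta>)) (splt (lens \<theta>) (drop (hd \<theta> + 1) c))"
    if "\<theta> \<noteq> []" "sorted \<theta>" "set \<theta> \<subseteq> {0..n}" for \<theta>
    using that
  proof (induction \<theta> rule: lens.induct)
    case (3 t t' ts)
    have tt: "t \<le> t'" "t' \<le> n" using 3 by auto
    have "pend (atrg (c ! t)) (take (t' - t) (drop (t + 1) c)) = pend j (take (t + 1) c @ take (t' - t) (drop (t + 1) c))"
      using pend[of t] tt assms by simp
    also have "take (t + 1) c @ take (t' - t) (drop (t + 1) c) = take (t' + 1) c"
      using tt take_add[of "t + 1" "t' - t" c] by simp
    also have "pend j \<dots> = atrg (c ! t')"
      using pend[of t'] tt assms by simp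
    finally have p: "pend (atrg (c ! t)) (take (t' - t) (drop (t + 1) c)) = atrg (c ! t')" .
    have u: "[0..<length (t # t' # ts) - 1] = 0 # map Suc [0..<length (t' # ts) - 1]"
      by (simp add: map_Suc_upt upt_conv_Cons del: upt_Suc)
    show ?case
      unfolding u using 3 tt p by (simp add: comp_def)
  qed simp_all
  have hd: "asrc (hd c) = j" using assms(1,3) by (cases c) auto
  have "hd \<theta> \<le> n" using assms(2) by (cases \<theta>) (auto simp: mono_maps_def)
  then have p: "pend j (take (hd \<theta> + 1) c) = atrg (c ! hd \<theta>)" using pend[of "hd \<theta>"] assms by simp
  have "\<theta> \<noteq> []" "sorted \<theta>" "set \<theta> \<subseteq> {0..n}" using assms(2) by (auto simp: mono_maps_def)
  from tl[OF this] show ?thesis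
    unfolding nop_def hd by (simp add: p[simplified])
qed

lemma nop_nerve:
  assumes "c \<in> nerve j k n" "\<theta> \<in> mono_maps m n"
  shows "nop \<theta> c \<in> nerve j k m" "path j (nop \<theta> c) = path j c"
  using assms pseg_cpath[of j "splt ((hd \<theta> + 1) # lens \<theta>) c"] nop_pseg[of j c \<theta> m n] mono_maps_nth(3)[OF assms(2)]
  unfolding nerve_iff by (auto simp del: splt.simps)

fun csegs :: "nat \<Rightarrow> nat \<Rightarrow> nat \<Rightarrow> chain list \<Rightarrow> chain list" where
  "csegs m x y [] = []"
| "csegs m x y (s # ss) = cut x y s # csegs (pend m s) (path m s ! x) (path m s ! y) ss"

lemma csegs_splt:
  assumes "cpath m c" "x < y" "y \<le> m"
  shows "csegs m x y (splt ls c) = splt ls (cut x y c)"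
  using assms
proof (induction ls c arbitrary: m x y rule: splt.induct)
  case (2 l ls c)
  have c: "cpath m (take l c)" "cpath (pend m (take l c)) (drop l c)"
    using 2(2) by (metis append_take_drop_id cpath_append)+
  let ?p = "path m (take l c)"
  have p: "?p ! x < ?p ! y" "?p ! y \<le> pend m (take l c)"
    using path_act[OF c(1)] act_nth(5)[of ?p x y] act_le_atrg[of ?p y] 2 by auto
  have "cut x y c = cut x y (take l c) @ cut (?p ! x) (?p ! y) (drop l c)"
    using cut_append[OF c(1), of y x "drop l c"] 2 by simp
  moreover have "length (cut x y (take l c)) = min (length c) l" by simp
  ultimately have "take l (cut x y c) = cut x y (take l c)" "drop l (cut x y c) = cut (?p ! x) (?p ! y) (drop l c)"
    by (auto simp: min_def)
  then show ?case using 2(1)[OF c(2) p] by simp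
qed simp

lemma cut_pseg:
  assumes "cpath m (concat ss)" "x < y" "y \<le> m"
  shows "cut x y (pseg m ss) = pseg (y - x) (csegs m x y ss)"
  using assms
proof (induction ss arbitrary: m x y)
  case (Cons s ss)
  have c: "cpath m s" "cpath (pend m s) (concat ss)" using Cons by auto
  let ?p = "path m s"
  have p: "?p ! x < ?p ! y" "?p ! y \<le> pend m s"
    using path_act[OF c(1)] act_nth(5)[of ?p x y] act_le_atrg[of ?p y] Cons by auto
  show ?case
    using Cons.IH[OF c(2) p] cut_cpath[OF c(1)] Cons.prems by (simp add: cut_Cons del: cut.simps)
qed simp

text \<open>Cutting treats each segment separately (\<open>csegs\<close>) and commutes with
  composing a segment, so the two operations can be exchanged. This makes the decomposition into
  blocks compatible with simplicial operators.\<close>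

lemma cut_nop:
  assumes "c \<in> nerve j k n" "\<theta> \<in> mono_maps m n" "x < y" "y \<le> j"
  shows "cut x y (nop \<theta> c) = nop \<theta> (cut x y c)"
proof -
  have c: "cpath j c" "length c = n + 2" using assms by (auto simp: nerve_iff)
  show ?thesis
    using nop_pseg[OF c(1) assms(2) c(2)] nop_pseg[OF cut_cpath(1)[OF c(1) assms(3,4)] assms(2)] c
      cut_pseg[of j "splt ((hd \<theta> + 1) # lens \<theta>) c" x y] csegs_splt[OF c(1) assms(3,4)] assms
    by (simp del: splt.simps)
qed

lemma cut_nerve:
  assumes "c \<in> nerve j k n" "x < y" "y \<le> j"
  shows "cut x y c \<in> nerve (y - x) (path j c ! y - path j c ! x) n"
  using assms cut_cpath[of j c x y] by (simp add: nerve_iff)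

lemma nerve_cend: "c \<in> nerve j k n \<Longrightarrow> cend c = k"
  and nerve_cdim: "c \<in> nerve j k n \<Longrightarrow> cdim c = n"
  and nerve_pos: "c \<in> nerve j k n \<Longrightarrow> j > 0 \<and> k > 0"
  using pend_last[of c j] cpath_pend_pos[of j c] cpath_pos[of j c]
  by (cases "c = []"; auto simp: nerve_iff cend_def cdim_def)+

lemma nerve_hd: "c \<in> nerve j k n \<Longrightarrow> asrc (hd c) = j"
  by (cases c) (auto simp: nerve_iff)

definition adiffs :: "nat list \<Rightarrow> nat list" where
  "adiffs \<alpha> = map (\<lambda>i. \<alpha> ! (i + 1) - \<alpha> ! i) [0..<asrc \<alpha>]"

lemma adiffs:
  assumes "act \<alpha>"
  shows "length (adiffs \<alpha>) = asrc \<alpha>" "\<forall>k\<in>set (adiffs \<alpha>). k > 0" "sum_list (adiffs \<alpha>) = atrg \<alpha>" "adiffs \<alpha> \<noteq> []"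
proof -
  show "length (adiffs \<alpha>) = asrc \<alpha>" by (simp add: adiffs_def)
  then show "adiffs \<alpha> \<noteq> []" using act_nth(1)[OF assms] by auto
  show "\<forall>k\<in>set (adiffs \<alpha>). k > 0" using act_nth(5)[OF assms] by (auto simp: adiffs_def)
  have "sum_list (map (\<lambda>i. \<alpha> ! (i + 1) - \<alpha> ! i) [0..<t]) = \<alpha> ! t" if "t \<le> asrc \<alpha>" for t
    using that
  proof (induction t)
    case 0 then show ?case using act_nth(3)[OF assms] by simp
  next
    case (Suc t)
    then show ?case using act_mono[OF assms, of t "Suc t"] by simp
  qed
  then show "sum_list (adiffs \<alpha>) = atrg \<alpha>" using act_nth(4)[OF assms] by (simp add: adiffs_def)
qed

lemma blocks_nth:
  assumes "c \<in> nerve j k n"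
  shows "blocks c = map (\<lambda>i. cut i (i + 1) c) [0..<j]" "length (blocks c) = j"
  using nerve_hd[OF assms] by (simp_all add: blocks_def)

lemma blocks_nerve:
  assumes "c \<in> nerve j k n" "b \<in> set (blocks c)"
  shows "b \<in> nerve 1 (cend b) n"
proof -
  obtain i where i: "i < j" "b = cut i (i + 1) c" using assms by (auto simp: blocks_nth)
  then have "b \<in> nerve (i + 1 - i) (path j c ! (i + 1) - path j c ! i) n"
    using cut_nerve[OF assms(1), of i "i + 1"] by simp
  then show ?thesis using nerve_cend by fastforce
qed

lemma blocks_cend:
  assumes "c \<in> nerve j k n"
  shows "map cend (blocks c) = adiffs (path j c)" "sum_list (map cend (blocks c)) = k"
proof -
  have p: "act (path j c)" "asrc (path j c) = j" "atrg (path j c) = k"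
    using assms path_act[of j c] by (auto simp: nerve_iff)
  have "cend (cut i (i + 1) c) = path j c ! (i + 1) - path j c ! i" if "i < j" for i
    using cut_nerve[OF assms, of i "i + 1"] that nerve_cend by fastforce
  then show *: "map cend (blocks c) = adiffs (path j c)"
    using p by (auto simp: adiffs_def blocks_nth[OF assms])
  show "sum_list (map cend (blocks c)) = k"
    unfolding * using adiffs(3)[OF p(1)] p by simp
qed

lemma blocks_nop:
  assumes "c \<in> nerve j k n" "\<theta> \<in> mono_maps m n"
  shows "blocks (nop \<theta> c) = map (nop \<theta>) (blocks c)"
  using cut_nop[OF assms] by (simp add: blocks_nth[OF assms(1)] blocks_nth[OF nop_nerve(1)[OF assms]])

lemma blocks_single:
  assumes "c \<in> nerve 1 k n"
  shows "blocks c = [c]"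
  using assms cut_full[of 1 c] by (simp add: blocks_nth[OF assms] nerve_iff)

text \<open>Recursion over the number of blocks: the later blocks are the blocks of the chain cut
  over all intervals but the first. It is what reduces a tensor product over Suc m blocks to two
  factors.\<close>

lemma blocks_split:
  assumes "c \<in> nerve (Suc m) k n" "m > 0"
  shows "blocks c = cut 0 1 c # blocks (cut 1 (Suc m) c)"
proof -
  have "cut 1 (Suc m) c \<in> nerve m (path (Suc m) c ! Suc m - path (Suc m) c ! 1) n"
    using cut_nerve[OF assms(1), of 1 "Suc m"] assms by simp
  moreover have "cut i (i + 1) (cut 1 (Suc m) c) = cut (Suc i) (Suc i + 1) c" if "i < m" for i
    using that assms cut_cut[of "Suc m" c 1 "Suc m" i "i + 1"] by (simp add: nerve_iff)
  ultimately show ?thesis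
    using assms by (simp add: blocks_nth upt_conv_Cons flip: map_Suc_upt del: upt_Suc)
qed

lemma cpost_nerve:
  assumes "c \<in> nerve j k n" "act \<beta>" "asrc \<beta> = k"
  shows "cpost \<beta> c \<in> nerve j (atrg \<beta>) n"
proof -
  have "c \<noteq> []" using assms by (auto simp: nerve_iff)
  then obtain as \<alpha> where c: "c = as @ [\<alpha>]" by (metis append_butlast_last_id)
  with assms show ?thesis
    using acomp_act[of \<alpha> \<beta>] act_atrg_pos[of \<beta>] by (auto simp: nerve_iff cpost_def)
qed

lemma cpre_nerve:
  assumes "c \<in> nerve j k n" "act \<alpha>" "atrg \<alpha> = j"
  shows "cpre c \<alpha> \<in> nerve (asrc \<alpha>) k n"
proof -
  obtain \<beta> as where c: "c = \<beta> # as" using assms by (cases c) (auto simp: nerve_iff)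
  with assms show ?thesis
    using acomp_act[of \<alpha> \<beta>] by (auto simp: nerve_iff cpre_def)
qed

context abelian_tensor_category
begin

section \<open>Coherent transformations\<close>

lemma dg_coalgebraD:
  assumes "dg_coalgebra X"
  shows "dgc X" "cplx (cx X)" "cmap (cx X) (cten (cx X) (cx X)) (cmul X)" "low (gr (cx X)) = 0"
proof -
  show "dgc X" using assms by (rule dg_coalgebra_dgc)
  show *: "cplx (cx X)" "low (gr (cx X)) = 0"
    using assms by (auto simp: dg_coalgebra_def nonneg_complex_def complex_cplx)
  have "chain_map (cx X) (cten (cx X) (cx X)) (cmul X)"
    using assms by (simp add: dg_coalgebra_def)
  then show "cmap (cx X) (cten (cx X) (cx X)) (cmul X)"
    using * by (simp add: chain_map_iff cten_simps)
qed

lemma coalgebra_homD: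
  assumes "dg_coalgebra X" "dg_coalgebra Y" "f \<in> coalgebra_hom X Y"
  shows "cmap (cx X) (cx Y) f" "gm f" "gsrc f = gr (cx X)" "gtgt f = gr (cx Y)" "gdeg f = 0" "(f \<odot> f) \<star> cmul X = cmul Y \<star> f"
proof -
  show *: "cmap (cx X) (cx Y) f"
    using assms dg_coalgebraD(2)[OF assms(1)] dg_coalgebraD(2)[OF assms(2)]
    by (auto simp: coalgebra_hom_def chain_map_iff)
  from cmapD[OF *] show "gm f" "gsrc f = gr (cx X)" "gtgt f = gr (cx Y)" "gdeg f = 0" by auto
  show "(f \<odot> f) \<star> cmul X = cmul Y \<star> f" using assms by (auto simp: coalgebra_hom_def)
qed

lemma comap_cmuls: "comap X \<alpha> = cmuls X (adiffs \<alpha>)"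
  by (simp add: comap_def cmuls_def adiffs_def Let_def comp_def)

lemma adiffs_one:
  assumes "act \<alpha>" "asrc \<alpha> = 1"
  shows "adiffs \<alpha> = [atrg \<alpha>]"
  using adiffs[OF assms(1)] assms by (cases "adiffs \<alpha>") auto

lemma comap_one [simp]: "act \<alpha> \<Longrightarrow> asrc \<alpha> = 1 \<Longrightarrow> comap X \<alpha> = icmul X (atrg \<alpha>)"
  by (simp add: comap_cmuls adiffs_one cmuls_def)

lemma act_pair: "k > 0 \<Longrightarrow> act [0, k]" "asrc [0, k] = 1" "atrg [0, k] = k"
  by (simp_all add: act_def asrc_def atrg_def)

lemma comap_pair [simp]: "comap X [0, k] = icmul X k"
  by (simp add: comap_cmuls adiffs_def asrc_def cmuls_def)

lemma mk_family_idem [simp]: "mk_family (mk_family F) = mk_family F"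
  by (auto simp: mk_family_def fun_eq_iff)

lemma mk_family_nerve: "c \<in> nerve 1 k n \<Longrightarrow> mk_family F k c = F k c"
  using nerve_pos[of c 1 k n] by (auto simp: mk_family_def)

text \<open>Typing and compatibility with simplicial operators, isolated from the chain condition
  and from (a) and (b). The multiplicative extension \<open>Phi_sdown\<close> and the formula for
  composites live on this level.\<close>

definition sfam :: "'a graded \<Rightarrow> 'a graded \<Rightarrow> ('a, 'b) family \<Rightarrow> bool" where
  "sfam A B \<mu> \<longleftrightarrow> (\<forall>k n. \<forall>c\<in>nerve 1 k n.
     (gmor (\<mu> k c) (sgr n A) (gpow B k) 0) \<and>
     (\<forall>m. \<forall>\<theta>\<in>mono_maps m n. \<mu> k (nop \<theta> c) = \<mu> k c \<star> sobj m n A \<theta>))"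

lemma sfam_typing:
  assumes "sfam A B \<mu>" "c \<in> nerve 1 k n"
  shows "gm (\<mu> k c)" "gsrc (\<mu> k c) = sgr n A" "gtgt (\<mu> k c) = gpow B k" "gdeg (\<mu> k c) = 0"
  using assms unfolding sfam_def by blast+

lemma sfam_nop: "sfam A B \<mu> \<Longrightarrow> c \<in> nerve 1 k n \<Longrightarrow> \<theta> \<in> mono_maps m n \<Longrightarrow> \<mu> k (nop \<theta> c) = \<mu> k c \<star> sobj m n A \<theta>"
  unfolding sfam_def by blast

lemma CohD:
  assumes "cplx (cx X)" "cplx (cx Y)" "\<mu> \<in> Coh X Y"
  shows "sfam (gr (cx X)) (gr (cx Y)) \<mu>"
    "c \<in> nerve 1 k n \<Longrightarrow> \<mu> k c \<in> shom n (cx X) (cpow (cx Y) k)"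
    "c \<in> nerve 1 k n \<Longrightarrow> act \<beta> \<Longrightarrow> asrc \<beta> = k \<Longrightarrow> \<mu> (atrg \<beta>) (cpost \<beta> c) = comap Y \<beta> \<star> \<mu> k c"
    "c \<in> nerve j k n \<Longrightarrow> act \<alpha> \<Longrightarrow> asrc \<alpha> = 1 \<Longrightarrow> atrg \<alpha> = j \<Longrightarrow> \<mu> k (cpre c \<alpha>) = fext X Y \<mu> c \<star> smap n (icmul X j)"
proof -
  have *: "c \<in> nerve 1 k n \<Longrightarrow> \<mu> k c \<in> shom n (cx X) (cpow (cx Y) k)" for k n c
    using assms(3) nerve_pos[of c 1 k n] unfolding Coh_def by simp
  have **: "c \<in> nerve 1 k n \<Longrightarrow> \<theta> \<in> mono_maps m n \<Longrightarrow> \<mu> k (nop \<theta> c) = \<mu> k c \<star> sobj m n (gr (cx X)) \<theta>" for k m n c \<theta>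
    using assms(3) nerve_pos[of c 1 k n] unfolding Coh_def by simp
  have "gmor (\<mu> k c) (sgr n (gr (cx X))) (gpow (gr (cx Y)) k) 0"
    if "c \<in> nerve 1 k n" for k n c
    using *[OF that] assms by (simp add: shom_iff)
  with ** show "sfam (gr (cx X)) (gr (cx Y)) \<mu>"
    unfolding sfam_def by blast
  show "c \<in> nerve 1 k n \<Longrightarrow> \<mu> k c \<in> shom n (cx X) (cpow (cx Y) k)" by (rule *)
  show "c \<in> nerve 1 k n \<Longrightarrow> act \<beta> \<Longrightarrow> asrc \<beta> = k \<Longrightarrow> \<mu> (atrg \<beta>) (cpost \<beta> c) = comap Y \<beta> \<star> \<mu> k c"
    using assms(3) nerve_pos[of c 1 k n] unfolding Coh_def by simp
  show "c \<in> nerve j k n \<Longrightarrow> act \<alpha> \<Longrightarrow> asrc \<alpha> = 1 \<Longrightarrow> atrg \<alpha> = j \<Longrightarrow> \<mu> k (cpre c \<alpha>) = fext X Y \<mu> c \<star> smap n (icmul X j)"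
    using assms(3) nerve_pos[of c j k n] comap_one[of \<alpha> X] unfolding Coh_def by simp
qed

lemma CohI:
  assumes "cplx (cx X)" "cplx (cx Y)" "\<mu> = mk_family F"
    "\<And>k n c. c \<in> nerve 1 k n \<Longrightarrow> F k c \<in> shom n (cx X) (cpow (cx Y) k)"
    "\<And>k m n c \<theta>. c \<in> nerve 1 k n \<Longrightarrow> \<theta> \<in> mono_maps m n \<Longrightarrow> F k (nop \<theta> c) = F k c \<star> sobj m n (gr (cx X)) \<theta>"
    "\<And>k n c \<beta>. c \<in> nerve 1 k n \<Longrightarrow> act \<beta> \<Longrightarrow> asrc \<beta> = k \<Longrightarrow> F (atrg \<beta>) (cpost \<beta> c) = comap Y \<beta> \<star> F k c"
    "\<And>j k n c \<alpha>. c \<in> nerve j k n \<Longrightarrow> act \<alpha> \<Longrightarrow> asrc \<alpha> = 1 \<Longrightarrow> atrg \<alpha> = j \<Longrightarrow> F k (cpre c \<alpha>) = fext X Y \<mu> c \<star> smap n (icmul X j)"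
  shows "\<mu> \<in> Coh X Y"
proof -
  have "\<mu> k (nop \<theta> c) = \<mu> k c \<star> sobj m n (gr (cx X)) \<theta>" if "c \<in> nerve 1 k n" "\<theta> \<in> mono_maps m n" for k m n c \<theta>
    using that assms(5) nop_nerve(1)[OF that] mk_family_nerve unfolding assms(3) by simp
  moreover have "\<mu> (atrg \<beta>) (cpost \<beta> c) = comap Y \<beta> \<star> \<mu> k c" if "c \<in> nerve 1 k n" "act \<beta>" "asrc \<beta> = k" for k n c \<beta>
    using assms(6)[OF that] cpost_nerve[OF that] that mk_family_nerve unfolding assms(3) by simp
  moreover have "\<mu> k (cpre c \<alpha>) = fext X Y \<mu> c \<star> smap n (comap X \<alpha>)" if "c \<in> nerve j k n" "act \<alpha>" "asrc \<alpha> = 1" "atrg \<alpha> = j" for j k n c \<alpha>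
    using assms(7)[OF that] cpre_nerve[OF that(1,2,4)] that mk_family_nerve[of "cpre c \<alpha>" k n F] unfolding assms(3) by simp
  moreover have "\<mu> k c \<in> shom n (cx X) (cpow (cx Y) k)" if "c \<in> nerve 1 k n" for k n c
    using assms(4)[OF that] mk_family_nerve[OF that] unfolding assms(3) by simp
  ultimately show ?thesis
    unfolding Coh_def using assms(3) by simp
qed

context
  fixes X Y :: "('a, 'b) coalgebra" and \<mu> :: "('a, 'b) family"
  assumes g: "graded_object (gr (cx X))" "graded_object (gr (cx Y))" and \<mu>: "sfam (gr (cx X)) (gr (cx Y)) \<mu>"
begin

lemma fext_factors:
  assumes "c \<in> nerve j k n"
  shows "factors (sgr n (gr (cx X))) (gr (cx Y)) (map (\<lambda>b. (cend b, \<mu> (cend b) b)) (blocks c))"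
proof -
  have "blocks c \<noteq> []" using blocks_nth(2)[OF assms] nerve_pos[OF assms] by auto
  moreover have "cend b > 0 \<and> gmor (\<mu> (cend b) b) (sgr n (gr (cx X))) (gpow (gr (cx Y)) (cend b)) 0" if "b \<in> set (blocks c)" for b
    using blocks_nerve[OF assms that] sfam_typing[OF \<mu>] nerve_pos by blast
  ultimately show ?thesis by (auto simp: factors_def)
qed

lemma fext_typing:
  assumes "c \<in> nerve j k n"
  shows "gm (fext X Y \<mu> c)" "gsrc (fext X Y \<mu> c) = sgr n (gpow (gr (cx X)) j)"
    "gtgt (fext X Y \<mu> c) = gpow (gr (cx Y)) k" "gdeg (fext X Y \<mu> c) = 0"
  using stens_typing[OF g fext_factors[OF assms]] blocks_cend(2)[OF assms] blocks_nth(2)[OF assms] nerve_cdim[OF assms]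
  by (simp_all add: fext_def comp_def)

text \<open>Combines \<open>blocks_nop\<close> with \<open>stens_sobj\<close>: simpliciality extends
  from chains starting at [1] to chains starting anywhere.\<close>

lemma fext_nop:
  assumes "c \<in> nerve j k n" "\<theta> \<in> mono_maps m n"
  shows "fext X Y \<mu> (nop \<theta> c) = fext X Y \<mu> c \<star> sobj m n (gpow (gr (cx X)) j) \<theta>"
proof -
  have c': "nop \<theta> c \<in> nerve j k m" using nop_nerve(1)[OF assms] .
  have b: "cend (nop \<theta> b) = cend b \<and> \<mu> (cend b) (nop \<theta> b) = \<mu> (cend b) b \<star> sobj m n (gr (cx X)) \<theta>"
    if "b \<in> set (blocks c)" for b
    using blocks_nerve[OF assms(1) that] nop_nerve(1)[OF blocks_nerve[OF assms(1) that] assms(2)]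
      sfam_nop[OF \<mu> _ assms(2)] nerve_cend by blast
  have "map (\<lambda>b. (cend b, \<mu> (cend b) b)) (blocks (nop \<theta> c))
    = map (\<lambda>(k, \<phi>). (k, \<phi> \<star> sobj m n (gr (cx X)) \<theta>)) (map (\<lambda>b. (cend b, \<mu> (cend b) b)) (blocks c))"
    unfolding blocks_nop[OF assms] using b by simp
  then show ?thesis
    using stens_sobj[OF g fext_factors[OF assms(1)] assms(2)] nerve_cdim[OF assms(1)] nerve_cdim[OF c'] blocks_nth(2)[OF assms(1)]
    by (simp add: fext_def)
qed

lemma fext_single:
  assumes "c \<in> nerve 1 k n"
  shows "fext X Y \<mu> c = \<mu> k c"
  using blocks_single[OF assms] nerve_cend[OF assms] by (simp add: fext_def)

end

text \<open>The value on a chain depends only on its dimension and its endpoint [k], so that (a) and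
  (b) become statements about maps of degree 0 between tensor powers.\<close>

lemma coh_of_hom_Coh:
  assumes "dg_coalgebra X" "dg_coalgebra Y" "f \<in> coalgebra_hom X Y"
  shows "coh_of_hom X Y f \<in> Coh X Y"
    "c \<in> nerve 1 k n \<Longrightarrow> coh_of_hom X Y f k c = sdegen n (mpow f k \<star> icmul X k)"
proof -
  note X = dg_coalgebraD[OF assms(1)] and Y = dg_coalgebraD[OF assms(2)] and f = coalgebra_homD[OF assms]
  have ic: "cmap (cx X) (cpow (cx Y) k) (mpow f k \<star> icmul X k)" if "k > 0" for k
    using cmap_mpow[OF X(2) Y(2) f(1), of k] cmap_icmul[OF X(2,3) that] X Y by (intro cmap_gcomp[of _ "cpow (cx X) k"]) auto
  have val: "sdegen (cdim c) (mpow f k \<star> comap X [0, k]) = sdegen n (mpow f k \<star> icmul X k)" if "c \<in> nerve 1 k n" for c k n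
    using nerve_cdim[OF that] by simp
  then show val': "c \<in> nerve 1 k n \<Longrightarrow> coh_of_hom X Y f k c = sdegen n (mpow f k \<star> icmul X k)" for c k n
    unfolding coh_of_hom_def using mk_family_nerve by simp
  \<comment> \<open>Conditions (a) and (b) after removing \<open>sdegen\<close>: the second identity
    is generalized coassociativity of X, and the first one follows from it because f commutes with
    \<open>cmuls\<close>.\<close>
  have cm: "cmuls Y ks \<star> mpow f (length ks) \<star> icmul X (length ks) = mpow f (sum_list ks) \<star> icmul X (sum_list ks)"
    "mpow f (sum_list ks) \<star> cmuls X ks \<star> icmul X (length ks) = mpow f (sum_list ks) \<star> icmul X (sum_list ks)"
    if "ks \<noteq> []" "\<forall>k\<in>set ks. k > 0" for ks
  proof -
    have pos: "length ks > 0" "sum_list ks > 0" using that by (auto simp: neq_Nil_conv)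
    show *: "mpow f (sum_list ks) \<star> cmuls X ks \<star> icmul X (length ks) = mpow f (sum_list ks) \<star> icmul X (sum_list ks)"
      using cmuls_icmul[OF X(1) that] by simp
    have "cmuls Y ks \<star> mpow f (length ks) \<star> icmul X (length ks) = (cmuls Y ks \<star> mpow f (length ks)) \<star> icmul X (length ks)"
      using X(1) Y(1) f that pos by simp
    also have "\<dots> = (mpow f (sum_list ks) \<star> cmuls X ks) \<star> icmul X (length ks)"
      using cmuls_nat[OF X(1) Y(1) f(2-6) that] by simp
    finally show "cmuls Y ks \<star> mpow f (length ks) \<star> icmul X (length ks) = mpow f (sum_list ks) \<star> icmul X (sum_list ks)"
      using * X(1) Y(1) f that pos by simp
  qed
  show "coh_of_hom X Y f \<in> Coh X Y"
  proof (rule CohI[OF X(2) Y(2) coh_of_hom_def])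
    fix k n c assume c: "c \<in> nerve 1 k n"
    then have k: "k > 0" using nerve_pos by blast
    show "sdegen (cdim c) (mpow f k \<star> comap X [0, k]) \<in> shom n (cx X) (cpow (cx Y) k)"
      unfolding val[OF c] using X Y ic[OF k] by (intro shom_sdegen) auto
    fix m \<theta> assume \<theta>: "\<theta> \<in> mono_maps m n"
    show "sdegen (cdim (nop \<theta> c)) (mpow f k \<star> comap X [0, k])
        = sdegen (cdim c) (mpow f k \<star> comap X [0, k]) \<star> sobj m n (gr (cx X)) \<theta>"
      unfolding val[OF c] val[OF nop_nerve(1)[OF c \<theta>]] using X(1) f \<theta> k by (simp add: sdegen_sobj)
  next
    fix k n c \<beta> assume c: "c \<in> nerve 1 k n" and \<beta>: "act \<beta>" "asrc \<beta> = k"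
    then have k: "k > 0" "atrg \<beta> > 0" using nerve_pos act_atrg_pos by blast+
    have "comap Y \<beta> \<star> mpow f k \<star> icmul X k = mpow f (atrg \<beta>) \<star> icmul X (atrg \<beta>)"
      using cm(1)[of "adiffs \<beta>"] adiffs[OF \<beta>(1)] \<beta> by (simp add: comap_cmuls)
    then show "sdegen (cdim (cpost \<beta> c)) (mpow f (atrg \<beta>) \<star> comap X [0, atrg \<beta>])
       = comap Y \<beta> \<star> sdegen (cdim c) (mpow f k \<star> comap X [0, k])"
      unfolding val[OF c] val[OF cpost_nerve[OF c \<beta>]]
      using X(1) Y(1) f k adiffs[OF \<beta>(1)] \<beta> by (simp add: gcomp_sdegen comap_cmuls)
  next
    fix j k n c \<alpha> assume c: "c \<in> nerve j k n" and \<alpha>: "act \<alpha>" "asrc \<alpha> = 1" "atrg \<alpha> = j"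
    then have jk: "j > 0" "k > 0" using nerve_pos by blast+
    let ?A = "gr (cx X)" and ?B = "gr (cx Y)"
    define ks where "ks = map cend (blocks c)"
    have p: "act (path j c)" "asrc (path j c) = j" using c path_act[of j c] by (auto simp: nerve_iff)
    have ks: "ks \<noteq> []" "\<forall>k\<in>set ks. k > 0" "length ks = j" "sum_list ks = k"
      using adiffs[OF p(1)] p blocks_cend[OF c] by (auto simp: ks_def)
    have fac: "factors ?A ?A (map (\<lambda>k. (k, icmul X k)) ks)" using cmuls_factors[OF X(1) ks(1,2)] .
    have "fext X Y (coh_of_hom X Y f) c
       = stens n ?A ?B (map (\<lambda>(k, f). (k, sdegen n f)) (map (\<lambda>(k, g). (k, mpow f k \<star> g)) (map (\<lambda>k. (k, icmul X k)) ks)))"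
      unfolding fext_def nerve_cdim[OF c] ks_def
      by (auto intro!: arg_cong[where f="stens n ?A ?B"] val' blocks_nerve[OF c])
    also have "\<dots> = sdegen n (mtens ?B (map (\<lambda>(k, g). (k, mpow f k \<star> g)) (map (\<lambda>k. (k, icmul X k)) ks)))"
      using X(1) f ks Y(2) by (intro stens_sdegen[of ?A]) (auto simp: factors_def)
    also have "mtens ?B (map (\<lambda>(k, g). (k, mpow f k \<star> g)) (map (\<lambda>k. (k, icmul X k)) ks)) = mpow f k \<star> cmuls X ks"
      using mpow_mtens[OF fac f(2,3,5)] f(4) ks by (simp add: cmuls_def comp_def)
    finally have fe: "fext X Y (coh_of_hom X Y f) c = sdegen n (mpow f k \<star> cmuls X ks)" .
    have "cpre c \<alpha> \<in> nerve 1 k n" using cpre_nerve[OF c \<alpha>(1,3)] \<alpha> by simp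
    from val[OF this] show "sdegen (cdim (cpre c \<alpha>)) (mpow f k \<star> comap X [0, k])
        = fext X Y (coh_of_hom X Y f) c \<star> smap n (icmul X j)"
      unfolding fe using X(1) f jk ks cm(2)[OF ks(1,2)] by (simp add: sdegen_smap)
  qed
qed

text \<open>The strict maps p and q pass through tensor products of simplices by
  \<open>stens_map\<close> and past iterated comultiplications by \<open>icmul_nat\<close> and
  \<open>cmuls_nat\<close>.\<close>

lemma coh_map_Coh:
  assumes "dg_coalgebra X'" "dg_coalgebra X" "dg_coalgebra Y" "dg_coalgebra Y'"
    "p \<in> coalgebra_hom X' X" "q \<in> coalgebra_hom Y Y'" "\<mu> \<in> Coh X Y"
  shows "coh_map p q \<mu> \<in> Coh X' Y'"
    "c \<in> nerve 1 k n \<Longrightarrow> coh_map p q \<mu> k c = mpow q k \<star> \<mu> k c \<star> smap n p"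
proof -
  note X' = dg_coalgebraD[OF assms(1)] and X = dg_coalgebraD[OF assms(2)] and Y = dg_coalgebraD[OF assms(3)]
    and Y' = dg_coalgebraD[OF assms(4)] and p = coalgebra_homD[OF assms(1,2,5)] and q = coalgebra_homD[OF assms(3,4,6)]
  note \<mu> = CohD[OF X(2) Y(2) assms(7)]
  have val: "mpow q k \<star> \<mu> k c \<star> smap (cdim c) p = mpow q k \<star> \<mu> k c \<star> smap n p" if "c \<in> nerve 1 k n" for c k n
    using nerve_cdim[OF that] by simp
  then show val': "c \<in> nerve 1 k n \<Longrightarrow> coh_map p q \<mu> k c = mpow q k \<star> \<mu> k c \<star> smap n p" for c k n
    unfolding coh_map_def using mk_family_nerve by simp
  show "coh_map p q \<mu> \<in> Coh X' Y'"
  proof (rule CohI[OF X'(2) Y'(2) coh_map_def])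
    fix k n c assume c: "c \<in> nerve 1 k n"
    then have k: "k > 0" using nerve_pos by blast
    show "mpow q k \<star> \<mu> k c \<star> smap (cdim c) p \<in> shom n (cx X') (cpow (cx Y') k)"
      unfolding val[OF c]
      by (rule shom_post[where Y="cpow (cx Y) k"])
        (use X' Y' X Y shom_pre[OF X'(2) X(2) _ \<mu>(2)[OF c] p(1)] cmap_mpow[OF Y(2) Y'(2) q(1)] in auto)
    fix m \<theta> assume \<theta>: "\<theta> \<in> mono_maps m n"
    show "mpow q k \<star> \<mu> k (nop \<theta> c) \<star> smap (cdim (nop \<theta> c)) p
        = (mpow q k \<star> \<mu> k c \<star> smap (cdim c) p) \<star> sobj m n (gr (cx X')) \<theta>"
      unfolding val[OF c] val[OF nop_nerve(1)[OF c \<theta>]]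
      using X(1) X'(1) p q \<theta> k sfam_nop[OF \<mu>(1) c \<theta>] sfam_typing[OF \<mu>(1) c] smap_sobj[of p \<theta> m n] by simp
  next
    fix k n c \<beta> assume c: "c \<in> nerve 1 k n" and \<beta>: "act \<beta>" "asrc \<beta> = k"
    then have k: "k > 0" "atrg \<beta> > 0" using nerve_pos act_atrg_pos by blast+
    have nat: "mpow q (atrg \<beta>) \<star> comap Y \<beta> = comap Y' \<beta> \<star> mpow q k"
      using cmuls_nat[OF Y(1) Y'(1) q(2-6), of "adiffs \<beta>"] adiffs[OF \<beta>(1)] \<beta> by (simp add: comap_cmuls)
    have ty: "gm (comap Y \<beta>)" "gsrc (comap Y \<beta>) = gpow (gr (cx Y)) k" "gtgt (comap Y \<beta>) = gpow (gr (cx Y)) (atrg \<beta>)"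
      "gm (comap Y' \<beta>)" "gsrc (comap Y' \<beta>) = gpow (gr (cx Y')) k"
      using Y(1) Y'(1) adiffs[OF \<beta>(1)] \<beta> by (simp_all add: comap_cmuls)
    have "mpow q (atrg \<beta>) \<star> \<mu> (atrg \<beta>) (cpost \<beta> c) \<star> smap n p = (mpow q (atrg \<beta>) \<star> comap Y \<beta>) \<star> \<mu> k c \<star> smap n p"
      using \<mu>(3)[OF c \<beta>] ty q k p sfam_typing[OF \<mu>(1) c] by simp
    also have "\<dots> = comap Y' \<beta> \<star> mpow q k \<star> \<mu> k c \<star> smap n p"
      unfolding nat using ty q k p sfam_typing[OF \<mu>(1) c] by simp
    finally show "mpow q (atrg \<beta>) \<star> \<mu> (atrg \<beta>) (cpost \<beta> c) \<star> smap (cdim (cpost \<beta> c)) p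
       = comap Y' \<beta> \<star> mpow q k \<star> \<mu> k c \<star> smap (cdim c) p"
      unfolding val[OF c] val[OF cpost_nerve[OF c \<beta>]] .
  next
    fix j k n c \<alpha> assume c: "c \<in> nerve j k n" and \<alpha>: "act \<alpha>" "asrc \<alpha> = 1" "atrg \<alpha> = j"
    then have jk: "j > 0" "k > 0" using nerve_pos by blast+
    have g: "graded_object (gr (cx X))" "graded_object (gr (cx Y))" using X Y by auto
    note fa = fext_factors[OF g \<mu>(1) c] and ft = fext_typing[OF g \<mu>(1) c]
    have "fext X' Y' (coh_map p q \<mu>) c
       = stens n (gsrc p) (gtgt q) (map (\<lambda>(k, \<phi>). (k, mpow q k \<star> \<phi> \<star> smap n p)) (map (\<lambda>b. (cend b, \<mu> (cend b) b)) (blocks c)))"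
      unfolding fext_def nerve_cdim[OF c] p q
      by (auto intro!: arg_cong[where f="stens n (gr (cx X')) (gr (cx Y'))"] val' blocks_nerve[OF c])
    also have "\<dots> = mpow q k \<star> fext X Y \<mu> c \<star> smap n (mpow p j)"
      using stens_map[OF g fa p(2,4,5) q(2,3,5)] blocks_cend(2)[OF c] blocks_nth(2)[OF c] nerve_cdim[OF c]
      by (simp add: fext_def comp_def)
    finally have fe: "fext X' Y' (coh_map p q \<mu>) c = mpow q k \<star> fext X Y \<mu> c \<star> smap n (mpow p j)" .
    have cp: "cpre c \<alpha> \<in> nerve 1 k n" using cpre_nerve[OF c \<alpha>(1,3)] \<alpha> by simp
    have "mpow q k \<star> \<mu> k (cpre c \<alpha>) \<star> smap n p = mpow q k \<star> fext X Y \<mu> c \<star> (smap n (icmul X j) \<star> smap n p)"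
      using \<mu>(4)[OF c \<alpha>] ft jk X(1) p q by simp
    also have "smap n (icmul X j) \<star> smap n p = smap n (mpow p j) \<star> smap n (icmul X' j)"
      using icmul_nat[OF X'(1) X(1) p(2-6) jk(1)] jk X(1) X'(1) p by (simp add: smap_gcomp)
    finally show "mpow q k \<star> \<mu> k (cpre c \<alpha>) \<star> smap (cdim (cpre c \<alpha>)) p
        = fext X' Y' (coh_map p q \<mu>) c \<star> smap n (icmul X' j)"
      unfolding fe val[OF cp] using ft jk X'(1) p q by simp
  qed
qed

section \<open>Matrices between tensor algebras\<close>

text \<open>Matrices that never shorten words. The finiteness condition for a morphism of
  pro-objects is then automatic, and composites become sums over intervals.\<close>

definition tmat :: "'a graded \<Rightarrow> 'a graded \<Rightarrow> int \<Rightarrow> ('a, 'b) matrix \<Rightarrow> bool" where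
  "tmat V W d M \<longleftrightarrow> (\<forall>j>0. \<forall>k>0. gmor (M j k) (gpow V j) (gpow W k) d \<and>
     (k < j \<longrightarrow> M j k = gzero (gpow V j) (gpow W k) d))"

lemma tmatD:
  assumes "tmat V W d M" "j > 0" "k > 0"
  shows "gm (M j k)" "gsrc (M j k) = gpow V j" "gtgt (M j k) = gpow W k" "gdeg (M j k) = d"
    "k < j \<Longrightarrow> M j k = gzero (gpow V j) (gpow W k) d"
  using assms unfolding tmat_def by blast+

lemma tmat_graded:
  assumes "tmat V W d M"
  shows "graded_object V" "graded_object W"
  using tmatD[OF assms, of 1 1] gm_graded[of "M 1 1"] by auto

text \<open>The upper limit K may be any number from k on, since \<open>N l k\<close> vanishes for l
  > k. A suitable choice writes different composites as sums over a common range.\<close>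

lemma pro_comp_eq:
  assumes M: "tmat U V d M" and N: "tmat V W e N" and "j > 0" "k > 0" "k \<le> K"
  shows "pro_comp N M j k = gsum (gpow U j) (gpow W k) (d + e) (\<lambda>l. N l k \<star> M j l) {1..K}"
proof -
  note g = tmat_graded[OF M] tmat_graded[OF N]
  have ty: "gmor (N l k \<star> M j l) (gpow U j) (gpow W k) (d + e)"
    if "l > 0" for l
    using that tmatD[OF M assms(3) that] tmatD[OF N that assms(4)] by simp
  have nz: "matrix_nonzero N k \<subseteq> {1..K}"
    using tmatD[OF N _ assms(4)] assms g by (auto simp: matrix_nonzero_def) (metis le_trans not_le_imp_less)
  have "pro_comp N M j k = gsum (gpow U j) (gpow W k) (d + e) (\<lambda>l. N l k \<star> M j l) (matrix_nonzero N k)"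
    using tmatD[OF M assms(3), of 1] tmatD[OF N _ assms(4), of 1] assms by (simp add: pro_comp_def mk_matrix_def)
  also have "\<dots> = gsum (gpow U j) (gpow W k) (d + e) (\<lambda>l. N l k \<star> M j l) {1..K}"
  proof (rule gsum_mono_neutral)
    fix l assume "l \<in> {1..K} - matrix_nonzero N k"
    then have "l > 0" and "N l k = gzero (gpow V l) (gpow W k) e"
      using tmatD[OF N, of l k] assms by (auto simp: matrix_nonzero_def)
    then show "N l k \<star> M j l = gzero (gpow U j) (gpow W k) (d + e)"
      using tmatD[OF M assms(3), of l] g by simp
  qed (use nz ty g in \<open>auto simp: matrix_nonzero_def\<close>)
  finally show ?thesis .
qed

lemma pro_comp_tmat:
  assumes M: "tmat U V d M" and N: "tmat V W e N"
  shows "tmat U W (d + e) (pro_comp N M)"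
  unfolding tmat_def
proof (intro allI impI conjI)
  note g = tmat_graded[OF M] tmat_graded[OF N]
  fix j k :: nat assume jk: "j > 0" "k > 0"
  note eq = pro_comp_eq[OF M N jk le_refl]
  have ty: "gmor (N l k \<star> M j l) (gpow U j) (gpow W k) (d + e)"
    if "l > 0" for l
    using that tmatD[OF M jk(1) that] tmatD[OF N that jk(2)] by simp
  show "gm (pro_comp N M j k)" "gsrc (pro_comp N M j k) = gpow U j" "gtgt (pro_comp N M j k) = gpow W k"
    "gdeg (pro_comp N M j k) = d + e"
    unfolding eq using g ty by auto
  assume kj: "k < j"
  have "N l k \<star> M j l = gzero (gpow U j) (gpow W k) (d + e)" if "l \<in> {1..k}" for l
    using that kj tmatD[OF M jk(1), of l] tmatD[OF N _ jk(2), of l] g by simp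
  then show "pro_comp N M j k = gzero (gpow U j) (gpow W k) (d + e)"
    unfolding eq using g by (intro gsum_neutral) auto
qed

lemma pro_comp_mk [simp]: "mk_matrix (pro_comp N M) = pro_comp N M"
  by (auto simp: pro_comp_def mk_matrix_def fun_eq_iff)

definition ahom :: "'a graded \<Rightarrow> 'a graded \<Rightarrow> ('a, 'b) matrix \<Rightarrow> bool" where
  "ahom V W M \<longleftrightarrow> M = mk_matrix M \<and> tmat V W 0 M \<and> (\<forall>j>0. \<forall>j'>0. \<forall>k>0. M (j + j') k \<star> can V j j' =
     gsum (gpow V j \<odot>\<^sub>o gpow V j') (gpow W k) 0 (\<lambda>l. can W l (k - l) \<star> (M j l \<odot> M j' (k - l))) {1..<k})"

lemma ahomD:
  assumes "ahom V W M"
  shows "tmat V W 0 M" "M = mk_matrix M"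
    "j > 0 \<Longrightarrow> j' > 0 \<Longrightarrow> k > 0 \<Longrightarrow> M (j + j') k \<star> can V j j' =
     gsum (gpow V j \<odot>\<^sub>o gpow V j') (gpow W k) 0 (\<lambda>l. can W l (k - l) \<star> (M j l \<odot> M j' (k - l))) {1..<k}"
  using assms unfolding ahom_def by blast+

lemma ahom_Suc:
  assumes "ahom V W M" "j > 0" "k > 0"
  shows "M (Suc j) k = gsum (gpow V (Suc j)) (gpow W k) 0 (\<lambda>l. can W l (k - l) \<star> (M 1 l \<odot> M j (k - l))) {1..<k}"
proof -
  have "M (1 + j) k \<star> can V 1 j = M (1 + j) k"
    using tmatD[OF ahomD(1)[OF assms(1)], of "1 + j" k] assms by simp
  then show ?thesis using ahomD(3)[OF assms(1), of 1 j k] assms by simp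
qed

lemma ahom_algebra_hom:
  assumes "ahom V W M"
  shows "M \<in> algebra_hom V W"
proof -
  note M = ahomD[OF assms]
  note t = tmatD[OF M(1)] and g = tmat_graded[OF M(1)]
  have "matrix_nonzero M k \<subseteq> {1..k}" if "k > 0" for k
    using t(5)[OF _ that] g that by (auto simp: matrix_nonzero_def) (metis not_le_imp_less gzero_simps(1-3))
  then have "finite (matrix_nonzero M k)" if "k \<ge> 1" for k
    using that finite_subset[of "matrix_nonzero M k" "{1..k}"] by auto
  then show ?thesis
    unfolding algebra_hom_def pro_hom_def using M t by (simp add: ghom_iff)
qed

text \<open>Freeness of the tensor algebra: multiplicativity with a single generator split off
  (\<open>ahom_Suc\<close>) determines each row from the first and the preceding one.\<close>

lemma ahom_eqI:
  assumes M: "ahom V W M" and N: "ahom V W N" and eq: "\<And>k. k > 0 \<Longrightarrow> M 1 k = N 1 k"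
  shows "M = N"
proof -
  have "\<forall>k>0. M j k = N j k" if "j > 0" for j
    using that
  proof (induction j rule: nat_induct_non_zero)
    case 1
    then show ?case using eq by simp
  next
    case (Suc j)
    note t = tmatD[OF ahomD(1)[OF M]] tmatD[OF ahomD(1)[OF N]] tmat_graded[OF ahomD(1)[OF M]]
    show ?case
    proof (intro allI impI)
      fix k :: nat assume k: "k > 0"
      show "M (Suc j) k = N (Suc j) k"
        unfolding ahom_Suc[OF M Suc(1) k] ahom_Suc[OF N Suc(1) k]
        by (rule gsum_cong) (use Suc eq t in auto)
    qed
  qed
  then have "mk_matrix M = mk_matrix N" by (auto simp: mk_matrix_def fun_eq_iff)
  then show ?thesis using ahomD(2)[OF M] ahomD(2)[OF N] by simp
qed

text \<open>Expanding by multiplicativity of M and then of N gives triples: l is the intermediate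
  length, m the part of it coming from the first factor, n the part of the final length k coming
  from the first factor. Reindexing (l, m) as (m, l - m) decouples the two factors.\<close>

lemma ahom_pro_comp:
  assumes M: "ahom U V M" and N: "ahom V W N"
  shows "ahom U W (pro_comp N M)"
  unfolding ahom_def
proof (intro conjI allI impI)
  note tM = tmatD[OF ahomD(1)[OF M]] and tN = tmatD[OF ahomD(1)[OF N]]
  note g = tmat_graded[OF ahomD(1)[OF M]] tmat_graded[OF ahomD(1)[OF N]]
  show "tmat U W 0 (pro_comp N M)" using pro_comp_tmat[OF ahomD(1)[OF M] ahomD(1)[OF N]] by simp
  fix j j' k :: nat assume j: "j > 0" "j' > 0" and k: "k > 0"
  let ?S = "gpow U j \<odot>\<^sub>o gpow U j'" and ?T = "gpow W k"
  define H where "H = (\<lambda>l m n. can W n (k - n) \<star> ((N m n \<star> M j m) \<odot> (N (l - m) (k - n) \<star> M j' (l - m))))"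
  have H: "gmor (H l m n) ?S ?T 0"
    if "m > 0" "m < l" "n > 0" "n < k" for l m n
    using that tM tN g j by (simp add: H_def)
  have PC: "pro_comp N M i k' = gsum (gpow U i) (gpow W k') 0 (\<lambda>l. N l k' \<star> M i l) {1..K}" if "i > 0" "k' > 0" "k' \<le> K" for i k' K
    using pro_comp_eq[OF ahomD(1)[OF M] ahomD(1)[OF N] that] by simp
  have "pro_comp N M (j + j') k \<star> can U j j' = gsum ?S ?T 0 (\<lambda>l. (N l k \<star> M (j + j') l) \<star> can U j j') {1..k}"
    unfolding PC[OF add_pos_pos[OF j] k le_refl] using j k tM tN g by (subst gcomp_gsum_right) auto
  also have "\<dots> = gsum ?S ?T 0 (\<lambda>l. gsum ?S ?T 0 (\<lambda>m. gsum ?S ?T 0 (H l m) {1..<k}) {1..<l}) {1..k}"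
  proof (rule gsum_cong)
    fix l assume l: "l \<in> {1..k}"
    have "(N l k \<star> M (j + j') l) \<star> can U j j' = N l k \<star> M (j + j') l \<star> can U j j'"
      using l j k tM tN g by simp
    also have "\<dots> = gsum ?S ?T 0 (\<lambda>m. N l k \<star> can V m (l - m) \<star> (M j m \<odot> M j' (l - m))) {1..<l}"
      using l j k tM tN g by (subst ahomD(3)[OF M]) (auto simp: gcomp_gsum_left)
    also have "\<dots> = gsum ?S ?T 0 (\<lambda>m. gsum ?S ?T 0 (H l m) {1..<k}) {1..<l}"
    proof (rule gsum_cong)
      fix m assume m: "m \<in> {1..<l}"
      have "N l k \<star> can V m (l - m) \<star> (M j m \<odot> M j' (l - m)) = (N (m + (l - m)) k \<star> can V m (l - m)) \<star> (M j m \<odot> M j' (l - m))"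
        using l m j k tM tN g by simp
      also have "\<dots> = gsum ?S ?T 0 (\<lambda>n. (can W n (k - n) \<star> (N m n \<odot> N (l - m) (k - n))) \<star> (M j m \<odot> M j' (l - m))) {1..<k}"
        using l m j k tM tN g by (subst ahomD(3)[OF N]) (auto simp: gcomp_gsum_right)
      also have "\<dots> = gsum ?S ?T 0 (H l m) {1..<k}"
      proof (rule gsum_cong)
        fix n assume "n \<in> {1..<k}"
        then show "(can W n (k - n) \<star> (N m n \<odot> N (l - m) (k - n))) \<star> (M j m \<odot> M j' (l - m)) = H l m n"
          using l m j k tM tN g by (simp add: gtenm_gcomp H_def)
      qed (use l m H g in auto)
      finally show "N l k \<star> can V m (l - m) \<star> (M j m \<odot> M j' (l - m)) = gsum ?S ?T 0 (H l m) {1..<k}" .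
    qed (use l H g in auto)
    finally show "(N l k \<star> M (j + j') l) \<star> can U j j' = gsum ?S ?T 0 (\<lambda>m. gsum ?S ?T 0 (H l m) {1..<k}) {1..<l}" .
  qed (use H g in auto)
  also have "\<dots> = gsum ?S ?T 0 (\<lambda>(l, m). gsum ?S ?T 0 (H l m) {1..<k}) (SIGMA l:{1..k}. {1..<l})"
    by (rule gsum_Sigma) (use H g in auto)
  also have "\<dots> = gsum ?S ?T 0 (\<lambda>n. gsum ?S ?T 0 (\<lambda>(l, m). H l m n) (SIGMA l:{1..k}. {1..<l})) {1..<k}"
    using gsum_swap[of ?S ?T "SIGMA l:{1..k}. {1..<l}" "{1..<k}" "\<lambda>(l, m) n. H l m n" 0] H g
    by (simp add: case_prod_unfold)
  also have "\<dots> = gsum ?S ?T 0 (\<lambda>n. can W n (k - n) \<star> (pro_comp N M j n \<odot> pro_comp N M j' (k - n))) {1..<k}"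
  proof (rule gsum_cong)
    fix n assume n: "n \<in> {1..<k}"
    define G where "G = (\<lambda>m i. can W n (k - n) \<star> ((N m n \<star> M j m) \<odot> (N i (k - n) \<star> M j' i)))"
    have G: "gmor (G m i) ?S ?T 0" if "m > 0" "i > 0" for m i
      using that n tM tN g j by (simp add: G_def)
    have "pro_comp N M j n \<odot> pro_comp N M j' (k - n) = gsum ?S (gpow W n \<odot>\<^sub>o gpow W (k - n)) 0
       (\<lambda>m. (N m n \<star> M j m) \<odot> gsum (gpow U j') (gpow W (k - n)) 0 (\<lambda>i. N i (k - n) \<star> M j' i) {1..k - n}) {1..n}"
      using n j tM tN g by (simp add: PC[of j n n] PC[of j' "k - n" "k - n"] gtenm_gsum_left)
    also have "\<dots> = gsum ?S (gpow W n \<odot>\<^sub>o gpow W (k - n)) 0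
       (\<lambda>m. gsum ?S (gpow W n \<odot>\<^sub>o gpow W (k - n)) 0 (\<lambda>i. (N m n \<star> M j m) \<odot> (N i (k - n) \<star> M j' i)) {1..k - n}) {1..n}"
      using n j tM tN g by (intro gsum_cong) (auto simp: gtenm_gsum_right)
    finally have "can W n (k - n) \<star> (pro_comp N M j n \<odot> pro_comp N M j' (k - n))
        = gsum ?S ?T 0 (\<lambda>m. can W n (k - n) \<star> gsum ?S (gpow W n \<odot>\<^sub>o gpow W (k - n)) 0 (\<lambda>i. (N m n \<star> M j m) \<odot> (N i (k - n) \<star> M j' i)) {1..k - n}) {1..n}"
      using n j tM tN g by (simp add: gcomp_gsum_left)
    also have "\<dots> = gsum ?S ?T 0 (\<lambda>m. gsum ?S ?T 0 (G m) {1..k - n}) {1..n}"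
    proof (rule gsum_cong)
      fix m assume "m \<in> {1..n}"
      then show "can W n (k - n) \<star> gsum ?S (gpow W n \<odot>\<^sub>o gpow W (k - n)) 0 (\<lambda>i. (N m n \<star> M j m) \<odot> (N i (k - n) \<star> M j' i)) {1..k - n}
        = gsum ?S ?T 0 (G m) {1..k - n}"
        using n j tM tN g by (simp add: gcomp_gsum_left G_def)
    qed (use G g in auto)
    also have "\<dots> = gsum ?S ?T 0 (\<lambda>(m, i). G m i) ({1..n} \<times> {1..k - n})"
      by (rule gsum_Sigma) (use G g in auto)
    \<comment> \<open>The rectangle obtained from the two composites is contained in the triangle
      obtained from the left side; the additional terms vanish because N never shortens
      words.\<close>
    also have "\<dots> = gsum ?S ?T 0 (\<lambda>(m, i). G m i) {(m, i). m > 0 \<and> i > 0 \<and> m + i \<le> k}"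
    proof (rule gsum_mono_neutral)
      show "finite {(m, i). m > 0 \<and> i > 0 \<and> m + i \<le> k}"
        by (rule finite_subset[of _ "{0..k} \<times> {0..k}"]) auto
      fix x assume x: "x \<in> {(m, i). m > 0 \<and> i > 0 \<and> m + i \<le> k} - {1..n} \<times> {1..k - n}"
      then obtain m i where mi: "x = (m, i)" "m > 0" "i > 0" "n < m \<or> k - n < i" by force
      have kn: "n > 0" "k - n > 0" using n by auto
      note t = tM(1-4)[OF j(1) mi(2)] tM(1-4)[OF j(2) mi(3)] tN(1-4)[OF mi(2) kn(1)] tN(1-4)[OF mi(3) kn(2)]
      from mi(4) have "G m i = gzero ?S ?T 0"
      proof
        assume "n < m"
        then show ?thesis unfolding G_def tN(5)[OF mi(2) kn(1) \<open>n < m\<close>] using t kn n j g by simp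
      next
        assume "k - n < i"
        then show ?thesis unfolding G_def tN(5)[OF mi(3) kn(2) \<open>k - n < i\<close>] using t kn n j g by simp
      qed
      then show "(case x of (m, i) \<Rightarrow> G m i) = gzero ?S ?T 0" using mi by simp
    qed (use G g n in auto)
    also have "\<dots> = gsum ?S ?T 0 (\<lambda>(l, m). H l m n) (SIGMA l:{1..k}. {1..<l})"
    proof (rule gsum_bij[symmetric, where h="\<lambda>(l, m). (m, l - m)"])
      show "bij_betw (\<lambda>(l, m). (m, l - m)) (SIGMA l:{1..k}. {1..<l}) {(m, i). m > 0 \<and> i > 0 \<and> m + i \<le> k}"
        by (rule bij_betw_byWitness[where f'="\<lambda>(m, i). (m + i, m)"]) auto
    qed (use G g n in \<open>auto simp: G_def H_def\<close>)
    finally show "gsum ?S ?T 0 (\<lambda>(l, m). H l m n) (SIGMA l:{1..k}. {1..<l})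
      = can W n (k - n) \<star> (pro_comp N M j n \<odot> pro_comp N M j' (k - n))" by simp
  qed (use tmatD[OF pro_comp_tmat[OF ahomD(1)[OF M] ahomD(1)[OF N]]] j g in auto)
  finally show "pro_comp N M (j + j') k \<star> can U j j'
    = gsum ?S ?T 0 (\<lambda>n. can W n (k - n) \<star> (pro_comp N M j n \<odot> pro_comp N M j' (k - n))) {1..<k}" .
qed simp

section \<open>Extension of a prescribed first row to an algebra morphism\<close>

fun alg :: "'a graded \<Rightarrow> 'a graded \<Rightarrow> (nat \<Rightarrow> ('a, 'b) gmap) \<Rightarrow> ('a, 'b) matrix" where
  "alg V W a 0 k = undefined"
| "alg V W a (Suc 0) k = (if k = 0 then undefined else a k)"
| "alg V W a (Suc (Suc j)) k = (if k = 0 then undefined else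
     gsum (gpow V (Suc (Suc j))) (gpow W k) 0 (\<lambda>l. can W l (k - l) \<star> (a l \<odot> alg V W a (Suc j) (k - l))) {1..<k})"

lemma alg_Suc: "j > 0 \<Longrightarrow> k > 0 \<Longrightarrow> alg V W a (Suc j) k =
    gsum (gpow V (Suc j)) (gpow W k) 0 (\<lambda>l. can W l (k - l) \<star> (a l \<odot> alg V W a j (k - l))) {1..<k}"
  by (cases j) auto

context
  fixes V W and a :: "nat \<Rightarrow> ('a, 'b) gmap"
  assumes g: "graded_object V" "graded_object W"
    and a: "\<forall>k>0. gmor (a k) V (gpow W k) 0"
begin

lemma alg_tmat: "tmat V W 0 (alg V W a)"
proof -
  have "\<forall>k>0. gmor (alg V W a j k) (gpow V j) (gpow W k) 0 \<and>
     (k < j \<longrightarrow> alg V W a j k = gzero (gpow V j) (gpow W k) 0)" if "j > 0" for j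
    using that
  proof (induction j rule: nat_induct_non_zero)
    case 1
    then show ?case using a by auto
  next
    case (Suc j)
    show ?case
    proof (intro allI impI conjI)
      fix k :: nat assume k: "k > 0"
      note eq = alg_Suc[OF Suc(1) k, of V W a]
      show "gm (alg V W a (Suc j) k)" "gsrc (alg V W a (Suc j) k) = gpow V (Suc j)"
        "gtgt (alg V W a (Suc j) k) = gpow W k" "gdeg (alg V W a (Suc j) k) = 0"
        unfolding eq using Suc a g by auto
      assume kj: "k < Suc j"
      have "can W l (k - l) \<star> (a l \<odot> alg V W a j (k - l)) = gzero (gpow V (Suc j)) (gpow W k) 0" if "l \<in> {1..<k}" for l
      proof -
        have "alg V W a j (k - l) = gzero (gpow V j) (gpow W (k - l)) 0" using Suc that kj by auto
        then show ?thesis using that a g Suc(1) by simp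
      qed
      then show "alg V W a (Suc j) k = gzero (gpow V (Suc j)) (gpow W k) 0"
        unfolding eq using g by (intro gsum_neutral) auto
    qed
  qed
  then show ?thesis unfolding tmat_def by blast
qed

text \<open>The recursion itself is multiplicativity for one generator. The induction on j regroups
  the length l of the image of the new generator and the length p of the image of the other j as n =
  l + p, and \<open>can_assoc\<close> reconciles the two bracketings.\<close>

lemma alg_ahom: "ahom V W (alg V W a)"
  unfolding ahom_def
proof (intro conjI allI impI)
  have "alg V W a j k = mk_matrix (alg V W a) j k" for j k
    by (cases "(V, W, a, j, k)" rule: alg.cases) (auto simp: mk_matrix_def)
  then show "alg V W a = mk_matrix (alg V W a)" by blast
  show "tmat V W 0 (alg V W a)" by (rule alg_tmat)
  note t = tmatD[OF alg_tmat]
  let ?M = "alg V W a"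
  fix j j' k :: nat assume j: "j > 0" and j': "j' > 0" and k: "k > 0"
  from j k show "?M (j + j') k \<star> can V j j' =
     gsum (gpow V j \<odot>\<^sub>o gpow V j') (gpow W k) 0 (\<lambda>l. can W l (k - l) \<star> (?M j l \<odot> ?M j' (k - l))) {1..<k}"
  proof (induction j arbitrary: k rule: nat_induct_non_zero)
    case 1
    note t' = t[OF j']
    have "?M (1 + j') k \<star> can V 1 j' = gsum (gpow V 1 \<odot>\<^sub>o gpow V j') (gpow W k) 0 (\<lambda>l. can W l (k - l) \<star> (a l \<odot> ?M j' (k - l))) {1..<k}"
      using alg_Suc[OF j' 1, of V W a] t(1)[of "Suc j'" k] t(2)[of "Suc j'" k] j' 1 by simp
    also have "\<dots> = gsum (gpow V 1 \<odot>\<^sub>o gpow V j') (gpow W k) 0 (\<lambda>l. can W l (k - l) \<star> (?M 1 l \<odot> ?M j' (k - l))) {1..<k}"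
      using a g t' by (intro gsum_cong) auto
    finally show ?case .
  next
    case (Suc j k)
    let ?S = "gpow V (Suc j) \<odot>\<^sub>o gpow V j'" and ?T = "gpow W k"
    let ?A = "gasc V (gpow V j) (gpow V j')"
    define H where "H = (\<lambda>l p. can W (l + p) (k - l - p) \<star> ((can W l p \<star> (a l \<odot> ?M j p)) \<odot> ?M j' (k - l - p)))"
    have H: "gmor (H l p) ?S ?T 0" if "l > 0" "p > 0" "l + p < k" for l p
      using that a t g Suc j' by (simp add: H_def)
    have a': "gm (a l)" "gsrc (a l) = V" "gtgt (a l) = gpow W l" "gdeg (a l) = 0" if "l > 0" for l using a that by auto
    have "?M (Suc j + j') k \<star> can V (Suc j) j'
        = gsum (gpow V (Suc (j + j'))) (gpow W k) 0 (\<lambda>l. can W l (k - l) \<star> (a l \<odot> ?M (j + j') (k - l))) {1..<k} \<star> can V (Suc j) j'"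
      using alg_Suc[of "j + j'" k V W a] j' Suc by simp
    also have "\<dots> = gsum ?S ?T 0 (\<lambda>l. (can W l (k - l) \<star> (a l \<odot> ?M (j + j') (k - l))) \<star> can V (Suc j) j') {1..<k}"
      using a' t g Suc j' by (subst gcomp_gsum_right) auto
    also have "\<dots> = gsum ?S ?T 0 (\<lambda>l. gsum ?S ?T 0 (H l) {1..<k - l}) {1..<k}"
    proof (rule gsum_cong)
      fix l assume l: "l \<in> {1..<k}"
      define P where "P = (\<lambda>p. can W p (k - l - p) \<star> (?M j p \<odot> ?M j' (k - l - p)))"
      have P: "gmor (P p) (gpow V j \<odot>\<^sub>o gpow V j') (gpow W (k - l)) 0"
        if "p \<in> {1..<k - l}" for p
      proof -
        have "p > 0" "k - l - p > 0" "p + (k - l - p) = k - l" using that by auto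
        then show ?thesis using t g Suc(1) j' by (simp add: P_def del: diff_diff_left)
      qed
      have "(can W l (k - l) \<star> (a l \<odot> ?M (j + j') (k - l))) \<star> can V (Suc j) j'
          = can W l (k - l) \<star> (a l \<odot> (?M (j + j') (k - l) \<star> can V j j')) \<star> ?A"
      proof -
        have "(a l \<odot> ?M (j + j') (k - l)) \<star> (gid V \<odot> can V j j') = a l \<odot> (?M (j + j') (k - l) \<star> can V j j')"
          using a' t g Suc(1) j' l by (simp add: gtenm_gcomp)
        moreover have "(can W l (k - l) \<star> (a l \<odot> ?M (j + j') (k - l))) \<star> can V (Suc j) j'
            = can W l (k - l) \<star> ((a l \<odot> ?M (j + j') (k - l)) \<star> (gid V \<odot> can V j j')) \<star> ?A"
          using a' t g Suc(1) j' l by (simp add: can_Suc)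
        ultimately show ?thesis by simp
      qed
      also have "?M (j + j') (k - l) \<star> can V j j' = gsum (gpow V j \<odot>\<^sub>o gpow V j') (gpow W (k - l)) 0 P {1..<k - l}"
        using Suc(2)[of "k - l"] l by (simp add: P_def)
      also have "can W l (k - l) \<star> (a l \<odot> \<dots>) \<star> ?A = gsum ?S ?T 0 (\<lambda>p. can W l (k - l) \<star> (a l \<odot> P p) \<star> ?A) {1..<k - l}"
        using a' P g Suc(1) j' l by (simp add: gtenm_gsum_right gcomp_gsum_right gcomp_gsum_left)
      also have "\<dots> = gsum ?S ?T 0 (H l) {1..<k - l}"
      proof (rule gsum_cong)
        fix p assume p: "p \<in> {1..<k - l}"
        let ?q = "k - l - p"
        have q: "p > 0" "?q > 0" "l > 0" "p + ?q = k - l" using p l by auto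
        have "can W l (k - l) \<star> (a l \<odot> P p) \<star> ?A
          = can W l (p + ?q) \<star> (gid (gpow W l) \<odot> can W p ?q) \<star> ((a l \<odot> (?M j p \<odot> ?M j' ?q)) \<star> ?A)"
        proof -
          have "a l \<odot> (can W p ?q \<star> (?M j p \<odot> ?M j' ?q)) = (gid (gpow W l) \<odot> can W p ?q) \<star> (a l \<odot> (?M j p \<odot> ?M j' ?q))"
            using a' t g Suc j' q by (simp add: gtenm_gcomp)
          then show ?thesis using a' t g Suc j' q by (simp add: P_def del: diff_diff_left)
        qed
        also have "(a l \<odot> (?M j p \<odot> ?M j' ?q)) \<star> ?A = gasc (gpow W l) (gpow W p) (gpow W ?q) \<star> ((a l \<odot> ?M j p) \<odot> ?M j' ?q)"
          using a' t g Suc j' q by (subst gtenm_gasc) auto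
        also have "can W l (p + ?q) \<star> (gid (gpow W l) \<odot> can W p ?q) \<star> \<dots> =
          (can W l (p + ?q) \<star> (gid (gpow W l) \<odot> can W p ?q) \<star> gasc (gpow W l) (gpow W p) (gpow W ?q)) \<star> ((a l \<odot> ?M j p) \<odot> ?M j' ?q)"
          using a' t g Suc j' q by (simp del: diff_diff_left)
        also have "\<dots> = (can W (l + p) ?q \<star> (can W l p \<odot> gid (gpow W ?q))) \<star> ((a l \<odot> ?M j p) \<odot> ?M j' ?q)"
          using can_assoc[OF g(2) q(3,1,2)] by simp
        also have "\<dots> = H l p"
          using a' t g Suc j' q by (simp add: gtenm_gcomp H_def del: diff_diff_left)
        finally show "can W l (k - l) \<star> (a l \<odot> P p) \<star> ?A = H l p" .
      qed (use H g l in auto)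
      finally show "(can W l (k - l) \<star> (a l \<odot> ?M (j + j') (k - l))) \<star> can V (Suc j) j' = gsum ?S ?T 0 (H l) {1..<k - l}" .
    qed (use H g in \<open>auto intro!: gsum_gm\<close>)
    also have "\<dots> = gsum ?S ?T 0 (\<lambda>(l, p). H l p) (SIGMA l:{1..<k}. {1..<k - l})"
      by (rule gsum_Sigma) (use H g in auto)
    also have "\<dots> = gsum ?S ?T 0 (\<lambda>(n, l). can W n (k - n) \<star> ((can W l (n - l) \<star> (a l \<odot> ?M j (n - l))) \<odot> ?M j' (k - n))) (SIGMA n:{1..<k}. {1..<n})"
    proof (rule gsum_bij[where h="\<lambda>(l, p). (l + p, l)"])
      show "bij_betw (\<lambda>(l, p). (l + p, l)) (SIGMA l:{1..<k}. {1..<k - l}) (SIGMA n:{1..<k}. {1..<n})"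
        by (rule bij_betw_byWitness[where f'="\<lambda>(n, l). (l, n - l)"]) auto
    qed (use a' t g Suc j' in \<open>auto simp: H_def\<close>)
    also have "\<dots> = gsum ?S ?T 0 (\<lambda>n. gsum ?S ?T 0 (\<lambda>l. can W n (k - n) \<star> ((can W l (n - l) \<star> (a l \<odot> ?M j (n - l))) \<odot> ?M j' (k - n))) {1..<n}) {1..<k}"
      by (rule gsum_Sigma[symmetric]) (use a' t g Suc j' in auto)
    also have "\<dots> = gsum ?S ?T 0 (\<lambda>n. can W n (k - n) \<star> (?M (Suc j) n \<odot> ?M j' (k - n))) {1..<k}"
    proof (rule gsum_cong)
      fix n assume n: "n \<in> {1..<k}"
      then have "n > 0" by simp
      show "gsum ?S ?T 0 (\<lambda>l. can W n (k - n) \<star> ((can W l (n - l) \<star> (a l \<odot> ?M j (n - l))) \<odot> ?M j' (k - n))) {1..<n}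
        = can W n (k - n) \<star> (?M (Suc j) n \<odot> ?M j' (k - n))"
        unfolding alg_Suc[OF Suc(1) \<open>n > 0\<close>] using n a' t g Suc j' by (simp add: gtenm_gsum_left gcomp_gsum_left)
    qed (use a' t g Suc j' in auto)
    finally show ?case .
  qed
qed

end

section \<open>Derivations\<close>

lemma derivation_1: "k > 0 \<Longrightarrow> derivation V b 1 k = b k"
  by simp

lemma derivation_Suc: "j > 0 \<Longrightarrow> k > 0 \<Longrightarrow> derivation V b (Suc j) k =
    (if k < Suc j then gzero (gpow V (Suc j)) (gpow V k) (-1)
     else gadd (can V (k - j) j \<star> (b (k - j) \<odot> gid (gpow V j))) (gid V \<odot> derivation V b j (k - 1)))"
  by (cases j) auto

context
  fixes V and b :: "nat \<Rightarrow> ('a, 'b) gmap"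
  assumes g: "graded_object V"
    and b: "\<forall>k>0. gmor (b k) V (gpow V k) (-1)"
begin

lemma derivation_tmat: "tmat V V (-1) (derivation V b)"
proof -
  have "\<forall>k>0. gmor (derivation V b j k) (gpow V j) (gpow V k) (-1) \<and>
     (k < j \<longrightarrow> derivation V b j k = gzero (gpow V j) (gpow V k) (-1))" if "j > 0" for j
    using that
  proof (induction j rule: nat_induct_non_zero)
    case 1
    then show ?case using b by auto
  next
    case (Suc j)
    show ?case
    proof (intro allI impI)
      fix k :: nat assume k: "k > 0"
      note eq = derivation_Suc[OF Suc(1) k, of V b]
      show "gmor (derivation V b (Suc j) k) (gpow V (Suc j)) (gpow V k) (-1) \<and>
        (k < Suc j \<longrightarrow> derivation V b (Suc j) k = gzero (gpow V (Suc j)) (gpow V k) (-1))"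
      proof (cases "k < Suc j")
        case True
        then show ?thesis unfolding eq using g by simp
      next
        case False
        then have "k - j > 0" "k - 1 > 0" "k - j + j = k" "gpow V k = V \<odot>\<^sub>o gpow V (k - 1)"
          using Suc(1) gpow_Suc[of "k - 1" V] by auto
        moreover from this have "gmor (derivation V b j (k - 1)) (gpow V j) (gpow V (k - 1)) (-1)"
          using Suc by blast
        ultimately show ?thesis
          unfolding eq using False g b Suc(1) by simp
      qed
    qed
  qed
  then show ?thesis unfolding tmat_def by blast
qed

text \<open>The Leibniz rule for an arbitrary cut, whereas \<open>derivation\<close> splits off a
  single generator. In the induction on p, the term acting on the first generator is rebracketed by
  \<open>can_assoc\<close>, and the other one is treated by the induction hypothesis.\<close>

lemma derivation_can:
  assumes "p > 0" "q > 0" "p + q \<le> k"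
  shows "derivation V b (p + q) k \<star> can V p q
    = gadd (can V (k - q) q \<star> (derivation V b p (k - q) \<odot> gid (gpow V q)))
        (can V p (k - p) \<star> (gid (gpow V p) \<odot> derivation V b q (k - p)))"
  using assms(1,3)
proof (induction p arbitrary: k rule: nat_induct_non_zero)
  case 1
  note t = tmatD[OF derivation_tmat]
  have "k - 1 > 0" "gpow V k = V \<odot>\<^sub>o gpow V (k - 1)" "k - q > 0" using 1 assms gpow_Suc[of "k - 1" V] by auto
  then show ?case
    using 1 assms derivation_Suc[of q k V b] t(1)[of "Suc q" k] t(2)[of "Suc q" k] t(1)[of q "k - 1"] t(2)[of q "k - 1"] t(3)[of q "k - 1"] g by simp
next
  case (Suc p)
  note t = tmatD[OF derivation_tmat]
  let ?D = "derivation V b"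
  obtain m where m: "k = Suc m" "p + q \<le> m" using Suc(3) by (cases k) auto
  \<comment> \<open>Names for the truncated differences: u and v are the lengths of the images of
    the p and of the q generators in the induction hypothesis, k' is the length of the image of the
    new generator.\<close>
  obtain k' u v where [simp]: "k' + (p + q) = Suc m" "k' + p = Suc u" "u + q = m" "p + v = m" and
    pos: "k' > 0" "u > 0" "v > 0" "m > 0" and
    e: "k - q = Suc u" "k - Suc p = v" "m - q = u" "m - p = v" "k - (p + q) = k'" "Suc u - p = k'"
    by (rule that[of "Suc m - (p + q)" "m - q" "m - p"]) (use m Suc(1) assms(2) in auto)
  let ?P = "gpow V p" and ?Q = "gpow V q"
  let ?A = "gasc V ?P ?Q"
  have b': "gm (b k')" "gsrc (b k') = V" "gtgt (b k') = gpow V k'" "gdeg (b k') = -1" using b pos by auto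
  have t1: "gm (?D (p + q) m)" "gsrc (?D (p + q) m) = gpow V (p + q)" "gtgt (?D (p + q) m) = gpow V m"
    "gdeg (?D (p + q) m) = -1"
    using t(1-4)[OF add_pos_pos[OF Suc(1) assms(2)] pos(4)] by blast+
  have t2: "gm (?D p u)" "gsrc (?D p u) = ?P" "gtgt (?D p u) = gpow V u" "gdeg (?D p u) = -1"
    using t(1-4)[OF Suc(1) pos(2)] by blast+
  have t3: "gm (?D q v)" "gsrc (?D q v) = ?Q" "gtgt (?D q v) = gpow V v" "gdeg (?D q v) = -1"
    using t(1-4)[OF assms(2) pos(3)] by blast+
  let ?X = "can V k' (p + q) \<star> (b k' \<odot> gid (gpow V (p + q)))" and ?Y = "gid V \<odot> ?D (p + q) m"
  have D: "?D (Suc p + q) (Suc m) = gadd ?X ?Y"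
    using derivation_Suc[of "p + q" "Suc m" V b] m Suc(1) assms(2) e(5) by simp
  have X: "?X \<star> can V (Suc p) q = can V (Suc u) q \<star> ((can V k' p \<star> (b k' \<odot> gid ?P)) \<odot> gid ?Q)"
  proof -
    have "?X \<star> can V (Suc p) q = can V k' (p + q) \<star> ((b k' \<odot> gid (gpow V (p + q))) \<star> (gid V \<odot> can V p q)) \<star> ?A"
      using Suc(1) assms(2) pos b' g by (simp add: can_Suc)
    also have "(b k' \<odot> gid (gpow V (p + q))) \<star> (gid V \<odot> can V p q) = (gid (gpow V k') \<odot> can V p q) \<star> (b k' \<odot> (gid ?P \<odot> gid ?Q))"
      using Suc(1) assms(2) pos b' g by (simp add: gtenm_gcomp)
    also have "can V k' (p + q) \<star> \<dots> \<star> ?A = can V k' (p + q) \<star> (gid (gpow V k') \<odot> can V p q) \<star> ((b k' \<odot> (gid ?P \<odot> gid ?Q)) \<star> ?A)"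
      using Suc(1) assms(2) pos b' g by simp
    also have "(b k' \<odot> (gid ?P \<odot> gid ?Q)) \<star> ?A = gasc (gpow V k') ?P ?Q \<star> ((b k' \<odot> gid ?P) \<odot> gid ?Q)"
      using Suc(1) assms(2) pos b' g by (subst gtenm_gasc) auto
    also have "can V k' (p + q) \<star> (gid (gpow V k') \<odot> can V p q) \<star> \<dots> =
        (can V k' (p + q) \<star> (gid (gpow V k') \<odot> can V p q) \<star> gasc (gpow V k') ?P ?Q) \<star> ((b k' \<odot> gid ?P) \<odot> gid ?Q)"
      using Suc(1) assms(2) pos b' g by simp
    also have "\<dots> = (can V (k' + p) q \<star> (can V k' p \<odot> gid ?Q)) \<star> ((b k' \<odot> gid ?P) \<odot> gid ?Q)"
      using can_assoc[OF g pos(1) Suc(1) assms(2)] by simp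
    finally show ?thesis
      using Suc(1) assms(2) pos b' g by (simp add: gtenm_gcomp)
  qed
  have Y1: "(gid V \<odot> (can V u q \<star> (?D p u \<odot> gid ?Q))) \<star> ?A = can V (Suc u) q \<star> ((gid V \<odot> ?D p u) \<odot> gid ?Q)"
  proof -
    have *: "gid V \<odot> (can V u q \<star> (?D p u \<odot> gid ?Q)) = (gid V \<odot> can V u q) \<star> (gid V \<odot> (?D p u \<odot> gid ?Q))"
      using Suc(1) assms(2) pos t2 g by (simp add: gtenm_gcomp)
    have "(gid V \<odot> (can V u q \<star> (?D p u \<odot> gid ?Q))) \<star> ?A = (gid V \<odot> can V u q) \<star> ((gid V \<odot> (?D p u \<odot> gid ?Q)) \<star> ?A)"
      unfolding * using Suc(1) assms(2) pos t2 g by simp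
    also have "(gid V \<odot> (?D p u \<odot> gid ?Q)) \<star> ?A = gasc V (gpow V u) ?Q \<star> ((gid V \<odot> ?D p u) \<odot> gid ?Q)"
      using gtenm_gasc[of "gid V" "?D p u" "gid ?Q" V "gpow V u" ?Q] t2 g by simp
    also have "(gid V \<odot> can V u q) \<star> \<dots> = can V (Suc u) q \<star> ((gid V \<odot> ?D p u) \<odot> gid ?Q)"
      using Suc(1) assms(2) pos t2 g by (simp add: can_Suc)
    finally show ?thesis .
  qed
  have Y2: "(gid V \<odot> (can V p v \<star> (gid ?P \<odot> ?D q v))) \<star> ?A = can V (Suc p) v \<star> (gid (gpow V (Suc p)) \<odot> ?D q v)"
  proof -
    have *: "gid V \<odot> (can V p v \<star> (gid ?P \<odot> ?D q v)) = (gid V \<odot> can V p v) \<star> (gid V \<odot> (gid ?P \<odot> ?D q v))"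
      using Suc(1) assms(2) pos t3 g by (simp add: gtenm_gcomp)
    have "(gid V \<odot> (can V p v \<star> (gid ?P \<odot> ?D q v))) \<star> ?A = (gid V \<odot> can V p v) \<star> ((gid V \<odot> (gid ?P \<odot> ?D q v)) \<star> ?A)"
      unfolding * using Suc(1) assms(2) pos t3 g by simp
    also have "(gid V \<odot> (gid ?P \<odot> ?D q v)) \<star> ?A = gasc V ?P (gpow V v) \<star> ((gid V \<odot> gid ?P) \<odot> ?D q v)"
      using gtenm_gasc[of "gid V" "gid ?P" "?D q v" V ?P "gpow V v"] t3 g by simp
    finally show ?thesis
      using Suc(1) assms(2) pos t3 g by (simp add: can_Suc)
  qed
  have tX: "gm ?X" "gtgt ?X = gpow V (Suc m)" "gsrc ?X = gpow V (Suc p + q)" "gdeg ?X = -1"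
    using Suc(1) assms(2) pos b' g by auto
  have tY: "gm ?Y" "gtgt ?Y = gpow V (Suc m)" "gsrc ?Y = gpow V (Suc p + q)" "gdeg ?Y = -1"
    using Suc(1) assms(2) pos t1 g by auto
  have "?D (Suc p + q) (Suc m) \<star> can V (Suc p) q = gadd (?X \<star> can V (Suc p) q) (?Y \<star> can V (Suc p) q)"
    unfolding D using tX tY Suc(1) assms(2) g by (intro gcomp_gadd) auto
  also have "?Y \<star> can V (Suc p) q = (gid V \<odot> (?D (p + q) m \<star> can V p q)) \<star> ?A"
  proof -
    have "?Y \<star> can V (Suc p) q = (?Y \<star> (gid V \<odot> can V p q)) \<star> ?A"
      using Suc(1) assms(2) t1 g by (simp add: can_Suc)
    also have "?Y \<star> (gid V \<odot> can V p q) = gid V \<odot> (?D (p + q) m \<star> can V p q)"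
      using Suc(1) assms(2) t1 g by (simp add: gtenm_gcomp)
    finally show ?thesis .
  qed
  also have "?D (p + q) m \<star> can V p q = gadd (can V u q \<star> (?D p u \<odot> gid ?Q)) (can V p v \<star> (gid ?P \<odot> ?D q v))"
    using Suc(2)[OF m(2)] unfolding e .
  also have "(gid V \<odot> \<dots>) \<star> ?A = gadd ((gid V \<odot> (can V u q \<star> (?D p u \<odot> gid ?Q))) \<star> ?A) ((gid V \<odot> (can V p v \<star> (gid ?P \<odot> ?D q v))) \<star> ?A)"
    using Suc(1) assms(2) pos t2 t3 g by (simp add: gtenm_gadd gcomp_gadd)
  also have "\<dots> = gadd (can V (Suc u) q \<star> ((gid V \<odot> ?D p u) \<odot> gid ?Q)) (can V (Suc p) v \<star> (gid (gpow V (Suc p)) \<odot> ?D q v))"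
    unfolding Y1 Y2 ..
  also have "gadd (?X \<star> can V (Suc p) q) \<dots> = gadd (gadd (can V (Suc u) q \<star> ((can V k' p \<star> (b k' \<odot> gid ?P)) \<odot> gid ?Q))
      (can V (Suc u) q \<star> ((gid V \<odot> ?D p u) \<odot> gid ?Q))) (can V (Suc p) v \<star> (gid (gpow V (Suc p)) \<odot> ?D q v))"
    unfolding X using Suc(1) assms(2) pos b' t2 t3 g
    by (intro gadd_assoc[symmetric]) simp_all
  also have "gadd (can V (Suc u) q \<star> ((can V k' p \<star> (b k' \<odot> gid ?P)) \<odot> gid ?Q)) (can V (Suc u) q \<star> ((gid V \<odot> ?D p u) \<odot> gid ?Q))
      = can V (Suc u) q \<star> (gadd (can V k' p \<star> (b k' \<odot> gid ?P)) (gid V \<odot> ?D p u) \<odot> gid ?Q)"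
    using Suc(1) assms(2) pos b' t2 g by (simp add: gtenm_gadd gcomp_gadd)
  also have "gadd (can V k' p \<star> (b k' \<odot> gid ?P)) (gid V \<odot> ?D p u) = ?D (Suc p) (Suc u)"
    using derivation_Suc[of p "Suc u" V b] Suc(1) pos e(6) \<open>k' + p = Suc u\<close> by auto
  finally show ?case unfolding m(1) using e m by simp
qed

end


context
  fixes V W F b b'
  assumes g: "graded_object V" "graded_object W" and F: "ahom V W F"
    and b: "\<forall>k>0. gmor (b k) V (gpow V k) (-1)"
    and b': "\<forall>k>0. gmor (b' k) W (gpow W k) (-1)"
begin

abbreviation (input) "DV \<equiv> derivation V b"
abbreviation (input) "DW \<equiv> derivation W b'"

text \<open>The composite is a derivation over F: the Leibniz rule with F in place of the identity
  on the passive factor. The terms \<open>PP\<close> differentiate the first generator, the terms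
  \<open>QQ\<close> one of the others.\<close>

lemma pro_comp_derivation_Suc:
  assumes "j > 0" "k > 0"
  shows "pro_comp F DV (Suc j) k = gsum (gpow V (Suc j)) (gpow W k) (-1)
    (\<lambda>m. can W m (k - m) \<star> gadd (pro_comp F DV 1 m \<odot> F j (k - m)) (F 1 m \<odot> pro_comp F DV j (k - m))) {1..<k}"
proof -
  note tF = tmatD[OF ahomD(1)[OF F]] and tD = tmatD[OF derivation_tmat[OF g(1) b]]
  note PC = pro_comp_eq[OF derivation_tmat[OF g(1) b] ahomD(1)[OF F], simplified]
  let ?S = "gpow V (Suc j)" and ?T = "gpow W k"
  define P where "P = (\<lambda>i. can V i j \<star> (b i \<odot> gid (gpow V j)))"
  define Q where "Q = (\<lambda>i. gid V \<odot> DV j (i + j - 1))"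
  have ty: "gm (b i)" "gsrc (b i) = V" "gtgt (b i) = gpow V i" "gdeg (b i) = -1"
    "gm (DV j (i + j - 1))" "gsrc (DV j (i + j - 1)) = gpow V j" "gtgt (DV j (i + j - 1)) = gpow V (i + j - 1)" "gdeg (DV j (i + j - 1)) = -1"
    "gpow V (i + j) = V \<odot>\<^sub>o gpow V (i + j - 1)" "i + j - 1 > 0" if "i > 0" for i
    using b tD[of j "i + j - 1"] that assms gpow_Suc[of "i + j - 1" V] by auto
  have P: "gmor (P i) ?S (gpow V (i + j)) (-1)" if "i > 0" for i
    using ty[OF that] that assms g by (simp add: P_def)
  have Q: "gmor (Q i) ?S (gpow V (i + j)) (-1)" if "i > 0" for i
    using ty[OF that] that assms g by (simp add: Q_def)
  have F': "gmor (F (i + j) k) (gpow V (i + j)) ?T 0" if "i > 0" for i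
    using tF[of "i + j" k] assms by simp
  define PP where "PP = (\<lambda>i m. can W m (k - m) \<star> ((F i m \<star> b i) \<odot> F j (k - m)))"
  define QQ where "QQ = (\<lambda>i m. can W m (k - m) \<star> (F 1 m \<odot> (F (i + j - 1) (k - m) \<star> DV j (i + j - 1))))"
  have PP: "gmor (PP i m) ?S ?T (-1)" if "i > 0" "m > 0" "m < k" for i m
    using ty[OF that(1)] that assms g tF by (simp add: PP_def)
  have QQ: "gmor (QQ i m) ?S ?T (-1)" if "i > 0" "m > 0" "m < k" for i m
    using ty[OF that(1)] that assms g tF(1-4)[of 1 m] tF(1-4)[of "i + j - 1" "k - m"] by (simp add: QQ_def)
  have "pro_comp F DV (Suc j) k = gsum ?S ?T (-1) (\<lambda>l. F l k \<star> DV (Suc j) l) {1..k + j}"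
    using PC[of "Suc j" k "k + j"] assms by simp
  also have "\<dots> = gsum ?S ?T (-1) (\<lambda>l. F l k \<star> DV (Suc j) l) {Suc j..k + j}"
    by (rule gsum_mono_neutral[symmetric]) (use tF tD[of "Suc j"] assms g in auto)
  \<comment> \<open>Intermediate lengths below Suc j contribute nothing, since the derivation does
    not shorten words. In \<open>P\<close>, i is the length to which the first generator is expanded
    while the other j are kept.\<close>
  also have "{Suc j..k + j} = (\<lambda>i. i + j) ` {1..k}"
    by (auto simp: image_iff intro!: bexI[of _ "x - j" for x])
  also have "gsum ?S ?T (-1) (\<lambda>l. F l k \<star> DV (Suc j) l) ((\<lambda>i. i + j) ` {1..k}) = gsum ?S ?T (-1) (\<lambda>i. F (i + j) k \<star> DV (Suc j) (i + j)) {1..k}"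
    by (rule gsum_reindex) (use tF tD[of "Suc j"] assms g in \<open>auto simp: inj_on_def\<close>)
  also have "\<dots> = gsum ?S ?T (-1) (\<lambda>i. gadd (gsum ?S ?T (-1) (PP i) {1..<k}) (gsum ?S ?T (-1) (QQ i) {1..<k})) {1..k}"
  proof (rule gsum_cong)
    fix i assume "i \<in> {1..k}"
    then have i: "i > 0" by simp
    have "DV (Suc j) (i + j) = gadd (P i) (Q i)"
      using derivation_Suc[of j "i + j" V b] i assms by (simp add: P_def Q_def)
    then have "F (i + j) k \<star> DV (Suc j) (i + j) = gadd (F (i + j) k \<star> P i) (F (i + j) k \<star> Q i)"
      using F'[OF i] P[OF i] Q[OF i] by (simp add: gcomp_gadd)
    also have "F (i + j) k \<star> P i = (F (i + j) k \<star> can V i j) \<star> (b i \<odot> gid (gpow V j))"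
      using F'[OF i] ty[OF i] i assms g by (simp add: P_def)
    also have "\<dots> = gsum ?S ?T (-1) (\<lambda>m. (can W m (k - m) \<star> (F i m \<odot> F j (k - m))) \<star> (b i \<odot> gid (gpow V j))) {1..<k}"
      unfolding ahomD(3)[OF F i assms] using ty[OF i] i assms g tF by (subst gcomp_gsum_right) auto
    also have "\<dots> = gsum ?S ?T (-1) (PP i) {1..<k}"
    proof (rule gsum_cong)
      fix m assume "m \<in> {1..<k}"
      then show "(can W m (k - m) \<star> (F i m \<odot> F j (k - m))) \<star> (b i \<odot> gid (gpow V j)) = PP i m"
        using ty[OF i] i assms g tF by (simp add: PP_def gtenm_gcomp)
    qed (use PP i g in auto)
    also have "F (i + j) k \<star> Q i = (F (1 + (i + j - 1)) k \<star> can V 1 (i + j - 1)) \<star> Q i"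
      using F'[OF i] ty[OF i] Q[OF i] i assms g by simp
    also have "\<dots> = gsum ?S ?T (-1) (\<lambda>m. (can W m (k - m) \<star> (F 1 m \<odot> F (i + j - 1) (k - m))) \<star> Q i) {1..<k}"
      unfolding ahomD(3)[OF F zero_less_one ty(10)[OF i] assms(2)]
      using ty[OF i] Q[OF i] i assms g tF(1-4)[of 1] tF(1-4)[of "i + j - 1"] by (subst gcomp_gsum_right) auto
    also have "\<dots> = gsum ?S ?T (-1) (QQ i) {1..<k}"
    proof (rule gsum_cong)
      fix m assume "m \<in> {1..<k}"
      then show "(can W m (k - m) \<star> (F 1 m \<odot> F (i + j - 1) (k - m))) \<star> Q i = QQ i m"
        using ty[OF i] i assms g tF(1-4)[of 1 m] tF(1-4)[of "i + j - 1" "k - m"] by (simp add: QQ_def Q_def gtenm_gcomp)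
    qed (use QQ i g in auto)
    finally show "F (i + j) k \<star> DV (Suc j) (i + j) = gadd (gsum ?S ?T (-1) (PP i) {1..<k}) (gsum ?S ?T (-1) (QQ i) {1..<k})" .
  qed (use PP QQ g in \<open>auto intro!: gadd_gm gsum_gm\<close>)
  also have "\<dots> = gadd (gsum ?S ?T (-1) (\<lambda>i. gsum ?S ?T (-1) (PP i) {1..<k}) {1..k}) (gsum ?S ?T (-1) (\<lambda>i. gsum ?S ?T (-1) (QQ i) {1..<k}) {1..k})"
    by (rule gsum_gadd) (use PP QQ g in \<open>auto intro!: gsum_gm\<close>)
  also have "gsum ?S ?T (-1) (\<lambda>i. gsum ?S ?T (-1) (PP i) {1..<k}) {1..k} = gsum ?S ?T (-1) (\<lambda>m. gsum ?S ?T (-1) (\<lambda>i. PP i m) {1..k}) {1..<k}"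
    by (rule gsum_swap) (use PP g in auto)
  also have "gsum ?S ?T (-1) (\<lambda>i. gsum ?S ?T (-1) (QQ i) {1..<k}) {1..k} = gsum ?S ?T (-1) (\<lambda>m. gsum ?S ?T (-1) (\<lambda>i. QQ i m) {1..k}) {1..<k}"
    by (rule gsum_swap) (use QQ g in auto)
  also have "gadd (gsum ?S ?T (-1) (\<lambda>m. gsum ?S ?T (-1) (\<lambda>i. PP i m) {1..k}) {1..<k}) (gsum ?S ?T (-1) (\<lambda>m. gsum ?S ?T (-1) (\<lambda>i. QQ i m) {1..k}) {1..<k})
    = gsum ?S ?T (-1) (\<lambda>m. gadd (gsum ?S ?T (-1) (\<lambda>i. PP i m) {1..k}) (gsum ?S ?T (-1) (\<lambda>i. QQ i m) {1..k})) {1..<k}"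
    by (rule gsum_gadd[symmetric]) (use PP QQ g in \<open>auto intro!: gsum_gm\<close>)
  also have "\<dots> = gsum ?S ?T (-1) (\<lambda>m. can W m (k - m) \<star> gadd (pro_comp F DV 1 m \<odot> F j (k - m)) (F 1 m \<odot> pro_comp F DV j (k - m))) {1..<k}"
  proof (rule gsum_cong)
    fix m assume "m \<in> {1..<k}"
    then have m: "m > 0" "m < k" "k - m > 0" "m \<le> k" by auto
    note tp = tmatD(1-4)[OF pro_comp_tmat[OF derivation_tmat[OF g(1) b] ahomD(1)[OF F]], simplified]
    note f = tF(1-4)[OF assms(1) m(3)] tF(1-4)[OF zero_less_one m(1)] tp[OF zero_less_one m(1)] tp[OF assms(1) m(3)]
    have FD: "gm (F (i + j - 1) (k - m))" "gsrc (F (i + j - 1) (k - m)) = gpow V (i + j - 1)" "gtgt (F (i + j - 1) (k - m)) = gpow W (k - m)"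
      "gdeg (F (i + j - 1) (k - m)) = 0" "gm (F i m)" "gsrc (F i m) = gpow V i" "gtgt (F i m) = gpow W m" "gdeg (F i m) = 0" if "i > 0" for i
      using tF(1-4)[OF ty(10)[OF that] m(3)] tF(1-4)[OF that m(1)] by blast+
    have "gsum ?S ?T (-1) (\<lambda>i. PP i m) {1..k} = can W m (k - m) \<star> (gsum V (gpow W m) (-1) (\<lambda>i. F i m \<star> b i) {1..k} \<odot> F j (k - m))"
      using ty FD f m assms g by (simp add: PP_def gtenm_gsum_left gcomp_gsum_left)
    also have "gsum V (gpow W m) (-1) (\<lambda>i. F i m \<star> b i) {1..k} = gsum V (gpow W m) (-1) (\<lambda>i. F i m \<star> DV 1 i) {1..k}"
      by (rule gsum_cong) (use ty FD g in auto)
    also have "\<dots> = pro_comp F DV 1 m"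
      using PC[of 1 m k] m by simp
    finally have 1: "gsum ?S ?T (-1) (\<lambda>i. PP i m) {1..k} = can W m (k - m) \<star> (pro_comp F DV 1 m \<odot> F j (k - m))" .
    have "gsum ?S ?T (-1) (\<lambda>i. QQ i m) {1..k}
      = can W m (k - m) \<star> (F 1 m \<odot> gsum (gpow V j) (gpow W (k - m)) (-1) (\<lambda>i. F (i + j - 1) (k - m) \<star> DV j (i + j - 1)) {1..k})"
      using ty FD f m assms g by (simp add: QQ_def gtenm_gsum_right gcomp_gsum_left)
    also have "gsum (gpow V j) (gpow W (k - m)) (-1) (\<lambda>i. F (i + j - 1) (k - m) \<star> DV j (i + j - 1)) {1..k}
      = gsum (gpow V j) (gpow W (k - m)) (-1) (\<lambda>l. F l (k - m) \<star> DV j l) ((\<lambda>i. i + j - 1) ` {1..k})"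
      by (rule gsum_reindex[symmetric]) (use ty FD g in \<open>auto simp: inj_on_def\<close>)
    also have "(\<lambda>i. i + j - 1) ` {1..k} = {j..k + j - 1}"
    proof (intro equalityI subsetI)
      fix x assume "x \<in> {j..k + j - 1}"
      then show "x \<in> (\<lambda>i. i + j - 1) ` {1..k}"
        using assms by (intro image_eqI[of _ _ "x + 1 - j"]) auto
    qed auto
    also have "gsum (gpow V j) (gpow W (k - m)) (-1) (\<lambda>l. F l (k - m) \<star> DV j l) {j..k + j - 1}
      = gsum (gpow V j) (gpow W (k - m)) (-1) (\<lambda>l. F l (k - m) \<star> DV j l) {1..k + j - 1}"
    proof (rule gsum_mono_neutral)
      fix l assume "l \<in> {1..k + j - 1} - {j..k + j - 1}"
      then have l: "l > 0" "l < j" by auto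
      show "F l (k - m) \<star> DV j l = gzero (gpow V j) (gpow W (k - m)) (-1)"
        unfolding tD(5)[OF assms(1) l] using tF(1-4)[OF l(1) m(3)] g by simp
    next
      have "l > 0" if "l \<in> {j..k + j - 1}" for l using that assms by auto
      then show "\<forall>l\<in>{j..k + j - 1}. gmor (F l (k - m) \<star> DV j l) (gpow V j) (gpow W (k - m)) (-1)"
        using tF(1-4)[OF _ m(3)] tD(1-4)[OF assms(1)] by auto
    qed (use g assms in auto)
    also have "\<dots> = pro_comp F DV j (k - m)"
      using PC[of j "k - m" "k + j - 1"] m assms by simp
    finally show "gadd (gsum ?S ?T (-1) (\<lambda>i. PP i m) {1..k}) (gsum ?S ?T (-1) (\<lambda>i. QQ i m) {1..k})
      = can W m (k - m) \<star> gadd (pro_comp F DV 1 m \<odot> F j (k - m)) (F 1 m \<odot> pro_comp F DV j (k - m))"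
      unfolding 1 using f m assms g by (simp add: gcomp_gadd)
  next
    have "gm (pro_comp F DV 1 m \<odot> F j (k - m)) \<and> gm (F 1 m \<odot> pro_comp F DV j (k - m))" if "m \<in> {1..<k}" for m
      using that tF assms tmatD(1-4)[OF pro_comp_tmat[OF derivation_tmat[OF g(1) b] ahomD(1)[OF F]], simplified] by simp
    then show "\<forall>m\<in>{1..<k}. gmor (can W m (k - m) \<star> gadd (pro_comp F DV 1 m \<odot> F j (k - m)) (F 1 m \<odot> pro_comp F DV j (k - m))) ?S ?T (-1)"
      using tF assms g tmatD(1-4)[OF pro_comp_tmat[OF derivation_tmat[OF g(1) b] ahomD(1)[OF F]], simplified] by simp
  qed (use g in auto)
  finally show ?thesis .
qed

text \<open>Here F is expanded first and \<open>derivation_can\<close> is applied to its image. The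
  resulting recursion has the same form as for the composite in the other order, which is what
  \<open>derivation_intertwine\<close> exploits.\<close>

lemma derivation_pro_comp_Suc:
  assumes "j > 0" "k > 0"
  shows "pro_comp DW F (Suc j) k = gsum (gpow V (Suc j)) (gpow W k) (-1)
    (\<lambda>m. can W m (k - m) \<star> gadd (pro_comp DW F 1 m \<odot> F j (k - m)) (F 1 m \<odot> pro_comp DW F j (k - m))) {1..<k}"
proof -
  note tF = tmatD[OF ahomD(1)[OF F]] and tD = tmatD[OF derivation_tmat[OF g(2) b']]
  note PC = pro_comp_eq[OF ahomD(1)[OF F] derivation_tmat[OF g(2) b'], simplified]
  let ?S = "gpow V (Suc j)" and ?T = "gpow W k"
  define PP where "PP = (\<lambda>n m. can W n (k - n) \<star> ((DW m n \<star> F 1 m) \<odot> F j (k - n)))"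
  define QQ where "QQ = (\<lambda>m i. can W m (k - m) \<star> (F 1 m \<odot> (DW i (k - m) \<star> F j i)))"
  have PP: "gmor (PP n m) ?S ?T (-1)" if "m > 0" "n > 0" "n < k" for n m
    using that assms g tF tD by (simp add: PP_def)
  have QQ: "gmor (QQ m i) ?S ?T (-1)" if "i > 0" "m > 0" "m < k" for i m
    using that assms g tF tD by (simp add: QQ_def)
  define PP' where "PP' = (\<lambda>l m. PP (k - (l - m)) m)"
  define QQ' where "QQ' = (\<lambda>l m. QQ m (l - m))"
  have PP': "gmor (PP' l m) ?S ?T (-1)" if "m > 0" "m < l" "l \<le> k" for l m
    unfolding PP'_def by (rule PP) (use that in auto)
  have QQ': "gmor (QQ' l m) ?S ?T (-1)" if "m > 0" "m < l" "l \<le> k" for l m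
    unfolding QQ'_def by (rule QQ) (use that in auto)
  have "pro_comp DW F (Suc j) k = gsum ?S ?T (-1) (\<lambda>l. DW l k \<star> F (Suc j) l) {1..k}"
    using PC[of "Suc j" k k] assms by simp
  also have "\<dots> = gsum ?S ?T (-1) (\<lambda>l. gsum ?S ?T (-1) (\<lambda>m. gadd (PP' l m) (QQ' l m)) {1..<l}) {1..k}"
  proof (rule gsum_cong)
    fix l assume "l \<in> {1..k}"
    then have l: "l > 0" "l \<le> k" by auto
    have "DW l k \<star> F (Suc j) l = gsum ?S ?T (-1) (\<lambda>m. DW l k \<star> can W m (l - m) \<star> (F 1 m \<odot> F j (l - m))) {1..<l}"
      unfolding ahom_Suc[OF F assms(1) l(1)] using l assms g tF tD by (subst gcomp_gsum_left) auto
    also have "\<dots> = gsum ?S ?T (-1) (\<lambda>m. gadd (PP' l m) (QQ' l m)) {1..<l}"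
    proof (rule gsum_cong)
      fix m assume "m \<in> {1..<l}"
      then have m: "m > 0" "m < l" by auto
      define i where "i = l - m"
      have i: "l = m + i" "i > 0" "l - m = i" using m by (auto simp: i_def)
      define n where "n = k - i"
      have n: "n > 0" "k - n = i" "k - m > 0" "k - i = n" "n + i = k" "n < k" using l m i by (auto simp: n_def)
      have "DW l k \<star> can W m i \<star> (F 1 m \<odot> F j i) = (DW (m + i) k \<star> can W m i) \<star> (F 1 m \<odot> F j i)"
        using l m i assms g tF tD by simp
      also have "\<dots> = gadd (can W n i \<star> (DW m n \<odot> gid (gpow W i))) (can W m (k - m) \<star> (gid (gpow W m) \<odot> DW i (k - m))) \<star> (F 1 m \<odot> F j i)"
        using derivation_can[OF g(2) b' m(1) i(2), of k] l i n by simp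
      also have "\<dots> = gadd ((can W n i \<star> (DW m n \<odot> gid (gpow W i))) \<star> (F 1 m \<odot> F j i)) ((can W m (k - m) \<star> (gid (gpow W m) \<odot> DW i (k - m))) \<star> (F 1 m \<odot> F j i))"
        using l m(1) i n assms g tF(1-4)[OF zero_less_one m(1)] tF(1-4)[OF assms(1) i(2)] tD(1-4)[OF m(1) n(1)] tD(1-4)[OF i(2) n(3)]
        by (intro gcomp_gadd) auto
      also have "(can W n i \<star> (DW m n \<odot> gid (gpow W i))) \<star> (F 1 m \<odot> F j i) = PP' l m"
        using m(1) i(2) n(1) assms(1) g tF(1-4)[OF zero_less_one m(1)] tF(1-4)[OF assms(1) i(2)] tD(1-4)[OF m(1) n(1)]
        by (simp add: PP'_def PP_def i(3) n gtenm_gcomp)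
      also have "(can W m (k - m) \<star> (gid (gpow W m) \<odot> DW i (k - m))) \<star> (F 1 m \<odot> F j i) = QQ' l m"
        using m(1) i(2) n(3) assms(1) g tF(1-4)[OF zero_less_one m(1)] tF(1-4)[OF assms(1) i(2)] tD(1-4)[OF i(2) n(3)]
        by (simp add: QQ'_def QQ_def i(3) gtenm_gcomp)
      finally show "DW l k \<star> can W m (l - m) \<star> (F 1 m \<odot> F j (l - m)) = gadd (PP' l m) (QQ' l m)"
        unfolding i(3) .
    qed (use PP' QQ' l g in auto)
    finally show "DW l k \<star> F (Suc j) l = gsum ?S ?T (-1) (\<lambda>m. gadd (PP' l m) (QQ' l m)) {1..<l}" .
  qed (use PP' QQ' g in \<open>auto intro!: gsum_gm gadd_gm\<close>)
  also have "\<dots> = gsum ?S ?T (-1) (\<lambda>(l, m). gadd (PP' l m) (QQ' l m)) (SIGMA l:{1..k}. {1..<l})"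
    by (rule gsum_Sigma) (use PP' QQ' g in auto)
  also have "\<dots> = gadd (gsum ?S ?T (-1) (\<lambda>(l, m). PP' l m) (SIGMA l:{1..k}. {1..<l})) (gsum ?S ?T (-1) (\<lambda>(l, m). QQ' l m) (SIGMA l:{1..k}. {1..<l}))"
    unfolding case_prod_unfold by (rule gsum_gadd) (use PP' QQ' g in auto)
  also have "gsum ?S ?T (-1) (\<lambda>(l, m). PP' l m) (SIGMA l:{1..k}. {1..<l}) = gsum ?S ?T (-1) (\<lambda>(n, m). PP n m) (SIGMA n:{1..<k}. {1..n})"
  proof (rule gsum_bij[where h="\<lambda>(l, m). (k - (l - m), m)"])
    show "bij_betw (\<lambda>(l, m). (k - (l - m), m)) (SIGMA l:{1..k}. {1..<l}) (SIGMA n:{1..<k}. {1..n})"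
      by (rule bij_betw_byWitness[where f'="\<lambda>(n, m). (m + k - n, m)"]) auto
  qed (use PP g in \<open>auto simp: PP'_def\<close>)
  also have "\<dots> = gsum ?S ?T (-1) (\<lambda>n. gsum ?S ?T (-1) (PP n) {1..n}) {1..<k}"
    by (rule gsum_Sigma[symmetric]) (use PP g in auto)
  also have "gsum ?S ?T (-1) (\<lambda>(l, m). QQ' l m) (SIGMA l:{1..k}. {1..<l}) = gsum ?S ?T (-1) (\<lambda>(m, i). QQ m i) (SIGMA m:{1..<k}. {1..k - m})"
  proof (rule gsum_bij[where h="\<lambda>(l, m). (m, l - m)"])
    show "bij_betw (\<lambda>(l, m). (m, l - m)) (SIGMA l:{1..k}. {1..<l}) (SIGMA m:{1..<k}. {1..k - m})"
      by (rule bij_betw_byWitness[where f'="\<lambda>(m, i). (m + i, m)"]) auto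
  qed (use QQ g in \<open>auto simp: QQ'_def\<close>)
  also have "\<dots> = gsum ?S ?T (-1) (\<lambda>m. gsum ?S ?T (-1) (QQ m) {1..k - m}) {1..<k}"
    by (rule gsum_Sigma[symmetric]) (use QQ g in auto)
  also have "gadd (gsum ?S ?T (-1) (\<lambda>n. gsum ?S ?T (-1) (PP n) {1..n}) {1..<k}) (gsum ?S ?T (-1) (\<lambda>m. gsum ?S ?T (-1) (QQ m) {1..k - m}) {1..<k})
    = gsum ?S ?T (-1) (\<lambda>m. gadd (gsum ?S ?T (-1) (PP m) {1..m}) (gsum ?S ?T (-1) (QQ m) {1..k - m})) {1..<k}"
    by (rule gsum_gadd[symmetric]) (use PP QQ g in \<open>auto intro!: gsum_gm\<close>)
  also have "\<dots> = gsum ?S ?T (-1) (\<lambda>m. can W m (k - m) \<star> gadd (pro_comp DW F 1 m \<odot> F j (k - m)) (F 1 m \<odot> pro_comp DW F j (k - m))) {1..<k}"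
  proof (rule gsum_cong)
    fix m assume "m \<in> {1..<k}"
    then have m: "m > 0" "m < k" "k - m > 0" "m \<le> k" by auto
    note tp = tmatD(1-4)[OF pro_comp_tmat[OF ahomD(1)[OF F] derivation_tmat[OF g(2) b']], simplified]
    note f = tF(1-4)[OF assms(1) m(3)] tF(1-4)[OF zero_less_one m(1)] tp[OF zero_less_one m(1)] tp[OF assms(1) m(3)]
    have 1: "gsum ?S ?T (-1) (PP m) {1..m} = can W m (k - m) \<star> (pro_comp DW F 1 m \<odot> F j (k - m))"
      using PC[of 1 m m] f m assms g tF(1-4) tD(1-4) by (simp add: PP_def gtenm_gsum_left gcomp_gsum_left)
    have 2: "gsum ?S ?T (-1) (QQ m) {1..k - m} = can W m (k - m) \<star> (F 1 m \<odot> pro_comp DW F j (k - m))"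
      using PC[of j "k - m" "k - m"] f m assms g tF(1-4) tD(1-4) by (simp add: QQ_def gtenm_gsum_right gcomp_gsum_left)
    show "gadd (gsum ?S ?T (-1) (PP m) {1..m}) (gsum ?S ?T (-1) (QQ m) {1..k - m})
      = can W m (k - m) \<star> gadd (pro_comp DW F 1 m \<odot> F j (k - m)) (F 1 m \<odot> pro_comp DW F j (k - m))"
      unfolding 1 2 using f m assms g by (simp add: gcomp_gadd)
  next
    note tp = tmatD(1-4)[OF pro_comp_tmat[OF ahomD(1)[OF F] derivation_tmat[OF g(2) b']], simplified]
    show "\<forall>m\<in>{1..<k}. gmor (can W m (k - m) \<star> gadd (pro_comp DW F 1 m \<odot> F j (k - m)) (F 1 m \<odot> pro_comp DW F j (k - m))) ?S ?T (-1)"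
      using tF(1-4) assms g tp by simp
  qed (use g in auto)
  finally show ?thesis .
qed

text \<open>Both composites are derivations over F, hence determined by their values on
  generators.\<close>

lemma derivation_intertwine:
  assumes "\<And>k. k > 0 \<Longrightarrow> pro_comp F DV 1 k = pro_comp DW F 1 k"
  shows "pro_comp F DV = pro_comp DW F"
proof -
  note tF = tmatD[OF ahomD(1)[OF F]]
  note tp = tmatD(1-4)[OF pro_comp_tmat[OF ahomD(1)[OF F] derivation_tmat[OF g(2) b']], simplified]
  have "\<forall>k>0. pro_comp F DV j k = pro_comp DW F j k" if "j > 0" for j
    using that
  proof (induction j rule: nat_induct_non_zero)
    case 1
    then show ?case using assms by simp
  next
    case (Suc j)
    show ?case
    proof (intro allI impI)
      fix k :: nat assume k: "k > 0"
      show "pro_comp F DV (Suc j) k = pro_comp DW F (Suc j) k"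
        unfolding pro_comp_derivation_Suc[OF Suc(1) k] derivation_pro_comp_Suc[OF Suc(1) k]
        by (rule gsum_cong) (use Suc tF tp assms g in auto)
    qed
  qed
  then have "mk_matrix (pro_comp F DV) = mk_matrix (pro_comp DW F)" by (auto simp: mk_matrix_def fun_eq_iff)
  then show ?thesis by simp
qed

end

end

section \<open>Explicit faces and degeneracies of chains\<close>

lemma splt_singles:
  assumes "cpath j c" "a \<le> length c"
  shows "pseg j (splt (replicate a 1 @ ls) c) = take a c @ pseg (pend j (take a c)) (splt ls (drop a c))"
  using assms
proof (induction a arbitrary: j c)
  case (Suc a)
  then obtain \<alpha> c' where c: "c = \<alpha> # c'" by (cases c) auto
  then show ?case using Suc.IH[of "atrg \<alpha>" c'] Suc.prems by (simp add: acomp_aid)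
qed simp

lemma lens_upt: "lens [a..<b] = replicate (b - a - 1) 1"
proof (induction "b - a" arbitrary: a)
  case (Suc d)
  show ?case
  proof (cases "Suc a < b")
    case True
    then have "[a..<b] = a # Suc a # [Suc (Suc a)..<b]" "[Suc a..<b] = Suc a # [Suc (Suc a)..<b]"
      by (auto simp: upt_conv_Cons)
    moreover have "b - a - 1 = Suc (b - Suc a - 1)" using True by simp
    ultimately show ?thesis using Suc(1)[of "Suc a"] Suc(2) by simp
  next
    case False
    then have "b = Suc a" using Suc(2) by simp
    then show ?thesis by simp
  qed
qed simp

lemma lens_append: "xs \<noteq> [] \<Longrightarrow> ys \<noteq> [] \<Longrightarrow> lens (xs @ ys) = lens xs @ (hd ys - last xs) # lens ys"
proof (induction xs rule: lens.induct)
  case (2 t)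
  then show ?case by (cases ys) auto
qed auto

lemma upt_mono_maps: "a < b \<Longrightarrow> b \<le> n + 1 \<Longrightarrow> [a..<b] \<in> mono_maps (b - a - 1) n"
  by (auto simp: mono_maps_def)

lemma path_last: "length c = Suc a \<Longrightarrow> cpath m c \<Longrightarrow> path (pend m (take a c)) (drop a c) = last c"
proof (induction c arbitrary: m a)
  case (Cons \<alpha> c)
  then show ?case by (cases c; cases a) (auto simp: acomp_aid)
qed simp

lemma pseg_last:
  assumes "cpath j c" "length c = Suc a"
  shows "pseg j (splt (replicate a 1) c) = c"
proof -
  have "take a c @ [last c] = c" using assms by (cases c rule: rev_cases) auto
  then show ?thesis using splt_singles[OF assms(1), of a "[]"] path_last[of c a j] assms by simp
qed

lemma nop_front:
  assumes "c \<in> nerve j k n" "v \<le> n"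
  shows "nop [0..<v + 1] c = take (v + 1) c @ [path (atrg (c ! v)) (drop (v + 1) c)]"
proof -
  have c: "cpath j c" "length c = n + 2" using assms by (auto simp: nerve_iff)
  have "hd [0..<v + 1] = 0" by (simp add: upt_conv_Cons del: upt_Suc)
  then have "nop [0..<v + 1] c = pseg j (splt (replicate (v + 1) 1 @ []) c)"
    using nop_pseg[OF c(1) upt_mono_maps[of 0 "v + 1" n] c(2)] assms by (simp add: lens_upt del: upt_Suc)
  also have "\<dots> = take (v + 1) c @ [path (pend j (take (v + 1) c)) (drop (v + 1) c)]"
    using splt_singles[OF c(1), of "v + 1" "[]"] c assms by simp
  also have "pend j (take (v + 1) c) = atrg (c ! v)"
    using pend_last[of "take (v + 1) c" j] c assms by (simp add: take_Suc_conv_app_nth)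
  finally show ?thesis .
qed

lemma nop_back:
  assumes "c \<in> nerve j k n" "v \<le> n"
  shows "nop [v..<n + 1] c = path j (take (v + 1) c) # drop (v + 1) c"
proof -
  have c: "cpath j c" "length c = n + 2" using assms by (auto simp: nerve_iff)
  have "hd [v..<n + 1] = v" using assms by (simp add: upt_conv_Cons del: upt_Suc)
  then have "nop [v..<n + 1] c = path j (take (v + 1) c) # pseg (pend j (take (v + 1) c)) (splt (replicate (n - v) 1) (drop (v + 1) c))"
    using nop_pseg[OF c(1) upt_mono_maps[of v "n + 1" n] c(2)] assms by (simp add: lens_upt del: upt_Suc)
  also have "pseg (pend j (take (v + 1) c)) (splt (replicate (n - v) 1) (drop (v + 1) c)) = drop (v + 1) c"
  proof (rule pseg_last)
    show "cpath (pend j (take (v + 1) c)) (drop (v + 1) c)"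
      using c(1) by (metis append_take_drop_id cpath_append)
  qed (use c assms in auto)
  finally show ?thesis .
qed

lemma nop_inner_face:
  assumes "c \<in> nerve j k n" "c = as @ [\<alpha>, \<beta>] @ bs" "length as = r" "0 < r" "r < n"
  shows "nop ([0..<r] @ [r + 1..<n + 1]) c = as @ [acomp \<beta> \<alpha>] @ bs"
    "[0..<r] @ [r + 1..<n + 1] \<in> mono_maps (n - 1) n"
proof -
  have c: "cpath j c" "length c = n + 2" using assms(1) by (auto simp: nerve_iff)
  let ?\<theta> = "[0..<r] @ [r + 1..<n + 1]"
  show m: "?\<theta> \<in> mono_maps (n - 1) n"
    using assms by (auto simp: mono_maps_def sorted_append)
  have "lens ?\<theta> = replicate (r - 1) 1 @ 2 # replicate (n - r - 1) 1"
    using assms by (subst lens_append) (auto simp: lens_upt last_conv_nth hd_conv_nth simp del: upt_Suc)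
  moreover have "hd ?\<theta> = 0" using assms by (simp add: upt_conv_Cons del: upt_Suc)
  moreover have "1 # replicate (r - 1) 1 = replicate r (1::nat)"
    using assms by (simp flip: replicate_Suc)
  ultimately have l: "(hd ?\<theta> + 1) # lens ?\<theta> = replicate r 1 @ 2 # replicate (n - r - 1) 1"
    by (simp del: replicate_Suc)
  have "nop ?\<theta> c = pseg j (splt (replicate r 1 @ 2 # replicate (n - r - 1) 1) c)"
    using nop_pseg[OF c(1) m c(2)] unfolding l .
  also have "\<dots> = as @ path (pend j as) [\<alpha>, \<beta>] # pseg (pend j (as @ [\<alpha>, \<beta>])) (splt (replicate (n - r - 1) 1) bs)"
    using splt_singles[OF c(1), of r] c assms by simp
  also have "pseg (pend j (as @ [\<alpha>, \<beta>])) (splt (replicate (n - r - 1) 1) bs) = bs"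
  proof (rule pseg_last)
    show "cpath (pend j (as @ [\<alpha>, \<beta>])) bs" using c(1) assms(2) by simp
    show "length bs = Suc (n - r - 1)" using c(2) assms by simp
  qed
  finally show "nop ?\<theta> c = as @ [acomp \<beta> \<alpha>] @ bs"
    using c(1) assms(2) by (simp add: acomp_aid)
qed

text \<open>Position t + 1 of the list holds the map from vertex t to vertex t + 1, so an identity
  there makes the chain a degeneracy along the \<theta> that repeats the value t.\<close>

lemma nop_degenerate:
  assumes "c \<in> nerve j k n" "t < n" "c ! (t + 1) = aid (asrc (c ! (t + 1)))"
  obtains c' \<theta> where "c' \<in> nerve j k (n - 1)" "\<theta> \<in> mono_maps n (n - 1)" "nop \<theta> c' = c" "\<theta> ! t = \<theta> ! (t + 1)"
proof -
  have c: "cpath j c" "pend j c = k" "length c = n + 2" using assms by (auto simp: nerve_iff)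
  define as bs where "as = take (t + 1) c" and "bs = drop (t + 2) c"
  obtain x where x: "x = c ! (t + 1)" by simp
  then have cc: "c = as @ x # bs" "length as = t + 1" "length bs = n - t"
    using c(3) assms(2) id_take_nth_drop[of "t + 1" c] by (auto simp: as_def bs_def)
  have a: "asrc x = pend j as" "cpath j as" "cpath (atrg x) bs" "pend (atrg x) bs = k"
    using c(1,2) unfolding cc(1) by simp_all
  have x': "x = aid (pend j as)" using assms(3) unfolding x[symmetric] a(1) .
  have "pend j as > 0" "atrg x = pend j as" using cpath_pend_pos[OF a(2)] unfolding x' by simp_all
  note a = this(1) a(2) a(3,4)[unfolded this(2)]
  let ?\<theta> = "[0..<t + 1] @ [t..<n]"
  have c': "as @ bs \<in> nerve j k (n - 1)"
    using assms(2) cc(2,3) a unfolding nerve_iff by simp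
  have \<theta>: "?\<theta> \<in> mono_maps n (n - 1)"
    using assms(2) by (auto simp: mono_maps_def sorted_append)
  have "lens ?\<theta> = replicate t 1 @ 0 # replicate (n - t - 1) 1"
    using assms(2) by (subst lens_append) (auto simp: lens_upt last_conv_nth hd_conv_nth simp del: upt_Suc)
  moreover have "hd ?\<theta> = 0" by (simp add: upt_conv_Cons del: upt_Suc)
  ultimately have l: "(hd ?\<theta> + 1) # lens ?\<theta> = replicate (t + 1) 1 @ 0 # replicate (n - t - 1) 1"
    by simp
  have cp: "cpath j (as @ bs)" "length (as @ bs) = n - 1 + 2" using c' by (auto simp: nerve_iff)
  have "nop ?\<theta> (as @ bs) = pseg j (splt (replicate (t + 1) 1 @ 0 # replicate (n - t - 1) 1) (as @ bs))"
    using nop_pseg[OF cp(1) \<theta> cp(2)] unfolding l .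
  also have "\<dots> = as @ aid (pend j as) # pseg (pend j as) (splt (replicate (n - t - 1) 1) bs)"
    using splt_singles[OF cp(1), of "t + 1"] cc(2) by simp
  also have "pseg (pend j as) (splt (replicate (n - t - 1) 1) bs) = bs"
    by (rule pseg_last) (use cp cc assms(2) in auto)
  also have "as @ aid (pend j as) # bs = c"
    using cc(1) x' by simp
  finally have "nop ?\<theta> (as @ bs) = c" .
  moreover have "?\<theta> ! t = ?\<theta> ! (t + 1)"
    using assms(2) by (simp add: nth_append del: upt_Suc)
  ultimately show thesis using that c' \<theta> by blast
qed

section \<open>Words of elementary refinements\<close>

definition dface :: "nat \<Rightarrow> nat \<Rightarrow> nat list" where
  "dface j i = map (\<lambda>v. if v < i then v else v + 1) [0..<j + 1]"

lemma dface_nth: "v \<le> j \<Longrightarrow> dface j i ! v = (if v < i then v else v + 1)" and dface_length [simp]: "length (dface j i) = j + 1"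
  by (auto simp: dface_def simp del: upt_Suc)

lemma dface_act:
  assumes "1 \<le> i" "i \<le> j"
  shows "act (dface j i)" "asrc (dface j i) = j" "atrg (dface j i) = j + 1"
  using actI[of "dface j i" j] assms by (auto simp: dface_nth)

lemma dface_dface:
  assumes "1 \<le> a" "a < b" "b \<le> j + 1"
  shows "acomp (dface (j + 1) b) (dface j a) = acomp (dface (j + 1) a) (dface j (b - 1))"
  using assms by (intro nth_equalityI) (auto simp: acomp_nth dface_nth)

text \<open>A word \<open>i\<^sub>1 \<dots> i\<^sub>n\<close> encodes the chain \<open>[m] = [m] \<rightarrow> [m + 1] \<rightarrow> \<dots> \<rightarrow> [m + n] = [m + n]\<close> whose steps are the
  coface maps missing \<open>i\<^sub>1, \<dots>, i\<^sub>n\<close>. For \<open>m = 1\<close> these are the \<open>n!\<close> nondegenerate maximal chains; with the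
  signs \<open>(-1)\<close> to the power \<open>i\<^sub>1 + \<dots> + i\<^sub>n\<close> they add up to a fundamental chain of an \<open>n\<close>-cube.\<close>

fun wd :: "nat \<Rightarrow> nat list \<Rightarrow> bool" where
  "wd m [] \<longleftrightarrow> True"
| "wd m (i # w) \<longleftrightarrow> 1 \<le> i \<and> i \<le> m \<and> wd (Suc m) w"

fun wsteps :: "nat \<Rightarrow> nat list \<Rightarrow> chain" where
  "wsteps m [] = []"
| "wsteps m (i # w) = dface m i # wsteps (Suc m) w"

definition wchain :: "nat \<Rightarrow> nat list \<Rightarrow> chain" where
  "wchain m w = aid m # wsteps m w @ [aid (m + length w)]"

definition words :: "nat \<Rightarrow> nat \<Rightarrow> nat list set" where
  "words m n = {w. length w = n \<and> wd m w}"

lemma wd_append [simp]: "wd m (u @ w) \<longleftrightarrow> wd m u \<and> wd (m + length u) w"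
  by (induction m u rule: wd.induct) auto

lemma wsteps_append [simp]: "wsteps m (u @ w) = wsteps m u @ wsteps (m + length u) w"
  by (induction m u rule: wsteps.induct) auto

lemma wsteps_length [simp]: "length (wsteps m w) = length w"
  by (induction m w rule: wsteps.induct) auto

lemma wd_pos: "wd m w \<Longrightarrow> i \<in> set w \<Longrightarrow> i \<ge> 1"
  by (induction m w rule: wd.induct) auto

lemma wd_bound: "wd m w \<Longrightarrow> i \<in> set w \<Longrightarrow> i < m + length w"
  by (induction m w rule: wd.induct) auto

lemma words_finite [simp]: "finite (words m n)"
  by (rule finite_subset[OF _ finite_lists_length_eq[of "{0..m + n}" n]])
    (auto simp: words_def dest: wd_bound)

lemma words_0 [simp]: "words m 0 = {[]}"
  by (auto simp: words_def)

lemma wsteps_cpath: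
  "wd m w \<Longrightarrow> m > 0 \<Longrightarrow> cpath m (wsteps m w) \<and> pend m (wsteps m w) = m + length w"
  by (induction m w rule: wsteps.induct) (auto simp: dface_act)

lemma wchain_nerve: "w \<in> words m n \<Longrightarrow> m > 0 \<Longrightarrow> wchain m w \<in> nerve m (m + n) n"
  using wsteps_cpath[of m w] by (auto simp: words_def wchain_def nerve_iff)

text \<open>The steps of a word chain cut at p. The letter i refines the i-th interval: if i \<le>
  p, the left part grows and the right part pauses with an identity, otherwise conversely. The
  argument p is the current size of the left part, and \<open>lsize\<close> computes its final
  size.\<close>

fun lsteps :: "nat \<Rightarrow> nat list \<Rightarrow> chain" where
  "lsteps p [] = []"
| "lsteps p (i # w) = (if i \<le> p then dface p i # lsteps (Suc p) w else aid p # lsteps p w)"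

fun rsteps :: "nat \<Rightarrow> nat \<Rightarrow> nat list \<Rightarrow> chain" where
  "rsteps p r [] = []"
| "rsteps p r (i # w) = (if i \<le> p then aid r # rsteps (Suc p) r w else dface r (i - p) # rsteps p (Suc r) w)"

fun lsize :: "nat \<Rightarrow> nat list \<Rightarrow> nat" where
  "lsize p [] = p"
| "lsize p (i # w) = (if i \<le> p then lsize (Suc p) w else lsize p w)"

lemma restr_dface:
  assumes "p < m" "0 < p" "1 \<le> i"
  shows "restr (dface m i) 0 p = (if i \<le> p then dface p i else aid p)"
    "restr (dface m i) p m = (if i \<le> p then aid (m - p) else dface (m - p) (i - p))"
  using assms
  by (auto simp: restr_def dface_nth intro!: nth_equalityI)

lemma restr_aid: "x < y \<Longrightarrow> y \<le> m \<Longrightarrow> restr (aid m) x y = aid (y - x)"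
  by (rule nth_equalityI) (auto simp: restr_def)

lemma cut_wsteps:
  assumes "wd m w" "0 < p" "p < m"
  shows "cut 0 p (wsteps m w @ [aid (m + length w)]) = lsteps p w @ [aid (lsize p w)]"
    "cut p m (wsteps m w @ [aid (m + length w)]) = rsteps p (m - p) w @ [aid (m + length w - lsize p w)]"
  using assms
proof (induction m w arbitrary: p rule: wsteps.induct)
  case (1 m)
  { case 1 then show ?case by (simp add: cut_Cons restr_aid del: cut.simps(2)) }
  { case 2 then show ?case by (simp add: cut_Cons restr_aid del: cut.simps(2)) }
next
  case (2 m i w)
  { case 1
    then show ?case using 2(1)[of p] 2(1)[of "Suc p"]
      by (auto simp: cut_Cons restr_dface dface_nth simp del: cut.simps(2)) }
  { case 2
    then show ?case using "2.IH"(2)[of p] "2.IH"(2)[of "Suc p"]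
      by (auto simp: cut_Cons restr_dface dface_nth Suc_diff_le simp del: cut.simps(2)) }
qed

lemma cut_wchain:
  assumes "wd m w" "0 < p" "p < m"
  shows "cut 0 p (wchain m w) = aid p # lsteps p w @ [aid (lsize p w)]"
    "cut p m (wchain m w) = aid (m - p) # rsteps p (m - p) w @ [aid (m + length w - lsize p w)]"
  using cut_wsteps[OF assms] assms by (simp_all add: wchain_def cut_Cons restr_aid del: cut.simps(2))

lemma lsteps_left: "wd p u \<Longrightarrow> lsteps p (u @ w) = wsteps p u @ lsteps (p + length u) w"
  and rsteps_left: "wd p u \<Longrightarrow> rsteps p r (u @ w) = replicate (length u) (aid r) @ rsteps (p + length u) r w"
  and lsize_left: "wd p u \<Longrightarrow> lsize p (u @ w) = lsize (p + length u) w"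
  by (induction p u rule: wd.induct) auto

lemma lsteps_right: "\<forall>i\<in>set u. p < i \<Longrightarrow> lsteps p (u @ w) = replicate (length u) (aid p) @ lsteps p w"
  and lsize_right: "\<forall>i\<in>set u. p < i \<Longrightarrow> lsize p (u @ w) = lsize p w"
  by (induction u) auto

lemma rsteps_right: "\<forall>i\<in>set u. p < i \<Longrightarrow> rsteps p r (u @ w) = wsteps r (map (\<lambda>i. i - p) u) @ rsteps p (r + length u) w"
  by (induction u arbitrary: r) auto

lemma path_aids [simp]: "m > 0 \<Longrightarrow> path m (replicate a (aid m)) = aid m"
  by (induction a) (auto simp: acomp_aid(1)[of "aid m", simplified])

text \<open>Picks the first letter that exceeds the current size of the left part; up to there the
  word refines only the left part.\<close>

lemma wd_split:
  "\<forall>i\<in>set w. 1 \<le> i \<Longrightarrow> \<not> wd p (take v w) \<Longrightarrow> \<exists>u i w'. w = u @ i # w' \<and> length u < v \<and> wd p u \<and> p + length u < i"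
proof (induction w arbitrary: p v)
  case (Cons i w)
  then obtain v' where v: "v = Suc v'" by (cases v) auto
  show ?case
  proof (cases "i \<le> p")
    case True
    then obtain u i' w' where "w = u @ i' # w'" "length u < v'" "wd (Suc p) u" "Suc p + length u < i'"
      using Cons.IH[of "Suc p" v'] Cons.prems v by auto
    then show ?thesis using True Cons.prems v by (intro exI[of _ "i # u"]) auto
  next
    case False
    then show ?thesis using v by (intro exI[of _ "[]"]) auto
  qed
qed simp

lemma wd_shift: "wd m u \<Longrightarrow> wd (q + m) (map ((+) q) u)"
  by (induction m u rule: wd.induct) auto

lemma wd_unshift: "wd (q + m) w \<Longrightarrow> \<forall>i\<in>set w. q < i \<Longrightarrow> wd m (map (\<lambda>i. i - q) w)"
  by (induction w arbitrary: m) auto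

lemma sum_list_shift: "sum_list (map ((+) q) u) = q * length u + sum_list u" for q :: nat
  by (induction u) auto

text \<open>When the word refines the first block first and only the others afterwards, the two
  parts pause at complementary times. Composing the pauses away gives word chains again; the letters
  of the second one drop by 1 + length u, the size that the first block has reached.\<close>

lemma wchain_front:
  assumes "wd (Suc m) (u @ w)" "wd 1 u" "\<forall>i\<in>set w. 1 + length u < i" "m > 0"
  shows "nop [0..<length u + 1] (cut 0 1 (wchain (Suc m) (u @ w))) = wchain 1 u"
    "nop [length u..<length (u @ w) + 1] (cut 1 (Suc m) (wchain (Suc m) (u @ w))) = wchain m (map (\<lambda>i. i - (1 + length u)) w)"
    "cut 0 1 (wchain (Suc m) (u @ w)) \<in> nerve 1 (1 + length u) (length (u @ w))"
    "cut 1 (Suc m) (wchain (Suc m) (u @ w)) \<in> nerve m (m + length w) (length (u @ w))"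
proof -
  let ?c = "wchain (Suc m) (u @ w)" and ?v = "length u" and ?n = "length (u @ w)"
  have cn: "?c \<in> nerve (Suc m) (Suc m + ?n) ?n"
    using wchain_nerve[of "u @ w" "Suc m" ?n] assms by (simp add: words_def)
  have ls: "lsize 1 (u @ w) = 1 + ?v"
    using lsize_left[OF assms(2), of w] lsize_right[OF assms(3), of "[]"] by simp
  have l: "lsteps 1 (u @ w) = wsteps 1 u @ replicate (length w) (aid (1 + ?v))"
    using lsteps_left[OF assms(2), of w] lsteps_right[OF assms(3), of "[]"] by simp
  have c1: "cut 0 1 ?c = (aid 1 # wsteps 1 u) @ replicate (Suc (length w)) (aid (1 + ?v))"
    using cut_wchain(1)[OF assms(1), of 1] assms(4) ls l by (simp add: replicate_append_same)
  have c2: "cut 1 (Suc m) ?c = replicate (Suc ?v) (aid m) @ wsteps m (map (\<lambda>i. i - (1 + ?v)) w) @ [aid (m + length w)]"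
    using cut_wchain(2)[OF assms(1), of 1] assms(4) ls rsteps_left[OF assms(2), of m w] rsteps_right[OF assms(3), of m "[]"]
    by simp
  have "cut 0 1 ?c \<in> nerve 1 (path (Suc m) ?c ! 1 - path (Suc m) ?c ! 0) ?n"
    using cut_nerve[OF cn, of 0 1] by simp
  moreover have "cend (cut 0 1 ?c) = 1 + ?v"
    unfolding c1 cend_def by simp
  ultimately show n1: "cut 0 1 ?c \<in> nerve 1 (1 + ?v) ?n" using nerve_cend by metis
  have "cut 1 (Suc m) ?c \<in> nerve m (path (Suc m) ?c ! Suc m - path (Suc m) ?c ! 1) ?n"
    using cut_nerve[OF cn, of 1 "Suc m"] assms(4) by simp
  moreover have "cend (cut 1 (Suc m) ?c) = m + length w"
    unfolding c2 cend_def by simp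
  ultimately show n2: "cut 1 (Suc m) ?c \<in> nerve m (m + length w) ?n" using nerve_cend by metis
  have cl: "cpath 1 (aid 1 # wsteps 1 u)" "pend 1 (aid 1 # wsteps 1 u) = 1 + ?v"
    using wsteps_cpath[OF assms(2)] by auto
  have at: "atrg (cut 0 1 ?c ! ?v) = 1 + ?v"
  proof -
    have "cut 0 1 ?c ! ?v = last (aid 1 # wsteps 1 u)"
      unfolding c1 nth_append last_conv_nth[OF list.distinct(2)] by simp
    then show ?thesis using pend_last[of "aid 1 # wsteps 1 u" 1] cl(2) by simp
  qed
  have "nop [0..<?v + 1] (cut 0 1 ?c) = take (?v + 1) (cut 0 1 ?c) @ [path (1 + ?v) (drop (?v + 1) (cut 0 1 ?c))]"
    using nop_front[OF n1, of ?v] at by simp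
  also have "\<dots> = wchain 1 u"
    unfolding c1 unfolding wchain_def using path_aids[of "1 + ?v" "Suc (length w)"] by simp
  finally show "nop [0..<?v + 1] (cut 0 1 ?c) = wchain 1 u" .
  have "nop [?v..<?n + 1] (cut 1 (Suc m) ?c) = path m (take (?v + 1) (cut 1 (Suc m) ?c)) # drop (?v + 1) (cut 1 (Suc m) ?c)"
    by (rule nop_back[OF n2]) simp
  also have "\<dots> = wchain m (map (\<lambda>i. i - (1 + ?v)) w)"
    unfolding c2 unfolding wchain_def using path_aids[OF assms(4), of "Suc ?v"] by simp
  finally show "nop [?v..<?n + 1] (cut 1 (Suc m) ?c) = wchain m (map (\<lambda>i. i - (1 + ?v)) w)" .
qed

lemma inj_on_nth_image:
  assumes "distinct \<theta>" "length \<theta> = m + 1"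
  shows "inj_on (nth \<theta>) {0..m}" "nth \<theta> ` {0..m} = set \<theta>"
  using assms by (auto simp: inj_on_def nth_eq_iff_index_eq set_conv_nth)

section \<open>The signed sums over the cube and their decomposition into blocks\<close>

context abelian_tensor_category
begin

definition Bsum :: "('a, 'b) coalgebra \<Rightarrow> ('a, 'b) coalgebra \<Rightarrow> ('a, 'b) family \<Rightarrow> nat \<Rightarrow> nat \<Rightarrow> ('a, 'b) gmap" where
  "Bsum X Y \<mu> m n = gsum (gpow (gr (cx X)) m) (gpow (gr (cx Y)) (m + n)) (int n)
     (\<lambda>w. gsgn (int (sum_list w)) (stop n (gpow (gr (cx X)) m) (fext X Y \<mu> (wchain m w)))) (words m n)"

context
  fixes X Y :: "('a, 'b) coalgebra" and \<mu> :: "('a, 'b) family"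
  assumes g: "graded_object (gr (cx X))" "graded_object (gr (cx Y))" and \<mu>: "sfam (gr (cx X)) (gr (cx Y)) \<mu>"
begin

abbreviation (input) "AX \<equiv> gr (cx X)"
abbreviation (input) "BY \<equiv> gr (cx Y)"

text \<open>Since \<theta> is injective, \<open>sobj\<close> carries the top simplex to the face
  spanned by the values of \<theta>; simpliciality then moves the operator into the chain.\<close>

lemma fext_face:
  assumes "c \<in> nerve j k n" "\<theta> \<in> mono_maps m n" "distinct \<theta>" "\<sigma> = set \<theta>"
  shows "fext X Y \<mu> c \<star> sinc n (gpow AX j) \<sigma> = stop m (gpow AX j) (fext X Y \<mu> (nop \<theta> c))"
proof -
  note t = fext_typing[OF g \<mu> assms(1)]
  have i: "inj_on (nth \<theta>) {0..m}" "nth \<theta> ` {0..m} = set \<theta>"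
    using inj_on_nth_image[OF assms(3)] mono_maps_nth(3)[OF assms(2)] by auto
  have "stop m (gpow AX j) (fext X Y \<mu> (nop \<theta> c)) = fext X Y \<mu> c \<star> (sobj m n (gpow AX j) \<theta> \<star> sinc m (gpow AX j) {0..m})"
    unfolding stop_def fext_nop[OF g \<mu> assms(1,2)] using t g assms(2) by simp
  also have "sobj m n (gpow AX j) \<theta> \<star> sinc m (gpow AX j) {0..m} = sinc n (gpow AX j) \<sigma>"
    using i g assms(2,4) by (simp add: sobj_sinc)
  finally show ?thesis by simp
qed

text \<open>The chain is a degeneracy along some \<theta> with equal values at t and t + 1, and
  \<open>sobj\<close> kills every simplex on which \<theta> is not injective.\<close>

lemma fext_degen:
  assumes "c \<in> nerve j k n" "t < n" "c ! (t + 1) = aid (asrc (c ! (t + 1)))" "\<sigma> \<in> splx n" "t \<in> \<sigma>" "t + 1 \<in> \<sigma>"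
  shows "fext X Y \<mu> c \<star> sinc n (gpow AX j) \<sigma> = gzero (gpow AX j) (gpow BY k) (sdim \<sigma>)"
proof -
  obtain c' \<theta> where c': "c' \<in> nerve j k (n - 1)" "\<theta> \<in> mono_maps n (n - 1)" "nop \<theta> c' = c" "\<theta> ! t = \<theta> ! (t + 1)"
    using nop_degenerate[OF assms(1-3)] .
  note t = fext_typing[OF g \<mu> c'(1)]
  have "\<not> inj_on (nth \<theta>) \<sigma>" using c'(4) assms(5,6) inj_onD[of "nth \<theta>" \<sigma> t "t + 1"] by auto
  then have "sobj n (n - 1) (gpow AX j) \<theta> \<star> sinc n (gpow AX j) \<sigma> = gzero (gpow AX j) (sgr (n - 1) (gpow AX j)) (sdim \<sigma>)"
    using g c'(2) assms(4) by (simp add: sobj_sinc)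
  then show ?thesis
    using fext_nop[OF g \<mu> c'(1,2)] t g c' assms(4) by simp
qed

lemma fext_split:
  assumes "c \<in> nerve (Suc m) k n" "m > 0" "cut 0 1 c \<in> nerve 1 k1 n" "cut 1 (Suc m) c \<in> nerve m k2 n"
  shows "fext X Y \<mu> c = can BY k1 k2 \<star> sten n AX (gpow AX m) (fext X Y \<mu> (cut 0 1 c)) (fext X Y \<mu> (cut 1 (Suc m) c))"
proof -
  have "blocks (cut 1 (Suc m) c) \<noteq> []" using blocks_nth(2)[OF assms(4)] assms(2) by auto
  moreover have "fext X Y \<mu> (cut 1 (Suc m) c) = stens n AX BY (map (\<lambda>b. (cend b, \<mu> (cend b) b)) (blocks (cut 1 (Suc m) c)))"
    unfolding fext_def nerve_cdim[OF assms(4)] ..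
  ultimately show ?thesis
    unfolding fext_def[of X Y \<mu> c] blocks_split[OF assms(1,2)] nerve_cdim[OF assms(1)]
    using fext_single[OF g \<mu> assms(3)] nerve_cend[OF assms(3)] blocks_cend(2)[OF assms(4)] blocks_nth(2)[OF assms(4)]
    by (simp add: stens_Cons comp_def)
qed

lemma top_typing:
  assumes "w \<in> words m n" "m > 0"
  shows "gm (stop n (gpow AX m) (fext X Y \<mu> (wchain m w)))" "gsrc (stop n (gpow AX m) (fext X Y \<mu> (wchain m w))) = gpow AX m"
    "gtgt (stop n (gpow AX m) (fext X Y \<mu> (wchain m w))) = gpow BY (m + n)" "gdeg (stop n (gpow AX m) (fext X Y \<mu> (wchain m w))) = int n"
  using fext_typing[OF g \<mu> wchain_nerve[OF assms]] g by (simp_all add: stop_def)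

lemma Bsum_typing [simp]:
  "gsrc (Bsum X Y \<mu> m n) = gpow AX m" "gtgt (Bsum X Y \<mu> m n) = gpow BY (m + n)" "gdeg (Bsum X Y \<mu> m n) = int n"
  "m > 0 \<Longrightarrow> gm (Bsum X Y \<mu> m n)"
  using top_typing g by (auto simp: Bsum_def intro!: gsum_gm)

text \<open>If one of the first v letters refines another block, the first block pauses before time
  v and its front face is degenerate. Otherwise some later letter refines the first block; then the
  other blocks pause after time v and their back face is degenerate.\<close>

lemma top_Suc_zero:
  assumes w: "w \<in> words (Suc m) n" and m: "m > 0" and v: "v \<le> n"
    and "\<not> (wd 1 (take v w) \<and> (\<forall>i\<in>set (drop v w). 1 + v < i))"
    and k: "cut 0 1 (wchain (Suc m) w) \<in> nerve 1 k1 n" "cut 1 (Suc m) (wchain (Suc m) w) \<in> nerve m k2 n"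
  shows "(fext X Y \<mu> (cut 0 1 (wchain (Suc m) w)) \<star> sinc n AX {0..v}) \<odot> (fext X Y \<mu> (cut 1 (Suc m) (wchain (Suc m) w)) \<star> sinc n (gpow AX m) {v..n})
    = gzero (AX \<odot>\<^sub>o gpow AX m) (gpow BY k1 \<odot>\<^sub>o gpow BY k2) (int n)"
proof -
  let ?c1 = "cut 0 1 (wchain (Suc m) w)" and ?c2 = "cut 1 (Suc m) (wchain (Suc m) w)"
  have wd: "wd (Suc m) w" "length w = n" using w by (auto simp: words_def)
  note t1 = fext_typing[OF g \<mu> k(1)] and t2 = fext_typing[OF g \<mu> k(2)]
  have s: "{0..v} \<in> splx n" "{v..n} \<in> splx n" "sdim {v..n} = int (n - v)" using v by (auto simp: splx_def sdim_def)
  note c = cut_wchain[OF wd(1), of 1, simplified, OF m]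
  show ?thesis
  proof (cases "wd 1 (take v w)")
    case False
    then obtain u i w' where u: "w = u @ i # w'" "length u < v" "wd 1 u" "1 + length u < i"
      using wd_split[of w 1 v] wd_pos[OF wd(1)] by auto
    have "?c1 ! (length u + 1) = aid (1 + length u)"
      unfolding c(1)[unfolded One_nat_def[symmetric]] using u(1) lsteps_left[OF u(3), of "i # w'"] u(4) by (simp add: nth_append)
    then have "fext X Y \<mu> ?c1 \<star> sinc n (gpow AX 1) {0..v} = gzero (gpow AX 1) (gpow BY k1) (sdim {0..v})"
      using u v by (intro fext_degen[OF k(1), of "length u"] s) auto
    then show ?thesis using t1 t2 s v g m by simp
  next
    case True
    then obtain i where "i \<in> set (drop v w)" "i \<le> 1 + v" using assms(4) by (auto simp: not_less)
    \<comment> \<open>The first letter after position v that falls into the first block; until then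
      this block keeps the size 1 + v.\<close>
    then obtain z i w' where z: "drop v w = z @ i # w'" "i \<le> 1 + v" "\<forall>j\<in>set z. 1 + v < j"
      using split_list_first_prop[of "drop v w" "\<lambda>i. i \<le> 1 + v"] by (auto simp: not_le)
    have w': "w = take v w @ z @ i # w'" using z(1) append_take_drop_id[of v w] by simp
    have lv: "length (take v w) = v" using wd v by simp
    have "length (drop v w) = n - v" using wd by simp
    then have lz: "v + length z < n" using z(1) by simp
    have "rsteps 1 m w = replicate v (aid m) @ wsteps m (map (\<lambda>i. i - (1 + v)) z) @ aid (m + length z) # rsteps (Suc (1 + v)) (m + length z) w'"
      using rsteps_left[OF True, of m "z @ i # w'"] rsteps_right[OF z(3), of m "i # w'"] z(2) lv unfolding w'[symmetric] by simp
    then have "?c2 ! (v + length z + 1) = aid (m + length z)"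
      unfolding c(2)[unfolded One_nat_def[symmetric]] by (simp add: nth_append)
    then have "fext X Y \<mu> ?c2 \<star> sinc n (gpow AX m) {v..n} = gzero (gpow AX m) (gpow BY k2) (sdim {v..n})"
      using lz m by (intro fext_degen[OF k(2), of "v + length z"] s) auto
    then show ?thesis using t1 t2 s v g m by simp
  qed
qed

text \<open>The shuffle map followed by the Alexander--Whitney map is the identity on normalized chains: the
  only word on which the front face of length \<open>v\<close> of the first block and the complementary back face
  of the other blocks are both nondegenerate is the one refining the first block during the first \<open>v\<close>
  steps and the other blocks afterwards.\<close>

lemma Bsum_Suc:
  assumes m: "m > 0"
  shows "Bsum X Y \<mu> (Suc m) n = gsum (gpow AX (Suc m)) (gpow BY (Suc m + n)) (int n)
    (\<lambda>v. gsgn (int ((1 + v) * (n - v))) (can BY (1 + v) (m + (n - v)) \<star> (Bsum X Y \<mu> 1 v \<odot> Bsum X Y \<mu> m (n - v)))) {0..n}"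
proof -
  let ?S = "gpow AX (Suc m)" and ?T = "gpow BY (Suc m + n)"
  let ?c1 = "\<lambda>w. cut 0 1 (wchain (Suc m) w)" and ?c2 = "\<lambda>w. cut 1 (Suc m) (wchain (Suc m) w)"
  define Z where "Z = (\<lambda>w v. gsgn (int (sum_list w)) (can BY (cend (?c1 w)) (cend (?c2 w)) \<star>
    ((fext X Y \<mu> (?c1 w) \<star> sinc n AX {0..v}) \<odot> (fext X Y \<mu> (?c2 w) \<star> sinc n (gpow AX m) {v..n}))))"
  define TT where "TT = (\<lambda>m n w. gsgn (int (sum_list w)) (stop n (gpow AX m) (fext X Y \<mu> (wchain m w))))"
  define G where "G = (\<lambda>v u u'. gsgn (int ((1 + v) * (n - v))) (can BY (1 + v) (m + (n - v)) \<star> (TT 1 v u \<odot> TT m (n - v) u')))"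
  have TT: "gm (TT m' n' w)" "gsrc (TT m' n' w) = gpow AX m'" "gtgt (TT m' n' w) = gpow BY (m' + n')" "gdeg (TT m' n' w) = int n'"
    if "w \<in> words m' n'" "m' > 0" for m' n' w
    using top_typing[OF that] by (simp_all add: TT_def)
  have Bs: "Bsum X Y \<mu> m' n' = gsum (gpow AX m') (gpow BY (m' + n')) (int n') (TT m' n') (words m' n')" for m' n'
    by (simp add: Bsum_def TT_def)
  have Gty: "gmor (G v u u') ?S ?T (int n)"
    if "v \<le> n" "u \<in> words 1 v" "u' \<in> words m (n - v)" for v u u'
  proof -
    have "1 + v + (m + (n - v)) = Suc m + n" using that by simp
    then show ?thesis using TT[OF that(2)] TT[OF that(3) m] that(1) m g by (simp add: G_def)
  qed
  have cn: "wchain (Suc m) w \<in> nerve (Suc m) (Suc m + n) n" "?c1 w \<in> nerve 1 (cend (?c1 w)) n" "?c2 w \<in> nerve m (cend (?c2 w)) n"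
    "cend (?c1 w) + cend (?c2 w) = Suc m + n" "cend (?c1 w) > 0" "cend (?c2 w) > 0" if "w \<in> words (Suc m) n" for w
  proof -
    show n: "wchain (Suc m) w \<in> nerve (Suc m) (Suc m + n) n" using wchain_nerve[OF that] by simp
    have "?c1 w \<in> nerve (1 - 0) (path (Suc m) (wchain (Suc m) w) ! 1 - path (Suc m) (wchain (Suc m) w) ! 0) n"
      by (rule cut_nerve[OF n]) auto
    then show 1: "?c1 w \<in> nerve 1 (cend (?c1 w)) n" using nerve_cend by fastforce
    have "?c2 w \<in> nerve (Suc m - 1) (path (Suc m) (wchain (Suc m) w) ! Suc m - path (Suc m) (wchain (Suc m) w) ! 1) n"
      by (rule cut_nerve[OF n]) (use m in auto)
    then show 2: "?c2 w \<in> nerve m (cend (?c2 w)) n" using nerve_cend by fastforce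
    show "cend (?c1 w) + cend (?c2 w) = Suc m + n"
      using blocks_cend(2)[OF n] blocks_cend(2)[OF 2] unfolding blocks_split[OF n m] by simp
    show "cend (?c1 w) > 0" "cend (?c2 w) > 0" using nerve_pos[OF 1] nerve_pos[OF 2] by auto
  qed
  have Z: "gmor (Z w v) ?S ?T (int n)" if "w \<in> words (Suc m) n" "v \<in> {0..n}" for w v
  proof -
    have s: "{0..v} \<in> splx n" "{v..n} \<in> splx n" "sdim {v..n} = int (n - v)" "v \<le> n" using that by (auto simp: splx_def sdim_def)
    show ?thesis
      using s fext_typing[OF g \<mu> cn(2)[OF that(1)]] fext_typing[OF g \<mu> cn(3)[OF that(1)]] cn(4-6)[OF that(1)] m g by (simp add: Z_def)
  qed
  have "Bsum X Y \<mu> (Suc m) n = gsum ?S ?T (int n) (\<lambda>w. gsum ?S ?T (int n) (Z w) {0..n}) (words (Suc m) n)"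
    unfolding Bsum_def
  proof (rule gsum_cong)
    fix w assume w: "w \<in> words (Suc m) n"
    note t1 = fext_typing[OF g \<mu> cn(2)[OF w]] and t2 = fext_typing[OF g \<mu> cn(3)[OF w]]
    have sets: "{u \<in> {0..n}. u \<le> v} = {0..v}" "{u \<in> {0..n}. v \<le> u} = {v..n}" "{0..v} \<in> splx n" "{v..n} \<in> splx n" "sdim {v..n} = int (n - v)" "v \<le> n"
      if "v \<in> {0..n}" for v using that by (auto simp: splx_def sdim_def)
    have "stop n ?S (fext X Y \<mu> (wchain (Suc m) w)) = can BY (cend (?c1 w)) (cend (?c2 w)) \<star>
        (sten n AX (gpow AX m) (fext X Y \<mu> (?c1 w)) (fext X Y \<mu> (?c2 w)) \<star> sinc n (AX \<odot>\<^sub>o gpow AX m) {0..n})"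
      unfolding stop_def fext_split[OF cn(1)[OF w] m cn(2)[OF w] cn(3)[OF w]] using t1 t2 cn(5,6)[OF w] m g by simp
    also have "sten n AX (gpow AX m) (fext X Y \<mu> (?c1 w)) (fext X Y \<mu> (?c2 w)) \<star> sinc n (AX \<odot>\<^sub>o gpow AX m) {0..n}
      = gsum (AX \<odot>\<^sub>o gpow AX m) (gpow BY (cend (?c1 w)) \<odot>\<^sub>o gpow BY (cend (?c2 w))) (int n)
        (\<lambda>v. (fext X Y \<mu> (?c1 w) \<star> sinc n AX {u \<in> {0..n}. u \<le> v}) \<odot> (fext X Y \<mu> (?c2 w) \<star> sinc n (gpow AX m) {u \<in> {0..n}. v \<le> u})) {0..n}"
      using t1 t2 g by (subst sten_sinc) auto
    also have "\<dots> = gsum (AX \<odot>\<^sub>o gpow AX m) (gpow BY (cend (?c1 w)) \<odot>\<^sub>o gpow BY (cend (?c2 w))) (int n)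
        (\<lambda>v. (fext X Y \<mu> (?c1 w) \<star> sinc n AX {0..v}) \<odot> (fext X Y \<mu> (?c2 w) \<star> sinc n (gpow AX m) {v..n})) {0..n}"
      by (rule gsum_cong) (use t1 t2 g sets in auto)
    finally have "gsgn (int (sum_list w)) (stop n ?S (fext X Y \<mu> (wchain (Suc m) w))) = gsgn (int (sum_list w)) (can BY (cend (?c1 w)) (cend (?c2 w)) \<star>
      gsum (AX \<odot>\<^sub>o gpow AX m) (gpow BY (cend (?c1 w)) \<odot>\<^sub>o gpow BY (cend (?c2 w))) (int n)
        (\<lambda>v. (fext X Y \<mu> (?c1 w) \<star> sinc n AX {0..v}) \<odot> (fext X Y \<mu> (?c2 w) \<star> sinc n (gpow AX m) {v..n})) {0..n})" by simp
    also have "\<dots> = gsum ?S ?T (int n) (Z w) {0..n}"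
      using t1 t2 g sets cn(4-6)[OF w] m by (simp add: gcomp_gsum_left gsgn_gsum Z_def)
    finally show "gsgn (int (sum_list w)) (stop n ?S (fext X Y \<mu> (wchain (Suc m) w))) = gsum ?S ?T (int n) (Z w) {0..n}" .
  qed (use Z g in \<open>auto intro!: gsum_gm\<close>)
  also have "\<dots> = gsum ?S ?T (int n) (\<lambda>v. gsum ?S ?T (int n) (\<lambda>w. Z w v) (words (Suc m) n)) {0..n}"
    by (rule gsum_swap) (use Z g in auto)
  also have "\<dots> = gsum ?S ?T (int n) (\<lambda>v. gsgn (int ((1 + v) * (n - v))) (can BY (1 + v) (m + (n - v)) \<star> (Bsum X Y \<mu> 1 v \<odot> Bsum X Y \<mu> m (n - v)))) {0..n}"
  proof (rule gsum_cong)
    fix v assume v': "v \<in> {0..n}"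
    then have v: "v \<le> n" by simp
    let ?good = "{w \<in> words (Suc m) n. wd 1 (take v w) \<and> (\<forall>i\<in>set (drop v w). 1 + v < i)}"
    let ?h = "\<lambda>(u, u'). u @ map ((+) (1 + v)) u'"
    have "gsum ?S ?T (int n) (\<lambda>w. Z w v) (words (Suc m) n) = gsum ?S ?T (int n) (\<lambda>w. Z w v) ?good"
    proof (rule gsum_mono_neutral[symmetric])
      fix w assume w: "w \<in> words (Suc m) n - ?good"
      then have w': "w \<in> words (Suc m) n" by simp
      have "\<not> (wd 1 (take v w) \<and> (\<forall>i\<in>set (drop v w). 1 + v < i))" using w by blast
      from top_Suc_zero[OF w' m v this cn(2,3)[OF w']]
      show "Z w v = gzero ?S ?T (int n)"
        unfolding Z_def using cn(4-6)[OF w'] g m by simp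
    qed (use Z g v' in auto)
    also have "\<dots> = gsum ?S ?T (int n) (\<lambda>(u, u'). G v u u') (words 1 v \<times> words m (n - v))"
    \<comment> \<open>A surviving word consists of a word u for the first block, followed by a word
      u' for the others whose letters are raised by the size 1 + v of the refined first
      block.\<close>
    proof (rule gsum_bij[symmetric, where h = ?h])
      show "bij_betw ?h (words 1 v \<times> words m (n - v)) ?good"
      proof (rule bij_betw_byWitness[where f' = "\<lambda>w. (take v w, map (\<lambda>i. i - (1 + v)) (drop v w))"])
        show "\<forall>a\<in>words 1 v \<times> words m (n - v). (\<lambda>w. (take v w, map (\<lambda>i. i - (1 + v)) (drop v w))) (?h a) = a"
          by (auto simp: words_def comp_def)
        show "\<forall>w\<in>?good. ?h (take v w, map (\<lambda>i. i - (1 + v)) (drop v w)) = w"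
        proof
          fix w assume "w \<in> ?good"
          then have "\<forall>i\<in>set (drop v w). 1 + v < i" by simp
          then have "map ((+) (1 + v)) (map (\<lambda>i. i - (1 + v)) (drop v w)) = drop v w"
            by (auto simp: comp_def intro!: map_idI)
          then show "?h (take v w, map (\<lambda>i. i - (1 + v)) (drop v w)) = w" by simp
        qed
        show "?h ` (words 1 v \<times> words m (n - v)) \<subseteq> ?good"
        proof (clarify, intro CollectI conjI)
          fix u u' assume u: "u \<in> words 1 v" "u' \<in> words m (n - v)"
          have uu: "wd 1 u" "length u = v" "wd m u'" "length u' = n - v" using u by (auto simp: words_def)
          have "wd (Suc m) u" using uu(1)
          proof -
            have "wd q u \<Longrightarrow> wd (p + q) u" for p q
              by (induction u arbitrary: q) (auto, metis add_Suc_right)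
            from this[of 1 m] uu(1) show ?thesis by simp
          qed
          moreover have "wd (1 + v + m) (map ((+) (1 + v)) u')" using wd_shift[OF uu(3)] by blast
          ultimately show "u @ map ((+) (1 + v)) u' \<in> words (Suc m) n"
            using uu v by (simp add: words_def add.commute)
          show "wd 1 (take v (u @ map ((+) (1 + v)) u'))" using uu by simp
          show "\<forall>i\<in>set (drop v (u @ map ((+) (1 + v)) u')). 1 + v < i"
            using uu wd_pos[OF uu(3)] by fastforce
        qed
        show "(\<lambda>w. (take v w, map (\<lambda>i. i - (1 + v)) (drop v w))) ` ?good \<subseteq> words 1 v \<times> words m (n - v)"
        proof (clarify, intro conjI)
          fix w assume w: "w \<in> words (Suc m) n" "wd 1 (take v w)" "\<forall>i\<in>set (drop v w). 1 + v < i"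
          then have "wd (Suc m) (take v w @ drop v w)" "length w = n" by (auto simp: words_def)
          then have "wd (Suc m + v) (drop v w)" using v unfolding wd_append by simp
          then have "wd m (map (\<lambda>i. i - (1 + v)) (drop v w))"
            using w(3) by (intro wd_unshift) (simp_all add: add.commute)
          then show "take v w \<in> words 1 v" "map (\<lambda>i. i - (1 + v)) (drop v w) \<in> words m (n - v)"
            using w v by (auto simp: words_def)
        qed
      qed
    next
      fix x assume x: "x \<in> words 1 v \<times> words m (n - v)"
      obtain u u' where uu': "x = (u, u')" by force
      have uu: "wd 1 u" "length u = v" "wd m u'" "length u' = n - v" "u \<in> words 1 v" "u' \<in> words m (n - v)"
        using x uu' by (auto simp: words_def)
      let ?w = "u @ map ((+) (1 + v)) u'"
      have "wd q u \<Longrightarrow> wd (p + q) u" for p q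
        by (induction u arbitrary: q) (auto, metis add_Suc_right)
      from this[of 1 m] have wm: "wd (Suc m) ?w" using uu wd_shift[OF uu(3), of "1 + v"] by (simp add: add.commute)
      have big: "\<forall>i\<in>set (map ((+) (1 + v)) u'). 1 + length u < i" using uu wd_pos[OF uu(3)] by fastforce
      note f = wchain_front[OF wm uu(1) big m]
      have len: "length ?w = n" using uu v by simp
      have ww: "?w \<in> words (Suc m) n" using wm len by (simp add: words_def)
      have e: "cend (?c1 ?w) = 1 + v" "cend (?c2 ?w) = m + (n - v)"
        using nerve_cend[OF f(3)] nerve_cend[OF f(4)] uu by auto
      have mp: "map (\<lambda>i. i - (1 + v)) (map ((+) (1 + v)) u') = u'" by (simp add: comp_def)
      have 1: "fext X Y \<mu> (?c1 ?w) \<star> sinc n (gpow AX 1) {0..v} = stop v (gpow AX 1) (fext X Y \<mu> (wchain 1 u))"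
        using fext_face[OF f(3)[unfolded len], of "[0..<v + 1]" v "{0..v}"] f(1) v uu upt_mono_maps[of 0 "v + 1" n]
        by (simp del: upt_Suc add: atLeastLessThanSuc_atLeastAtMost)
      have 2: "fext X Y \<mu> (?c2 ?w) \<star> sinc n (gpow AX m) {v..n} = stop (n - v) (gpow AX m) (fext X Y \<mu> (wchain m u'))"
        using fext_face[OF f(4)[unfolded len], of "[v..<n + 1]" "n - v" "{v..n}"] f(2) v uu mp len upt_mono_maps[of v "n + 1" n]
        by (simp del: upt_Suc add: atLeastLessThanSuc_atLeastAtMost)
      \<comment> \<open>Raising each of the n - v letters of u' by 1 + v is the origin of the sign
        exponent (1 + v) * (n - v) in the formula.\<close>
      have s: "sum_list ?w = sum_list u + ((1 + v) * (n - v) + sum_list u')"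
        using uu by (simp add: sum_list_shift)
      obtain q where q: "(1 + v) * (n - v) = q" by simp
      have "Z ?w v = G v u u'"
        using 1 2 top_typing[OF uu(5)] top_typing[OF uu(6) m] m g v
        unfolding Z_def G_def TT_def e s q by (simp add: ac_simps)
      then show "(case x of (u, u') \<Rightarrow> G v u u') = Z (?h x) v"
        unfolding uu' by simp
    qed (use Z g v' in auto)
    also have "\<dots> = gsum ?S ?T (int n) (\<lambda>u. gsum ?S ?T (int n) (\<lambda>u'. G v u u') (words m (n - v))) (words 1 v)"
      by (rule gsum_Sigma[symmetric]) (use Gty v g in auto)
    also have "\<dots> = gsgn (int ((1 + v) * (n - v))) (can BY (1 + v) (m + (n - v)) \<star> (Bsum X Y \<mu> 1 v \<odot> Bsum X Y \<mu> m (n - v)))"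
    proof -
      obtain p q K1 K2 where p: "n - v = p" "K1 * p = q" "1 + v = K1" "m + p = K2" by simp
      then have K: "K1 + K2 = Suc m + n" "K1 > 0" "K2 > 0" "int v + int p = int n" using v m by auto
      have T1: "gm (TT 1 v u)" "gsrc (TT 1 v u) = AX" "gtgt (TT 1 v u) = gpow BY K1" "gdeg (TT 1 v u) = int v" if "u \<in> words 1 v" for u
        using TT[OF that] p by simp_all
      have T2: "gm (TT m p u)" "gsrc (TT m p u) = gpow AX m" "gtgt (TT m p u) = gpow BY K2" "gdeg (TT m p u) = int p" if "u \<in> words m p" for u
        using TT[OF that m] p by simp_all
      have "Bsum X Y \<mu> 1 v \<odot> Bsum X Y \<mu> m p = gsum AX (gpow BY K1) (int v) (TT 1 v) (words 1 v) \<odot> gsum (gpow AX m) (gpow BY K2) (int p) (TT m p) (words m p)"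
        unfolding Bs p by simp
      also have "\<dots> = gsum (AX \<odot>\<^sub>o gpow AX m) (gpow BY K1 \<odot>\<^sub>o gpow BY K2) (int n)
         (\<lambda>u. TT 1 v u \<odot> gsum (gpow AX m) (gpow BY K2) (int p) (TT m p) (words m p)) (words 1 v)"
        using T1 T2 g K(4) by (subst gtenm_gsum_left) auto
      also have "\<dots> = gsum (AX \<odot>\<^sub>o gpow AX m) (gpow BY K1 \<odot>\<^sub>o gpow BY K2) (int n)
         (\<lambda>u. gsum (AX \<odot>\<^sub>o gpow AX m) (gpow BY K1 \<odot>\<^sub>o gpow BY K2) (int n) (\<lambda>u'. TT 1 v u \<odot> TT m p u') (words m p)) (words 1 v)"
        using T1 T2 g K(4) by (intro gsum_cong) (auto simp: gtenm_gsum_right)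
      finally have eq: "Bsum X Y \<mu> 1 v \<odot> Bsum X Y \<mu> m p = \<dots>" .
      have G': "G v u u' = gsgn (int q) (can BY K1 K2 \<star> (TT 1 v u \<odot> TT m p u'))" for u u'
        unfolding G_def p ..
      have S: "?S = AX \<odot>\<^sub>o gpow AX m" using m by simp
      have inner: "can BY K1 K2 \<star> gsum (AX \<odot>\<^sub>o gpow AX m) (gpow BY K1 \<odot>\<^sub>o gpow BY K2) (int n) (\<lambda>u'. TT 1 v u \<odot> TT m p u') (words m p)
        = gsum ?S ?T (int n) (\<lambda>u'. can BY K1 K2 \<star> (TT 1 v u \<odot> TT m p u')) (words m p)" if "u \<in> words 1 v" for u
        unfolding S using that T1 T2 g K by (simp add: gcomp_gsum_left)
      have "gsgn (int q) (can BY K1 K2 \<star> (Bsum X Y \<mu> 1 v \<odot> Bsum X Y \<mu> m p))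
        = gsgn (int q) (gsum ?S ?T (int n) (\<lambda>u. can BY K1 K2 \<star> gsum (AX \<odot>\<^sub>o gpow AX m) (gpow BY K1 \<odot>\<^sub>o gpow BY K2) (int n) (\<lambda>u'. TT 1 v u \<odot> TT m p u') (words m p)) (words 1 v))"
        unfolding eq S using T1 T2 g K by (simp add: gcomp_gsum_left)
      also have "\<dots> = gsgn (int q) (gsum ?S ?T (int n) (\<lambda>u. gsum ?S ?T (int n) (\<lambda>u'. can BY K1 K2 \<star> (TT 1 v u \<odot> TT m p u')) (words m p)) (words 1 v))"
        unfolding S using T1 T2 g K inner[unfolded S] by (intro arg_cong[where f="gsgn (int q)"] gsum_cong) auto
      also have "\<dots> = gsum ?S ?T (int n) (\<lambda>u. gsum ?S ?T (int n) (\<lambda>u'. gsgn (int q) (can BY K1 K2 \<star> (TT 1 v u \<odot> TT m p u'))) (words m p)) (words 1 v)"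
      proof -
        have "gsgn (int q) (gsum ?S ?T (int n) (\<lambda>u. gsum ?S ?T (int n) (\<lambda>u'. can BY K1 K2 \<star> (TT 1 v u \<odot> TT m p u')) (words m p)) (words 1 v))
          = gsum ?S ?T (int n) (\<lambda>u. gsgn (int q) (gsum ?S ?T (int n) (\<lambda>u'. can BY K1 K2 \<star> (TT 1 v u \<odot> TT m p u')) (words m p))) (words 1 v)"
          unfolding S using T1 T2 g K by (simp add: gsgn_gsum)
        also have "\<dots> = gsum ?S ?T (int n) (\<lambda>u. gsum ?S ?T (int n) (\<lambda>u'. gsgn (int q) (can BY K1 K2 \<star> (TT 1 v u \<odot> TT m p u'))) (words m p)) (words 1 v)"
          unfolding S using T1 T2 g K by (intro gsum_cong) (auto simp: gsgn_gsum)
        finally show ?thesis .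
      qed
      finally show ?thesis
        unfolding p G' by simp
    qed
    finally show "gsum ?S ?T (int n) (\<lambda>w. Z w v) (words (Suc m) n)
      = gsgn (int ((1 + v) * (n - v))) (can BY (1 + v) (m + (n - v)) \<star> (Bsum X Y \<mu> 1 v \<odot> Bsum X Y \<mu> m (n - v)))" .
  next
    show "\<forall>v\<in>{0..n}. gmor (gsgn (int ((1 + v) * (n - v))) (can BY (1 + v) (m + (n - v)) \<star> (Bsum X Y \<mu> 1 v \<odot> Bsum X Y \<mu> m (n - v)))) ?S ?T (int n)"
      using m g by simp
  qed (use g in auto)
  finally show ?thesis .
qed

end

end

section \<open>The boundary of the cube\<close>

lemma wd_nth: "wd m w \<longleftrightarrow> (\<forall>t<length w. 1 \<le> w ! t \<and> w ! t \<le> m + t)"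
  by (induction m w rule: wd.induct) (auto simp: All_less_Suc2)

lemma words_Suc_front: "bij_betw (\<lambda>(i, w). i # w) ({1..m} \<times> words (Suc m) n) (words m (Suc n))"
  by (rule bij_betw_byWitness[where f' = "\<lambda>w. (hd w, tl w)"]) (auto simp: words_def length_Suc_conv)

lemma words_Suc_back: "bij_betw (\<lambda>(w, i). w @ [i]) (words m n \<times> {1..m + n}) (words m (Suc n))"
proof (rule bij_betw_byWitness[where f' = "\<lambda>w. (butlast w, last w)"])
  show "(\<lambda>w. (butlast w, last w)) ` words m (Suc n) \<subseteq> words m n \<times> {1..m + n}"
  proof (rule image_subsetI)
    fix w assume w: "w \<in> words m (Suc n)"
    then have "w \<noteq> []" "length w = Suc n" by (auto simp: words_def)
    then obtain u i where u: "w = u @ [i]" by (cases w rule: rev_cases) auto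
    then show "(butlast w, last w) \<in> words m n \<times> {1..m + n}" using w by (auto simp: words_def)
  qed
next
  show "\<forall>w\<in>words m (Suc n). (\<lambda>(w, i). w @ [i]) (butlast w, last w) = w"
  proof
    fix w assume "w \<in> words m (Suc n)"
    then have "w \<noteq> []" by (auto simp: words_def)
    then show "(\<lambda>(w, i). w @ [i]) (butlast w, last w) = w" by simp
  qed
qed (auto simp: words_def)

context abelian_tensor_category
begin

text \<open>The alternating sum of the inner cofaces of Y. Up to desuspension and sign it is the
  quadratic part of the cobar derivation on words of length n, see
  \<open>cobar_upper\<close>.\<close>

definition Eface :: "('a, 'b) coalgebra \<Rightarrow> nat \<Rightarrow> ('a, 'b) gmap" where
  "Eface Y n = gsum (gpow (gr (cx Y)) n) (gpow (gr (cx Y)) (n + 1)) 0 (\<lambda>i. gsgn (int i) (comap Y (dface n i))) {1..n}"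

lemma comap_typing:
  assumes "dgc Y" "act \<beta>"
  shows "gm (comap Y \<beta>)" "gsrc (comap Y \<beta>) = gpow (gr (cx Y)) (asrc \<beta>)" "gtgt (comap Y \<beta>) = gpow (gr (cx Y)) (atrg \<beta>)" "gdeg (comap Y \<beta>) = 0"
  using assms adiffs[OF assms(2)] by (simp_all add: comap_cmuls)

lemma Eface_typing [simp]:
  assumes "dgc Y"
  shows "gsrc (Eface Y n) = gpow (gr (cx Y)) n" "gtgt (Eface Y n) = gpow (gr (cx Y)) (n + 1)" "gdeg (Eface Y n) = 0"
    "gm (Eface Y n)"
  using assms comap_typing[OF assms] dface_act[of _ n] by (auto simp: Eface_def intro!: gsum_gm)

context
  fixes X Y :: "('a, 'b) coalgebra" and \<mu> :: "('a, 'b) family"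
  assumes X: "dg_coalgebra X" and Y: "dg_coalgebra Y" and \<mu>: "\<mu> \<in> Coh X Y"
begin

abbreviation (input) "AC \<equiv> gr (cx X)"
abbreviation (input) "BC \<equiv> gr (cx Y)"

lemma Coh_sfam: "graded_object AC" "graded_object BC" "sfam AC BC \<mu>"
  using dg_coalgebraD[OF X] dg_coalgebraD[OF Y] CohD(1)[OF _ _ \<mu>] by auto

definition ctop :: "nat \<Rightarrow> nat list \<Rightarrow> ('a, 'b) gmap" where
  "ctop n w = stop n AC (\<mu> (1 + n) (wchain 1 w))"

definition cface :: "nat \<Rightarrow> nat \<Rightarrow> nat list \<Rightarrow> ('a, 'b) gmap" where
  "cface n r w = \<mu> (1 + n) (wchain 1 w) \<star> sinc n AC ({0..n} - {r})"

lemma fext_wchain: "w \<in> words 1 n \<Longrightarrow> fext X Y \<mu> (wchain 1 w) = \<mu> (1 + n) (wchain 1 w)"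
  using fext_single[OF Coh_sfam wchain_nerve[of w 1 n]] by simp

lemma Bsum_ctop: "Bsum X Y \<mu> 1 n = gsum AC (gpow BC (1 + n)) (int n) (\<lambda>w. gsgn (int (sum_list w)) (ctop n w)) (words 1 n)"
  using top_typing[OF Coh_sfam, of _ 1 n] Coh_sfam(1,2) fext_wchain[of _ n]
  by (auto simp: Bsum_def ctop_def intro!: gsum_cong)

lemma mu_typing:
  assumes "w \<in> words 1 n"
  shows "gm (\<mu> (1 + n) (wchain 1 w))" "gsrc (\<mu> (1 + n) (wchain 1 w)) = sgr n AC" "gtgt (\<mu> (1 + n) (wchain 1 w)) = gpow BC (1 + n)"
    "gdeg (\<mu> (1 + n) (wchain 1 w)) = 0"
  using sfam_typing[OF Coh_sfam(3) wchain_nerve[OF assms]] by simp_all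

lemma ctop_typing:
  assumes "w \<in> words 1 n"
  shows "gm (ctop n w)" "gsrc (ctop n w) = AC" "gtgt (ctop n w) = gpow BC (1 + n)" "gdeg (ctop n w) = int n"
  using mu_typing[OF assms] Coh_sfam(1) by (simp_all add: ctop_def stop_def)

lemma face_splx: "r \<le> n \<Longrightarrow> n > 0 \<Longrightarrow> {0..n} - {r} \<in> splx n \<and> sdim ({0..n} - {r}) = int n - 1"
  using splx_remove[of "{0..n}" n r] by simp

lemma cface_typing:
  assumes "w \<in> words 1 n" "r \<le> n" "n > 0"
  shows "gm (cface n r w)" "gsrc (cface n r w) = AC" "gtgt (cface n r w) = gpow BC (1 + n)" "gdeg (cface n r w) = int n - 1"
  using mu_typing[OF assms(1)] Coh_sfam(1) face_splx[OF assms(2,3)] by (simp_all add: cface_def)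

lemma cface_nop:
  assumes "w \<in> words 1 (Suc n)" "r \<le> Suc n" "\<theta> \<in> mono_maps n (Suc n)" "distinct \<theta>" "set \<theta> = {0..Suc n} - {r}"
  shows "cface (Suc n) r w = stop n AC (\<mu> (2 + n) (nop \<theta> (wchain 1 w)))"
proof -
  have c: "wchain 1 w \<in> nerve 1 (2 + n) (Suc n)" using wchain_nerve[OF assms(1)] by simp
  have "cface (Suc n) r w = fext X Y \<mu> (wchain 1 w) \<star> sinc (Suc n) (gpow AC 1) ({0..Suc n} - {r})"
    using fext_wchain[OF assms(1)] by (simp add: cface_def)
  also have "\<dots> = stop n (gpow AC 1) (fext X Y \<mu> (nop \<theta> (wchain 1 w)))"
    by (rule fext_face[OF Coh_sfam c assms(3,4)]) (simp add: assms(5))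
  also have "fext X Y \<mu> (nop \<theta> (wchain 1 w)) = \<mu> (2 + n) (nop \<theta> (wchain 1 w))"
    by (rule fext_single[OF Coh_sfam nop_nerve(1)[OF c assms(3)]])
  finally show ?thesis by simp
qed

text \<open>For m = 1 the first letter can only be 1. Deleting the first vertex composes the initial
  identity with the map [1] -> [2], so that the chain becomes
  \<open>cpre (wchain 2 w) [0, 2]\<close> and condition (b) applies.\<close>

lemma cface_first:
  assumes "w \<in> words 2 n"
  shows "cface (Suc n) 0 (1 # w) = stop n (gpow AC 2) (fext X Y \<mu> (wchain 2 w)) \<star> icmul X 2"
proof -
  have w: "1 # w \<in> words 1 (Suc n)" using assms by (auto simp: words_def numeral_2_eq_2)
  have c2: "wchain 2 w \<in> nerve 2 (2 + n) n" using wchain_nerve[OF assms] by simp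
  have c: "wchain 1 (1 # w) \<in> nerve 1 (2 + n) (Suc n)" using wchain_nerve[OF w] by simp
  have d: "dface (Suc 0) (Suc 0) = [0, 2]" by (simp add: dface_def)
  have "nop [1..<Suc n + 1] (wchain 1 (1 # w)) = path 1 (take 2 (wchain 1 (1 # w))) # drop 2 (wchain 1 (1 # w))"
    using nop_back[OF c, of 1] by (simp del: upt_Suc add: numeral_2_eq_2)
  also have "\<dots> = cpre (wchain 2 w) [0, 2]"
    using dface_act[of 1 1] acomp_aid[of "[0, 2]"] words_def assms
    by (simp add: wchain_def cpre_def d numeral_2_eq_2 acomp_aid act_pair asrc_def atrg_def aid_def acomp_def)
  finally have nop: "nop [1..<Suc n + 1] (wchain 1 (1 # w)) = cpre (wchain 2 w) [0, 2]" .
  have "cface (Suc n) 0 (1 # w) = stop n AC (\<mu> (2 + n) (nop [1..<Suc n + 1] (wchain 1 (1 # w))))"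
  proof (rule cface_nop[OF w])
    show "[1..<Suc n + 1] \<in> mono_maps n (Suc n)" using upt_mono_maps[of 1 "Suc n + 1" "Suc n"] by simp
    show "set [1..<Suc n + 1] = {0..Suc n} - {0}" by auto
  qed auto
  also have "\<mu> (2 + n) (nop [1..<Suc n + 1] (wchain 1 (1 # w))) = fext X Y \<mu> (wchain 2 w) \<star> smap n (icmul X 2)"
    unfolding nop using CohD(4)[OF dg_coalgebraD(2)[OF X] dg_coalgebraD(2)[OF Y] \<mu> c2, of "[0, 2]"] act_pair[of 2] by simp
  finally show ?thesis
    using fext_typing[OF Coh_sfam c2] Coh_sfam dg_coalgebraD(1)[OF X] by (simp add: stop_def smap_sinc numeral_2_eq_2 del: icmul.simps)
qed

text \<open>Deleting the last vertex absorbs the last step into the final map; the chain becomes the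
  postcomposition of a shorter one with a coface, and condition (a) applies.\<close>

lemma cface_last:
  assumes "w \<in> words 1 n" "i \<in> {1..Suc n}"
  shows "cface (Suc n) (Suc n) (w @ [i]) = comap Y (dface (Suc n) i) \<star> ctop n w"
proof -
  have w: "w @ [i] \<in> words 1 (Suc n)" using assms by (auto simp: words_def)
  have c1: "wchain 1 w \<in> nerve 1 (1 + n) n" using wchain_nerve[OF assms(1)] by simp
  have c: "wchain 1 (w @ [i]) \<in> nerve 1 (2 + n) (Suc n)" using wchain_nerve[OF w] by simp
  note d = dface_act[of i "Suc n"]
  have l: "length w = n" "wd 1 w" using assms(1) by (auto simp: words_def)
  have we: "wchain 1 (w @ [i]) = (aid 1 # wsteps 1 w) @ [dface (Suc n) i, aid (Suc (Suc n))]"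
    using l by (simp add: wchain_def)
  have "nop [0..<n + 1] (wchain 1 (w @ [i])) = take (n + 1) (wchain 1 (w @ [i])) @ [path (atrg (wchain 1 (w @ [i]) ! n)) (drop (n + 1) (wchain 1 (w @ [i])))]"
    by (rule nop_front[OF c]) simp
  also have "take (n + 1) (wchain 1 (w @ [i])) @ [path (atrg (wchain 1 (w @ [i]) ! n)) (drop (n + 1) (wchain 1 (w @ [i])))] = aid 1 # wsteps 1 w @ [dface (Suc n) i]"
    unfolding we using l d assms(2) acomp_aid(1)[of "dface (Suc n) i"] by (simp add: acomp_aid(1)[of "aid (Suc (Suc n))", simplified])
  also have "\<dots> = cpost (dface (Suc n) i) (wchain 1 w)"
    using l d assms(2) acomp_aid(2)[of "dface (Suc n) i"] by (simp add: cpost_def wchain_def butlast_append)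
  finally have nop: "nop [0..<n + 1] (wchain 1 (w @ [i])) = cpost (dface (Suc n) i) (wchain 1 w)" .
  have "cface (Suc n) (Suc n) (w @ [i]) = stop n AC (\<mu> (2 + n) (nop [0..<n + 1] (wchain 1 (w @ [i]))))"
  proof (rule cface_nop[OF w])
    show "[0..<n + 1] \<in> mono_maps n (Suc n)" using upt_mono_maps[of 0 "n + 1" "Suc n"] by simp
    show "set [0..<n + 1] = {0..Suc n} - {Suc n}" by auto
  qed auto
  also have "\<mu> (2 + n) (nop [0..<n + 1] (wchain 1 (w @ [i]))) = comap Y (dface (Suc n) i) \<star> \<mu> (1 + n) (wchain 1 w)"
    unfolding nop using CohD(3)[OF dg_coalgebraD(2)[OF X] dg_coalgebraD(2)[OF Y] \<mu> c1, of "dface (Suc n) i"] d assms(2) by simp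
  finally show ?thesis
    using mu_typing[OF assms(1)] Coh_sfam comap_typing[OF dg_coalgebraD(1)[OF Y] d(1)] d assms(2)
    by (simp add: stop_def ctop_def)
qed

text \<open>The inner faces of the simplices of the cube cancel in pairs, by the simplicial identity for two
  consecutive coface maps.\<close>

lemma cface_inner_sum:
  assumes "0 < r" "r < n"
  shows "gsum AC (gpow BC (1 + n)) (int n - 1) (\<lambda>w. gsgn (int (sum_list w)) (cface n r w)) (words 1 n) = gzero AC (gpow BC (1 + n)) (int n - 1)"
proof -
  obtain n' where n': "n = Suc n'" using assms by (cases n) auto
  let ?T = "gpow BC (1 + n)"
  define H where "H = (\<lambda>w. gsgn (int (sum_list w)) (cface n r w))"
  have H: "gmor (H w) AC ?T (int n - 1)" if "w \<in> words 1 n" for w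
    using cface_typing[OF that, of r] assms by (simp add: H_def)
  \<comment> \<open>For a < b the letters (a, b) and (b - 1, a) at positions r - 1 and r, the steps
    on both sides of vertex r, have the same composite. The exchange matches words with an ascent
    there to words without one; it lowers the sum of the letters by one and so reverses the
    sign.\<close>
  define f where "f = (\<lambda>w :: nat list. take (r - 1) w @ [w ! r - 1, w ! (r - 1)] @ drop (r + 1) w)"
  define f' where "f' = (\<lambda>w :: nat list. take (r - 1) w @ [w ! r, w ! (r - 1) + 1] @ drop (r + 1) w)"
  let ?L = "{w \<in> words 1 n. w ! (r - 1) < w ! r}" and ?R = "{w \<in> words 1 n. \<not> w ! (r - 1) < w ! r}"
  have split: "w = take (r - 1) w @ [w ! (r - 1), w ! r] @ drop (r + 1) w" if "length w = n" for w :: "nat list"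
    using that assms id_take_nth_drop[of "r - 1" w] Cons_nth_drop_Suc[of r w] by simp
  have nth: "(take (r - 1) w @ [x, y] @ drop (r + 1) w) ! t = (if t = r - 1 then x else if t = r then y else w ! t)"
    "length (take (r - 1) w @ [x, y] @ drop (r + 1) w) = n"
    if "length w = n" "t < n" for w :: "nat list" and x y t
    using that assms by (auto simp: nth_append min_def nth_Cons')
  have wdn: "w \<in> words 1 n \<longleftrightarrow> length w = n \<and> (\<forall>t<n. 1 \<le> w ! t \<and> w ! t \<le> 1 + t)" for w
    by (auto simp: words_def wd_nth)
  note wdn = wdn wdn[unfolded One_nat_def]
  have rr: "r - 1 < n" "r < n" "r - 1 \<noteq> r" using assms by auto
  have fL: "f w \<in> ?R" "f' (f w) = w" if "w \<in> ?L" for w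
  proof -
    have l: "length w = n" "\<forall>t<n. 1 \<le> w ! t \<and> w ! t \<le> 1 + t" "w ! (r - 1) < w ! r" using that by (auto simp: wdn)
    have "\<forall>t<n. 1 \<le> f w ! t \<and> f w ! t \<le> 1 + t"
    proof (intro allI impI)
      fix t assume t: "t < n"
      have "1 \<le> w ! (r - 1)" "w ! (r - 1) \<le> r" "w ! r \<le> r + 1" using l(2) rr assms(1) by fastforce+
      then show "1 \<le> f w ! t \<and> f w ! t \<le> 1 + t"
        unfolding f_def nth(1)[OF l(1) t] using l(2,3) t assms(1) by auto
    qed
    moreover have "\<not> f w ! (r - 1) < f w ! r" unfolding f_def nth(1)[OF l(1) rr(1)] nth(1)[OF l(1) rr(2)] using l(3) rr by auto
    moreover have lf: "length (f w) = n" unfolding f_def by (rule nth(2)[OF l(1) rr(1)])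
    ultimately show "f w \<in> ?R" by (simp add: wdn)
    show "f' (f w) = w"
    proof (rule nth_equalityI)
      show "length (f' (f w)) = length w" unfolding f'_def using nth(2)[OF lf rr(1)] l(1) by simp
      fix t assume "t < length (f' (f w))"
      then have t: "t < n" unfolding f'_def using nth(2)[OF lf rr(1)] by simp
      show "f' (f w) ! t = w ! t"
        unfolding f'_def nth(1)[OF lf t] unfolding f_def nth(1)[OF l(1) t] nth(1)[OF l(1) rr(1)] nth(1)[OF l(1) rr(2)] using l(3) rr by auto
    qed
  qed
  have fR: "f' w \<in> ?L" "f (f' w) = w" if "w \<in> ?R" for w
  proof -
    have l: "length w = n" "\<forall>t<n. 1 \<le> w ! t \<and> w ! t \<le> 1 + t" "w ! r \<le> w ! (r - 1)" using that by (auto simp: wdn)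
    have "\<forall>t<n. 1 \<le> f' w ! t \<and> f' w ! t \<le> 1 + t"
    proof (intro allI impI)
      fix t assume t: "t < n"
      have "1 \<le> w ! r" "w ! (r - 1) \<le> r" using l(2) rr assms(1) by fastforce+
      then show "1 \<le> f' w ! t \<and> f' w ! t \<le> 1 + t"
        unfolding f'_def nth(1)[OF l(1) t] using l(2,3) t assms(1) by auto
    qed
    moreover have "f' w ! (r - 1) < f' w ! r" unfolding f'_def nth(1)[OF l(1) rr(1)] nth(1)[OF l(1) rr(2)] using l(3) rr by auto
    moreover have lf: "length (f' w) = n" unfolding f'_def by (rule nth(2)[OF l(1) rr(1)])
    ultimately show "f' w \<in> ?L" by (simp add: wdn)
    show "f (f' w) = w"
    proof (rule nth_equalityI)
      show "length (f (f' w)) = length w" unfolding f_def using nth(2)[OF lf rr(1)] l(1) by simp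
      fix t assume "t < length (f (f' w))"
      then have t: "t < n" unfolding f_def using nth(2)[OF lf rr(1)] by simp
      show "f (f' w) ! t = w ! t"
        unfolding f_def nth(1)[OF lf t] unfolding f'_def nth(1)[OF l(1) t] nth(1)[OF l(1) rr(1)] nth(1)[OF l(1) rr(2)] using rr by auto
    qed
  qed
  have bij: "bij_betw f ?L ?R"
    by (rule bij_betw_byWitness[where f' = f']) (use fL fR in auto)
  have Hf: "H (f w) = gsgn 1 (H w)" if w: "w \<in> ?L" for w
  proof -
    have wn: "w \<in> words 1 n" using w by simp
    then have l: "length w = n" by (simp add: words_def)
    obtain p q a b where pq: "p = take (r - 1) w" "q = drop (r + 1) w" "a = w ! (r - 1)" "b = w ! r" by simp
    have we: "w = p @ [a, b] @ q" "f w = p @ [b - 1, a] @ q" "length p = r - 1"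
      using split[OF l] l rr by (auto simp: pq f_def)
    have fw: "f w \<in> words 1 n" using fL(1)[OF w] by simp
    have ab: "1 \<le> a" "a < b" "b \<le> r + 1"
      using w rr assms(1) by (auto simp: wdn pq)
    let ?\<theta> = "[0..<r] @ [r + 1..<n + 1]"
    have c: "wchain 1 w \<in> nerve 1 (1 + n) n" "wchain 1 (f w) \<in> nerve 1 (1 + n) n"
      using wchain_nerve[OF wn] wchain_nerve[OF fw] by simp_all
    let ?as = "aid 1 # wsteps 1 p" and ?bs = "wsteps (r + 2) q @ [aid (1 + n)]"
    have as: "length ?as = r" using we assms by simp
    have lf: "length (p @ [a, b] @ q) = n" "length (p @ [b - 1, a] @ q) = n" using l we(1,3) by auto
    have "wchain 1 w = ?as @ [dface r a, dface (r + 1) b] @ ?bs"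
      unfolding we(1) wchain_def lf using we(3) assms(1) by (simp add: Suc_diff_le flip: numeral_2_eq_2)
    then have n1: "nop ?\<theta> (wchain 1 w) = ?as @ [acomp (dface (r + 1) b) (dface r a)] @ ?bs"
      by (rule nop_inner_face(1)[OF c(1) _ as assms])
    have "wchain 1 (f w) = ?as @ [dface r (b - 1), dface (r + 1) a] @ ?bs"
      unfolding we(2) wchain_def lf using we(3) assms(1) by (simp add: Suc_diff_le flip: numeral_2_eq_2)
    then have n2: "nop ?\<theta> (wchain 1 (f w)) = ?as @ [acomp (dface (r + 1) a) (dface r (b - 1))] @ ?bs"
      by (rule nop_inner_face(1)[OF c(2) _ as assms])
    have nop: "nop ?\<theta> (wchain 1 (f w)) = nop ?\<theta> (wchain 1 w)"
      unfolding n1 n2 using dface_dface[OF ab(1,2), of r] ab(3) by simp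
    have th: "?\<theta> \<in> mono_maps n' (Suc n')" "distinct ?\<theta>" "set ?\<theta> = {0..Suc n'} - {r}" "r \<le> Suc n'"
      using assms by (auto simp: mono_maps_def sorted_append n')
    have "cface n r (f w) = cface n r w"
      using cface_nop[OF wn[unfolded n'] th(4,1,2,3)] cface_nop[OF fw[unfolded n'] th(4,1,2,3)] nop unfolding n' by simp
    moreover have "int (sum_list w) = int (sum_list (f w)) + 1"
    proof -
      have "sum_list w = sum_list p + (a + (b + sum_list q))" by (subst we(1)) simp
      moreover have "sum_list (f w) = sum_list p + (b - 1 + (a + sum_list q))" by (subst we(2)) simp
      ultimately show ?thesis using ab by simp
    qed
    ultimately show ?thesis
      unfolding H_def using cface_typing[OF wn, of r] assms by (auto intro!: gsgn_cong)
  qed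
  have "gsum AC ?T (int n - 1) H (words 1 n) = gsum AC ?T (int n - 1) H (?L \<union> ?R)"
    by (rule arg_cong[where f="gsum AC ?T (int n - 1) H"]) auto
  also have "\<dots> = gadd (gsum AC ?T (int n - 1) H ?L) (gsum AC ?T (int n - 1) H ?R)"
    by (rule gsum_union) (use H Coh_sfam in auto)
  also have "gsum AC ?T (int n - 1) H ?R = gsum AC ?T (int n - 1) (\<lambda>w. gsgn 1 (H w)) ?L"
    by (rule gsum_bij[OF _ _ bij, symmetric]) (use H Hf Coh_sfam in auto)
  also have "\<dots> = gsgn 1 (gsum AC ?T (int n - 1) H ?L)"
    by (rule gsgn_gsum[symmetric]) (use H Coh_sfam in auto)
  also have "gadd (gsum AC ?T (int n - 1) H ?L) (gsgn 1 (gsum AC ?T (int n - 1) H ?L)) = gzero AC ?T (int n - 1)"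
    using gadd_gsgn_cancel[of "gsum AC ?T (int n - 1) H ?L" 0 1] H Coh_sfam by simp
  finally show ?thesis unfolding H_def .
qed

text \<open>The cube is a point and has no faces, so only the chain map condition is left.\<close>

lemma Bsum_boundary_0: "dif (cx Y) \<star> Bsum X Y \<mu> 1 0 = Bsum X Y \<mu> 1 0 \<star> dif (cx X)"
proof -
  note cX = dg_coalgebraD(2)[OF X] and cY = dg_coalgebraD(2)[OF Y]
  have w: "[] \<in> words 1 0" by simp
  have s: "\<mu> 1 (wchain 1 []) \<in> shom 0 (cx X) (cpow (cx Y) 1)"
    using CohD(2)[OF cX cY \<mu> wchain_nerve[OF w]] by simp
  have Bs: "Bsum X Y \<mu> 1 0 = ctop 0 []"
    unfolding Bsum_ctop words_0 using ctop_typing[OF w] Coh_sfam by simp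
  have "sbd 0 AC (\<mu> 1 (wchain 1 [])) {0..0} = gzero AC BC (-1)"
    using Coh_sfam mu_typing[OF w] by (simp add: sbd_def)
  moreover have "dif (cpow (cx Y) 1) \<star> \<mu> 1 (wchain 1 []) \<star> sinc 0 AC {0..0}
    = gadd (sbd 0 AC (\<mu> 1 (wchain 1 [])) {0..0}) (gsgn (sdim {0..0}) (\<mu> 1 (wchain 1 []) \<star> sinc 0 AC {0..0} \<star> dif (cx X)))"
    using s splx_top[of 0] unfolding shom_iff[OF cX cpow_cplx(1)[OF cY]] by simp
  ultimately show ?thesis
    unfolding Bs ctop_def stop_def using mu_typing[OF w] cX cY by simp
qed

lemma Bsum_boundary:
  assumes n: "n > 0"
  shows "dif (cpow (cx Y) (1 + n)) \<star> Bsum X Y \<mu> 1 n = gadd (gadd (gsgn 1 (Bsum X Y \<mu> 2 (n - 1) \<star> icmul X 2))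
      (gsgn (int n) (Eface Y n \<star> Bsum X Y \<mu> 1 (n - 1)))) (gsgn (int n) (Bsum X Y \<mu> 1 n \<star> dif (cx X)))"
proof -
  note cX = dg_coalgebraD(2)[OF X] and cY = dg_coalgebraD(2)[OF Y]
  obtain n' where n': "n = Suc n'" using n by (cases n) auto
  let ?T = "gpow BC (1 + n)" and ?DY = "dif (cpow (cx Y) (1 + n))"
  have DY: "gm ?DY" "gsrc ?DY = ?T" "gtgt ?DY = ?T" "gdeg ?DY = -1"
    using cpow_cplx(1)[OF cY, of "1 + n"] cpow_cplx(2)[of "cx Y" "1 + n"] by (auto simp del: cpow.simps gpow_Suc)
  define K where "K = (\<lambda>r w. gsgn (int r) (gsgn (int (sum_list w)) (cface n r w)))"
  have K: "gmor (K r w) AC ?T (int n - 1)" if "w \<in> words 1 n" "r \<le> n" for r w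
    using cface_typing[OF that n] by (simp add: K_def)
  have one: "?DY \<star> ctop n w = gadd (gsum AC ?T (int n - 1) (\<lambda>r. gsgn (int r) (cface n r w)) {0..n}) (gsgn (int n) (ctop n w \<star> dif (cx X)))"
    if w: "w \<in> words 1 n" for w
  proof -
    let ?m = "\<mu> (1 + n) (wchain 1 w)"
    have "?m \<in> shom n (cx X) (cpow (cx Y) (1 + n))"
      using CohD(2)[OF cX cY \<mu> wchain_nerve[OF w]] by simp
    then have "?DY \<star> ?m \<star> sinc n AC {0..n} = gadd (sbd n AC ?m {0..n}) (gsgn (sdim {0..n}) (?m \<star> sinc n AC {0..n} \<star> dif (cx X)))"
      unfolding shom_iff[OF cX cpow_cplx(1)[OF cY]] using splx_top by blast
    moreover have "sbd n AC ?m {0..n} = gsum AC ?T (int n - 1) (\<lambda>r. gsgn (int r) (cface n r w)) {0..n}"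
    proof -
      have "card {v \<in> {0..n}. v < r} = r" if "r \<le> n" for r
      proof -
        have "{v \<in> {0..n}. v < r} = {0..<r}" using that by auto
        then show ?thesis by simp
      qed
      then show ?thesis
        unfolding sbd_def mu_typing[OF w] using n Coh_sfam cface_typing[OF w _ n]
        by (auto simp: cface_def intro!: gsum_cong)
    qed
    ultimately show ?thesis
      unfolding ctop_def stop_def using mu_typing[OF w] cX Coh_sfam by simp
  qed
  have "?DY \<star> Bsum X Y \<mu> 1 n = gsum AC ?T (int n - 1) (\<lambda>w. ?DY \<star> gsgn (int (sum_list w)) (ctop n w)) (words 1 n)"
    unfolding Bsum_ctop using DY ctop_typing Coh_sfam by (subst gcomp_gsum_left) (auto simp del: cpow.simps)
  also have "\<dots> = gsum AC ?T (int n - 1) (\<lambda>w. gadd (gsum AC ?T (int n - 1) (\<lambda>r. K r w) {0..n}) (gsgn (int n) (gsgn (int (sum_list w)) (ctop n w) \<star> dif (cx X)))) (words 1 n)"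
  proof (rule gsum_cong)
    fix w assume w: "w \<in> words 1 n"
    note t = ctop_typing[OF w] cface_typing[OF w _ n]
    have "?DY \<star> gsgn (int (sum_list w)) (ctop n w) = gsgn (int (sum_list w)) (?DY \<star> ctop n w)"
      using DY t by (simp del: cpow.simps)
    also have "\<dots> = gadd (gsgn (int (sum_list w)) (gsum AC ?T (int n - 1) (\<lambda>r. gsgn (int r) (cface n r w)) {0..n}))
       (gsgn (int (sum_list w)) (gsgn (int n) (ctop n w \<star> dif (cx X))))"
      unfolding one[OF w] using t cX Coh_sfam by (intro gsgn_gadd) auto
    also have "gsgn (int (sum_list w)) (gsum AC ?T (int n - 1) (\<lambda>r. gsgn (int r) (cface n r w)) {0..n})
       = gsum AC ?T (int n - 1) (\<lambda>r. gsgn (int (sum_list w)) (gsgn (int r) (cface n r w))) {0..n}"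
      using t Coh_sfam by (intro gsgn_gsum) auto
    also have "\<dots> = gsum AC ?T (int n - 1) (\<lambda>r. K r w) {0..n}"
      using t Coh_sfam by (intro gsum_cong) (auto simp: K_def add.commute)
    finally show "?DY \<star> gsgn (int (sum_list w)) (ctop n w)
       = gadd (gsum AC ?T (int n - 1) (\<lambda>r. K r w) {0..n}) (gsgn (int n) (gsgn (int (sum_list w)) (ctop n w) \<star> dif (cx X)))"
      using t cX by (simp add: add.commute)
  qed (use K ctop_typing cX Coh_sfam in \<open>auto intro!: gadd_gm gsum_gm\<close>)
  also have "\<dots> = gadd (gsum AC ?T (int n - 1) (\<lambda>w. gsum AC ?T (int n - 1) (\<lambda>r. K r w) {0..n}) (words 1 n))
      (gsum AC ?T (int n - 1) (\<lambda>w. gsgn (int n) (gsgn (int (sum_list w)) (ctop n w) \<star> dif (cx X))) (words 1 n))"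
    by (rule gsum_gadd) (use K ctop_typing cX Coh_sfam in \<open>auto intro!: gsum_gm\<close>)
  also have "gsum AC ?T (int n - 1) (\<lambda>w. gsgn (int n) (gsgn (int (sum_list w)) (ctop n w) \<star> dif (cx X))) (words 1 n)
      = gsgn (int n) (Bsum X Y \<mu> 1 n \<star> dif (cx X))"
  proof -
    have "Bsum X Y \<mu> 1 n \<star> dif (cx X) = gsum AC ?T (int n - 1) (\<lambda>w. gsgn (int (sum_list w)) (ctop n w) \<star> dif (cx X)) (words 1 n)"
      unfolding Bsum_ctop using ctop_typing cX Coh_sfam by (subst gcomp_gsum_right) auto
    then show ?thesis
      using ctop_typing cX Coh_sfam gsgn_gsum[of AC ?T "words 1 n" "\<lambda>w. gsgn (int (sum_list w)) (ctop n w) \<star> dif (cx X)" "int n - 1" "int n"] by simp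
  qed
  also have "gsum AC ?T (int n - 1) (\<lambda>w. gsum AC ?T (int n - 1) (\<lambda>r. K r w) {0..n}) (words 1 n)
      = gsum AC ?T (int n - 1) (\<lambda>r. gsum AC ?T (int n - 1) (K r) (words 1 n)) {0..n}"
    by (rule gsum_swap) (use K Coh_sfam in auto)
  also have "\<dots> = gsum AC ?T (int n - 1) (\<lambda>r. gsum AC ?T (int n - 1) (K r) (words 1 n)) {0, n}"
  proof (rule gsum_mono_neutral[symmetric])
    fix r assume "r \<in> {0..n} - {0, n}"
    then have r: "0 < r" "r < n" by auto
    have "gsum AC ?T (int n - 1) (K r) (words 1 n) = gsgn (int r) (gsum AC ?T (int n - 1) (\<lambda>w. gsgn (int (sum_list w)) (cface n r w)) (words 1 n))"
      unfolding K_def using cface_typing[of _ n r] r Coh_sfam by (subst gsgn_gsum) auto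
    then show "gsum AC ?T (int n - 1) (K r) (words 1 n) = gzero AC ?T (int n - 1)"
      unfolding cface_inner_sum[OF r] using Coh_sfam by simp
  qed (use K Coh_sfam in \<open>auto intro!: gsum_gm\<close>)
  also have "\<dots> = gadd (gsum AC ?T (int n - 1) (K 0) (words 1 n)) (gsum AC ?T (int n - 1) (K n) (words 1 n))"
    using n K Coh_sfam by (subst gsum_insert) (auto intro!: gsum_gm gsum_singleton)
  \<comment> \<open>The face 0 carries no sign of its own; \<open>gsgn 1\<close> stems from the
    initial letter 1, which all words share.\<close>
  also have "gsum AC ?T (int n - 1) (K 0) (words 1 n) = gsgn 1 (Bsum X Y \<mu> 2 (n - 1) \<star> icmul X 2)"
  proof -
    let ?t = "\<lambda>w. stop n' (gpow AC 2) (fext X Y \<mu> (wchain 2 w))"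
    note t = top_typing[OF Coh_sfam, of _ 2 n', simplified]
    note ic = icmul_typing[OF dg_coalgebraD(1)[OF X], of 2, simplified]
    have bij: "bij_betw (\<lambda>w. 1 # w) (words 2 n') (words 1 n)"
    proof -
      have "bij_betw ((\<lambda>(i, w). i # w) \<circ> Pair 1) (words 2 n') (words 1 n)"
        unfolding n' by (rule bij_betw_trans[OF _ words_Suc_front[of 1 n']]) (auto simp: bij_betw_def inj_on_def numeral_2_eq_2)
      then show ?thesis by (simp add: comp_def)
    qed
    have "gsum AC ?T (int n - 1) (K 0) (words 1 n) = gsum AC ?T (int n - 1) (\<lambda>w. gsgn 1 (gsgn (int (sum_list w)) (?t w) \<star> icmul X 2)) (words 2 n')"
    proof (rule gsum_bij[OF Coh_sfam(1) _ bij, symmetric])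
      fix w assume w: "w \<in> words 2 n'"
      then show "gsgn 1 (gsgn (int (sum_list w)) (?t w) \<star> icmul X 2) = K 0 (1 # w)"
        unfolding K_def n' cface_first[OF w] using t[OF w] ic by (simp del: icmul.simps)
    qed (use K Coh_sfam in auto)
    also have "\<dots> = gsgn 1 (gsum AC ?T (int n - 1) (\<lambda>w. gsgn (int (sum_list w)) (?t w) \<star> icmul X 2) (words 2 n'))"
      by (rule gsgn_gsum[symmetric]) (use t ic Coh_sfam n' in \<open>auto simp del: icmul.simps\<close>)
    also have "gsum AC ?T (int n - 1) (\<lambda>w. gsgn (int (sum_list w)) (?t w) \<star> icmul X 2) (words 2 n') = Bsum X Y \<mu> 2 n' \<star> icmul X 2"
      unfolding Bsum_def using t ic Coh_sfam n' by (subst gcomp_gsum_right) (auto simp del: icmul.simps)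
    finally show ?thesis using n' by simp
  qed
  \<comment> \<open>The sign of the face n stays outside. The last letter i is free, and its sign
    together with the coface missing i sums up to \<open>Eface\<close>.\<close>
  also have "gsum AC ?T (int n - 1) (K n) (words 1 n) = gsgn (int n) (Eface Y n \<star> Bsum X Y \<mu> 1 (n - 1))"
  proof -
    let ?U = "gpow BC n"
    let ?e = "\<lambda>i. gsgn (int i) (comap Y (dface n i))" and ?c = "\<lambda>w. gsgn (int (sum_list w)) (ctop n' w)"
    have e: "gmor (?e i) ?U ?T 0" if "i \<in> {1..n}" for i
      using comap_typing[OF dg_coalgebraD(1)[OF Y] dface_act(1)[of i n]] dface_act[of i n] that by simp
    have c: "gmor (?c w) AC ?U (int n - 1)" if "w \<in> words 1 n'" for w
      using ctop_typing[OF that] n' by simp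
    have "gsum AC ?T (int n - 1) (K n) (words 1 n) = gsum AC ?T (int n - 1) (\<lambda>(w, i). gsgn (int n) (?e i \<star> ?c w)) (words 1 n' \<times> {1..n})"
    proof (rule gsum_bij[symmetric, where h = "\<lambda>(w, i). w @ [i]"])
      show "bij_betw (\<lambda>(w, i). w @ [i]) (words 1 n' \<times> {1..n}) (words 1 n)"
        using words_Suc_back[of 1 n'] by (simp add: n')
      fix x assume x: "x \<in> words 1 n' \<times> {1..n}"
      obtain w i where wi: "x = (w, i)" "w \<in> words 1 n'" "i \<in> {1..n}" using x by auto
      show "(case x of (w, i) \<Rightarrow> gsgn (int n) (?e i \<star> ?c w)) = K n ((\<lambda>(w, i). w @ [i]) x)"
        using e[OF wi(3)] c[OF wi(2)] comap_typing[OF dg_coalgebraD(1)[OF Y] dface_act(1)[of i n]] dface_act[of i n] ctop_typing[OF wi(2)] wi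
        unfolding K_def n' by (simp add: cface_last ac_simps)
    qed (use K Coh_sfam in auto)
    also have "\<dots> = gsum AC ?T (int n - 1) (\<lambda>w. gsum AC ?T (int n - 1) (\<lambda>i. gsgn (int n) (?e i \<star> ?c w)) {1..n}) (words 1 n')"
      by (rule gsum_Sigma[symmetric]) (use e c Coh_sfam in auto)
    also have "\<dots> = gsum AC ?T (int n - 1) (\<lambda>w. gsgn (int n) (Eface Y n \<star> ?c w)) (words 1 n')"
    proof (rule gsum_cong)
      fix w assume w: "w \<in> words 1 n'"
      have "Eface Y n \<star> ?c w = gsum AC ?T (int n - 1) (\<lambda>i. ?e i \<star> ?c w) {1..n}"
        unfolding Eface_def using e c[OF w] Coh_sfam by (subst gcomp_gsum_right) auto
      then show "gsum AC ?T (int n - 1) (\<lambda>i. gsgn (int n) (?e i \<star> ?c w)) {1..n} = gsgn (int n) (Eface Y n \<star> ?c w)"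
        using gsgn_gsum[of AC ?T "{1..n}" "\<lambda>i. ?e i \<star> ?c w" "int n - 1" "int n"] e c[OF w] Coh_sfam by simp
    qed (use c Eface_typing[OF dg_coalgebraD(1)[OF Y]] Coh_sfam in auto)
    also have "\<dots> = gsgn (int n) (gsum AC ?T (int n - 1) (\<lambda>w. Eface Y n \<star> ?c w) (words 1 n'))"
      by (rule gsgn_gsum[symmetric]) (use c Eface_typing[OF dg_coalgebraD(1)[OF Y]] Coh_sfam in auto)
    also have "gsum AC ?T (int n - 1) (\<lambda>w. Eface Y n \<star> ?c w) (words 1 n') = Eface Y n \<star> Bsum X Y \<mu> 1 n'"
      unfolding Bsum_ctop using c Eface_typing[OF dg_coalgebraD(1)[OF Y], of n] Coh_sfam n' by (subst gcomp_gsum_left) auto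
    finally show ?thesis using n' by simp
  qed
  finally show ?thesis .
qed

end

section \<open>The morphism of \<open>A\<^sub>\<infinity>\<close>-coalgebras\<close>

lemma desusp_cpt [simp]: "cpt (desusp A) i = cpt A (i + 1)" and desusp_low [simp]: "low (desusp A) = low A - 1"
  by (simp_all add: desusp_def)

lemma desusp_graded [simp]: "graded_object A \<Longrightarrow> graded_object (desusp A)"
  unfolding graded_object_def[of "desusp A"] by simp

lemma sdown_simps [simp]: "gsrc (sdown A) = A" "gtgt (sdown A) = desusp A" "gdeg (sdown A) = -1"
  and slift_simps [simp]: "gsrc (slift A) = desusp A" "gtgt (slift A) = A" "gdeg (slift A) = 1"
  by (simp_all add: sdown_def slift_def)

lemma sdown_gm [simp]: "graded_object A \<Longrightarrow> gm (sdown A)" and slift_gm [simp]: "graded_object A \<Longrightarrow> gm (slift A)"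
  by (auto intro!: gmI simp: hom_iff sdown_def slift_def)

lemma slift_sdown [simp]: "graded_object A \<Longrightarrow> slift A \<star> sdown A = gid A"
  by (rule gmap_eqI) (auto simp: sdown_def slift_def)

lemma slift_sdown_gcomp [simp]: "gm f \<Longrightarrow> gtgt f = A \<Longrightarrow> slift A \<star> sdown A \<star> f = f"
  by (subst gcomp_assoc[symmetric]) auto

text \<open>The sign is the Koszul sign for moving a map of degree k - 1 past one copy of
  \<open>sdown\<close>. It is the case j = 1 of the sign in \<open>Phi_sdown\<close>.\<close>

definition row :: "('a, 'b) coalgebra \<Rightarrow> ('a, 'b) coalgebra \<Rightarrow> ('a, 'b) family \<Rightarrow> nat \<Rightarrow> ('a, 'b) gmap" where
  "row X Y \<mu> k = gsgn (int (k - 1)) (mpow (sdown (gr (cx Y))) k \<star> Bsum X Y \<mu> 1 (k - 1) \<star> slift (gr (cx X)))"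

definition Phi :: "('a, 'b) coalgebra \<Rightarrow> ('a, 'b) coalgebra \<Rightarrow> ('a, 'b) family \<Rightarrow> ('a, 'b) matrix" where
  "Phi X Y \<mu> = alg (desusp (gr (cx X))) (desusp (gr (cx Y))) (row X Y \<mu>)"

lemma Phi_1: "Phi X Y \<mu> 1 (1 + n) = row X Y \<mu> (1 + n)"
  by (simp add: Phi_def)

context
  fixes X Y :: "('a, 'b) coalgebra" and \<mu> :: "('a, 'b) family"
  assumes g: "graded_object (gr (cx X))" "graded_object (gr (cx Y))" and \<mu>: "sfam (gr (cx X)) (gr (cx Y)) \<mu>"
begin

lemma row_typing: "\<forall>k>0. gmor (row X Y \<mu> k) (desusp (gr (cx X))) (gpow (desusp (gr (cx Y))) k) 0"
  using g Bsum_typing[OF g \<mu>, of 1] by (auto simp: row_def of_nat_diff)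

lemma Phi_ahom: "ahom (desusp (gr (cx X))) (desusp (gr (cx Y))) (Phi X Y \<mu>)"
  unfolding Phi_def using g row_typing by (intro alg_ahom) auto

lemma row_sdown: "row X Y \<mu> (1 + n) \<star> sdown (gr (cx X)) = gsgn (int n) (mpow (sdown (gr (cx Y))) (1 + n) \<star> Bsum X Y \<mu> 1 n)"
  using g Bsum_typing[OF g \<mu>, of 1] by (simp add: row_def)

text \<open>The free extension of the row agrees with the tensor extension of the family, since
  \<open>alg_Suc\<close> and \<open>Bsum_Suc\<close> are the same recursion up to signs. The proof
  is the comparison of these signs under desuspension.\<close>

lemma Phi_sdown:
  assumes "j > 0"
  shows "Phi X Y \<mu> j (j + n) \<star> mpow (sdown (gr (cx X))) j = gsgn (int (j * n)) (mpow (sdown (gr (cx Y))) (j + n) \<star> Bsum X Y \<mu> j n)"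
  using assms
proof (induction j arbitrary: n rule: nat_induct_non_zero)
  case 1
  then show ?case using row_sdown[of n] Phi_1[of X Y \<mu> n] by simp
next
  case (Suc j)
  let ?A = "gr (cx X)" and ?B = "gr (cx Y)" and ?F = "Phi X Y \<mu>" and ?a = "row X Y \<mu>"
  let ?V = "desusp ?A" and ?W = "desusp ?B" and ?S = "gpow ?A (Suc j)" and ?k = "Suc j + n"
  let ?T = "gpow ?W ?k" and ?d = "- int (Suc j)"
  note tF = tmatD[OF ahomD(1)[OF Phi_ahom]]
  note ty = Bsum_typing[OF g \<mu>]
  note a = row_typing[rule_format]
  define P where "P = (\<lambda>l. can ?W l (?k - l) \<star> ((?a l \<star> sdown ?A) \<odot> (?F j (?k - l) \<star> mpow (sdown ?A) j)))"
  have P: "gmor (P l) ?S ?T ?d" if "l \<in> {1..<?k}" for l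
    using that a[of l] tF(1-4)[OF Suc(1), of "?k - l"] g Suc(1) by (simp add: P_def)
  define Q where "Q = (\<lambda>v. gsgn (int ((1 + v) * (n - v))) (can ?B (1 + v) (j + (n - v)) \<star> (Bsum X Y \<mu> 1 v \<odot> Bsum X Y \<mu> j (n - v))))"
  have Q: "gmor (Q v) ?S (gpow ?B ?k) (int n)" if "v \<in> {0..n}" for v
  proof -
    have "1 + v + (j + (n - v)) = ?k" using that by simp
    then show ?thesis using that ty Suc(1) g by (simp add: Q_def)
  qed
  have "?F (Suc j) ?k \<star> mpow (sdown ?A) (Suc j) = gsum ?S ?T ?d (\<lambda>l. (can ?W l (?k - l) \<star> (?a l \<odot> ?F j (?k - l))) \<star> (sdown ?A \<odot> mpow (sdown ?A) j)) {1..<?k}"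
    unfolding Phi_def using Suc(1) alg_Suc[of j ?k ?V ?W ?a] a tF(1-4)[OF Suc(1), unfolded Phi_def] g
    by (simp add: mpow_Suc) (subst gcomp_gsum_right; auto simp: gcomp_gsum_right)
  also have "\<dots> = gsum ?S ?T ?d P {1..<?k}"
  proof (rule gsum_cong)
    fix l assume "l \<in> {1..<?k}"
    then show "(can ?W l (?k - l) \<star> (?a l \<odot> ?F j (?k - l))) \<star> (sdown ?A \<odot> mpow (sdown ?A) j) = P l"
      using a[of l] tF(1-4)[OF Suc(1), of "?k - l"] g Suc(1) by (simp add: P_def gtenm_gcomp)
  qed (use P g in auto)
  \<comment> \<open>If the first factor takes more than n + 1 of the j + 1 + n letters, fewer than j
    remain for the other j factors.\<close>
  also have "\<dots> = gsum ?S ?T ?d P {1..<n + 2}"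
  proof (rule gsum_mono_neutral[symmetric])
    fix l assume l: "l \<in> {1..<?k} - {1..<n + 2}"
    then have "?F j (?k - l) = gzero (gpow ?V j) (gpow ?W (?k - l)) 0" by (intro tF(5)) (use Suc(1) in auto)
    then show "P l = gzero ?S ?T ?d" using l a[of l] g Suc(1) by (simp add: P_def)
  qed (use P g Suc(1) in auto)
  also have "\<dots> = gsum ?S ?T ?d (\<lambda>v. gsgn (int (Suc j * n)) (mpow (sdown ?B) ?k \<star> Q v)) {0..n}"
  proof (rule gsum_bij[symmetric, where h = "\<lambda>v. 1 + v"])
    show "bij_betw ((+) 1) {0..n} {1..<n + 2}"
      by (rule bij_betw_byWitness[where f' = "\<lambda>l. l - 1"]) auto
    fix v assume v: "v \<in> {0..n}"
    obtain p where p: "n = v + p" using v le_Suc_ex by auto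
    let ?b = "Bsum X Y \<mu> 1 v" and ?c = "Bsum X Y \<mu> j p"
    have kv: "?k - (1 + v) = j + p" "n - v = p" "?k = (1 + v) + (j + p)" using p by auto
    have ev: "even ((int j + int p) * int v + (- int j - int p) * int v)" by (simp add: algebra_simps)
    have "P (1 + v) = can ?W (1 + v) (j + p) \<star> (gsgn (int v) (mpow (sdown ?B) (1 + v) \<star> ?b) \<odot> gsgn (int (j * p)) (mpow (sdown ?B) (j + p) \<star> ?c))"
      unfolding P_def kv(1) row_sdown Suc.IH ..
    also have "\<dots> = gsgn (int v + int (j * p)) (can ?W (1 + v) (j + p) \<star> ((mpow (sdown ?B) (1 + v) \<star> ?b) \<odot> (mpow (sdown ?B) (j + p) \<star> ?c)))"
      using ty g Suc(1) by (simp add: add.commute)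
    \<comment> \<open>The power \<open>mpow (sdown ?B) (j + p)\<close>, of degree -(j + p), passes
      \<open>?b\<close>, of degree v.\<close>
    also have "(mpow (sdown ?B) (1 + v) \<star> ?b) \<odot> (mpow (sdown ?B) (j + p) \<star> ?c)
      = gsgn (int (j + p) * int v) ((mpow (sdown ?B) (1 + v) \<odot> mpow (sdown ?B) (j + p)) \<star> (?b \<odot> ?c))"
      using gtenm_gcomp[of ?b ?c "mpow (sdown ?B) (1 + v)" "mpow (sdown ?B) (j + p)"] ty g Suc(1) ev by simp
    also have "gsgn (int v + int (j * p)) (can ?W (1 + v) (j + p) \<star> gsgn (int (j + p) * int v) ((mpow (sdown ?B) (1 + v) \<odot> mpow (sdown ?B) (j + p)) \<star> (?b \<odot> ?c)))
      = gsgn (int v + int (j * p) + int (j + p) * int v) ((can ?W (1 + v) (j + p) \<star> (mpow (sdown ?B) (1 + v) \<odot> mpow (sdown ?B) (j + p))) \<star> (?b \<odot> ?c))"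
      using ty g Suc(1) by simp
    also have "can ?W (1 + v) (j + p) \<star> (mpow (sdown ?B) (1 + v) \<odot> mpow (sdown ?B) (j + p)) = mpow (sdown ?B) ?k \<star> can ?B (1 + v) (j + p)"
      unfolding kv(3) using g Suc(1) by (intro can_mpow[symmetric]) auto
    also have "gsgn (int v + int (j * p) + int (j + p) * int v) ((mpow (sdown ?B) ?k \<star> can ?B (1 + v) (j + p)) \<star> (?b \<odot> ?c))
      = gsgn (int v + int (j * p) + int (j + p) * int v) (mpow (sdown ?B) ?k \<star> can ?B (1 + v) (j + p) \<star> (?b \<odot> ?c))"
      unfolding kv(3) using ty g Suc(1) by simp
    \<comment> \<open>With n = v + p the exponents v + j * p + (j + p) * v and (j + 1) * (v + p) +
      (1 + v) * p differ by 2 * p.\<close>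
    also have "\<dots> = gsgn (int (Suc j * n) + int ((1 + v) * p)) (mpow (sdown ?B) ?k \<star> can ?B (1 + v) (j + p) \<star> (?b \<odot> ?c))"
      unfolding p by (rule gsgn_cong) (simp add: algebra_simps)
    also have "\<dots> = gsgn (int (Suc j * n)) (mpow (sdown ?B) ?k \<star> Q v)"
      unfolding Q_def kv(2) unfolding kv(3) using ty g Suc(1) by (simp add: ac_simps)
    finally show "gsgn (int (Suc j * n)) (mpow (sdown ?B) ?k \<star> Q v) = P (1 + v)" by simp
  qed (use P g Suc(1) in auto)
  also have "\<dots> = gsgn (int (Suc j * n)) (mpow (sdown ?B) ?k \<star> gsum ?S (gpow ?B ?k) (int n) Q {0..n})"
    using Q g Suc(1) by (simp add: gsgn_gsum gcomp_gsum_left minus_diff_commute)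
  also have "gsum ?S (gpow ?B ?k) (int n) Q {0..n} = Bsum X Y \<mu> (Suc j) n"
    unfolding Q_def by (rule Bsum_Suc[OF g \<mu> Suc(1), symmetric])
  finally show ?case .
qed

end

section \<open>The cobar derivation, entry by entry\<close>

definition cobar_row :: "('a, 'b) coalgebra \<Rightarrow> nat \<Rightarrow> ('a, 'b) gmap" where
  "cobar_row X k = (if k = 1 then gsgn 1 (sdown (gr (cx X)) \<star> dif (cx X) \<star> slift (gr (cx X)))
     else if k = 2 then (sdown (gr (cx X)) \<odot> sdown (gr (cx X))) \<star> cmul X \<star> slift (gr (cx X))
     else gzero (desusp (gr (cx X))) (gpow (desusp (gr (cx X))) k) (-1))"

lemma cobar_derivation: "cobar X = derivation (desusp (gr (cx X))) (cobar_row X)"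
  by (simp add: cobar_def cobar_row_def[abs_def] Let_def)

context
  fixes Y :: "('a, 'b) coalgebra"
  assumes Y: "dg_coalgebra Y"
begin

abbreviation (input) "BU \<equiv> gr (cx Y)"
abbreviation (input) "WU \<equiv> desusp (gr (cx Y))"

lemma cobar_row_typing: "\<forall>k>0. gmor (cobar_row Y k) WU (gpow WU k) (-1)"
  using dg_coalgebraD(1,2)[OF Y] by (auto simp: cobar_row_def numeral_2_eq_2)

lemma cobar_tmat: "tmat WU WU (-1) (cobar Y)"
  unfolding cobar_derivation using dg_coalgebraD(1)[OF Y] by (intro derivation_tmat cobar_row_typing) auto

lemma cobar_Suc:
  assumes "j > 0" "k > j"
  shows "cobar Y (Suc j) k = gadd (can WU (k - j) j \<star> (cobar_row Y (k - j) \<odot> gid (gpow WU j))) (gid WU \<odot> cobar Y j (k - 1))"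
  unfolding cobar_derivation using derivation_Suc[of j k WU "cobar_row Y"] assms by simp

lemma cobar_1: "k > 0 \<Longrightarrow> cobar Y 1 k = cobar_row Y k"
  unfolding cobar_derivation by (rule derivation_1)

text \<open>Both terms of the induction step acquire the exponent j + 1: on the first factor from
  the minus sign in \<open>cobar_row\<close> and from the differential passing j copies of
  \<open>sdown\<close>, on the others from the induction hypothesis and from the derivation passing
  one copy.\<close>

lemma cobar_diag:
  assumes "j > 0"
  shows "cobar Y j j \<star> mpow (sdown BU) j = gsgn (int j) (mpow (sdown BU) j \<star> dif (cpow (cx Y) j))"
  using assms
proof (induction j rule: nat_induct_non_zero)
  case 1
  then show ?case using cobar_1[of 1] dg_coalgebraD(1,2)[OF Y] by (simp add: cobar_row_def)
next
  case (Suc j)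
  note c = dg_coalgebraD(1,2)[OF Y] and tD = tmatD(1-4)[OF cobar_tmat Suc(1) Suc(1)]
  let ?s = "sdown BU" and ?t = "mpow (sdown BU) j" and ?d = "dif (cpow (cx Y) j)"
  have g: "graded_object BU" using c by simp
  have d: "gm ?d" "gsrc ?d = gpow BU j" "gtgt ?d = gpow BU j" "gdeg ?d = -1"
    using cpow_cplx(1)[OF c(2), of j] cpow_cplx(2)[of "cx Y" j] by auto
  note b = cobar_row_typing[rule_format, of 1]
  have b1: "cobar_row Y 1 \<star> ?s = gsgn 1 (?s \<star> dif (cx Y))"
    using c g by (simp add: cobar_row_def)
  have "cobar Y (Suc j) (Suc j) \<star> (?s \<odot> ?t)
    = gadd (cobar_row Y 1 \<odot> gid (gpow WU j)) (gid WU \<odot> cobar Y j j) \<star> (?s \<odot> ?t)"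
    unfolding cobar_Suc[OF Suc(1) lessI] using b g Suc(1) by simp
  also have "\<dots> = gadd ((cobar_row Y 1 \<star> ?s) \<odot> ?t) (gsgn 1 (?s \<odot> (cobar Y j j \<star> ?t)))"
    using b tD g Suc(1) by (subst gcomp_gadd) (auto simp: gtenm_gcomp)
  also have "\<dots> = gadd (gsgn 1 ((?s \<star> dif (cx Y)) \<odot> (?t \<star> gid (gpow BU j)))) (gsgn (int (Suc j)) ((?s \<star> gid BU) \<odot> (?t \<star> ?d)))"
    unfolding b1 Suc.IH using c d g Suc(1) by (simp add: add.commute)
  also have "(?s \<star> dif (cx Y)) \<odot> (?t \<star> gid (gpow BU j)) = gsgn (int j) ((?s \<odot> ?t) \<star> (dif (cx Y) \<odot> gid (gpow BU j)))"
    using gtenm_gcomp[of "dif (cx Y)" "gid (gpow BU j)" ?s ?t] c g Suc(1) by simp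
  also have "(?s \<star> gid BU) \<odot> (?t \<star> ?d) = (?s \<odot> ?t) \<star> (gid BU \<odot> ?d)"
    using gtenm_gcomp[of "gid BU" ?d ?s ?t] c d g Suc(1) by simp
  also have "gadd (gsgn 1 (gsgn (int j) ((?s \<odot> ?t) \<star> (dif (cx Y) \<odot> gid (gpow BU j))))) (gsgn (int (Suc j)) ((?s \<odot> ?t) \<star> (gid BU \<odot> ?d)))
    = gsgn (int (Suc j)) ((?s \<odot> ?t) \<star> gadd (dif (cx Y) \<odot> gid (gpow BU j)) (gid BU \<odot> ?d))"
    using c d g Suc(1) by (simp add: gcomp_gadd gsgn_gadd)
  finally show ?case
    using Suc(1) by (simp add: mpow_Suc cpow_Suc cten_simps)
qed

lemma adiffs_dface:
  assumes "j > 0"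
  shows "adiffs (dface (Suc j) 1) = 2 # replicate j 1" "1 \<le> i \<Longrightarrow> adiffs (dface (Suc j) (Suc i)) = 1 # adiffs (dface j i)"
proof -
  show "adiffs (dface (Suc j) 1) = 2 # replicate j 1"
    by (rule nth_equalityI) (auto simp: adiffs_def asrc_def dface_nth nth_Cons split: nat.splits simp del: upt_Suc)
  show "adiffs (dface (Suc j) (Suc i)) = 1 # adiffs (dface j i)" if "1 \<le> i"
    using that by (intro nth_equalityI) (auto simp: adiffs_def asrc_def dface_nth nth_Cons split: nat.splits simp del: upt_Suc)
qed

text \<open>The first coface doubles the first factor, and the coface with index i + 1 is the
  identity tensored with the coface of index i; the shift of the index accounts for the common sign.
  The same recursion describes the cobar derivation.\<close>

lemma Eface_Suc:
  assumes "j > 0"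
  shows "gsgn 1 (Eface Y (Suc j)) = gadd (can BU 2 j \<star> (cmul Y \<odot> gid (gpow BU j))) (gid BU \<odot> Eface Y j)"
proof -
  note c = dg_coalgebraD(1)[OF Y]
  have g: "graded_object BU" using c by simp
  let ?S = "gpow BU (Suc j)" and ?T = "gpow BU (Suc j + 1)"
  let ?e = "\<lambda>j i. gsgn (int i) (comap Y (dface j i))"
  have e: "gmor (?e j i) (gpow BU j) (gpow BU (j + 1)) 0" if "i \<in> {1..j}" for i j
    using comap_typing[OF c dface_act(1)[of i j]] dface_act[of i j] that by simp
  have E: "Eface Y j = gsum (gpow BU j) (gpow BU (j + 1)) 0 (?e j) {1..j}" for j by (simp add: Eface_def)
  have s: "{1..Suc j} = insert 1 {Suc 1..Suc j}" by auto
  have "Eface Y (Suc j) = gadd (?e (Suc j) 1) (gsum ?S ?T 0 (?e (Suc j)) {Suc 1..Suc j})"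
    unfolding E unfolding s by (rule gsum_insert) (use e[of _ "Suc j"] e[of 1 "Suc j"] g s in auto)
  also have "gsum ?S ?T 0 (?e (Suc j)) {Suc 1..Suc j} = gsum ?S ?T 0 (\<lambda>i. gsgn 1 (gid BU \<odot> ?e j i)) {1..j}"
  proof (rule gsum_bij[symmetric, where h = Suc])
    show "bij_betw Suc {1..j} {Suc 1..Suc j}" by (simp add: bij_betw_def)
    fix i assume i: "i \<in> {1..j}"
    have "comap Y (dface (Suc j) (Suc i)) = gid BU \<odot> comap Y (dface j i)"
      using adiffs_dface(2)[OF assms, of i] i adiffs[OF dface_act(1)[of i j]] dface_act[of i j] c comap_typing[OF c dface_act(1)[of i j]]
      by (simp add: comap_cmuls cmuls_Cons)
    then show "gsgn 1 (gid BU \<odot> ?e j i) = ?e (Suc j) (Suc i)"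
      using comap_typing[OF c dface_act(1)[of i j]] i g by simp
  qed (use e[of _ "Suc j"] g in auto)
  also have "\<dots> = gsgn 1 (gid BU \<odot> Eface Y j)"
    unfolding E using e g assms by (simp add: gtenm_gsum_right gsgn_gsum)
  also have "?e (Suc j) 1 = gsgn 1 (can BU 2 j \<star> (cmul Y \<odot> gid (gpow BU j)))"
    using adiffs_dface(1)[OF assms] cmuls_ones[OF c assms] c assms cmuls_typing[OF c, of "replicate j 1"]
    by (simp add: comap_cmuls cmuls_Cons sum_list_replicate numeral_2_eq_2)
  finally have eq: "Eface Y (Suc j) = gadd (gsgn 1 (can BU 2 j \<star> (cmul Y \<odot> gid (gpow BU j)))) (gsgn 1 (gid BU \<odot> Eface Y j))" .
  define P Q where "P = can BU 2 j \<star> (cmul Y \<odot> gid (gpow BU j))" and "Q = gid BU \<odot> Eface Y j"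
  have "gm P" "gsrc P = ?S" "gtgt P = ?T" "gdeg P = 0" "gm Q" "gsrc Q = ?S" "gtgt Q = ?T" "gdeg Q = 0"
    using c g assms Eface_typing[OF c, of j] by (simp_all add: P_def Q_def numeral_2_eq_2)
  then show ?thesis
    unfolding eq P_def[symmetric] Q_def[symmetric] by (simp add: gsgn_gadd)
qed

text \<open>The quadratic part alone lengthens words by one. Both sides obey the same recursion, by
  \<open>cobar_Suc\<close> on the left and \<open>Eface_Suc\<close> on the right.\<close>

lemma cobar_upper:
  assumes "j > 0"
  shows "cobar Y j (j + 1) \<star> mpow (sdown BU) j = gsgn 1 (mpow (sdown BU) (j + 1) \<star> Eface Y j)"
  using assms
proof (induction j rule: nat_induct_non_zero)
  case 1
  note c = dg_coalgebraD(1)[OF Y]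
  have "dface 1 1 = [0, 2]" by (simp add: dface_def)
  then have "Eface Y 1 = gsgn 1 (cmul Y)"
    using c by (simp add: Eface_def numeral_2_eq_2)
  then show ?case using cobar_1[of 2] c by (simp add: cobar_row_def numeral_2_eq_2 mpow_Suc)
next
  case (Suc j)
  note c = dg_coalgebraD(1)[OF Y] and tD = tmatD(1-4)[OF cobar_tmat Suc(1), of "j + 1", simplified]
  note E = Eface_typing[OF c, of j] and b = cobar_row_typing[rule_format, of 2]
  let ?s = "sdown BU" and ?t = "mpow (sdown BU) j"
  have g: "graded_object BU" using c by simp
  have b2: "cobar_row Y 2 \<star> ?s = mpow ?s 2 \<star> cmul Y"
    using c g by (simp add: cobar_row_def numeral_2_eq_2)
  have "cobar Y (Suc j) (Suc j + 1) \<star> (?s \<odot> ?t)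
    = gadd (can WU 2 j \<star> (cobar_row Y 2 \<odot> gid (gpow WU j))) (gid WU \<odot> cobar Y j (j + 1)) \<star> (?s \<odot> ?t)"
    using cobar_Suc[of j "Suc j + 1"] Suc(1) by simp
  also have "\<dots> = gadd (can WU 2 j \<star> ((cobar_row Y 2 \<star> ?s) \<odot> ?t)) (gsgn 1 (?s \<odot> (cobar Y j (j + 1) \<star> ?t)))"
    using b tD g Suc(1) by (subst gcomp_gadd) (auto simp: gtenm_gcomp)
  also have "\<dots> = gadd (can WU 2 j \<star> ((mpow ?s 2 \<star> cmul Y) \<odot> (?t \<star> gid (gpow BU j)))) ((?s \<star> gid BU) \<odot> (mpow ?s (j + 1) \<star> Eface Y j))"
    unfolding b2 Suc.IH using c E g Suc(1) by simp
  also have "(mpow ?s 2 \<star> cmul Y) \<odot> (?t \<star> gid (gpow BU j)) = (mpow ?s 2 \<odot> ?t) \<star> (cmul Y \<odot> gid (gpow BU j))"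
    using gtenm_gcomp[of "cmul Y" "gid (gpow BU j)" "mpow ?s 2" ?t] c g Suc(1) by (simp add: numeral_2_eq_2)
  also have "can WU 2 j \<star> ((mpow ?s 2 \<odot> ?t) \<star> (cmul Y \<odot> gid (gpow BU j))) = (can WU 2 j \<star> (mpow ?s 2 \<odot> ?t)) \<star> (cmul Y \<odot> gid (gpow BU j))"
    using c g Suc(1) by (simp add: numeral_2_eq_2)
  also have "can WU 2 j \<star> (mpow ?s 2 \<odot> ?t) = mpow ?s (2 + j) \<star> can BU 2 j"
    using g Suc(1) by (intro can_mpow[symmetric]) auto
  also have "(mpow ?s (2 + j) \<star> can BU 2 j) \<star> (cmul Y \<odot> gid (gpow BU j)) = mpow ?s (2 + j) \<star> can BU 2 j \<star> (cmul Y \<odot> gid (gpow BU j))"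
    using c g Suc(1) by (simp add: numeral_2_eq_2)
  also have "(?s \<star> gid BU) \<odot> (mpow ?s (j + 1) \<star> Eface Y j) = (?s \<odot> mpow ?s (j + 1)) \<star> (gid BU \<odot> Eface Y j)"
    using gtenm_gcomp[of "gid BU" "Eface Y j" ?s "mpow ?s (j + 1)"] E g by simp
  also have "?s \<odot> mpow ?s (j + 1) = mpow ?s (2 + j)"
    by (simp add: mpow_Suc numeral_2_eq_2)
  also have "gadd (mpow ?s (2 + j) \<star> can BU 2 j \<star> (cmul Y \<odot> gid (gpow BU j))) (mpow ?s (2 + j) \<star> (gid BU \<odot> Eface Y j))
    = mpow ?s (2 + j) \<star> gadd (can BU 2 j \<star> (cmul Y \<odot> gid (gpow BU j))) (gid BU \<odot> Eface Y j)"
    using c g Suc(1) E by (subst gcomp_gadd(2)) (auto simp: numeral_2_eq_2)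
  also have "\<dots> = mpow ?s (2 + j) \<star> gsgn 1 (Eface Y (Suc j))"
    unfolding Eface_Suc[OF Suc(1)] ..
  finally show ?case
    using Eface_typing[OF c, of "Suc j"] g Suc(1) by (simp add: mpow_Suc numeral_2_eq_2)
qed

text \<open>The components of the derivation on generators are only linear and quadratic.\<close>

lemma cobar_zero:
  assumes "j > 0" "k > j + 1"
  shows "cobar Y j k = gzero (gpow WU j) (gpow WU k) (-1)"
  using assms
proof (induction j arbitrary: k rule: nat_induct_non_zero)
  case 1
  then show ?case using cobar_1[of k] by (simp add: cobar_row_def)
next
  case (Suc j)
  have g: "graded_object WU" using dg_coalgebraD(1)[OF Y] by simp
  have k: "k - j > 2" "k - 1 > j + 1" "k > j" "Suc (k - 1) = k" "k - 1 > 0" using Suc by auto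
  have "cobar_row Y (k - j) = gzero WU (gpow WU (k - j)) (-1)" using k by (simp add: cobar_row_def)
  moreover have "gpow WU k = WU \<odot>\<^sub>o gpow WU (k - 1)" using gpow_Suc[OF k(5), of WU] k(4) by simp
  ultimately show ?case
    unfolding cobar_Suc[OF Suc(1) k(3)] Suc(2)[OF k(2)] using g k Suc(1) by simp
qed

end

text \<open>The cobar derivation lives on the diagonal and just above it, so on generators each side
  of the equation has at most two terms. After desuspension they are the terms of
  \<open>Bsum_boundary\<close>; the one with two blocks enters through row 2 of \<open>Phi\<close>,
  known from \<open>Phi_sdown\<close>.\<close>

lemma Phi_Ainf_hom:
  assumes X: "dg_coalgebra X" and Y: "dg_coalgebra Y" and \<mu>: "\<mu> \<in> Coh X Y"
  shows "Phi X Y \<mu> \<in> Ainf_hom X Y"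
proof -
  let ?A = "gr (cx X)" and ?B = "gr (cx Y)" and ?F = "Phi X Y \<mu>"
  let ?V = "desusp ?A" and ?W = "desusp ?B"
  note G = Coh_sfam[OF X Y \<mu>]
  note cX = dg_coalgebraD(1,2)[OF X] and cY = dg_coalgebraD(1,2)[OF Y]
  note ah = Phi_ahom[OF G] and ty = Bsum_typing[OF G]
  note tF = tmatD[OF ahomD(1)[OF ah]] and tX = tmatD[OF cobar_tmat[OF X]] and tY = tmatD[OF cobar_tmat[OF Y]]
  have g: "graded_object ?V" "graded_object ?W" using G by auto
  have first: "pro_comp ?F (cobar X) 1 (1 + n) = pro_comp (cobar Y) ?F 1 (1 + n)" for n
  proof -
    let ?k = "1 + n"
    define b where "b = Bsum X Y \<mu> 1 n"
    have b: "gm b" "gsrc b = ?A" "gtgt b = gpow ?B ?k" "gdeg b = int n" using ty[of 1 n] by (simp_all add: b_def)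
    define t where "t = mpow (sdown ?B) ?k"
    have t: "gm t" "gsrc t = gpow ?B ?k" "gtgt t = gpow ?W ?k" "gdeg t = - int ?k" using G by (simp_all add: t_def)
    have d: "gm (dif (cx X))" "gsrc (dif (cx X)) = ?A" "gtgt (dif (cx X)) = ?A" "gdeg (dif (cx X)) = -1" using cX by auto
    let ?u = "slift ?A"
    let ?D = "dif (cpow (cx Y) ?k)"
    have D: "gm ?D" "gsrc ?D = gpow ?B ?k" "gtgt ?D = gpow ?B ?k" "gdeg ?D = -1"
      using cpow_cplx(1)[OF cY(2), of ?k] cpow_cplx(2)[of "cx Y" ?k] by (auto simp del: cpow.simps gpow_Suc)
    define R where "R = t \<star> b \<star> dif (cx X) \<star> ?u"
    have R: "gm R" "gsrc R = ?V" "gtgt R = gpow ?W ?k" "gdeg R = -1" using b t d G by (simp_all add: R_def)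
    have row: "row X Y \<mu> ?k = gsgn (int n) (t \<star> b \<star> ?u)"
      by (simp add: row_def t_def b_def)
    have F1: "?F 1 ?k \<star> cobar X 1 1 = gsgn (int n + 1) R"
      unfolding Phi_1 row using cobar_1[OF X, of 1] b t d G by (simp add: cobar_row_def R_def add.commute)
    have G1: "cobar Y ?k ?k \<star> ?F 1 ?k = gsgn 1 (t \<star> ?D \<star> b \<star> ?u)"
    proof -
      have "cobar Y ?k ?k \<star> ?F 1 ?k = gsgn (int n) ((cobar Y ?k ?k \<star> t) \<star> b \<star> ?u)"
        unfolding Phi_1 row using tY(1-4)[of ?k ?k] b t G by (simp del: gpow_Suc)
      also have "cobar Y ?k ?k \<star> t = gsgn (int ?k) (t \<star> ?D)"
        unfolding t_def by (rule cobar_diag[OF Y]) simp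
      also have "gsgn (int n) (gsgn (int ?k) (t \<star> ?D) \<star> b \<star> ?u) = gsgn (int n + int ?k) (t \<star> ?D \<star> b \<star> ?u)"
        using D b t G by (simp del: gpow_Suc cpow.simps)
      also have "\<dots> = gsgn 1 (t \<star> ?D \<star> b \<star> ?u)" by (rule gsgn_cong) simp
      finally show ?thesis .
    qed
    have L: "pro_comp ?F (cobar X) 1 ?k = gadd (?F 1 ?k \<star> cobar X 1 1) (?F 2 ?k \<star> cobar X 1 2)"
    proof -
      have "pro_comp ?F (cobar X) 1 ?k = gsum ?V (gpow ?W ?k) (-1) (\<lambda>l. ?F l ?k \<star> cobar X 1 l) {1..?k + 1}"
        using pro_comp_eq[OF cobar_tmat[OF X] ahomD(1)[OF ah], of 1 ?k "?k + 1"] by simp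
      also have "\<dots> = gadd (?F 1 ?k \<star> cobar X 1 1) (?F 2 ?k \<star> cobar X 1 2)"
      proof (rule gsum_two)
        fix l assume "l \<in> {1..?k + 1}" "l \<noteq> 1" "l \<noteq> 2"
        then have l: "l > 1 + 1" "l > 0" by auto
        show "?F l ?k \<star> cobar X 1 l = gzero ?V (gpow ?W ?k) (-1)"
          using cobar_zero[OF X _ l(1)] tF(1-4)[OF l(2), of ?k] g by simp
      qed (use tF(1-4)[of 1 ?k] tF(1-4)[of 2 ?k] tX(1-4)[of 1 1] tX(1-4)[of 1 2] g in auto)
      finally show ?thesis .
    qed
    show ?thesis
    \<comment> \<open>For n = 0 the cube is a point and only the linear terms remain.\<close>
    proof (cases "n = 0")
      case True
      have "?F 2 ?k \<star> cobar X 1 2 = gzero ?V (gpow ?W ?k) (-1)"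
        using tF(5)[of 2 ?k] tX(1-4)[of 1 2] g True by simp
      then have "pro_comp ?F (cobar X) 1 ?k = gsgn 1 R"
        unfolding L F1 using R True by simp
      moreover have "pro_comp (cobar Y) ?F 1 ?k = cobar Y ?k ?k \<star> ?F 1 ?k"
        using pro_comp_eq[OF ahomD(1)[OF ah] cobar_tmat[OF Y], of 1 ?k ?k] tF(1-4)[of 1 1] tY(1-4)[of 1 1] g True by simp
      moreover have "?D \<star> b = b \<star> dif (cx X)"
        using Bsum_boundary_0[OF X Y \<mu>] True by (simp add: b_def)
      then have "t \<star> (?D \<star> b) \<star> ?u = R" unfolding R_def using b d t G by simp
      then have "t \<star> ?D \<star> b \<star> ?u = R" using b D t G by (simp del: gpow_Suc cpow.simps)
      ultimately show ?thesis unfolding G1 by simp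
    next
      case False
      define b2 e where "b2 = Bsum X Y \<mu> 2 (n - 1)" and "e = Bsum X Y \<mu> 1 (n - 1)"
      have n: "n > 0" "2 + (n - 1) = ?k" "1 + (n - 1) = n" "n + 1 = ?k" "int (n - 1) = int n - 1" using False by auto
      have b2: "gm b2" "gsrc b2 = gpow ?A 2" "gtgt b2 = gpow ?B ?k" "gdeg b2 = int n - 1"
        using ty[of 2 "n - 1"] unfolding n(2) n(5) b2_def by simp_all
      have e: "gm e" "gsrc e = ?A" "gtgt e = gpow ?B n" "gdeg e = int n - 1"
        using ty[of 1 "n - 1"] unfolding n(3) n(5) e_def by simp_all
      note E = Eface_typing[OF cY(1), of n, unfolded n(4)]
      have ic: "gm (icmul X 2)" "gsrc (icmul X 2) = ?A" "gtgt (icmul X 2) = gpow ?A 2" "gdeg (icmul X 2) = 0"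
        using icmul_typing[OF cX(1), of 2] by auto
      \<comment> \<open>The terms of the boundary formula after desuspension: P comes from the
        comultiplication of X, Q from that of Y, and R from the differential of X. Composing with
        \<open>cobar Y\<close> produces Q twice with opposite signs; what remains, P and a signed R,
        is the composite with \<open>cobar X\<close>.\<close>
      define P Q where "P = t \<star> b2 \<star> icmul X 2 \<star> ?u" and "Q = t \<star> Eface Y n \<star> e \<star> ?u"
      have P: "gm P" "gsrc P = ?V" "gtgt P = gpow ?W ?k" "gdeg P = -1" using b2 t ic G by (simp_all add: P_def del: icmul.simps gpow_Suc)
      have Q: "gm Q" "gsrc Q = ?V" "gtgt Q = gpow ?W ?k" "gdeg Q = -1" using e t E G by (simp_all add: Q_def del: gpow_Suc)
      have F2: "?F 2 ?k \<star> cobar X 1 2 = P"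
      proof -
        have c2: "cobar X 1 2 = mpow (sdown ?A) 2 \<star> icmul X 2 \<star> ?u"
          using cobar_1[OF X, of 2] cX G by (simp add: cobar_row_def numeral_2_eq_2)
        have "?F 2 ?k \<star> cobar X 1 2 = (?F 2 ?k \<star> mpow (sdown ?A) 2) \<star> icmul X 2 \<star> ?u"
          unfolding c2 using tF(1-4)[of 2 ?k] ic G by (simp del: icmul.simps gpow_Suc)
        also have "?F 2 ?k \<star> mpow (sdown ?A) 2 = t \<star> b2"
          using Phi_sdown[OF G, of 2 "n - 1"] unfolding n(2) t_def b2_def by simp
        finally show ?thesis unfolding P_def using t b2 ic G by (simp del: icmul.simps gpow_Suc)
      qed
      have G2: "cobar Y n ?k \<star> ?F 1 n = gsgn (int n) Q"
      proof -
        have "?F 1 n = gsgn (int n - 1) (mpow (sdown ?B) n \<star> e \<star> ?u)"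
          using Phi_1[of X Y \<mu> "n - 1"] unfolding n(3) row_def e_def n(5)[symmetric] by simp
        then have "cobar Y n ?k \<star> ?F 1 n = gsgn (int n - 1) ((cobar Y n ?k \<star> mpow (sdown ?B) n) \<star> e \<star> ?u)"
          using tY(1-4)[of n ?k] n(1) e G by (simp del: gpow_Suc)
        also have "cobar Y n ?k \<star> mpow (sdown ?B) n = gsgn 1 (t \<star> Eface Y n)"
          using cobar_upper[OF Y n(1)] unfolding n(4) t_def .
        also have "gsgn (int n - 1) (gsgn 1 (t \<star> Eface Y n) \<star> e \<star> ?u) = gsgn (int n) Q"
          unfolding Q_def using e t E G by (simp del: gpow_Suc)
        finally show ?thesis .
      qed
      have "t \<star> ?D \<star> b \<star> ?u = t \<star> (?D \<star> b) \<star> ?u" using b D t G by (simp del: gpow_Suc cpow.simps)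
      also have "?D \<star> b = gadd (gadd (gsgn 1 (b2 \<star> icmul X 2)) (gsgn (int n) (Eface Y n \<star> e))) (gsgn (int n) (b \<star> dif (cx X)))"
        unfolding b_def b2_def e_def by (rule Bsum_boundary[OF X Y \<mu> n(1)])
      also have "t \<star> gadd (gadd (gsgn 1 (b2 \<star> icmul X 2)) (gsgn (int n) (Eface Y n \<star> e))) (gsgn (int n) (b \<star> dif (cx X))) \<star> ?u
        = gadd (gadd (gsgn 1 P) (gsgn (int n) Q)) (gsgn (int n) R)"
        unfolding P_def Q_def R_def using b b2 e t d E ic G by (simp add: gcomp_gadd del: icmul.simps gpow_Suc)
      finally have G1': "cobar Y ?k ?k \<star> ?F 1 ?k = gadd (gadd P (gsgn (int n + 1) Q)) (gsgn (int n + 1) R)"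
        unfolding G1 using P Q R by (simp add: gsgn_gadd add.commute del: gpow_Suc)
      have "pro_comp (cobar Y) ?F 1 ?k = gadd (cobar Y n ?k \<star> ?F 1 n) (cobar Y ?k ?k \<star> ?F 1 ?k)"
      proof -
        have "pro_comp (cobar Y) ?F 1 ?k = gsum ?V (gpow ?W ?k) (-1) (\<lambda>l. cobar Y l ?k \<star> ?F 1 l) {1..?k}"
          using pro_comp_eq[OF ahomD(1)[OF ah] cobar_tmat[OF Y], of 1 ?k ?k] by simp
        also have "\<dots> = gadd (cobar Y n ?k \<star> ?F 1 n) (cobar Y ?k ?k \<star> ?F 1 ?k)"
        proof (rule gsum_two)
          fix l assume "l \<in> {1..?k}" "l \<noteq> n" "l \<noteq> ?k"
          then have l: "l > 0" "?k > l + 1" by auto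
          show "cobar Y l ?k \<star> ?F 1 l = gzero ?V (gpow ?W ?k) (-1)"
            unfolding cobar_zero[OF Y l] using tF(1-4)[of 1 l] l(1) g by simp
        qed (use tF(1-4)[of 1 ?k] tF(1-4)[of 1 n] tY(1-4)[of n ?k] tY(1-4)[of ?k ?k] n(1) g in \<open>auto simp del: gpow_Suc\<close>)
        finally show ?thesis .
      qed
      also have "\<dots> = gadd (gadd (gsgn (int n) Q) (gsgn (int n + 1) Q)) (gadd P (gsgn (int n + 1) R))"
        unfolding G1' G2 using P Q R gadd_commute[of P "gsgn (int n + 1) Q"]
        by (simp add: gadd_assoc del: gpow_Suc)
      also have "gadd (gsgn (int n) Q) (gsgn (int n + 1) Q) = gzero ?V (gpow ?W ?k) (-1)"
        using gadd_gsgn_cancel[of Q "int n" "int n + 1"] Q by (simp del: gpow_Suc)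
      also have "gadd (gzero ?V (gpow ?W ?k) (-1)) (gadd P (gsgn (int n + 1) R)) = gadd P (gsgn (int n + 1) R)"
        using P R by (simp del: gpow_Suc)
      also have "\<dots> = gadd (gsgn (int n + 1) R) P"
        using P R by (intro gadd_commute) auto
      finally show ?thesis unfolding L F1 F2 by simp
    qed
  qed
  have "pro_comp ?F (cobar X) = pro_comp (cobar Y) ?F"
    unfolding cobar_derivation
  proof (rule derivation_intertwine[OF g ah cobar_row_typing[OF X] cobar_row_typing[OF Y]])
    fix k :: nat assume "k > 0"
    then obtain n where "k = 1 + n" using less_iff_Suc_add by auto
    then show "pro_comp ?F (derivation ?V (cobar_row X)) 1 k = pro_comp (derivation ?W (cobar_row Y)) ?F 1 k"
      using first[of n] by (simp only: cobar_derivation)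
  qed
  then show ?thesis using ahom_algebra_hom[OF ah] by (simp add: Ainf_hom_def)
qed

section \<open>Strict morphisms and naturality\<close>

lemma Ainf_of_hom_ahom:
  assumes f: "gm f" "gdeg f = 0"
  shows "ahom (desusp (gsrc f)) (desusp (gtgt f)) (Ainf_of_hom f)"
proof -
  let ?V = "desusp (gsrc f)" and ?W = "desusp (gtgt f)"
  define h where "h = sdown (gtgt f) \<star> f \<star> slift (gsrc f)"
  have h: "gm h" "gsrc h = ?V" "gtgt h = ?W" "gdeg h = 0" using f by (simp_all add: h_def)
  have g: "graded_object ?V" "graded_object ?W" using f by simp_all
  define M where "M = (\<lambda>j k. if j = k then mpow h k else gzero (gpow ?V j) (gpow ?W k) 0)"
  have A: "Ainf_of_hom f = mk_matrix M" unfolding Ainf_of_hom_def M_def h_def ..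
  have t: "gmor (M j k) (gpow ?V j) (gpow ?W k) 0" if "j > 0" "k > 0" for j k
    using that h g by (simp add: M_def)
  have M: "Ainf_of_hom f j k = M j k" if "j > 0" "k > 0" for j k using that by (simp add: A mk_matrix_def)
  show ?thesis
    unfolding ahom_def
  proof (intro conjI allI impI)
    show "Ainf_of_hom f = mk_matrix (Ainf_of_hom f)" by (auto simp: A mk_matrix_def fun_eq_iff)
    show "tmat ?V ?W 0 (Ainf_of_hom f)"
      unfolding tmat_def using M t by (auto simp: M_def)
    fix j j' k :: nat assume j: "j > 0" "j' > 0" "k > 0"
    let ?G = "\<lambda>l. can ?W l (k - l) \<star> (Ainf_of_hom f j l \<odot> Ainf_of_hom f j' (k - l))"
    have z: "?G l = gzero (gpow ?V j \<odot>\<^sub>o gpow ?V j') (gpow ?W k) 0" if "l \<in> {1..<k}" "l \<noteq> j \<or> k - l \<noteq> j'" for l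
      using that j h g by (auto simp: M M_def)
    show "Ainf_of_hom f (j + j') k \<star> can ?V j j' = gsum (gpow ?V j \<odot>\<^sub>o gpow ?V j') (gpow ?W k) 0 ?G {1..<k}"
    proof (cases "k = j + j'")
      case True
      have "gsum (gpow ?V j \<odot>\<^sub>o gpow ?V j') (gpow ?W k) 0 ?G {1..<k} = ?G j"
        using True j z h g by (subst gsum_delta[where j = j]) (auto simp: M M_def)
      then show ?thesis using True j h g can_mpow[of h j j'] by (simp add: M M_def)
    next
      case False
      have "gsum (gpow ?V j \<odot>\<^sub>o gpow ?V j') (gpow ?W k) 0 ?G {1..<k} = gzero (gpow ?V j \<odot>\<^sub>o gpow ?V j') (gpow ?W k) 0"
      proof (rule gsum_neutral)
        fix l assume l: "l \<in> {1..<k}"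
        then have "l \<noteq> j \<or> k - l \<noteq> j'" using False by auto
        then show "?G l = gzero (gpow ?V j \<odot>\<^sub>o gpow ?V j') (gpow ?W k) 0" by (rule z[OF l])
      qed (use g in auto)
      then show ?thesis using False j h g by (simp add: M M_def)
    qed
  qed
qed

lemma Ainf_of_hom_entry:
  "j > 0 \<Longrightarrow> k > 0 \<Longrightarrow> Ainf_of_hom f j k = (if j = k then mpow (sdown (gtgt f) \<star> f \<star> slift (gsrc f)) k
     else gzero (gpow (desusp (gsrc f)) j) (gpow (desusp (gtgt f)) k) 0)"
  by (simp add: Ainf_of_hom_def mk_matrix_def)

text \<open>A degenerate simplex vanishes on the nondegenerate n-simplex for n > 0, so only the
  point n = 0 contributes to the first row.\<close>

lemma Phi_coh_of_hom:
  assumes X: "dg_coalgebra X" and Y: "dg_coalgebra Y" and f: "f \<in> coalgebra_hom X Y"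
  shows "Phi X Y (coh_of_hom X Y f) = Ainf_of_hom f"
proof -
  let ?A = "gr (cx X)" and ?B = "gr (cx Y)" and ?\<mu> = "coh_of_hom X Y f"
  note co = coh_of_hom_Coh[OF assms] and F = coalgebra_homD[OF assms]
  note G = Coh_sfam[OF X Y co(1)] and cX = dg_coalgebraD(1)[OF X]
  show ?thesis
  proof (rule ahom_eqI)
    show "ahom (desusp ?A) (desusp ?B) (Phi X Y ?\<mu>)" by (rule Phi_ahom[OF G])
    show "ahom (desusp ?A) (desusp ?B) (Ainf_of_hom f)" using Ainf_of_hom_ahom[of f] F by simp
    fix k :: nat assume "k > 0"
    then obtain n where k: "k = 1 + n" using less_iff_Suc_add by auto
    have top: "ctop X ?\<mu> n w = (if n = 0 then f else gzero ?A (gpow ?B (1 + n)) (int n))" if w: "w \<in> words 1 n" for w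
    proof -
      have "ctop X ?\<mu> n w = sdegen n (mpow f (1 + n) \<star> icmul X (1 + n)) \<star> sinc n ?A {0..n}"
        unfolding ctop_def[OF X Y co(1)] stop_def using co(2)[OF wchain_nerve[OF w]] by simp
      also have "\<dots> = (if n = 0 then f else gzero ?A (gpow ?B (1 + n)) (int n))"
        using F cX icmul_typing[OF cX, of "1 + n"] by (simp add: sdegen_sinc del: gpow_Suc)
      finally show ?thesis .
    qed
    have "Bsum X Y ?\<mu> 1 n = (if n = 0 then f else gzero ?A (gpow ?B (1 + n)) (int n))"
    proof (cases "n = 0")
      case True
      show ?thesis unfolding Bsum_ctop[OF X Y co(1)] using top[of "[]"] F G True by simp
    next
      case False
      show ?thesis unfolding Bsum_ctop[OF X Y co(1)] using top G False by (auto intro!: gsum_neutral)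
    qed
    then show "Phi X Y ?\<mu> 1 k = Ainf_of_hom f 1 k"
      unfolding k Phi_1 using F G by (simp add: row_def Ainf_of_hom_entry)
  qed
qed

text \<open>Composing with diagonal matrices leaves a single term in the first row. Having degree 0,
  the maps p and q pass through the signed sums and past the powers of \<open>sdown\<close> without
  signs.\<close>

lemma Phi_coh_map:
  assumes X': "dg_coalgebra X'" and X: "dg_coalgebra X" and Y: "dg_coalgebra Y" and Y': "dg_coalgebra Y'"
    and p: "p \<in> coalgebra_hom X' X" and q: "q \<in> coalgebra_hom Y Y'" and \<mu>: "\<mu> \<in> Coh X Y"
  shows "Phi X' Y' (coh_map p q \<mu>) = pro_comp (Ainf_of_hom q) (pro_comp (Phi X Y \<mu>) (Ainf_of_hom p))"
proof -
  let ?A' = "gr (cx X')" and ?A = "gr (cx X)" and ?B = "gr (cx Y)" and ?B' = "gr (cx Y')" and ?\<mu> = "coh_map p q \<mu>"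
  note co = coh_map_Coh[OF assms] and P = coalgebra_homD[OF X' X p] and Q = coalgebra_homD[OF Y Y' q]
  note G' = Coh_sfam[OF X' Y' co(1)] and G = Coh_sfam[OF X Y \<mu>]
  note aP = Ainf_of_hom_ahom[OF P(2,5), unfolded P(3,4)] and aQ = Ainf_of_hom_ahom[OF Q(2,5), unfolded Q(3,4)] and aF = Phi_ahom[OF G]
  note aFP = ahom_pro_comp[OF aP aF]
  show ?thesis
  proof (rule ahom_eqI)
    show "ahom (desusp ?A') (desusp ?B') (Phi X' Y' ?\<mu>)" by (rule Phi_ahom[OF G'])
    show "ahom (desusp ?A') (desusp ?B') (pro_comp (Ainf_of_hom q) (pro_comp (Phi X Y \<mu>) (Ainf_of_hom p)))"
      by (rule ahom_pro_comp[OF aFP aQ])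
    fix k :: nat assume k0: "k > 0"
    then obtain n where k: "k = 1 + n" using less_iff_Suc_add by auto
    let ?h = "sdown ?B' \<star> q \<star> slift ?B" and ?l = "sdown ?A \<star> p \<star> slift ?A'"
    have h: "gm ?h" "gsrc ?h = desusp ?B" "gtgt ?h = desusp ?B'" "gdeg ?h = 0" using Q G G' by simp_all
    have l: "gm ?l" "gsrc ?l = desusp ?A'" "gtgt ?l = desusp ?A" "gdeg ?l = 0" using P G G' by simp_all
    note tF = tmatD[OF ahomD(1)[OF aF] zero_less_one]
    note tFP = tmatD[OF ahomD(1)[OF aFP] zero_less_one]
    have g: "graded_object (desusp ?A')" "graded_object (desusp ?A)" "graded_object (desusp ?B)" "graded_object (desusp ?B')" using G G' by auto
    have FP: "pro_comp (Phi X Y \<mu>) (Ainf_of_hom p) 1 k = Phi X Y \<mu> 1 k \<star> ?l"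
    proof -
      have "pro_comp (Phi X Y \<mu>) (Ainf_of_hom p) 1 k = gsum (desusp ?A') (gpow (desusp ?B) k) 0 (\<lambda>j. Phi X Y \<mu> j k \<star> Ainf_of_hom p 1 j) {1..k}"
        using pro_comp_eq[OF ahomD(1)[OF aP] ahomD(1)[OF aF], of 1 k k] k0 by simp
      also have "\<dots> = Phi X Y \<mu> 1 k \<star> Ainf_of_hom p 1 1"
      proof (subst gsum_delta[where j = 1])
        fix j assume "j \<in> {1..k}" "j \<noteq> 1"
        then show "Phi X Y \<mu> j k \<star> Ainf_of_hom p 1 j = gzero (desusp ?A') (gpow (desusp ?B) k) 0"
          using tmatD(1-4)[OF ahomD(1)[OF aF], of j k] k0 g P by (simp add: Ainf_of_hom_entry)
      qed (use tF(1-4)[OF k0] l k0 g P in \<open>auto simp: Ainf_of_hom_entry\<close>)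
      finally show ?thesis using P by (simp add: Ainf_of_hom_entry)
    qed
    have "pro_comp (Ainf_of_hom q) (pro_comp (Phi X Y \<mu>) (Ainf_of_hom p)) 1 k
      = gsum (desusp ?A') (gpow (desusp ?B') k) 0 (\<lambda>j. Ainf_of_hom q j k \<star> pro_comp (Phi X Y \<mu>) (Ainf_of_hom p) 1 j) {1..k}"
      using pro_comp_eq[OF ahomD(1)[OF aFP] ahomD(1)[OF aQ], of 1 k k] k0 by simp
    also have "\<dots> = Ainf_of_hom q k k \<star> pro_comp (Phi X Y \<mu>) (Ainf_of_hom p) 1 k"
    proof (subst gsum_delta[where j = k])
      fix j assume "j \<in> {1..k}" "j \<noteq> k"
      then show "Ainf_of_hom q j k \<star> pro_comp (Phi X Y \<mu>) (Ainf_of_hom p) 1 j = gzero (desusp ?A') (gpow (desusp ?B') k) 0"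
        using tFP(1-4)[of j] k0 g Q by (simp add: Ainf_of_hom_entry)
    qed (use tFP(1-4)[OF k0] h k0 g Q in \<open>auto simp: Ainf_of_hom_entry\<close>)
    also have "\<dots> = mpow ?h k \<star> Phi X Y \<mu> 1 k \<star> ?l"
      unfolding FP using Q k0 by (simp add: Ainf_of_hom_entry)
    finally have R: "pro_comp (Ainf_of_hom q) (pro_comp (Phi X Y \<mu>) (Ainf_of_hom p)) 1 k = mpow ?h k \<star> Phi X Y \<mu> 1 k \<star> ?l" .
    define b t t' where "b = Bsum X Y \<mu> 1 n" and "t = mpow (sdown ?B) k" and "t' = mpow (sdown ?B') k"
    have b: "gm b" "gsrc b = ?A" "gtgt b = gpow ?B k" "gdeg b = int n" using Bsum_typing[OF G, of 1 n] by (simp_all add: b_def k)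
    have t: "gm t" "gsrc t = gpow ?B k" "gtgt t = gpow (desusp ?B) k" "gm t'" "gsrc t' = gpow ?B' k" "gtgt t' = gpow (desusp ?B') k"
      using G G' by (simp_all add: t_def t'_def)
    have "Bsum X' Y' ?\<mu> 1 n = gsum ?A' (gpow ?B' k) (int n) (\<lambda>w. gsgn (int (sum_list w)) (mpow q k \<star> ctop X \<mu> n w \<star> p)) (words 1 n)"
      unfolding Bsum_ctop[OF X' Y' co(1)] k
    proof (rule gsum_cong)
      fix w assume w: "w \<in> words 1 n"
      have "ctop X' ?\<mu> n w = mpow q (1 + n) \<star> ctop X \<mu> n w \<star> p"
        unfolding ctop_def[OF X' Y' co(1)] ctop_def[OF X Y \<mu>] stop_def co(2)[OF wchain_nerve[OF w zero_less_one]]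
        using mu_typing[OF X Y \<mu> w] P Q G G' by (simp add: smap_sinc del: gpow_Suc)
      then show "gsgn (int (sum_list w)) (ctop X' ?\<mu> n w) = gsgn (int (sum_list w)) (mpow q (1 + n) \<star> ctop X \<mu> n w \<star> p)" by simp
    qed (use ctop_typing[OF X Y \<mu>] P Q G' in \<open>auto simp del: gpow_Suc\<close>)
    also have "\<dots> = gsum ?A' (gpow ?B' k) (int n) (\<lambda>w. mpow q k \<star> gsgn (int (sum_list w)) (ctop X \<mu> n w) \<star> p) (words 1 n)"
      unfolding k by (rule gsum_cong) (use ctop_typing[OF X Y \<mu>] P Q G' in \<open>auto simp del: gpow_Suc\<close>)
    also have "\<dots> = mpow q k \<star> b \<star> p"
      unfolding b_def Bsum_ctop[OF X Y \<mu>] k using ctop_typing[OF X Y \<mu>] P Q G G' by (simp add: gcomp_gsum_left gcomp_gsum_right del: gpow_Suc)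
    finally have B: "Bsum X' Y' ?\<mu> 1 n = mpow q k \<star> b \<star> p" .
    have nat: "mpow ?h k \<star> t = t' \<star> mpow q k"
    proof -
      have "mpow ?h k \<star> t = mpow (?h \<star> sdown ?B) k" unfolding t_def using h G by (intro mpow_gcomp_left) auto
      also have "?h \<star> sdown ?B = sdown ?B' \<star> q" using Q G G' by simp
      also have "mpow (sdown ?B' \<star> q) k = t' \<star> mpow q k" unfolding t'_def using Q G' by (intro mpow_gcomp[symmetric]) auto
      finally show ?thesis .
    qed
    have "mpow ?h k \<star> Phi X Y \<mu> 1 k \<star> ?l = gsgn (int n) ((mpow ?h k \<star> t) \<star> b \<star> p \<star> slift ?A')"
    proof -
      have F: "Phi X Y \<mu> 1 k = gsgn (int n) (t \<star> b \<star> slift ?A)" unfolding k Phi_1 by (simp add: row_def b_def t_def k)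
      have hk: "gm (mpow ?h k)" "gsrc (mpow ?h k) = gpow (desusp ?B) k" using h by simp_all
      show ?thesis unfolding F using hk b t P G G' by (simp del: mpow_typing)
    qed
    also have "\<dots> = gsgn (int n) (t' \<star> (mpow q k \<star> b \<star> p) \<star> slift ?A')"
      unfolding nat using b t P Q G G' by simp
    also have "\<dots> = Phi X' Y' ?\<mu> 1 k"
      unfolding B[symmetric] unfolding k Phi_1 by (simp add: row_def t'_def k)
    finally show "Phi X' Y' ?\<mu> 1 k = pro_comp (Ainf_of_hom q) (pro_comp (Phi X Y \<mu>) (Ainf_of_hom p)) 1 k" unfolding R by simp
  qed
qed

end

section \<open>Composition\<close>

lemma chain_front_back:
  assumes "c \<in> nerve j k n" "i \<le> n"
  shows "cfront i c \<in> nerve j (atrg (c ! i)) i" "cback i c \<in> nerve (atrg (c ! i)) k (n - i)"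
proof -
  let ?t = "take (i + 1) c" and ?d = "drop (i + 1) c"
  have c: "cpath j (?t @ ?d)" "pend j (?t @ ?d) = k" "length c = n + 2" using assms by (auto simp: nerve_iff)
  then have cp: "cpath j ?t" "cpath (pend j ?t) ?d" "pend (pend j ?t) ?d = k" by (simp_all del: append_take_drop_id)
  have t: "pend j ?t = atrg (c ! i)"
    using pend_last[of ?t j] cp(1) c(3) assms(2) by (simp add: take_Suc_conv_app_nth)
  have "atrg (c ! i) > 0" using cpath_pend_pos[OF cp(1)] t by simp
  with cp t c(3) assms(2) show "cfront i c \<in> nerve j (atrg (c ! i)) i" "cback i c \<in> nerve (atrg (c ! i)) k (n - i)"
    by (auto simp: nerve_iff cfront_def cback_def)
qed

lemma nop_aid:
  assumes "c \<in> nerve j k n"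
  shows "nop [0..<n + 1] c = c"
proof -
  have c: "cpath j c" "length c = n + 2" using assms by (auto simp: nerve_iff)
  then obtain \<alpha> as where "c = \<alpha> # as" by (cases c) auto
  then show ?thesis using nop_back[OF assms, of 0] c by (simp add: acomp_aid)
qed

text \<open>The identities inserted by \<open>cfront\<close> and \<open>cback\<close> are precisely
  the padding of \<open>wchain\<close>, so both parts are word chains again.\<close>

lemma wchain_front_back:
  assumes "u @ v \<in> words m n" "length u = i" "m > 0"
  shows "wchain m (u @ v) ! i = last (aid m # wsteps m u)" "atrg (wchain m (u @ v) ! i) = m + i"
    "cfront i (wchain m (u @ v)) = wchain m u" "cback i (wchain m (u @ v)) = wchain (m + i) v"
proof -
  have w: "wd m u" "length u + length v = n" using assms by (auto simp: words_def)
  have e: "wchain m (u @ v) = (aid m # wsteps m u) @ wsteps (m + i) v @ [aid (m + n)]"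
    using w assms(2) by (auto simp: wchain_def)
  have l: "length (aid m # wsteps m u) = i + 1" using assms by simp
  show 1: "wchain m (u @ v) ! i = last (aid m # wsteps m u)"
    unfolding e nth_append last_conv_nth[OF list.distinct(2)] l by simp
  have "pend m (aid m # wsteps m u) = m + i" using wsteps_cpath[OF w(1) assms(3)] assms by simp
  then show 2: "atrg (wchain m (u @ v) ! i) = m + i"
    unfolding 1 using pend_last[of "aid m # wsteps m u" m] wsteps_cpath[OF w(1) assms(3)] assms(3) by simp
  show "cfront i (wchain m (u @ v)) = wchain m u"
    unfolding cfront_def 2 unfolding e using l assms(2) by (simp add: wchain_def)
  show "cback i (wchain m (u @ v)) = wchain (m + i) v"
    unfolding cback_def 2 unfolding e using l assms(2) w by (simp add: wchain_def add.assoc)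
qed

lemma words_append: "i \<le> n \<Longrightarrow> bij_betw (\<lambda>(u, v). u @ v) (words m i \<times> words (m + i) (n - i)) (words m n)"
proof (rule bij_betw_byWitness[where f' = "\<lambda>w. (take i w, drop i w)"])
  assume i: "i \<le> n"
  show "(\<lambda>w. (take i w, drop i w)) ` words m n \<subseteq> words m i \<times> words (m + i) (n - i)"
  proof (rule image_subsetI)
    fix w assume "w \<in> words m n"
    then have "wd m (take i w @ drop i w)" "length w = n" by (auto simp: words_def)
    with i show "(take i w, drop i w) \<in> words m i \<times> words (m + i) (n - i)"
      by (simp only: wd_append) (auto simp: words_def)
  qed
qed (auto simp: words_def)

context abelian_tensor_category
begin

context
  fixes X Y Z :: "('a, 'b) coalgebra" and f g :: "('a, 'b) family"
  assumes gr: "graded_object (gr (cx X))" "graded_object (gr (cx Y))" "graded_object (gr (cx Z))"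
    and f: "sfam (gr (cx X)) (gr (cx Y)) f" and g: "sfam (gr (cx Y)) (gr (cx Z)) g"
begin

lemma coh_comp_top_term:
  assumes "c \<in> nerve 1 k n" "i \<le> n"
  defines "T \<equiv> stop (n - i) (gpow (gr (cx Y)) (atrg (c ! i))) (fext Y Z g (cback i c)) \<star> stop i (gr (cx X)) (f (atrg (c ! i)) (cfront i c))"
  shows "gm T" "gsrc T = gr (cx X)" "gtgt T = gpow (gr (cx Z)) k" "gdeg T = int n"
  using chain_front_back[OF assms(1,2)] fext_typing[OF gr(2,3) g] sfam_typing[OF f] gr assms(2)
  by (auto simp: T_def stop_def)

lemma coh_comp_top_typing:
  assumes "c \<in> nerve 1 k n"
  shows "gm (coh_comp_top X Y Z g f c)" "gsrc (coh_comp_top X Y Z g f c) = gr (cx X)"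
    "gtgt (coh_comp_top X Y Z g f c) = gpow (gr (cx Z)) k" "gdeg (coh_comp_top X Y Z g f c) = int n"
  using coh_comp_top_term[OF assms] gr nerve_cdim[OF assms] nerve_cend[OF assms]
  by (auto simp: coh_comp_top_def Let_def intro!: gsum_gm)

text \<open>\<open>coh_comp\<close> is glued from values on all faces; at the top simplex the face
  operator is the identity (\<open>nop_aid\<close>) and the value in the normalized complex is
  recovered.\<close>

lemma coh_comp_stop:
  assumes c: "c \<in> nerve 1 k n"
  shows "stop n (gr (cx X)) (fext X Z (coh_comp X Y Z g f) c) = coh_comp_top X Y Z g f c"
proof -
  let ?\<psi> = "\<lambda>\<sigma>. coh_comp_top X Y Z g f (nop (sorted_list_of_set \<sigma>) c)"
  have "\<forall>\<sigma>\<in>splx n. gmor (?\<psi> \<sigma>) (gr (cx X)) (gpow (gr (cx Z)) k) (sdim \<sigma>)"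
  proof
    fix \<sigma> assume \<sigma>: "\<sigma> \<in> splx n"
    then have "card \<sigma> > 0" by (simp add: card_gt_0_iff splx_nonempty)
    moreover have "\<sigma> \<subseteq> {0..n}" using \<sigma> by (simp add: splx_def)
    ultimately have "sorted_list_of_set \<sigma> \<in> mono_maps (card \<sigma> - 1) n" "int (card \<sigma> - 1) = sdim \<sigma>"
      using \<sigma> by (auto simp: mono_maps_def sdim_def)
    then show "gmor (?\<psi> \<sigma>) (gr (cx X)) (gpow (gr (cx Z)) k) (sdim \<sigma>)"
      using coh_comp_top_typing[OF nop_nerve(1)[OF c]] by metis
  qed
  then have "sglue n (gr (cx X)) (gpow (gr (cx Z)) k) ?\<psi> \<star> sinc n (gr (cx X)) {0..n} = ?\<psi> {0..n}"
    using gr by (intro sglue_sinc) auto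
  moreover have "sorted_list_of_set {0..n} = [0..<n + 1]"
    by (metis atLeast_upt atLeast0AtMost atLeast0LessThan lessThan_Suc_atMost sorted_list_of_set_lessThan_Suc sorted_list_of_set_range Suc_eq_plus1)
  moreover have "fext X Z (coh_comp X Y Z g f) c = coh_comp X Y Z g f k c"
    using blocks_single[OF c] nerve_cend[OF c] by (simp add: fext_def)
  ultimately show ?thesis
    using nop_aid[OF c] mk_family_nerve[OF c] nerve_cdim[OF c] by (simp add: stop_def coh_comp_def)
qed

text \<open>Splitting a word leaves its letters unchanged, so the sign of a word is the product of
  the signs of its two parts, and only the sign of the composition rule is left over.\<close>

lemma Bsum_coh_comp:
  "Bsum X Z (coh_comp X Y Z g f) 1 n = gsum (gr (cx X)) (gpow (gr (cx Z)) (1 + n)) (int n)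
     (\<lambda>i. gsgn (int (i * (n - i))) (Bsum Y Z g (1 + i) (n - i) \<star> Bsum X Y f 1 i)) {0..n}"
proof -
  let ?A = "gr (cx X)" and ?T = "gpow (gr (cx Z)) (1 + n)"
  define p where "p = (\<lambda>i u. gsgn (int (sum_list u)) (stop i ?A (fext X Y f (wchain 1 u))))"
  define q where "q = (\<lambda>i v. gsgn (int (sum_list v)) (stop (n - i) (gpow (gr (cx Y)) (1 + i)) (fext Y Z g (wchain (1 + i) v))))"
  have p: "gmor (p i u) ?A (gpow (gr (cx Y)) (1 + i)) (int i)" if "u \<in> words 1 i" for i u
    using top_typing[OF gr(1,2) f that] by (simp add: p_def)
  have q: "gmor (q i v) (gpow (gr (cx Y)) (1 + i)) ?T (int (n - i))"
    if "v \<in> words (1 + i) (n - i)" "i \<le> n" for i v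
    using top_typing[OF gr(2,3) g that(1)] that(2) by (simp add: q_def)
  define T where "T = (\<lambda>i c. gsgn (int (i * (n - i))) (stop (n - i) (gpow (gr (cx Y)) (atrg (c ! i))) (fext Y Z g (cback i c)) \<star>
      stop i ?A (f (atrg (c ! i)) (cfront i c))))"
  have T: "gmor (T i (wchain 1 w)) ?A ?T (int n)"
    if "w \<in> words 1 n" "i \<in> {0..n}" for i w
    using coh_comp_top_term[OF wchain_nerve[OF that(1)], of i] that(2) by (simp add: T_def)
  have "Bsum X Z (coh_comp X Y Z g f) 1 n
    = gsum ?A ?T (int n) (\<lambda>w. gsum ?A ?T (int n) (\<lambda>i. gsgn (int (sum_list w)) (T i (wchain 1 w))) {0..n}) (words 1 n)"
    unfolding Bsum_def gpow.simps(2)[folded One_nat_def]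
  proof (rule gsum_cong)
    fix w assume w: "w \<in> words 1 n"
    have c: "wchain 1 w \<in> nerve 1 (1 + n) n" using wchain_nerve[OF w] by simp
    have eq: "coh_comp_top X Y Z g f (wchain 1 w) = gsum ?A ?T (int n) (\<lambda>i. T i (wchain 1 w)) {0..n}"
      unfolding coh_comp_top_def Let_def nerve_cdim[OF c] nerve_cend[OF c] T_def ..
    show "gsgn (int (sum_list w)) (stop n ?A (fext X Z (coh_comp X Y Z g f) (wchain 1 w)))
      = gsum ?A ?T (int n) (\<lambda>i. gsgn (int (sum_list w)) (T i (wchain 1 w))) {0..n}"
      unfolding coh_comp_stop[OF c] eq by (rule gsgn_gsum) (use T[OF w] gr in auto)
  qed (use T gr in \<open>auto intro!: gsum_gm\<close>)
  also have "\<dots> = gsum ?A ?T (int n) (\<lambda>i. gsum ?A ?T (int n) (\<lambda>w. gsgn (int (sum_list w)) (T i (wchain 1 w))) (words 1 n)) {0..n}"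
    by (rule gsum_swap) (use T gr in auto)
  also have "\<dots> = gsum ?A ?T (int n) (\<lambda>i. gsgn (int (i * (n - i))) (Bsum Y Z g (1 + i) (n - i) \<star> Bsum X Y f 1 i)) {0..n}"
  proof (rule gsum_cong)
    fix i assume "i \<in> {0..n}"
    then have i: "i \<le> n" by simp
    have "gsum ?A ?T (int n) (\<lambda>w. gsgn (int (sum_list w)) (T i (wchain 1 w))) (words 1 n)
      = gsum ?A ?T (int n) (\<lambda>(u, v). gsgn (int (i * (n - i))) (q i v \<star> p i u)) (words 1 i \<times> words (1 + i) (n - i))"
    proof (rule gsum_bij[symmetric, OF _ _ words_append[OF i, of 1]])
      fix x assume "x \<in> words 1 i \<times> words (1 + i) (n - i)"
      then obtain u v where x: "x = (u, v)" "u \<in> words 1 i" "v \<in> words (1 + i) (n - i)" by auto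
      have "(\<lambda>(u, v). u @ v) x \<in> words 1 n" using words_append[OF i, of 1] x bij_betwE by blast
      then have uv: "u @ v \<in> words 1 n" "length u = i" using x by (auto simp: words_def)
      note fb = wchain_front_back[OF uv zero_less_one]
      have "stop (n - i) (gpow (gr (cx Y)) (1 + i)) (fext Y Z g (wchain (1 + i) v)) = gsgn (int (sum_list v)) (q i v)"
        using top_typing[OF gr(2,3) g x(3)] by (simp add: q_def)
      moreover have "stop i ?A (f (1 + i) (wchain 1 u)) = gsgn (int (sum_list u)) (p i u)"
        using top_typing[OF gr(1,2) f x(2)] fext_single[OF gr(1,2) f wchain_nerve[OF x(2)]] by (simp add: p_def)
      ultimately have "T i (wchain 1 (u @ v)) = gsgn (int (i * (n - i))) (gsgn (int (sum_list v)) (q i v) \<star> gsgn (int (sum_list u)) (p i u))"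
        unfolding T_def fb(2-4) by simp
      also have "\<dots> = gsgn (int (sum_list (u @ v))) (gsgn (int (i * (n - i))) (q i v \<star> p i u))"
        using p[OF x(2)] q[OF x(3) i] by (simp add: ac_simps)
      finally show "(case x of (u, v) \<Rightarrow> gsgn (int (i * (n - i))) (q i v \<star> p i u)) = gsgn (int (sum_list ((\<lambda>(u, v). u @ v) x))) (T i (wchain 1 ((\<lambda>(u, v). u @ v) x)))"
        using p[OF x(2)] q[OF x(3) i] x(1) by simp (rule gsgn_cong, simp)
    qed (use T i gr in auto)
    also have "\<dots> = gsum ?A ?T (int n) (\<lambda>u. gsum ?A ?T (int n) (\<lambda>v. gsgn (int (i * (n - i))) (q i v \<star> p i u)) (words (1 + i) (n - i))) (words 1 i)"
      by (rule gsum_Sigma[symmetric]) (use p q i gr in auto)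
    also have "\<dots> = gsum ?A ?T (int n) (\<lambda>u. gsgn (int (i * (n - i))) (Bsum Y Z g (1 + i) (n - i) \<star> p i u)) (words 1 i)"
    proof (rule gsum_cong)
      fix u assume u: "u \<in> words 1 i"
      have B: "Bsum Y Z g (1 + i) (n - i) = gsum (gpow (gr (cx Y)) (1 + i)) ?T (int (n - i)) (q i) (words (1 + i) (n - i))"
        using i by (simp add: Bsum_def q_def)
      have "Bsum Y Z g (1 + i) (n - i) \<star> p i u = gsum ?A ?T (int n) (\<lambda>v. q i v \<star> p i u) (words (1 + i) (n - i))"
        unfolding B using p[OF u] q i gr by (subst gcomp_gsum_right) auto
      then show "gsum ?A ?T (int n) (\<lambda>v. gsgn (int (i * (n - i))) (q i v \<star> p i u)) (words (1 + i) (n - i))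
        = gsgn (int (i * (n - i))) (Bsum Y Z g (1 + i) (n - i) \<star> p i u)"
        using gsgn_gsum[of ?A ?T "words (1 + i) (n - i)" "\<lambda>v. q i v \<star> p i u" "int n" "int (i * (n - i))"] p[OF u] q i gr by simp
    qed (use p i gr Bsum_typing[OF gr(2,3) g, of "1 + i"] in auto)
    also have "\<dots> = gsgn (int (i * (n - i))) (gsum ?A ?T (int n) (\<lambda>u. Bsum Y Z g (1 + i) (n - i) \<star> p i u) (words 1 i))"
      by (rule gsgn_gsum[symmetric]) (use p i gr Bsum_typing[OF gr(2,3) g, of "1 + i"] in auto)
    also have "gsum ?A ?T (int n) (\<lambda>u. Bsum Y Z g (1 + i) (n - i) \<star> p i u) (words 1 i) = Bsum Y Z g (1 + i) (n - i) \<star> Bsum X Y f 1 i"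
    proof -
      have "Bsum X Y f 1 i = gsum ?A (gpow (gr (cx Y)) (1 + i)) (int i) (p i) (words 1 i)"
        by (simp add: Bsum_def p_def)
      then show ?thesis using p i gr Bsum_typing[OF gr(2,3) g, of "1 + i"] by (simp add: gcomp_gsum_left)
    qed
    finally show "gsum ?A ?T (int n) (\<lambda>w. gsgn (int (sum_list w)) (T i (wchain 1 w))) (words 1 n)
      = gsgn (int (i * (n - i))) (Bsum Y Z g (1 + i) (n - i) \<star> Bsum X Y f 1 i)" .
  qed (use gr Bsum_typing[OF gr(2,3) g] Bsum_typing[OF gr(1,2) f, of 1] in auto)
  finally show ?thesis .
qed

text \<open>Both sides are algebra morphisms, so first rows are compared. On the left these involve
  only chains starting at [1], so a possible failure of (b) for the composite does no harm; on the
  right the rows of \<open>Phi Y Z g\<close> beyond the first are supplied by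
  \<open>Phi_sdown\<close>.\<close>

lemma Phi_coh_comp: "Phi X Z (coh_comp X Y Z g f) = pro_comp (Phi Y Z g) (Phi X Y f)"
proof -
  let ?A = "gr (cx X)" and ?B = "gr (cx Y)" and ?D = "gr (cx Z)" and ?h = "coh_comp X Y Z g f"
  note tf = Bsum_typing[OF gr(1,2) f, of 1] and tg = Bsum_typing[OF gr(2,3) g]
  note af = Phi_ahom[OF gr(1,2) f] and ag = Phi_ahom[OF gr(2,3) g]
  \<comment> \<open>The typing is read off from \<open>Bsum_coh_comp\<close>, because
    \<open>Bsum_typing\<close> would ask for \<open>sfam\<close> of the composite.\<close>
  have Bh: "gm (Bsum X Z ?h 1 n)" "gsrc (Bsum X Z ?h 1 n) = ?A" "gtgt (Bsum X Z ?h 1 n) = gpow ?D (1 + n)" "gdeg (Bsum X Z ?h 1 n) = int n" for n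
    unfolding Bsum_coh_comp using tf tg gr by auto
  have row: "\<forall>k>0. gmor (row X Z ?h k) (desusp ?A) (gpow (desusp ?D) k) 0"
    using gr Bh by (auto simp: row_def of_nat_diff)
  show ?thesis
  proof (rule ahom_eqI)
    show "ahom (desusp ?A) (desusp ?D) (Phi X Z ?h)"
      unfolding Phi_def using gr row by (intro alg_ahom) auto
    show "ahom (desusp ?A) (desusp ?D) (pro_comp (Phi Y Z g) (Phi X Y f))"
      by (rule ahom_pro_comp[OF af ag])
    fix k :: nat assume k0: "k > 0"
    then obtain n where k: "k = 1 + n" using less_iff_Suc_add by auto
    let ?S = "desusp ?A" and ?T = "gpow (desusp ?D) k" and ?t = "mpow (sdown ?D) k" and ?u = "slift ?A"
    define b where "b = (\<lambda>i. gsgn (int (i * (n - i))) (Bsum Y Z g (1 + i) (n - i) \<star> Bsum X Y f 1 i))"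
    have b: "gmor (b i) ?A (gpow ?D k) (int n)" if "i \<in> {0..n}" for i
      using that tf tg by (simp add: b_def k)
    have t: "gm ?t" "gsrc ?t = gpow ?D k" "gtgt ?t = ?T" "gdeg ?t = - int k" using gr k0 by simp_all
    have "Phi X Z ?h 1 k = gsgn (int n) (?t \<star> gsum ?A (gpow ?D k) (int n) b {0..n} \<star> ?u)"
      unfolding k Phi_1 unfolding row_def b_def using Bsum_coh_comp[of n] by (simp add: k)
    also have "\<dots> = gsum ?S ?T 0 (\<lambda>i. gsgn (int n) (?t \<star> b i \<star> ?u)) {0..n}"
    proof -
      have "gsum ?A (gpow ?D k) (int n) b {0..n} \<star> ?u = gsum ?S (gpow ?D k) (int n + 1) (\<lambda>i. b i \<star> ?u) {0..n}"
        using b gr by (subst gcomp_gsum_right) (auto simp: add.commute)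
      then show ?thesis using b t gr k by (simp add: gcomp_gsum_left gsgn_gsum del: mpow_typing)
    qed
    also have "\<dots> = gsum ?S ?T 0 (\<lambda>l. Phi Y Z g l k \<star> Phi X Y f 1 l) {1..k}"
    proof (rule gsum_bij[where h = "\<lambda>i. 1 + i"])
      show "bij_betw ((+) 1) {0..n} {1..k}"
        unfolding k by (rule bij_betw_byWitness[where f' = "\<lambda>l. l - 1"]) auto
      fix i assume "i \<in> {0..n}"
      then obtain p where p: "n = i + p" using le_Suc_ex by auto
      define x y where "x = Bsum X Y f 1 i" and "y = Bsum Y Z g (1 + i) p"
      have kp: "n - i = p" "k = (1 + i) + p" using k p by auto
      have x: "gm x" "gsrc x = ?A" "gtgt x = gpow ?B (1 + i)" "gdeg x = int i" using tf by (simp_all add: x_def)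
      have y: "gm y" "gsrc y = gpow ?B (1 + i)" "gtgt y = gpow ?D k" "gdeg y = int p" using tg unfolding kp(2) by (simp_all add: y_def)
      have G: "Phi Y Z g (1 + i) k \<star> mpow (sdown ?B) (1 + i) = gsgn (int ((1 + i) * p)) (?t \<star> y)"
        using Phi_sdown[OF gr(2,3) g, of "1 + i" p] unfolding kp(2) y_def by simp
      have tG: "gm (Phi Y Z g (1 + i) k)" "gsrc (Phi Y Z g (1 + i) k) = gpow (desusp ?B) (1 + i)"
        using tmatD(1,2)[OF ahomD(1)[OF ag], of "1 + i" k] k0 by auto
      have "Phi Y Z g (1 + i) k \<star> Phi X Y f 1 (1 + i) = gsgn (int i) ((Phi Y Z g (1 + i) k \<star> mpow (sdown ?B) (1 + i)) \<star> x \<star> ?u)"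
        unfolding Phi_1 row_def using x tG gr by (simp add: x_def del: gpow_Suc)
      also have "\<dots> = gsgn (int i + int ((1 + i) * p)) (?t \<star> y \<star> x \<star> ?u)"
        unfolding G using x y t gr by (simp del: gpow_Suc mpow_typing)
      \<comment> \<open>Since n = i + p, the exponent i + (1 + i) * p equals n + i * p: the two
        desuspension signs combine to the sign of the row and that of the composition rule.\<close>
      also have "\<dots> = gsgn (int n + int (i * p)) (?t \<star> y \<star> x \<star> ?u)"
        unfolding p by (rule gsgn_cong) (simp add: algebra_simps)
      also have "\<dots> = gsgn (int n) (?t \<star> b i \<star> ?u)"
        unfolding b_def kp(1) x_def[symmetric] y_def[symmetric] using x y t gr by (simp del: gpow_Suc mpow_typing)
      finally show "gsgn (int n) (?t \<star> b i \<star> ?u) = Phi Y Z g (1 + i) k \<star> Phi X Y f 1 (1 + i)" ..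
    qed (use tmatD(1-4)[OF ahomD(1)[OF af], of 1] tmatD(1-4)[OF ahomD(1)[OF ag], of _ k] k0 gr in auto)
    also have "\<dots> = pro_comp (Phi Y Z g) (Phi X Y f) 1 k"
      using pro_comp_eq[OF ahomD(1)[OF af] ahomD(1)[OF ag], of 1 k k] k0 by simp
    finally show "Phi X Z ?h 1 k = pro_comp (Phi Y Z g) (Phi X Y f) 1 k" .
  qed
qed

end

end

theorem proposition6p40:
  fixes C :: "('o, 'm) tensor_category"
  assumes "abelian_tensor_category C"
  shows "\<exists>\<Phi> :: ('o, 'm) coalgebra \<Rightarrow> ('o, 'm) coalgebra \<Rightarrow> ('o, 'm) family \<Rightarrow> ('o, 'm) matrix.
    (\<forall>X Y. category.dg_coalgebra C X \<and> category.dg_coalgebra C Y \<longrightarrow>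
       (\<forall>\<mu>\<in>category.Coh C X Y. \<Phi> X Y \<mu> \<in> category.Ainf_hom C X Y)) \<and>
    (\<forall>X Y. category.dg_coalgebra C X \<and> category.dg_coalgebra C Y \<longrightarrow>
       (\<forall>f\<in>category.coalgebra_hom C X Y.
          category.coh_of_hom C X Y f \<in> category.Coh C X Y \<and>
          \<Phi> X Y (category.coh_of_hom C X Y f) = category.Ainf_of_hom C f)) \<and>
    (\<forall>X' X Y Y'. category.dg_coalgebra C X' \<and> category.dg_coalgebra C X \<and>
       category.dg_coalgebra C Y \<and> category.dg_coalgebra C Y' \<longrightarrow>
       (\<forall>p\<in>category.coalgebra_hom C X' X. \<forall>q\<in>category.coalgebra_hom C Y Y'.
        \<forall>\<mu>\<in>category.Coh C X Y.
          category.coh_map C p q \<mu> \<in> category.Coh C X' Y' \<and>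
          \<Phi> X' Y' (category.coh_map C p q \<mu>) =
          category.pro_comp C (category.Ainf_of_hom C q)
            (category.pro_comp C (\<Phi> X Y \<mu>) (category.Ainf_of_hom C p)))) \<and>
    (\<forall>X Y Z. category.dg_coalgebra C X \<and> category.dg_coalgebra C Y \<and> category.dg_coalgebra C Z \<longrightarrow>
       (\<forall>f\<in>category.Coh C X Y. \<forall>g\<in>category.Coh C Y Z.
          \<Phi> X Z (category.coh_comp C X Y Z g f) =
          category.pro_comp C (\<Phi> Y Z g) (\<Phi> X Y f)))"
proof -
  interpret abelian_tensor_category C by fact
  show ?thesis
  proof (intro exI[of _ Phi] conjI allI impI ballI; elim conjE)
    fix X Y Z f g
    assume X: "dg_coalgebra X" and Y: "dg_coalgebra Y" and Z: "dg_coalgebra Z" and f: "f \<in> Coh X Y" and g: "g \<in> Coh Y Z"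
    show "Phi X Z (coh_comp X Y Z g f) = pro_comp (Phi Y Z g) (Phi X Y f)"
      using Coh_sfam[OF X Y f] Coh_sfam[OF Y Z g] by (intro Phi_coh_comp) auto
  qed (auto intro: Phi_Ainf_hom coh_of_hom_Coh(1) Phi_coh_of_hom coh_map_Coh(1) Phi_coh_map)
qed
end
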